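(* Let $\alpha\in(0,1)$ and let $\mu$ be a probability measure with $\operatorname{supp}(\mu)\subset[\underline\theta,\bar\theta]$, $-\alpha<\underline\theta\le 0\le\bar\theta<+\infty$. Let $(\Pi_n)_{n\ge1}$ be the exchangeable Gibbs partition with parameter $\alpha$ and weights $v_{n,k}=\int v_{n,k}(\alpha,\theta)\,d\mu(\theta)$, and let $\hat\alpha_n$ be the quasi-maximum likelihood estimator. Let $\mathcal F_\infty=\sigma(\cup_{n\ge1}\mathcal F_n)$ with $\mathcal F_n=\sigma(\Pi_n)$. Then, as $n\to\infty$, $$\sqrt{n^\alpha\,\mathfrak i(\alpha)}\cdot(\hat\alpha_n-\alpha)\to N/\sqrt{\mathsf S_{\alpha,\mu}}\qquad \mathcal F_\infty\text{-stably},$$ where $N\sim\mathcal N(0,1)$ is independent of $\mathcal F_\infty$, and $\mathsf S_{\alpha,\mu}=\lim_{n\to\infty}n^{-\alpha}\mathsf k_n$ (almost sure limit) is the $\alpha$-diversity, which is $\mathcal F_\infty$-measurable.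
   Context: Weights: for $1\le k\le n$, $v_{n,k}(\alpha,\theta)=\frac{\prod_{i=1}^{k-1}(\theta+i\alpha)}{\prod_{i=1}^{n-1}(\theta+i)}$ (empty products equal 1) and $v_{n,k}=\int v_{n,k}(\alpha,\theta)\,d\mu(\theta)$; $\mu$ does not depend on $\alpha$. Gibbs partition: $\Pi_n$ is a random partition of $\{1,\dots,n\}$ defined sequentially on a probability space $(\Omega,\mathcal F,P)$. $\Pi_1=\{\{1\}\}$. Given $\Pi_n=\{U_1,\dots,U_{\mathsf k_n}\}$ ($\mathsf k_n$ = number of blocks), the partition $\Pi_{n+1}$ is obtained by putting $n+1$ into a new block with probability $v_{n+1,\mathsf k_n+1}/v_{n,\mathsf k_n}$ and into $U_i$ with probability $\frac{v_{n+1,\mathsf k_n}}{v_{n,\mathsf k_n}}(|U_i|-\alpha)$, $i=1,\dots,\mathsf k_n$. Let $\mathsf k_{n,j}$ be the number of blocks of $\Pi_n$ of size $j$. The sequence $n^{-\alpha}\mathsf k_n$ converges almost surely to a positive random variable $\mathsf S_{\alpha,\mu}$. QMLE: for $n\ge2$, $\hat\alpha_n$ is the maximizer over $x\in(0,1)$ of $(\mathsf k_n-1)\log x+\sum_{j=2}^n\mathsf k_{n,j}\sum_{i=1}^{j-1}\log(i-x)$, understood as: $\hat\alpha_n=0$ if $\mathsf k_n=1$; $\hat\alpha_n=1$ if $\mathsf k_n=n$; and if $1<\mathsf k_n<n$, $\hat\alpha_n$ is the unique solution $x\in(0,1)$ of $\frac{\mathsf k_n-1}{x}-\sum_{j=2}^n\mathsf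 k_{n,j}\sum_{i=1}^{j-1}\frac1{i-x}=0$. Fisher information: $\mathfrak i(\alpha)=\sum_{j\ge1}\mathfrak p_\alpha(j)\left(\frac{\partial}{\partial\alpha}\log\mathfrak p_\alpha(j)\right)^2$ with $\mathfrak p_\alpha(j)=\frac{\alpha\prod_{i=1}^{j-1}(i-\alpha)}{j!}$, $j\in\mathbb N$. Stable convergence: for a sub-$\sigma$-field $\mathcal G\subset\mathcal F$, real random variables $X_n\to X$ $\mathcal G$-stably if $\lim_n\mathbb E[f\,\mathbb E[h(X_n)\mid\mathcal G]]=\mathbb E[f\,\mathbb E[h(X)\mid\mathcal G]]$ for every $\mathcal F$-measurable integrable $f$ and every bounded continuous $h:\mathbb R\to\mathbb R$. The probability space is assumed rich enough (enlarged if necessary) to carry $N$ independent of $\mathcal F_\infty$. *)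

theory Defs
  imports "HOL-Probability.Probability"
begin

section \<open>Gibbs partitions\<close>

definition ewens_pitman_weight :: "real \<Rightarrow> real \<Rightarrow> nat \<Rightarrow> nat \<Rightarrow> real" where
  "ewens_pitman_weight \<alpha> \<theta> n k =
     (\<Prod>i\<in>{1..<k}. \<theta> + real i * \<alpha>) / (\<Prod>i\<in>{1..<n}. \<theta> + real i)"

definition gibbs_weight :: "real \<Rightarrow> real measure \<Rightarrow> nat \<Rightarrow> nat \<Rightarrow> real" where
  "gibbs_weight \<alpha> \<mu> n k = (\<integral>\<theta>. ewens_pitman_weight \<alpha> \<theta> n k \<partial>\<mu>)"

definition measure_support :: "'a::topological_space measure \<Rightarrow> 'a set" where
  "measure_support \<mu> = {x. \<forall>U. open U \<longrightarrow> x \<in> U \<longrightarrow> emeasure \<mu> U > 0}"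

definition new_block :: "nat \<Rightarrow> nat set set \<Rightarrow> nat set set" where
  "new_block m P = insert {m} P"

definition join_block :: "nat \<Rightarrow> nat set \<Rightarrow> nat set set \<Rightarrow> nat set set" where
  "join_block m U P = insert (insert m U) (P - {U})"

text \<open>The index 0 of the process \<open>\<pi>\<close> is irrelevant: \<open>\<pi> n\<close> is a partition of
  \<open>{1..n}\<close> for \<open>n \<ge> 1\<close>, and nothing is assumed about \<open>\<pi> 0\<close>. Since \<open>\<pi> n\<close> determines
  \<open>\<pi> 1, \<dots>, \<pi> n\<close> by \<open>extends\<close>, the transition probabilities given \<open>\<pi> n\<close> determine the
  law of the whole process.\<close>

locale gibbs_partition = prob_space M
  for M :: "'a measure" and \<alpha> :: real and \<mu> :: "real measure"
    and \<pi> :: "nat \<Rightarrow> 'a \<Rightarrow> nat set set" +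
  assumes partition_valued:
      "\<And>n. n \<ge> 1 \<Longrightarrow> \<pi> n \<in> M \<rightarrow>\<^sub>M count_space {P. partition_on {1..n} P}"
    and initial: "\<And>\<omega>. \<omega> \<in> space M \<Longrightarrow> \<pi> 1 \<omega> = {{1}}"
    and extends: "\<And>n \<omega>. n \<ge> 1 \<Longrightarrow> \<omega> \<in> space M \<Longrightarrow>
      \<pi> (Suc n) \<omega> = new_block (Suc n) (\<pi> n \<omega>) \<or>
      (\<exists>U\<in>\<pi> n \<omega>. \<pi> (Suc n) \<omega> = join_block (Suc n) U (\<pi> n \<omega>))"
    and prob_new: "\<And>n P. n \<ge> 1 \<Longrightarrow> partition_on {1..n} P \<Longrightarrow>
      \<P>(\<omega> in M. \<pi> n \<omega> = P) > 0 \<Longrightarrow>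
      \<P>(\<omega> in M. \<pi> (Suc n) \<omega> = new_block (Suc n) P \<bar> \<pi> n \<omega> = P) =
        gibbs_weight \<alpha> \<mu> (Suc n) (card P + 1) / gibbs_weight \<alpha> \<mu> n (card P)"
    and prob_join: "\<And>n P U. n \<ge> 1 \<Longrightarrow> partition_on {1..n} P \<Longrightarrow>
      \<P>(\<omega> in M. \<pi> n \<omega> = P) > 0 \<Longrightarrow> U \<in> P \<Longrightarrow>
      \<P>(\<omega> in M. \<pi> (Suc n) \<omega> = join_block (Suc n) U P \<bar> \<pi> n \<omega> = P) =
        gibbs_weight \<alpha> \<mu> (Suc n) (card P) / gibbs_weight \<alpha> \<mu> n (card P) * (real (card U) - \<alpha>)"

definition partition_field :: "'a measure \<Rightarrow> (nat \<Rightarrow> 'a \<Rightarrow> nat set set) \<Rightarrow> nat \<Rightarrow> 'a measure" where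
  "partition_field M \<pi> n = vimage_algebra (space M) (\<pi> n) (count_space UNIV)"

definition partition_field_inf :: "'a measure \<Rightarrow> (nat \<Rightarrow> 'a \<Rightarrow> nat set set) \<Rightarrow> 'a measure" where
  "partition_field_inf M \<pi> = sigma (space M) (\<Union>n\<in>{1..}. sets (partition_field M \<pi> n))"

text \<open>Pointwise \<open>lim\<close>; its value is unspecified where the sequence diverges.\<close>

definition alpha_diversity :: "real \<Rightarrow> (nat \<Rightarrow> 'a \<Rightarrow> nat set set) \<Rightarrow> 'a \<Rightarrow> real" where
  "alpha_diversity \<alpha> \<pi> \<omega> = lim (\<lambda>n. real n powr (- \<alpha>) * real (card (\<pi> n \<omega>)))"


section \<open>Quasi-maximum likelihood estimator and Fisher information\<close>

definition blocks_of_size :: "nat \<Rightarrow> nat set set \<Rightarrow> nat" where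
  "blocks_of_size j P = card {U\<in>P. card U = j}"

text \<open>The derivative in \<open>x\<close> of the quasi-log-likelihood
  \<open>(card P - 1) * ln x + (\<Sum>j=2..n. blocks_of_size j P * (\<Sum>i=1..j-1. ln (i - x)))\<close>.\<close>

definition quasi_score :: "nat \<Rightarrow> nat set set \<Rightarrow> real \<Rightarrow> real" where
  "quasi_score n P x = (real (card P) - 1) / x
     - (\<Sum>j=2..n. real (blocks_of_size j P) * (\<Sum>i=1..j-1. 1 / (real i - x)))"

text \<open>For \<open>1 < card P < n\<close> the score decreases strictly from \<open>\<infinity>\<close> to \<open>-\<infinity>\<close> on the open unit
  interval, so the description is proper.\<close>

definition qmle :: "nat \<Rightarrow> nat set set \<Rightarrow> real" where
  "qmle n P = (if card P = 1 then 0 else if card P = n then 1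
     else (THE x. 0 < x \<and> x < 1 \<and> quasi_score n P x = 0))"

definition sibuya_prob :: "real \<Rightarrow> nat \<Rightarrow> real" where
  "sibuya_prob \<alpha> j = \<alpha> * (\<Prod>i\<in>{1..<j}. real i - \<alpha>) / fact j"

definition fisher_info :: "real \<Rightarrow> real" where
  "fisher_info \<alpha> = (\<Sum>\<^sub>\<infinity>j\<in>{1::nat..}. sibuya_prob \<alpha> j * (deriv (\<lambda>a. ln (sibuya_prob a j)) \<alpha>)\<^sup>2)"


section \<open>Stable convergence\<close>

definition stably_converges ::
    "'a measure \<Rightarrow> 'a measure \<Rightarrow> (nat \<Rightarrow> 'a \<Rightarrow> real) \<Rightarrow> ('a \<Rightarrow> real) \<Rightarrow> bool" where
  "stably_converges M G X Y \<longleftrightarrow>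
     subalgebra M G \<and> (\<forall>n. X n \<in> borel_measurable M) \<and> Y \<in> borel_measurable M \<and>
     (\<forall>f h. integrable M f \<longrightarrow> continuous_on UNIV h \<longrightarrow> bounded (range h) \<longrightarrow>
        (\<lambda>n. \<integral>\<omega>. f \<omega> * real_cond_exp M G (\<lambda>\<omega>. h (X n \<omega>)) \<omega> \<partial>M)
          \<longlonglongrightarrow> (\<integral>\<omega>. f \<omega> * real_cond_exp M G (\<lambda>\<omega>. h (Y \<omega>)) \<omega> \<partial>M))"

text \<open>The \<open>\<sigma>\<close>-field generated by \<open>X\<close> is independent of the \<open>\<sigma>\<close>-field \<open>G\<close>.\<close>

definition indep_of_field :: "'a measure \<Rightarrow> ('a \<Rightarrow> real) \<Rightarrow> 'a measure \<Rightarrow> bool" where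
  "indep_of_field M X G \<longleftrightarrow>
     prob_space.indep_set M (sets (vimage_algebra (space M) X borel)) (sets G)"

end

theory Submission
  imports Defs
begin

text \<open>Adding elements one by one, let the size of a block be recorded whenever a new element joins it, with
  0 for a new block. The quasi-score at the true \<open>\<alpha>\<close> is additive along this chain: joining a block of size
  \<open>j\<close> changes it by \<open>- 1 / (j - \<alpha>)\<close>, and a new block changes it by \<open>1 / \<alpha>\<close>. If blocks of size \<open>j\<close>
  were joined with probability \<open>(j - \<alpha>) / n\<close>, which is the case \<open>\<theta> = 0\<close>, the score would be a
  martingale. For a mixture over a bounded set of \<open>\<theta>\<close> the ratio of weights is
  \<open>1 / n + O(1 / n\<^sup>2)\<close> uniformly in the number of blocks (\<open>w_near\<close>), so the score is a martingale up to
  a drift of order \<open>log n\<close> (\<open>score_decomposition\<close>), negligible against its fluctuations of order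
  \<open>n powr (\<alpha> / 2)\<close>.

  The same uniform approximation shows that \<open>n powr (- \<alpha>)\<close> times the number of blocks is a martingale up to
  summable errors, whence the diversity \<open>S\<close> (\<open>AE_r_tendsto\<close>), with a polynomial rate in mean. It is positive
  because the mean of the inverse number of blocks decays like \<open>n powr (- \<alpha>)\<close> once there are two blocks
  (\<open>AE_S_pos\<close>). A recursion in the size shows that the number of blocks larger than \<open>j\<close> is asymptotic in mean to
  \<open>T j * S * n powr \<alpha>\<close>, where \<open>T\<close> is the tail of the Sibuya law (\<open>block_counts_L1\<close>). Hence the conditional
  variance of the score, divided by \<open>n powr \<alpha>\<close>, tends to \<open>S\<close> times the sum of \<open>T j\<close> weighted by the squared
  increments, and summation by parts identifies this sum as the Fisher information of the Sibuya law
  (\<open>fisher_info_eq\<close>).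

  These are the hypotheses of a central limit theorem for martingales whose limiting variance is random
  (\<open>stable_martingale_clt\<close>). Its proof replaces the characteristic exponential of the normalized sum by one that is
  corrected by the conditional variance and stopped when that variance gets large; the corrected process is almost a martingale, and
  therefore its expectation on any event of the filtration converges to the probability of the event.

  Finally, the score is decreasing in its argument and its divided differences near \<open>\<alpha>\<close> agree with the observed
  information up to a small relative error (\<open>divided_score_near\<close>). So the estimator is with high probability
  the unique root close to \<open>\<alpha>\<close>, and its error equals the score divided by the observed information up to a
  negligible term (\<open>estimation_error_null\<close>). After normalization this is the martingale multiplied by
  \<open>1 / (S * sqrt (fisher_info \<alpha>))\<close>. The multiplier is measurable with respect to the limiting \<open>\<sigma>\<close>-field,
  so stable convergence permits it to be absorbed in the limit (\<open>random_multiplier\<close>), which is \<open>N / sqrt S\<close>.\<close>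



section \<open>Limits of integrals by approximation\<close>

lemma tendsto_by_approximation:
  fixes b :: "nat \<Rightarrow> 'b::metric_space"
  assumes "\<And>e. 0 < e \<Longrightarrow> \<exists>a L. a \<longlonglongrightarrow> L \<and> dist L l \<le> e \<and> (\<forall>\<^sub>F n in sequentially. dist (b n) (a n) \<le> e)"
  shows "b \<longlonglongrightarrow> l"
proof (rule tendstoI)
  fix r :: real assume "0 < r"
  then obtain a L where a: "a \<longlonglongrightarrow> L" "dist L l \<le> r/4" "\<forall>\<^sub>F n in sequentially. dist (b n) (a n) \<le> r/4"
    using assms[of "r/4"] by auto
  have "\<forall>\<^sub>F n in sequentially. dist (a n) L < r/4"
    using \<open>0 < r\<close> by (intro tendstoD[OF a(1)]) simp
  with a(3) show "\<forall>\<^sub>F n in sequentially. dist (b n) l < r"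
  proof eventually_elim
    case (elim n)
    have "dist (b n) l \<le> dist (b n) (a n) + dist (a n) L + dist L l"
      using dist_triangle[of "b n" l "a n"] dist_triangle[of "a n" l L] by linarith
    with elim a(2) \<open>0 < r\<close> show ?case by linarith
  qed
qed

text \<open>Convergence in mean of \<open>u\<close> transfers to \<open>H\<close> by passing to
  subsequences: every subsequence has a further one along which \<open>u\<close> vanishes
  almost everywhere, hence so does \<open>H\<close>, and dominated convergence applies. The
  hypothesis is pointwise and quantifies over all subsequences because the further subsequence
  is not known in advance.\<close>
lemma integral_tendsto_zero_of_L1:
  fixes H :: "nat \<Rightarrow> 'a \<Rightarrow> 'b::{banach, second_countable_topology}"
    and u :: "nat \<Rightarrow> 'a \<Rightarrow> 'c::{banach, second_countable_topology}"
  assumes u: "\<And>n. integrable M (u n)" "(\<lambda>n. \<integral>x. norm (u n x) \<partial>M) \<longlonglongrightarrow> 0"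
    and H[measurable]: "\<And>n. H n \<in> borel_measurable M"
    and B: "integrable M B" "\<And>n. AE x in M. norm (H n x) \<le> B x"
    and lim: "AE x in M. \<forall>r::nat \<Rightarrow> nat. strict_mono r \<longrightarrow> (\<lambda>n. u (r n) x) \<longlonglongrightarrow> 0 \<longrightarrow> (\<lambda>n. H (r n) x) \<longlonglongrightarrow> 0"
  shows "(\<lambda>n. \<integral>x. H n x \<partial>M) \<longlonglongrightarrow> 0"
proof (rule ccontr)
  assume "\<not> ?thesis"
  then obtain e where e: "e > 0" "\<not> (\<forall>\<^sub>F n in sequentially. norm (\<integral>x. H n x \<partial>M) < e)"
    unfolding tendsto_iff by auto
  have "infinite {n. norm (\<integral>x. H n x \<partial>M) \<ge> e}"
    using e(2) unfolding not_eventually by (simp add: frequently_cofinite[symmetric] cofinite_eq_sequentially not_less)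
  then obtain r :: "nat \<Rightarrow> nat" where r: "strict_mono r" "\<And>n. norm (\<integral>x. H (r n) x \<partial>M) \<ge> e"
    using infinite_enumerate by (metis (no_types, lifting) mem_Collect_eq)
  have "(\<lambda>n. \<integral>x. norm (u (r n) x) \<partial>M) \<longlonglongrightarrow> 0"
    using LIMSEQ_subseq_LIMSEQ[OF u(2) r(1)] by (simp add: o_def)
  from tendsto_L1_AE_subseq[OF _ this] u(1) obtain s :: "nat \<Rightarrow> nat"
    where s: "strict_mono s" "AE x in M. (\<lambda>n. u (r (s n)) x) \<longlonglongrightarrow> 0" by auto
  have rs: "strict_mono (\<lambda>n. r (s n))" using r(1) s(1) by (simp add: strict_mono_def)
  have "(\<lambda>n. \<integral>x. H (r (s n)) x \<partial>M) \<longlonglongrightarrow> (\<integral>x. 0 \<partial>M)"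
  proof (rule integral_dominated_convergence)
    show "AE x in M. (\<lambda>n. H (r (s n)) x) \<longlonglongrightarrow> 0"
      using s(2) lim
    proof eventually_elim
      case (elim x)
      show ?case using elim(2)[rule_format, OF rs elim(1)] .
    qed
  qed (use B in auto)
  then have "\<forall>\<^sub>F n in sequentially. norm (\<integral>x. H (r (s n)) x \<partial>M) < e"
    using e(1) unfolding tendsto_iff by auto
  then obtain n where "norm (\<integral>x. H (r (s n)) x \<partial>M) < e" using eventually_happens by force
  with r(2)[of "s n"] show False by simp
qed

context prob_space
begin

text \<open>Indicators span the simple functions, and these are dense in \<open>L\<^sup>1\<close>; the
  uniform bound \<open>K\<close> makes the approximation error independent of
  \<open>n\<close>.\<close>
lemma stable_limit_of_sets:
  fixes Y :: "nat \<Rightarrow> 'a \<Rightarrow> 'b::{real_normed_field, banach, second_countable_topology}"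
  assumes G: "subalgebra M G"
    and Y[measurable]: "\<And>n. Y n \<in> borel_measurable M" "Z \<in> borel_measurable M"
    and bnd: "\<And>n x. x \<in> space M \<Longrightarrow> norm (Y n x) \<le> K" "\<And>x. x \<in> space M \<Longrightarrow> norm (Z x) \<le> K"
    and sets: "\<And>A. A \<in> sets G \<Longrightarrow> (\<lambda>n. \<integral>x. indicator A x *\<^sub>R Y n x \<partial>M) \<longlonglongrightarrow> (\<integral>x. indicator A x *\<^sub>R Z x \<partial>M)"
    and f: "integrable M f" "f \<in> borel_measurable G"
  shows "(\<lambda>n. \<integral>x. f x * Y n x \<partial>M) \<longlonglongrightarrow> (\<integral>x. f x * Z x \<partial>M)"
proof -
  let ?R = "restr_to_subalg M G"
  have K: "0 \<le> K" using bnd(2) not_empty norm_ge_zero order_trans by blast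
  have Gm: "g \<in> borel_measurable M" if "g \<in> borel_measurable G" for g :: "'a \<Rightarrow> 'b"
    using measurable_from_subalg[OF G that] .
  have int: "integrable M (\<lambda>x. g x * Y n x)" "integrable M (\<lambda>x. g x * Z x)" if g: "integrable M g" for g n
  proof -
    have [measurable]: "g \<in> borel_measurable M" using g by auto
    have *: "norm (g x * y) \<le> norm (K * norm (g x))" if "norm y \<le> K" for x y
      using mult_left_mono[OF that, of "norm (g x)"] K by (simp add: norm_mult mult.commute)
    have i: "integrable M (\<lambda>x. K * norm (g x))" using g by auto
    show "integrable M (\<lambda>x. g x * Y n x)"
      by (rule Bochner_Integration.integrable_bound[OF i]) (use * bnd in \<open>auto\<close>)
    show "integrable M (\<lambda>x. g x * Z x)"
      by (rule Bochner_Integration.integrable_bound[OF i]) (use * bnd in \<open>auto\<close>)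
  qed
  have fR: "integrable ?R f" using integrable_in_subalg[OF G f(2,1)] .
  then show ?thesis
  proof (induction rule: integrable_induct)
    case (base A c)
    then have A: "A \<in> sets G" by (simp add: sets_restr_to_subalg[OF G])
    have *: "(\<integral>x. indicator A x *\<^sub>R c * y x \<partial>M) = c * (\<integral>x. indicator A x *\<^sub>R y x \<partial>M)" for y :: "'a \<Rightarrow> 'b"
      by (subst integral_mult_right_zero[symmetric]) (simp add: ac_simps)
    show ?case unfolding * by (intro tendsto_mult tendsto_const sets A)
  next
    case (add f g)
    then have fg: "integrable M f" "integrable M g" using integrable_from_subalg[OF G] by auto
    show ?case using tendsto_add[OF add(3,4)]
      by (simp add: distrib_right Bochner_Integration.integral_add int fg)
  next
    case (lim f s)
    have fI: "integrable M f" and sI: "\<And>i. integrable M (s i)"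
      by (rule integrable_from_subalg[OF G lim.hyps(4)], rule integrable_from_subalg[OF G lim.hyps(1)])
    have [measurable]: "f \<in> borel_measurable M" "\<And>i. s i \<in> borel_measurable M" using fI sI by auto
    have c: "(\<lambda>i. \<integral>x. norm (f x - s i x) \<partial>M) \<longlonglongrightarrow> (\<integral>x. 0 \<partial>M)"
    proof (rule integral_dominated_convergence[where w="\<lambda>x. 3 * norm (f x)"])
      show "AE x in M. (\<lambda>i. norm (f x - s i x)) \<longlonglongrightarrow> 0"
      proof (rule AE_I2)
        fix x assume "x \<in> space M"
        then have "(\<lambda>i. s i x) \<longlonglongrightarrow> f x" using lim.hyps(2) by (simp add: space_restr_to_subalg)
        then have "(\<lambda>i. norm (f x - s i x)) \<longlonglongrightarrow> norm (f x - f x)" by (intro tendsto_intros)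
        then show "(\<lambda>i. norm (f x - s i x)) \<longlonglongrightarrow> 0" by simp
      qed
      show "AE x in M. norm (norm (f x - s i x)) \<le> 3 * norm (f x)" for i
      proof (rule AE_I2)
        fix x assume "x \<in> space M"
        then have "norm (s i x) \<le> 2 * norm (f x)" using lim.hyps(3) by (simp add: space_restr_to_subalg)
        then show "norm (norm (f x - s i x)) \<le> 3 * norm (f x)"
          using norm_triangle_ineq4[of "f x" "s i x"] by simp
      qed
    qed (use fI in auto)
    have est: "dist (\<integral>x. f x * y x \<partial>M) (\<integral>x. s i x * y x \<partial>M) \<le> K * (\<integral>x. norm (f x - s i x) \<partial>M)"
      if y: "\<And>x. x \<in> space M \<Longrightarrow> norm (y x) \<le> K"
        and iy: "integrable M (\<lambda>x. f x * y x)" "integrable M (\<lambda>x. s i x * y x)" for y i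
    proof -
      have "norm (\<integral>x. f x * y x \<partial>M - (\<integral>x. s i x * y x \<partial>M)) = norm (\<integral>x. f x * y x - s i x * y x \<partial>M)"
        using iy by simp
      also have "\<dots> \<le> (\<integral>x. norm (f x * y x - s i x * y x) \<partial>M)"
        by (rule integral_norm_bound)
      also have "\<dots> \<le> (\<integral>x. K * norm (f x - s i x) \<partial>M)"
      proof (rule integral_mono)
        fix x assume x: "x \<in> space M"
        have "norm (f x * y x - s i x * y x) = norm (f x - s i x) * norm (y x)"
          by (simp add: left_diff_distrib[symmetric] norm_mult)
        then show "norm (f x * y x - s i x * y x) \<le> K * norm (f x - s i x)"
          using mult_left_mono[OF y[OF x], of "norm (f x - s i x)"] by (simp add: mult.commute)
      qed (use iy fI sI in auto)
      finally show ?thesis by (simp add: dist_norm)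
    qed
    show ?case
    proof (rule tendsto_by_approximation)
      fix e :: real assume "0 < e"
      have "(\<lambda>i. K * (\<integral>x. norm (f x - s i x) \<partial>M)) \<longlonglongrightarrow> K * 0"
        using c by (intro tendsto_intros) simp
      then have "\<forall>\<^sub>F i in sequentially. K * (\<integral>x. norm (f x - s i x) \<partial>M) < e"
        using order_tendstoD(2) \<open>0 < e\<close> by fastforce
      then obtain i where i: "K * (\<integral>x. norm (f x - s i x) \<partial>M) < e" using eventually_happens by force
      show "\<exists>a L. a \<longlonglongrightarrow> L \<and> dist L (\<integral>x. f x * Z x \<partial>M) \<le> e \<and>
          (\<forall>\<^sub>F n in sequentially. dist (\<integral>x. f x * Y n x \<partial>M) (a n) \<le> e)"
      proof (intro exI conjI)
        show "(\<lambda>n. \<integral>x. s i x * Y n x \<partial>M) \<longlonglongrightarrow> (\<integral>x. s i x * Z x \<partial>M)" by (rule lim.IH)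
        show "dist (\<integral>x. s i x * Z x \<partial>M) (\<integral>x. f x * Z x \<partial>M) \<le> e"
          using est[OF bnd(2) int(2)[OF fI] int(2)[OF sI], of i] i by (simp add: dist_commute)
        show "\<forall>\<^sub>F n in sequentially. dist (\<integral>x. f x * Y n x \<partial>M) (\<integral>x. s i x * Y n x \<partial>M) \<le> e"
          by (intro always_eventually allI order_trans[OF est[OF bnd(1) int(1)[OF fI] int(1)[OF sI]] less_imp_le[OF i]])
      qed
    qed
  qed
qed

text \<open>The events for which the limit holds form a Dynkin system. The bound \<open>K\<close>
  controls the tail of a countable disjoint union uniformly in \<open>n\<close>.\<close>
lemma stable_limit_of_generator:
  fixes Y :: "nat \<Rightarrow> 'a \<Rightarrow> 'b::{real_normed_field, banach, second_countable_topology}"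
  assumes E: "Int_stable E" "E \<subseteq> events" "space M \<in> E"
    and Y[measurable]: "\<And>n. Y n \<in> borel_measurable M" "Z \<in> borel_measurable M"
    and bnd: "\<And>n x. x \<in> space M \<Longrightarrow> norm (Y n x) \<le> K" "\<And>x. x \<in> space M \<Longrightarrow> norm (Z x) \<le> K"
    and E_lim: "\<And>A. A \<in> E \<Longrightarrow> (\<lambda>n. \<integral>x. indicator A x *\<^sub>R Y n x \<partial>M) \<longlonglongrightarrow> (\<integral>x. indicator A x *\<^sub>R Z x \<partial>M)"
    and A: "A \<in> sigma_sets (space M) E"
  shows "(\<lambda>n. \<integral>x. indicator A x *\<^sub>R Y n x \<partial>M) \<longlonglongrightarrow> (\<integral>x. indicator A x *\<^sub>R Z x \<partial>M)"
proof -
  have K: "0 \<le> K" using bnd(2) not_empty norm_ge_zero order_trans by blast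
  have sub: "sigma_sets (space M) E \<subseteq> events" using E(2) by (simp add: sets.sigma_sets_subset)
  have YI: "integrable M (Y n)" and ZI: "integrable M Z" for n
    using bnd by (auto intro!: integrable_const_bound[where B=K])
  have I: "integrable M (\<lambda>x. indicator B x *\<^sub>R y x)" if "B \<in> events" "integrable M y" for B and y :: "'a \<Rightarrow> 'b"
    using that by (auto intro!: integrable_mult_indicator)
  have "E \<subseteq> Pow (space M)" using E(2) sets.sets_into_space by blast
  with E(1) show ?thesis using A
  proof (induction rule: sigma_sets_induct_disjoint)
    case (compl A)
    then have [measurable]: "A \<in> events" using sub by auto
    have *: "(\<integral>x. indicator (space M - A) x *\<^sub>R y x \<partial>M) = (\<integral>x. indicator (space M) x *\<^sub>R y x \<partial>M) - (\<integral>x. indicator A x *\<^sub>R y x \<partial>M)"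
      if "integrable M y" for y :: "'a \<Rightarrow> 'b"
    proof -
      have "(\<integral>x. indicator (space M) x *\<^sub>R y x \<partial>M) - (\<integral>x. indicator A x *\<^sub>R y x \<partial>M)
        = (\<integral>x. indicator (space M) x *\<^sub>R y x - indicator A x *\<^sub>R y x \<partial>M)"
        using I that by (intro Bochner_Integration.integral_diff[symmetric]) auto
      also have "\<dots> = (\<integral>x. indicator (space M - A) x *\<^sub>R y x \<partial>M)"
        by (intro Bochner_Integration.integral_cong) (auto simp: indicator_def)
      finally show ?thesis by simp
    qed
    show ?case unfolding *[OF YI] *[OF ZI] by (intro tendsto_diff E_lim E(3) compl)
  next
    case (union B)
    have [measurable]: "B i \<in> events" for i using union(2) sub by auto
    let ?U = "\<lambda>k. \<Union>i<k. B i"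
    have part: "(\<lambda>n. \<integral>x. indicator (?U k) x *\<^sub>R Y n x \<partial>M) \<longlonglongrightarrow> (\<integral>x. indicator (?U k) x *\<^sub>R Z x \<partial>M)" for k
    proof -
      have *: "(\<integral>x. indicator (?U k) x *\<^sub>R y x \<partial>M) = (\<Sum>i<k. \<integral>x. indicator (B i) x *\<^sub>R y x \<partial>M)"
        if "integrable M y" for y :: "'a \<Rightarrow> 'b"
      proof -
        have ind: "(indicator (?U k) x :: real) = (\<Sum>i<k. indicator (B i) x)" for x
          using union(1) by (intro indicator_UN_disjoint) (auto simp: disjoint_family_on_def)
        show ?thesis unfolding ind scaleR_sum_left using I that by (subst Bochner_Integration.integral_sum) auto
      qed
      show ?thesis unfolding *[OF YI] *[OF ZI] by (intro tendsto_sum union)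
    qed
    let ?V = "\<lambda>k. (\<Union>i. B i) - ?U k"
    have est: "dist (\<integral>x. indicator (\<Union>i. B i) x *\<^sub>R y x \<partial>M) (\<integral>x. indicator (?U k) x *\<^sub>R y x \<partial>M) \<le> K * prob (?V k)"
      if y: "integrable M y" "\<And>x. x \<in> space M \<Longrightarrow> norm (y x) \<le> K" for y :: "'a \<Rightarrow> 'b" and k
    proof -
      have "(\<integral>x. indicator (\<Union>i. B i) x *\<^sub>R y x \<partial>M) - (\<integral>x. indicator (?U k) x *\<^sub>R y x \<partial>M)
        = (\<integral>x. indicator (\<Union>i. B i) x *\<^sub>R y x - indicator (?U k) x *\<^sub>R y x \<partial>M)"
        using I y by (intro Bochner_Integration.integral_diff[symmetric]) auto
      also have "\<dots> = (\<integral>x. indicator (?V k) x *\<^sub>R y x \<partial>M)"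
        by (intro Bochner_Integration.integral_cong) (auto simp: indicator_def)
      also have "norm \<dots> \<le> (\<integral>x. norm (indicator (?V k) x *\<^sub>R y x) \<partial>M)" by (rule integral_norm_bound)
      also have "\<dots> \<le> (\<integral>x. K * indicator (?V k) x \<partial>M)"
      proof (rule integral_mono)
        show "integrable M (\<lambda>x. norm (indicator (?V k) x *\<^sub>R y x))" by (intro integrable_norm I y(1)) auto
        show "integrable M (\<lambda>x. K * indicator (?V k) x)"
          by (intro integrable_mult_right integrable_real_indicator) (auto simp: emeasure_eq_measure)
        show "norm (indicator (?V k) x *\<^sub>R y x) \<le> K * indicator (?V k) x" if "x \<in> space M" for x
          using y(2)[OF that] by (cases "x \<in> ?V k") simp_all
      qed
      finally show ?thesis by (simp add: dist_norm)
    qed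
    have "(\<lambda>k. prob (?U k)) \<longlonglongrightarrow> prob (\<Union>k. ?U k)"
      by (rule finite_Lim_measure_incseq) (auto simp: incseq_def, fastforce)
    moreover have "(\<Union>k. ?U k) = (\<Union>i. B i)" by auto
    moreover have "prob (?V k) = prob (\<Union>i. B i) - prob (?U k)" for k
      by (intro finite_measure_Diff) auto
    ultimately have "(\<lambda>k. K * prob (?V k)) \<longlonglongrightarrow> K * (prob (\<Union>i. B i) - prob (\<Union>i. B i))"
      by (simp only:) (intro tendsto_intros)
    then have lim0: "(\<lambda>k. K * prob (?V k)) \<longlonglongrightarrow> 0" by simp
    show ?case
    proof (rule tendsto_by_approximation)
      fix e :: real assume "0 < e"
      then have "\<forall>\<^sub>F k in sequentially. K * prob (?V k) < e" using order_tendstoD(2)[OF lim0] by simp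
      then obtain k where k: "K * prob (?V k) < e" using eventually_happens by force
      show "\<exists>a L. a \<longlonglongrightarrow> L \<and> dist L (\<integral>x. indicator (\<Union>i. B i) x *\<^sub>R Z x \<partial>M) \<le> e \<and>
          (\<forall>\<^sub>F n in sequentially. dist (\<integral>x. indicator (\<Union>i. B i) x *\<^sub>R Y n x \<partial>M) (a n) \<le> e)"
      proof (intro exI conjI)
        show "dist (\<integral>x. indicator (?U k) x *\<^sub>R Z x \<partial>M) (\<integral>x. indicator (\<Union>i. B i) x *\<^sub>R Z x \<partial>M) \<le> e"
          using est[OF ZI bnd(2), of k] k by (simp add: dist_commute)
        show "\<forall>\<^sub>F n in sequentially. dist (\<integral>x. indicator (\<Union>i. B i) x *\<^sub>R Y n x \<partial>M)
            (\<integral>x. indicator (?U k) x *\<^sub>R Y n x \<partial>M) \<le> e"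
          by (intro always_eventually allI order_trans[OF est[OF YI bnd(1)] less_imp_le[OF k]])
      qed (rule part)
    qed
  qed (auto intro: E_lim)
qed

end


section \<open>A stable central limit theorem for bounded martingale differences\<close>

text \<open>The martingale property and the identification of \<open>q n\<close> as the conditional
  variance of \<open>D (Suc n)\<close> given \<open>F n\<close> are stated by testing against
  bounded \<open>F n\<close>-measurable functions; this is the form in which they are used,
  and it avoids versions of conditional expectations. The indices start at 1, as the
  filtration of a partition of \<open>{1..n}\<close> does.\<close>
locale bounded_martingale_differences = prob_space M for M :: "'a measure" +
  fixes F :: "nat \<Rightarrow> 'a measure" and D q :: "nat \<Rightarrow> 'a \<Rightarrow> real" and c :: real
  assumes subalg: "\<And>n. 1 \<le> n \<Longrightarrow> subalgebra M (F n)"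
    and filt: "\<And>m n. 1 \<le> m \<Longrightarrow> m \<le> n \<Longrightarrow> subalgebra (F n) (F m)"
    and D_meas: "\<And>n. 1 \<le> n \<Longrightarrow> D (Suc n) \<in> borel_measurable (F (Suc n))"
    and q_meas: "\<And>n. 1 \<le> n \<Longrightarrow> q n \<in> borel_measurable (F n)"
    and D_bound: "\<And>n \<omega>. 1 \<le> n \<Longrightarrow> \<omega> \<in> space M \<Longrightarrow> \<bar>D (Suc n) \<omega>\<bar> \<le> c"
    and q_nonneg: "\<And>n \<omega>. 1 \<le> n \<Longrightarrow> \<omega> \<in> space M \<Longrightarrow> 0 \<le> q n \<omega>"
    and q_bound: "\<And>n \<omega>. 1 \<le> n \<Longrightarrow> \<omega> \<in> space M \<Longrightarrow> q n \<omega> \<le> c\<^sup>2"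
    and mean_zero: "\<And>n W B. 1 \<le> n \<Longrightarrow> W \<in> borel_measurable (F n) \<Longrightarrow> (\<And>\<omega>. \<omega> \<in> space M \<Longrightarrow> \<bar>W \<omega>\<bar> \<le> B)
       \<Longrightarrow> (\<integral>\<omega>. W \<omega> * D (Suc n) \<omega> \<partial>M) = (0::real)"
    and cond_var: "\<And>n W B. 1 \<le> n \<Longrightarrow> W \<in> borel_measurable (F n) \<Longrightarrow> (\<And>\<omega>. \<omega> \<in> space M \<Longrightarrow> \<bar>W \<omega>\<bar> \<le> B)
       \<Longrightarrow> (\<integral>\<omega>. W \<omega> * (D (Suc n) \<omega>)\<^sup>2 \<partial>M) = (\<integral>\<omega>. W \<omega> * q n \<omega> \<partial>M)"
begin

lemma c_nonneg: "0 \<le> c"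
proof -
  obtain \<omega> where "\<omega> \<in> space M" using not_empty by blast
  from D_bound[OF le_refl this] show ?thesis by linarith
qed

lemma measurable_D: "1 \<le> i \<Longrightarrow> i < n \<Longrightarrow> D (Suc i) \<in> borel_measurable (F n)"
  using measurable_from_subalg[OF filt D_meas] by simp

lemma measurable_q: "1 \<le> i \<Longrightarrow> i \<le> n \<Longrightarrow> q i \<in> borel_measurable (F n)"
  using measurable_from_subalg[OF filt q_meas] by simp

lemma measurable_DM [measurable]: "1 \<le> i \<Longrightarrow> D (Suc i) \<in> borel_measurable M"
  using measurable_from_subalg[OF subalg D_meas] by simp

lemma measurable_qM [measurable]: "1 \<le> i \<Longrightarrow> q i \<in> borel_measurable M"
  using measurable_from_subalg[OF subalg q_meas] by simp

lemma integrable_bounded: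
  fixes W :: "'a \<Rightarrow> 'b::{banach, second_countable_topology}"
  assumes "W \<in> borel_measurable M" "\<And>\<omega>. \<omega> \<in> space M \<Longrightarrow> norm (W \<omega>) \<le> B"
  shows "integrable M W"
  using assms by (intro integrable_const_bound[where B=B]) auto

lemma integrable_mult_bounded:
  fixes W :: "'a \<Rightarrow> 'b::{real_normed_field, banach, second_countable_topology}"
  assumes [measurable]: "W \<in> borel_measurable M" "r \<in> borel_measurable M"
    and "\<And>\<omega>. \<omega> \<in> space M \<Longrightarrow> norm (W \<omega>) \<le> B" "\<And>\<omega>. \<omega> \<in> space M \<Longrightarrow> \<bar>r \<omega>\<bar> \<le> b"
  shows "integrable M (\<lambda>\<omega>. W \<omega> * of_real (r \<omega>))"
proof (rule integrable_bounded)
  show "norm (W \<omega> * of_real (r \<omega>)) \<le> B * b" if "\<omega> \<in> space M" for \<omega>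
    unfolding norm_mult norm_of_real
    by (rule mult_mono') (use assms(3,4)[OF that] in auto)
qed simp

lemma D_square_bound: "1 \<le> n \<Longrightarrow> \<omega> \<in> space M \<Longrightarrow> \<bar>(D (Suc n) \<omega>)\<^sup>2\<bar> \<le> c\<^sup>2"
  using D_bound[of n \<omega>] power_mono[of "\<bar>D (Suc n) \<omega>\<bar>" c 2] by simp

lemma q_abs_bound: "1 \<le> n \<Longrightarrow> \<omega> \<in> space M \<Longrightarrow> \<bar>q n \<omega>\<bar> \<le> c\<^sup>2"
  using q_bound q_nonneg by simp

lemma integrable_q: "1 \<le> i \<Longrightarrow> integrable M (q i)"
  using q_nonneg q_bound by (intro integrable_bounded[where B="c\<^sup>2"]) auto

text \<open>Martingale differences are orthogonal, so the variance of a weighted sum is the sum of the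
  variances.\<close>
lemma second_moment_sum:
  assumes "1 \<le> m"
  shows "(\<integral>\<omega>. (\<Sum>i\<in>{m..<n}. d i * D (Suc i) \<omega>)\<^sup>2 \<partial>M) = (\<Sum>i\<in>{m..<n}. (d i)\<^sup>2 * (\<integral>\<omega>. q i \<omega> \<partial>M))"
proof (induction n)
  case (Suc n)
  show ?case
  proof (cases "m \<le> n")
    case True
    then have n: "1 \<le> n" using assms by simp
    let ?S = "\<lambda>\<omega>. \<Sum>i\<in>{m..<n}. d i * D (Suc i) \<omega>"
    have S_meas: "?S \<in> borel_measurable (F n)"
      using assms by (intro borel_measurable_sum borel_measurable_times measurable_D) auto
    then have [measurable]: "?S \<in> borel_measurable M" by (rule measurable_from_subalg[OF subalg[OF n]])
    have [measurable]: "D (Suc n) \<in> borel_measurable M" using n by simp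
    have S_bd: "\<bar>?S \<omega>\<bar> \<le> (\<Sum>i\<in>{m..<n}. \<bar>d i\<bar> * c)" if "\<omega> \<in> space M" for \<omega>
      using assms D_bound[OF _ that]
      by (intro order_trans[OF sum_abs] sum_mono) (auto simp: abs_mult intro!: mult_left_mono)
    have D_bd: "\<bar>D (Suc n) \<omega>\<bar> \<le> c" if "\<omega> \<in> space M" for \<omega> using D_bound[OF n that] .
    have bd2: "norm ((x::real)\<^sup>2) \<le> B\<^sup>2" if "\<bar>x\<bar> \<le> B" for x B
      using power_mono[OF that, of 2] by simp
    have i1: "integrable M (\<lambda>\<omega>. (?S \<omega>)\<^sup>2)" by (rule integrable_bounded[OF _ bd2[OF S_bd]]) auto
    have i2: "integrable M (\<lambda>\<omega>. (D (Suc n) \<omega>)\<^sup>2)" by (rule integrable_bounded[OF _ bd2[OF D_bd]]) auto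
    have i3: "integrable M (\<lambda>\<omega>. ?S \<omega> * D (Suc n) \<omega>)"
      by (rule integrable_bounded[where B="(\<Sum>i\<in>{m..<n}. \<bar>d i\<bar> * c) * c"])
        (use S_bd D_bd c_nonneg in \<open>auto simp: abs_mult intro!: mult_mono sum_nonneg\<close>)
    have "(\<integral>\<omega>. (\<Sum>i\<in>{m..<Suc n}. d i * D (Suc i) \<omega>)\<^sup>2 \<partial>M)
      = (\<integral>\<omega>. (?S \<omega>)\<^sup>2 + 2 * d n * (?S \<omega> * D (Suc n) \<omega>) + (d n)\<^sup>2 * (D (Suc n) \<omega>)\<^sup>2 \<partial>M)"
      using True by (intro Bochner_Integration.integral_cong) (auto simp: power2_eq_square algebra_simps)
    also have "\<dots> = (\<integral>\<omega>. (?S \<omega>)\<^sup>2 \<partial>M) + 2 * d n * (\<integral>\<omega>. ?S \<omega> * D (Suc n) \<omega> \<partial>M) + (d n)\<^sup>2 * (\<integral>\<omega>. (D (Suc n) \<omega>)\<^sup>2 \<partial>M)"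
      using i1 i2 i3 by simp
    also have "(\<integral>\<omega>. ?S \<omega> * D (Suc n) \<omega> \<partial>M) = 0" by (rule mean_zero[OF n S_meas S_bd])
    also have "(\<integral>\<omega>. (D (Suc n) \<omega>)\<^sup>2 \<partial>M) = (\<integral>\<omega>. q n \<omega> \<partial>M)"
      using cond_var[OF n, of "\<lambda>_. 1" 1] by simp
    finally show ?thesis using True Suc.IH by simp
  next
    case False
    then show ?thesis by simp
  qed
qed simp

lemma complex_mean_zero:
  fixes W :: "'a \<Rightarrow> complex"
  assumes n: "1 \<le> n" and W: "W \<in> borel_measurable (F n)" and bd: "\<And>\<omega>. \<omega> \<in> space M \<Longrightarrow> norm (W \<omega>) \<le> B"
  shows "(\<integral>\<omega>. W \<omega> * of_real (D (Suc n) \<omega>) \<partial>M) = 0"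
    "(\<integral>\<omega>. W \<omega> * of_real ((D (Suc n) \<omega>)\<^sup>2) \<partial>M) = (\<integral>\<omega>. W \<omega> * of_real (q n \<omega>) \<partial>M)"
proof -
  have [measurable]: "W \<in> borel_measurable M" "D (Suc n) \<in> borel_measurable M" "q n \<in> borel_measurable M"
    using measurable_from_subalg[OF subalg[OF n] W] n by auto
  have B: "0 \<le> B" using bd not_empty norm_ge_zero order_trans by blast
  have i: "integrable M (\<lambda>\<omega>. W \<omega> * of_real (D (Suc n) \<omega>))"
    "integrable M (\<lambda>\<omega>. W \<omega> * of_real ((D (Suc n) \<omega>)\<^sup>2))" "integrable M (\<lambda>\<omega>. W \<omega> * of_real (q n \<omega>))"
    by (rule integrable_mult_bounded[OF _ _ bd D_bound[OF n]] integrable_mult_bounded[OF _ _ bd D_square_bound[OF n]]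
        integrable_mult_bounded[OF _ _ bd q_abs_bound[OF n]]; measurable)+
  have Wr: "(\<lambda>\<omega>. Re (W \<omega>)) \<in> borel_measurable (F n)" "(\<lambda>\<omega>. Im (W \<omega>)) \<in> borel_measurable (F n)" using W by auto
  have bdr: "\<bar>Re (W \<omega>)\<bar> \<le> B" "\<bar>Im (W \<omega>)\<bar> \<le> B" if "\<omega> \<in> space M" for \<omega>
    using bd[OF that] abs_Re_le_cmod[of "W \<omega>"] abs_Im_le_cmod[of "W \<omega>"] by linarith+
  show "(\<integral>\<omega>. W \<omega> * of_real (D (Suc n) \<omega>) \<partial>M) = 0"
    using mean_zero[OF n Wr(1) bdr(1)] mean_zero[OF n Wr(2) bdr(2)]
    by (intro complex_eqI) (simp_all add: integral_Re[OF i(1), symmetric] integral_Im[OF i(1), symmetric])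
  show "(\<integral>\<omega>. W \<omega> * of_real ((D (Suc n) \<omega>)\<^sup>2) \<partial>M) = (\<integral>\<omega>. W \<omega> * of_real (q n \<omega>) \<partial>M)"
    using cond_var[OF n Wr(1) bdr(1)] cond_var[OF n Wr(2) bdr(2)]
    by (intro complex_eqI) (simp_all only: integral_Re[OF i(2), symmetric] integral_Im[OF i(2), symmetric]
       integral_Re[OF i(3), symmetric] integral_Im[OF i(3), symmetric], simp_all)
qed

end

lemma exp_minus_second_order:
  fixes x :: real assumes "0 \<le> x" shows "\<bar>1 - x - exp (- x)\<bar> \<le> x\<^sup>2"
proof -
  have 1: "1 - x \<le> exp (- x)" using exp_ge_add_one_self[of "- x"] by simp
  have "exp (- x) \<le> 1 / (1 + x)" using exp_ge_add_one_self[of x] assms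
    by (simp add: exp_minus field_simps)
  also have "\<dots> \<le> 1 - x + x\<^sup>2"
    using assms by (simp add: field_simps power2_eq_square)
  finally show ?thesis using 1 by (simp add: abs_if)
qed

lemma iexp_second_order:
  fixes x :: real shows "cmod (iexp x - 1 - \<i> * x + x\<^sup>2 / 2) \<le> \<bar>x\<bar>^3 / 6"
proof -
  have "(\<Sum>k \<le> 2. (\<i> * x)^k / fact k) = 1 + \<i> * x - x\<^sup>2 / 2"
    by (simp add: numeral_2_eq_2 power_mult_distrib)
  then have "iexp x - 1 - \<i> * x + x\<^sup>2 / 2 = iexp x - (\<Sum>k \<le> 2. (\<i> * x)^k / fact k)" by (simp add: algebra_simps)
  moreover have "\<bar>x\<bar> ^ Suc 2 / fact (Suc 2) = \<bar>x\<bar>^3 / 6" by (simp add: fact_numeral numeral_3_eq_3)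
  ultimately show ?thesis using iexp_approx1[of x 2] by (simp only:)
qed

context bounded_martingale_differences
begin

text \<open>Expanding \<open>iexp (s * D)\<close> and \<open>exp (- s\<^sup>2 * q / 2)\<close> to second
  order, the terms of order one and two cancel after integration against an \<open>F
  n\<close>-measurable \<open>W\<close>. The remainders are \<open>O(\<bar>s\<bar>\<^sup>3
  D\<^sup>2)\<close> and \<open>O(s\<^sup>4 q)\<close> because \<open>D\<close> and
  \<open>q\<close> are bounded, so both are paid for by the conditional variance; summed over
  the steps they stay of order \<open>\<bar>s\<bar>\<^sup>3\<close> times the total variance.\<close>
lemma one_step_estimate:
  fixes W :: "'a \<Rightarrow> complex" and s :: real
  assumes n: "1 \<le> n" and W: "W \<in> borel_measurable (F n)" and bd: "\<And>\<omega>. \<omega> \<in> space M \<Longrightarrow> norm (W \<omega>) \<le> B"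
  shows "norm (\<integral>\<omega>. W \<omega> * (iexp (s * D (Suc n) \<omega>) - of_real (exp (- (s\<^sup>2 * q n \<omega> / 2)))) \<partial>M)
    \<le> (\<bar>s\<bar>^3 * c / 6 + s^4 * c\<^sup>2 / 4) * (\<integral>\<omega>. norm (W \<omega>) * q n \<omega> \<partial>M)"
proof -
  define R1 where "R1 \<omega> = iexp (s * D (Suc n) \<omega>) - 1 - \<i> * (s * D (Suc n) \<omega>) + (s * D (Suc n) \<omega>)\<^sup>2 / 2" for \<omega>
  define R2 where "R2 \<omega> = 1 - s\<^sup>2 * q n \<omega> / 2 - exp (- (s\<^sup>2 * q n \<omega> / 2))" for \<omega>
  have [measurable]: "W \<in> borel_measurable M" "D (Suc n) \<in> borel_measurable M" "q n \<in> borel_measurable M"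
    using measurable_from_subalg[OF subalg[OF n] W] n by auto
  have [measurable]: "R1 \<in> borel_measurable M" "R2 \<in> borel_measurable M"
    unfolding R1_def R2_def by measurable
  have B: "0 \<le> B" using bd not_empty norm_ge_zero order_trans by blast
  have i: "integrable M (\<lambda>\<omega>. W \<omega> * of_real (D (Suc n) \<omega>))"
    "integrable M (\<lambda>\<omega>. W \<omega> * of_real ((D (Suc n) \<omega>)\<^sup>2))" "integrable M (\<lambda>\<omega>. W \<omega> * of_real (q n \<omega>))"
    by (rule integrable_mult_bounded[OF _ _ bd D_bound[OF n]] integrable_mult_bounded[OF _ _ bd D_square_bound[OF n]]
        integrable_mult_bounded[OF _ _ bd q_abs_bound[OF n]]; measurable)+
  have nbd: "norm (norm (W \<omega>)) \<le> B" if "\<omega> \<in> space M" for \<omega> using bd[OF that] by simp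
  have i': "integrable M (\<lambda>\<omega>. norm (W \<omega>) * ((D (Suc n) \<omega>)\<^sup>2))" "integrable M (\<lambda>\<omega>. norm (W \<omega>) * q n \<omega>)"
    using integrable_mult_bounded[OF _ _ nbd D_square_bound[OF n]] integrable_mult_bounded[OF _ _ nbd q_abs_bound[OF n]]
    by simp_all
  have R1: "norm (R1 \<omega>) \<le> \<bar>s\<bar>^3 * c / 6 * (D (Suc n) \<omega>)\<^sup>2" if "\<omega> \<in> space M" for \<omega>
  proof -
    have "norm (R1 \<omega>) \<le> \<bar>s * D (Suc n) \<omega>\<bar>^3 / 6" unfolding R1_def using iexp_second_order[of "s * D (Suc n) \<omega>"] by simp
    also have "\<dots> = \<bar>s\<bar>^3 / 6 * (\<bar>D (Suc n) \<omega>\<bar> * (D (Suc n) \<omega>)\<^sup>2)"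
    proof -
      have "\<bar>y\<bar>^3 = \<bar>y\<bar> * y\<^sup>2" for y :: real
      proof -
        have "\<bar>y\<bar>^3 = \<bar>y\<bar> * \<bar>y\<bar>\<^sup>2" by (simp add: eval_nat_numeral)
        then show ?thesis by simp
      qed
      then show ?thesis by (simp add: abs_mult power_mult_distrib)
    qed
    also have "\<dots> \<le> \<bar>s\<bar>^3 / 6 * (c * (D (Suc n) \<omega>)\<^sup>2)"
      using D_bound[OF n that] by (intro mult_left_mono mult_right_mono) auto
    finally show ?thesis by (simp add: algebra_simps)
  qed
  have R2: "\<bar>R2 \<omega>\<bar> \<le> s^4 * c\<^sup>2 / 4 * q n \<omega>" if "\<omega> \<in> space M" for \<omega>
  proof -
    have "\<bar>R2 \<omega>\<bar> \<le> (s\<^sup>2 * q n \<omega> / 2)\<^sup>2" unfolding R2_def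
      using exp_minus_second_order[of "s\<^sup>2 * q n \<omega> / 2"] q_nonneg[OF n that] by simp
    also have "\<dots> = s^4 / 4 * (q n \<omega> * q n \<omega>)" by (simp add: power2_eq_square power4_eq_xxxx field_simps)
    also have "\<dots> \<le> s^4 / 4 * (c\<^sup>2 * q n \<omega>)"
      using q_bound[OF n that] q_nonneg[OF n that] by (intro mult_left_mono mult_right_mono) auto
    finally show ?thesis by (simp add: algebra_simps)
  qed
  have n1: "norm (W \<omega> * R1 \<omega>) \<le> \<bar>s\<bar>^3 * c / 6 * (norm (W \<omega>) * (D (Suc n) \<omega>)\<^sup>2)" if "\<omega> \<in> space M" for \<omega>
    using mult_left_mono[OF R1[OF that], of "norm (W \<omega>)"] by (simp add: norm_mult algebra_simps)
  have n2: "norm (W \<omega> * of_real (R2 \<omega>)) \<le> s^4 * c\<^sup>2 / 4 * (norm (W \<omega>) * q n \<omega>)" if "\<omega> \<in> space M" for \<omega>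
    using mult_left_mono[OF R2[OF that], of "norm (W \<omega>)"] by (simp add: norm_mult algebra_simps)
  have i1: "integrable M (\<lambda>\<omega>. W \<omega> * R1 \<omega>)"
    by (rule Bochner_Integration.integrable_bound[OF integrable_mult_right[OF i'(1), of "\<bar>s\<bar>^3 * c / 6"]])
      (use order_trans[OF n1 abs_ge_self] in \<open>auto intro!: AE_I2\<close>)
  have i2: "integrable M (\<lambda>\<omega>. W \<omega> * of_real (R2 \<omega>))"
    by (rule Bochner_Integration.integrable_bound[OF integrable_mult_right[OF i'(2), of "s^4 * c\<^sup>2 / 4"]])
      (use order_trans[OF n2 abs_ge_self] in \<open>auto intro!: AE_I2\<close>)
  have "(\<integral>\<omega>. W \<omega> * (iexp (s * D (Suc n) \<omega>) - of_real (exp (- (s\<^sup>2 * q n \<omega> / 2)))) \<partial>M)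
     = (\<integral>\<omega>. W \<omega> * R1 \<omega> + (\<i> * s) * (W \<omega> * of_real (D (Suc n) \<omega>))
          - (s\<^sup>2 / 2) * (W \<omega> * of_real ((D (Suc n) \<omega>)\<^sup>2)) + (s\<^sup>2 / 2) * (W \<omega> * of_real (q n \<omega>)) + W \<omega> * of_real (R2 \<omega>) \<partial>M)"
    by (intro Bochner_Integration.integral_cong) (auto simp: R1_def R2_def field_simps power2_eq_square)
  also have "\<dots> = (\<integral>\<omega>. W \<omega> * R1 \<omega> \<partial>M) + (\<i> * s) * (\<integral>\<omega>. W \<omega> * of_real (D (Suc n) \<omega>) \<partial>M)
          - (s\<^sup>2 / 2) * (\<integral>\<omega>. W \<omega> * of_real ((D (Suc n) \<omega>)\<^sup>2) \<partial>M)
          + (s\<^sup>2 / 2) * (\<integral>\<omega>. W \<omega> * of_real (q n \<omega>) \<partial>M) + (\<integral>\<omega>. W \<omega> * of_real (R2 \<omega>) \<partial>M)"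
    using i i1 i2 by simp
  also have "\<dots> = (\<integral>\<omega>. W \<omega> * R1 \<omega> \<partial>M) + (\<integral>\<omega>. W \<omega> * of_real (R2 \<omega>) \<partial>M)"
    using complex_mean_zero[OF n W bd] by simp
  also have "norm \<dots> \<le> (\<integral>\<omega>. norm (W \<omega> * R1 \<omega>) \<partial>M) + (\<integral>\<omega>. norm (W \<omega> * of_real (R2 \<omega>)) \<partial>M)"
    by (rule norm_triangle_le[OF add_mono[OF integral_norm_bound integral_norm_bound]])
  also have "\<dots> \<le> (\<integral>\<omega>. \<bar>s\<bar>^3 * c / 6 * (norm (W \<omega>) * (D (Suc n) \<omega>)\<^sup>2) \<partial>M)
      + (\<integral>\<omega>. s^4 * c\<^sup>2 / 4 * (norm (W \<omega>) * q n \<omega>) \<partial>M)"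
    using i i' i1 i2 n1 n2 by (intro add_mono integral_mono) auto
  also have "\<dots> = \<bar>s\<bar>^3 * c / 6 * (\<integral>\<omega>. norm (W \<omega>) * (D (Suc n) \<omega>)\<^sup>2 \<partial>M)
      + s^4 * c\<^sup>2 / 4 * (\<integral>\<omega>. norm (W \<omega>) * q n \<omega> \<partial>M)" by simp
  also have "(\<integral>\<omega>. norm (W \<omega>) * (D (Suc n) \<omega>)\<^sup>2 \<partial>M) = (\<integral>\<omega>. norm (W \<omega>) * q n \<omega> \<partial>M)"
    using W bd by (intro cond_var[OF n, where B=B]) auto
  finally show ?thesis by (simp add: algebra_simps)
qed

end


context bounded_martingale_differences
begin

text \<open>The sums are stopped when the accumulated conditional variance \<open>V\<close> would exceed
  the level \<open>L\<close>. Since \<open>V (Suc k)\<close> is already \<open>F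
  k\<close>-measurable, the decision is predictable, and the stopped variance never exceeds
  \<open>L\<close>. This keeps the normalizing factor in \<open>exp_mart\<close> bounded.\<close>
definition V :: "nat \<Rightarrow> 'a \<Rightarrow> real" where "V n \<omega> = (\<Sum>i\<in>{1..<n}. q i \<omega>)"
definition active :: "real \<Rightarrow> nat \<Rightarrow> 'a \<Rightarrow> real" where "active L k \<omega> = of_bool (V (Suc k) \<omega> \<le> L)"
definition stopped_sum :: "real \<Rightarrow> nat \<Rightarrow> 'a \<Rightarrow> real" where
  "stopped_sum L n \<omega> = (\<Sum>i\<in>{1..<n}. active L i \<omega> * D (Suc i) \<omega>)"
definition stopped_var :: "real \<Rightarrow> nat \<Rightarrow> 'a \<Rightarrow> real" where
  "stopped_var L n \<omega> = (\<Sum>i\<in>{1..<n}. active L i \<omega> * q i \<omega>)"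
definition exp_mart :: "real \<Rightarrow> real \<Rightarrow> nat \<Rightarrow> 'a \<Rightarrow> complex" where
  "exp_mart s L n \<omega> = of_real (exp (s\<^sup>2 * stopped_var L n \<omega> / 2)) * iexp (s * stopped_sum L n \<omega>)"

lemma V_mono: "\<omega> \<in> space M \<Longrightarrow> m \<le> n \<Longrightarrow> V m \<omega> \<le> V n \<omega>"
  unfolding V_def using q_nonneg by (intro sum_mono2) auto

lemma stopped_eq:
  assumes "\<omega> \<in> space M" "V n \<omega> \<le> L"
  shows "stopped_var L n \<omega> = V n \<omega>" "stopped_sum L n \<omega> = (\<Sum>i\<in>{1..<n}. D (Suc i) \<omega>)"
proof -
  have "active L i \<omega> = 1" if "i \<in> {1..<n}" for i
    using V_mono[OF assms(1), of "Suc i" n] assms(2) that by (simp add: active_def)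
  then show "stopped_var L n \<omega> = V n \<omega>" "stopped_sum L n \<omega> = (\<Sum>i\<in>{1..<n}. D (Suc i) \<omega>)"
    by (simp_all add: stopped_var_def stopped_sum_def V_def)
qed

lemma stopped_var_le_V: "\<omega> \<in> space M \<Longrightarrow> stopped_var L n \<omega> \<le> V n \<omega>"
  unfolding stopped_var_def V_def using q_nonneg by (intro sum_mono) (auto simp: active_def)

lemma stopped_var_nonneg: "\<omega> \<in> space M \<Longrightarrow> 0 \<le> stopped_var L n \<omega>"
  unfolding stopped_var_def using q_nonneg by (intro sum_nonneg) (auto simp: active_def)

lemma stopped_var_le:
  assumes \<omega>: "\<omega> \<in> space M" and "0 \<le> L"
  shows "stopped_var L n \<omega> \<le> L"
proof (induction n)
  case (Suc n)
  show ?case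
  proof (cases "1 \<le> n \<and> V (Suc n) \<omega> \<le> L")
    case True
    then show ?thesis using stopped_var_le_V[OF \<omega>, of L "Suc n"] by linarith
  next
    case False
    then have "stopped_var L (Suc n) \<omega> = stopped_var L n \<omega>"
      by (cases "1 \<le> n") (auto simp: stopped_var_def active_def)
    then show ?thesis using Suc.IH by simp
  qed
qed (use assms in \<open>simp add: stopped_var_def\<close>)

lemma measurable_V: "1 \<le> n \<Longrightarrow> V (Suc n) \<in> borel_measurable (F n)"
  unfolding V_def by (intro borel_measurable_sum measurable_q) auto

lemma measurable_active: "1 \<le> i \<Longrightarrow> i \<le> n \<Longrightarrow> active L i \<in> borel_measurable (F n)"
proof -
  assume i: "1 \<le> i" "i \<le> n"
  have [measurable]: "V (Suc i) \<in> borel_measurable (F n)"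
    by (rule measurable_from_subalg[OF filt measurable_V]) (use i in auto)
  show ?thesis unfolding active_def by measurable
qed

lemma measurable_stopped:
  assumes "1 \<le> n"
  shows "stopped_sum L n \<in> borel_measurable (F n)" "stopped_var L n \<in> borel_measurable (F n)"
  unfolding stopped_sum_def stopped_var_def
  by (intro borel_measurable_sum borel_measurable_times measurable_D measurable_q measurable_active; simp)+

lemma measurable_exp_mart: "1 \<le> n \<Longrightarrow> exp_mart s L n \<in> borel_measurable (F n)"
  using measurable_stopped[of n L] unfolding exp_mart_def by measurable

lemma norm_exp_mart_le:
  assumes "\<omega> \<in> space M" "0 \<le> L"
  shows "norm (exp_mart s L n \<omega>) \<le> exp (s\<^sup>2 * L / 2)"
  unfolding exp_mart_def norm_mult norm_exp_i_times
  using stopped_var_le[OF assms] by (simp add: mult_left_mono)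

lemma exp_mart_integrable:
  assumes "1 \<le> k" "0 \<le> L" shows "integrable M (exp_mart s L k)"
proof (rule integrable_bounded)
  show "exp_mart s L k \<in> borel_measurable M"
    by (rule measurable_from_subalg[OF subalg measurable_exp_mart]; fact)
  show "norm (exp_mart s L k \<omega>) \<le> exp (s\<^sup>2 * L / 2)" if "\<omega> \<in> space M" for \<omega>
    by (rule norm_exp_mart_le[OF that assms(2)])
qed

text \<open>On the event that step \<open>k\<close> is active, the increment of the exponential is the
  one-step difference estimated in \<open>one_step_estimate\<close>, multiplied by an \<open>F
  k\<close>-measurable weight; otherwise it vanishes.\<close>
lemma exp_mart_increment:
  fixes A :: "'a set"
  assumes k: "1 \<le> k" and A: "A \<in> sets (F k)" and L: "0 \<le> L"
  shows "norm (\<integral>\<omega>. indicator A \<omega> *\<^sub>R (exp_mart s L (Suc k) \<omega> - exp_mart s L k \<omega>) \<partial>M)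
    \<le> (\<bar>s\<bar>^3 * c / 6 + s^4 * c\<^sup>2 / 4) * exp (s\<^sup>2 * L / 2) * (\<integral>\<omega>. active L k \<omega> * q k \<omega> \<partial>M)"
proof -
  define W :: "'a \<Rightarrow> complex" where "W \<omega> = of_real (indicator A \<omega>) * of_real (active L k \<omega>) *
    of_real (exp (s\<^sup>2 * stopped_var L (Suc k) \<omega> / 2)) * iexp (s * stopped_sum L k \<omega>)" for \<omega>
  have sv: "stopped_var L (Suc k) \<omega> = stopped_var L k \<omega> + active L k \<omega> * q k \<omega>"
    and ss: "stopped_sum L (Suc k) \<omega> = stopped_sum L k \<omega> + active L k \<omega> * D (Suc k) \<omega>" for \<omega>
    using k by (auto simp: stopped_var_def stopped_sum_def)
  have [measurable]: "stopped_var L k \<in> borel_measurable (F k)" "stopped_sum L k \<in> borel_measurable (F k)"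
    "active L k \<in> borel_measurable (F k)" "q k \<in> borel_measurable (F k)"
    using measurable_stopped[OF k] measurable_active[OF k le_refl] q_meas[OF k] by auto
  have [measurable]: "stopped_var L (Suc k) \<in> borel_measurable (F k)" unfolding sv by measurable
  have [measurable]: "A \<in> sets (F k)" by fact
  have Wm: "W \<in> borel_measurable (F k)" unfolding W_def by measurable
  note [measurable] = Wm
  have act: "active L k \<omega> = 0 \<or> active L k \<omega> = 1" for \<omega> by (auto simp: active_def)
  have Wb': "norm (W \<omega>) \<le> active L k \<omega> * exp (s\<^sup>2 * L / 2)" if "\<omega> \<in> space M" for \<omega>
    using stopped_var_le[OF that L, of "Suc k"] act[of \<omega>] unfolding W_def norm_mult norm_exp_i_times
    by (auto simp: mult_left_mono indicator_def)
  then have Wb: "norm (W \<omega>) \<le> exp (s\<^sup>2 * L / 2)" if "\<omega> \<in> space M" for \<omega>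
    using Wb'[OF that] act[of \<omega>] by (cases "active L k \<omega> = 0") auto
  have [measurable]: "W \<in> borel_measurable M" "active L k \<in> borel_measurable M" "q k \<in> borel_measurable M"
    by (rule measurable_from_subalg[OF subalg[OF k]]; measurable)+
  have "indicator A \<omega> *\<^sub>R (exp_mart s L (Suc k) \<omega> - exp_mart s L k \<omega>)
     = W \<omega> * (iexp (s * D (Suc k) \<omega>) - of_real (exp (- (s\<^sup>2 * q k \<omega> / 2))))" for \<omega>
    using act[of \<omega>]
  proof
    assume a: "active L k \<omega> = 0"
    then show ?thesis by (simp add: W_def exp_mart_def sv ss)
  next
    assume a: "active L k \<omega> = 1"
    have "exp (s\<^sup>2 * stopped_var L (Suc k) \<omega> / 2) * exp (- (s\<^sup>2 * q k \<omega> / 2)) = exp (s\<^sup>2 * stopped_var L k \<omega> / 2)"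
      unfolding exp_add[symmetric] sv a by (simp add: algebra_simps add_divide_distrib)
    then have 1: "complex_of_real (exp (s\<^sup>2 * stopped_var L (Suc k) \<omega> / 2)) * of_real (exp (- (s\<^sup>2 * q k \<omega> / 2)))
        = of_real (exp (s\<^sup>2 * stopped_var L k \<omega> / 2))"
      unfolding of_real_mult[symmetric] by simp
    have 2: "iexp (s * stopped_sum L k \<omega>) * iexp (s * D (Suc k) \<omega>) = iexp (s * stopped_sum L (Suc k) \<omega>)"
      unfolding exp_add[symmetric] ss a by (simp add: algebra_simps)
    have "W \<omega> * (iexp (s * D (Suc k) \<omega>) - of_real (exp (- (s\<^sup>2 * q k \<omega> / 2))))
      = of_real (indicator A \<omega>) * (of_real (exp (s\<^sup>2 * stopped_var L (Suc k) \<omega> / 2)) * (iexp (s * stopped_sum L k \<omega>) * iexp (s * D (Suc k) \<omega>))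
        - (complex_of_real (exp (s\<^sup>2 * stopped_var L (Suc k) \<omega> / 2)) * of_real (exp (- (s\<^sup>2 * q k \<omega> / 2)))) * iexp (s * stopped_sum L k \<omega>))"
      unfolding W_def a by (simp add: algebra_simps)
    then show ?thesis unfolding 1 2 by (simp add: exp_mart_def scaleR_conv_of_real)
  qed
  then have "norm (\<integral>\<omega>. indicator A \<omega> *\<^sub>R (exp_mart s L (Suc k) \<omega> - exp_mart s L k \<omega>) \<partial>M)
     \<le> (\<bar>s\<bar>^3 * c / 6 + s^4 * c\<^sup>2 / 4) * (\<integral>\<omega>. norm (W \<omega>) * q k \<omega> \<partial>M)"
    using one_step_estimate[OF k Wm Wb] by simp
  also have "\<dots> \<le> (\<bar>s\<bar>^3 * c / 6 + s^4 * c\<^sup>2 / 4) * (\<integral>\<omega>. exp (s\<^sup>2 * L / 2) * (active L k \<omega> * q k \<omega>) \<partial>M)"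
  proof (intro mult_left_mono integral_mono)
    have nb: "norm (norm (W \<omega>)) \<le> exp (s\<^sup>2 * L / 2)" if "\<omega> \<in> space M" for \<omega> using Wb[OF that] by simp
    have nb': "norm (active L k \<omega>) \<le> 1" for \<omega> using act[of \<omega>] by auto
    show "integrable M (\<lambda>\<omega>. norm (W \<omega>) * q k \<omega>)"
      using integrable_mult_bounded[OF _ _ nb q_abs_bound[OF k]] by simp
    show "integrable M (\<lambda>\<omega>. exp (s\<^sup>2 * L / 2) * (active L k \<omega> * q k \<omega>))"
      using integrable_mult_bounded[OF _ _ nb' q_abs_bound[OF k]] by simp
    show "norm (W \<omega>) * q k \<omega> \<le> exp (s\<^sup>2 * L / 2) * (active L k \<omega> * q k \<omega>)" if "\<omega> \<in> space M" for \<omega>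
      using mult_right_mono[OF Wb'[OF that] q_nonneg[OF k that]] by (simp add: algebra_simps)
  qed (use c_nonneg in auto)
  finally show ?thesis by (simp only: integral_mult_right_zero mult.assoc)
qed

text \<open>The process \<open>exp_mart\<close> is a martingale up to an error proportional to the
  variance consumed, and the total consumption is at most \<open>L\<close>. For
  \<open>s\<close> of order \<open>1 / a\<close> and \<open>L\<close> of order
  \<open>a\<^sup>2\<close> the bound is of order \<open>1 / a\<close>.\<close>
lemma exp_mart_difference:
  assumes m: "1 \<le> m" "m \<le> n" and A: "A \<in> sets (F m)" and L: "0 \<le> L"
  shows "norm (\<integral>\<omega>. indicator A \<omega> *\<^sub>R (exp_mart s L n \<omega> - exp_mart s L m \<omega>) \<partial>M)
    \<le> (\<bar>s\<bar>^3 * c / 6 + s^4 * c\<^sup>2 / 4) * exp (s\<^sup>2 * L / 2) * L"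
proof -
  let ?\<kappa> = "(\<bar>s\<bar>^3 * c / 6 + s^4 * c\<^sup>2 / 4) * exp (s\<^sup>2 * L / 2)"
  have AM: "A \<in> events" using A subalg[OF m(1)] by (auto simp: subalgebra_def)
  have em: "exp_mart s L k \<in> borel_measurable M" if "1 \<le> k" for k
    by (rule measurable_from_subalg[OF subalg measurable_exp_mart]) (use that in auto)
  have ei: "integrable M (\<lambda>\<omega>. indicator A \<omega> *\<^sub>R (exp_mart s L k \<omega> - exp_mart s L l \<omega>))" if "1 \<le> k" "1 \<le> l" for k l
    by (rule integrable_mult_indicator[OF AM], rule Bochner_Integration.integrable_diff)
      (rule exp_mart_integrable[OF _ L], fact)+
  have aqi: "integrable M (\<lambda>\<omega>. active L k \<omega> * q k \<omega>)" if "1 \<le> k" for k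
  proof -
    have am: "active L k \<in> borel_measurable M"
      by (rule measurable_from_subalg[OF subalg measurable_active]) (use that in auto)
    have nb: "norm (active L k \<omega>) \<le> 1" for \<omega> by (simp add: active_def)
    show ?thesis
      using integrable_mult_bounded[OF am measurable_qM[OF that] nb q_abs_bound[OF that]] by simp
  qed
  have main: "norm (\<integral>\<omega>. indicator A \<omega> *\<^sub>R (exp_mart s L n \<omega> - exp_mart s L m \<omega>) \<partial>M)
    \<le> ?\<kappa> * (\<Sum>k\<in>{m..<n}. \<integral>\<omega>. active L k \<omega> * q k \<omega> \<partial>M)"
    using m(2)
  proof (induction n rule: dec_induct)
    case (step k)
    have k: "1 \<le> k" using step.hyps m by simp
    have Ak: "A \<in> sets (F k)" using A filt[OF m(1), of k] step.hyps by (auto simp: subalgebra_def)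
    let ?I = "\<lambda>k l. \<integral>\<omega>. indicator A \<omega> *\<^sub>R (exp_mart s L k \<omega> - exp_mart s L l \<omega>) \<partial>M"
    have "?I (Suc k) m
      = (\<integral>\<omega>. indicator A \<omega> *\<^sub>R (exp_mart s L (Suc k) \<omega> - exp_mart s L k \<omega>) + indicator A \<omega> *\<^sub>R (exp_mart s L k \<omega> - exp_mart s L m \<omega>) \<partial>M)"
      by (intro Bochner_Integration.integral_cong) (auto simp: algebra_simps)
    then have eq: "?I (Suc k) m = ?I (Suc k) k + ?I k m"
      by (simp only: Bochner_Integration.integral_add[OF ei[OF le_SucI[OF k] k] ei[OF k m(1)]])
    have "norm (?I (Suc k) m) \<le> ?\<kappa> * (\<integral>\<omega>. active L k \<omega> * q k \<omega> \<partial>M) + ?\<kappa> * (\<Sum>k\<in>{m..<k}. \<integral>\<omega>. active L k \<omega> * q k \<omega> \<partial>M)"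
      unfolding eq by (rule norm_triangle_le[OF add_mono[OF exp_mart_increment[OF k Ak L] step.IH]])
    then show ?case using step.hyps by (simp only: sum.atLeastLessThan_Suc distrib_left add.commute)
  qed simp
  have "(\<Sum>k\<in>{m..<n}. \<integral>\<omega>. active L k \<omega> * q k \<omega> \<partial>M) = (\<integral>\<omega>. (\<Sum>k\<in>{m..<n}. active L k \<omega> * q k \<omega>) \<partial>M)"
    using m aqi by (intro Bochner_Integration.integral_sum[symmetric]) auto
  also have "\<dots> \<le> L"
  proof (rule integral_le_const)
    show "integrable M (\<lambda>\<omega>. \<Sum>k\<in>{m..<n}. active L k \<omega> * q k \<omega>)" using m aqi by auto
    have "(\<Sum>k\<in>{m..<n}. active L k \<omega> * q k \<omega>) \<le> L" if "\<omega> \<in> space M" for \<omega>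
    proof -
      have "(\<Sum>k\<in>{m..<n}. active L k \<omega> * q k \<omega>) \<le> stopped_var L n \<omega>"
        unfolding stopped_var_def using m q_nonneg[OF _ that] by (intro sum_mono2) (auto simp: active_def)
      then show ?thesis using stopped_var_le[OF that L, of n] by linarith
    qed
    then show "AE \<omega> in M. (\<Sum>k\<in>{m..<n}. active L k \<omega> * q k \<omega>) \<le> L" by simp
  qed
  finally have "(\<Sum>k\<in>{m..<n}. \<integral>\<omega>. active L k \<omega> * q k \<omega> \<partial>M) \<le> L" .
  moreover have "0 \<le> ?\<kappa>" using c_nonneg by simp
  ultimately show ?thesis by (rule order_trans[OF main mult_left_mono])
qed

end


context bounded_martingale_differences
begin

text \<open>With \<open>s = t / a n\<close> and \<open>L = C * (a n)\<^sup>2\<close> the product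
  \<open>s\<^sup>2 * L\<close> is constant. The value at a fixed time \<open>m\<close> tends
  to 1 because only finitely many bounded terms are involved, and between \<open>m\<close> and
  \<open>n\<close> the near-martingale property holds up to \<open>O(1 / a n)\<close> on every
  event of \<open>F m\<close>.\<close>
lemma exp_mart_limit:
  fixes a :: "nat \<Rightarrow> real"
  assumes m: "1 \<le> m" and A: "A \<in> sets (F m)" and C: "0 \<le> C"
    and a: "filterlim a at_top sequentially"
  shows "(\<lambda>n. \<integral>\<omega>. indicator A \<omega> *\<^sub>R exp_mart (t / a n) (C * (a n)\<^sup>2) n \<omega> \<partial>M) \<longlonglongrightarrow> (\<integral>\<omega>. indicator A \<omega> *\<^sub>R (1::complex) \<partial>M)"
proof -
  let ?L = "\<lambda>n. C * (a n)\<^sup>2" let ?s = "\<lambda>n. t / a n"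
  let ?E = "\<lambda>n k. exp_mart (?s n) (?L n) k"
  have L: "0 \<le> ?L n" for n using C by simp
  have AM[measurable]: "A \<in> events" using A subalg[OF m] by (auto simp: subalgebra_def)
  have s0: "?s \<longlonglongrightarrow> 0" using a tendsto_divide_0[OF tendsto_const] filterlim_at_top_imp_at_infinity by blast
  have inva: "(\<lambda>n. 1 / a n) \<longlonglongrightarrow> 0" using a tendsto_divide_0[OF tendsto_const] filterlim_at_top_imp_at_infinity by blast
  have pos: "\<forall>\<^sub>F n in sequentially. 0 < a n" using a by (simp add: filterlim_at_top_dense)
  have sL: "(?s n)\<^sup>2 * ?L n / 2 \<le> t\<^sup>2 * C / 2" for n
    using C by (cases "a n = 0") (simp_all add: power_divide)
  have em: "?E n m \<in> borel_measurable M" for n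
    by (rule measurable_from_subalg[OF subalg[OF m] measurable_exp_mart[OF m]])
  have start: "(\<lambda>n. \<integral>\<omega>. indicator A \<omega> *\<^sub>R ?E n m \<omega> \<partial>M) \<longlonglongrightarrow> (\<integral>\<omega>. indicator A \<omega> *\<^sub>R (1::complex) \<partial>M)"
  proof (rule integral_dominated_convergence[where w="\<lambda>_. exp (t\<^sup>2 * C / 2)"])
    show "AE \<omega> in M. norm (indicator A \<omega> *\<^sub>R ?E n m \<omega>) \<le> exp (t\<^sup>2 * C / 2)" for n
    proof (rule AE_I2)
      fix \<omega> assume "\<omega> \<in> space M"
      then have "norm (?E n m \<omega>) \<le> exp (t\<^sup>2 * C / 2)"
        using norm_exp_mart_le[of \<omega> "?L n" "?s n" m] L[of n] sL[of n] by (meson exp_le_cancel_iff order_trans)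
      then show "norm (indicator A \<omega> *\<^sub>R ?E n m \<omega>) \<le> exp (t\<^sup>2 * C / 2)"
        by (cases "\<omega> \<in> A") simp_all
    qed
    show "AE \<omega> in M. (\<lambda>n. indicator A \<omega> *\<^sub>R ?E n m \<omega>) \<longlonglongrightarrow> indicator A \<omega> *\<^sub>R 1"
    proof (rule AE_I2)
      fix \<omega> assume \<omega>: "\<omega> \<in> space M"
      have b1: "\<bar>stopped_sum l m \<omega>\<bar> \<le> (\<Sum>i\<in>{1..<m}. c)" for l
        unfolding stopped_sum_def using D_bound[OF _ \<omega>] c_nonneg
        by (intro order_trans[OF sum_abs] sum_mono) (auto simp: active_def)
      have b2: "\<bar>stopped_var l m \<omega>\<bar> \<le> V m \<omega>" for l
        using stopped_var_le_V[OF \<omega>] stopped_var_nonneg[OF \<omega>] by simp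
      have 1: "(\<lambda>n. ?s n * stopped_sum (?L n) m \<omega>) \<longlonglongrightarrow> 0"
        by (rule Lim_null_comparison[OF _ tendsto_mult_left_zero[OF tendsto_rabs_zero[OF s0], of "\<Sum>i\<in>{1..<m}. c"]])
          (use b1 in \<open>auto simp: abs_mult intro!: divide_right_mono mult_left_mono always_eventually simp del: sum_constant\<close>)
      have 2: "(\<lambda>n. (?s n)\<^sup>2 * stopped_var (?L n) m \<omega>) \<longlonglongrightarrow> 0"
        by (rule Lim_null_comparison[OF _ tendsto_mult_left_zero[OF tendsto_null_power[OF s0], of 2 "V m \<omega>"]])
          (use b2 in \<open>auto simp: abs_mult intro!: mult_left_mono always_eventually\<close>)
      have "(\<lambda>n. ?E n m \<omega>) \<longlonglongrightarrow> of_real (exp (0 / 2)) * iexp 0"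
        unfolding exp_mart_def by (intro tendsto_intros 1 2) simp
      then show "(\<lambda>n. indicator A \<omega> *\<^sub>R ?E n m \<omega>) \<longlonglongrightarrow> indicator A \<omega> *\<^sub>R 1"
        by (intro tendsto_intros) simp
    qed
  qed (use em in auto)
  let ?\<delta> = "\<lambda>n. (\<bar>t\<bar>^3 * c / 6 * (1 / a n) + t^4 * c\<^sup>2 / 4 * (1 / a n)\<^sup>2) * exp (t\<^sup>2 * C / 2) * C"
  have diff: "(\<lambda>n. (\<integral>\<omega>. indicator A \<omega> *\<^sub>R ?E n n \<omega> \<partial>M) - (\<integral>\<omega>. indicator A \<omega> *\<^sub>R ?E n m \<omega> \<partial>M)) \<longlonglongrightarrow> 0"
  proof (rule Lim_null_comparison)
    have "?\<delta> \<longlonglongrightarrow> (\<bar>t\<bar>^3 * c / 6 * 0 + t^4 * c\<^sup>2 / 4 * 0\<^sup>2) * exp (t\<^sup>2 * C / 2) * C"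
      by (intro tendsto_intros inva)
    then show "?\<delta> \<longlonglongrightarrow> 0" by simp
    show "\<forall>\<^sub>F n in sequentially. norm ((\<integral>\<omega>. indicator A \<omega> *\<^sub>R ?E n n \<omega> \<partial>M) - (\<integral>\<omega>. indicator A \<omega> *\<^sub>R ?E n m \<omega> \<partial>M)) \<le> ?\<delta> n"
      using pos eventually_ge_at_top[of m]
    proof eventually_elim
      case (elim n)
      have i: "integrable M (\<lambda>\<omega>. indicator A \<omega> *\<^sub>R ?E n k \<omega>)" if "1 \<le> k" for k
        by (intro integrable_mult_indicator AM exp_mart_integrable that L)
      have n1: "1 \<le> n" using m elim by simp
      have eq: "(\<integral>\<omega>. indicator A \<omega> *\<^sub>R ?E n n \<omega> \<partial>M) - (\<integral>\<omega>. indicator A \<omega> *\<^sub>R ?E n m \<omega> \<partial>M)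
         = (\<integral>\<omega>. indicator A \<omega> *\<^sub>R (?E n n \<omega> - ?E n m \<omega>) \<partial>M)"
        using Bochner_Integration.integral_diff[OF i[OF n1] i[OF m]] by (simp add: scaleR_diff_right)
      have "norm (\<integral>\<omega>. indicator A \<omega> *\<^sub>R (?E n n \<omega> - ?E n m \<omega>) \<partial>M)
        \<le> (\<bar>?s n\<bar>^3 * c / 6 + (?s n)^4 * c\<^sup>2 / 4) * exp ((?s n)\<^sup>2 * ?L n / 2) * ?L n"
        by (rule exp_mart_difference[OF m elim(2) A L])
      moreover have "\<dots> = ?\<delta> n"
      proof -
        have e: "(?s n)\<^sup>2 * ?L n / 2 = t\<^sup>2 * C / 2" using elim by (simp add: power_divide)
        have r: "(\<bar>?s n\<bar>^3 * c / 6 + (?s n)^4 * c\<^sup>2 / 4) * ?L n = (\<bar>t\<bar>^3 * c / 6 * (1 / a n) + t^4 * c\<^sup>2 / 4 * (1 / a n)\<^sup>2) * C"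
          using elim(1) by (simp add: field_simps eval_nat_numeral)
        have swap: "x * y * z = (x * z) * y" for x y z :: real by simp
        show ?thesis unfolding e by (subst (1 2) swap) (simp only: r)
      qed
      ultimately show ?case unfolding eq by (simp only:)
    qed
  qed
  show ?thesis using tendsto_add[OF diff start] by simp
qed

text \<open>Where \<open>\<Lambda> < C\<close>, eventually \<open>V n < C * (a n)\<^sup>2\<close>, no
  stopping occurs, and \<open>exp_mart\<close> is the characteristic exponential of the
  normalized sum times \<open>exp (t\<^sup>2 V / (2 a\<^sup>2))\<close>, a factor that
  converges to the \<open>G\<close>-measurable \<open>exp (t\<^sup>2 \<Lambda> / 2)\<close>.
  Multiplying by \<open>exp (- t\<^sup>2 \<Lambda> / 2)\<close>, which is an admissible test
  function since it is \<open>G\<close>-measurable, turns the limit 1 of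
  \<open>exp_mart\<close> into the claim. The restriction \<open>\<Lambda> < C\<close> is
  removed by letting \<open>C\<close> grow, so the limiting variance may be random and
  unbounded.\<close>
theorem stable_martingale_clt:
  fixes a :: "nat \<Rightarrow> real" and f :: "'a \<Rightarrow> complex"
  assumes G: "subalgebra M G" "sets G = sigma_sets (space M) (\<Union>n\<in>{1..}. sets (F n))"
    and a: "filterlim a at_top sequentially"
    and \<Lambda>: "\<Lambda> \<in> borel_measurable G" "\<And>\<omega>. \<omega> \<in> space M \<Longrightarrow> 0 \<le> \<Lambda> \<omega>" "integrable M \<Lambda>"
    and V_lim: "(\<lambda>n. \<integral>\<omega>. \<bar>V n \<omega> / (a n)\<^sup>2 - \<Lambda> \<omega>\<bar> \<partial>M) \<longlonglongrightarrow> 0"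
    and f: "integrable M f" "f \<in> borel_measurable G"
  shows "(\<lambda>n. \<integral>\<omega>. f \<omega> * iexp (t * ((\<Sum>i\<in>{1..<n}. D (Suc i) \<omega>) / a n)) \<partial>M)
     \<longlonglongrightarrow> (\<integral>\<omega>. f \<omega> * of_real (exp (- (t\<^sup>2 * \<Lambda> \<omega> / 2))) \<partial>M)"
proof -
  define U where "U n \<omega> = (\<Sum>i\<in>{1..<n}. D (Suc i) \<omega>) / a n" for n \<omega>
  have [measurable]: "f \<in> borel_measurable G" "\<Lambda> \<in> borel_measurable G" by fact+
  have \<Lambda>M[measurable]: "\<Lambda> \<in> borel_measurable M" "f \<in> borel_measurable M"
    by (rule measurable_from_subalg[OF G(1) \<Lambda>(1)], rule measurable_from_subalg[OF G(1) f(2)])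
  have U_M: "U n \<in> borel_measurable M" for n
    unfolding U_def by (intro borel_measurable_divide borel_measurable_sum measurable_DM) auto
  have VM: "V n \<in> borel_measurable M" for n 
    unfolding V_def by (intro borel_measurable_sum measurable_qM) auto
  define Y where "Y C n = exp_mart (t / a n) (C * (a n)\<^sup>2) n" for C n
  have Y_M: "Y C n \<in> borel_measurable M" for C n
  proof (cases "1 \<le> n")
    case True
    then show ?thesis unfolding Y_def
      by (intro measurable_from_subalg[OF subalg measurable_exp_mart])
  next
    case False
    then have "Y C n = (\<lambda>_. 1)" by (auto simp: Y_def exp_mart_def stopped_sum_def stopped_var_def fun_eq_iff)
    then show ?thesis by simp
  qed
  have Y_b: "norm (Y C n \<omega>) \<le> exp (t\<^sup>2 * C / 2)" if "\<omega> \<in> space M" "0 \<le> C" for C n \<omega>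
  proof -
    have "(t / a n)\<^sup>2 * (C * (a n)\<^sup>2) / 2 \<le> t\<^sup>2 * C / 2"
      using that by (cases "a n = 0") (simp_all add: power_divide)
    then show ?thesis unfolding Y_def
      using norm_exp_mart_le[OF that(1), of "C * (a n)\<^sup>2" "t / a n" n] that(2) by (meson exp_le_cancel_iff order_trans zero_le_power2 mult_nonneg_nonneg)
  qed
  have Y_lim: "(\<lambda>n. \<integral>\<omega>. g \<omega> * Y C n \<omega> \<partial>M) \<longlonglongrightarrow> (\<integral>\<omega>. g \<omega> * 1 \<partial>M)"
    if g: "integrable M g" "g \<in> borel_measurable G" and C: "0 \<le> C" for g C
  proof (rule stable_limit_of_sets[OF G(1) Y_M _ _ _ _ g, where K="exp (t\<^sup>2 * C / 2)"])
    fix A assume A: "A \<in> sets G"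
    show "(\<lambda>n. \<integral>\<omega>. indicator A \<omega> *\<^sub>R Y C n \<omega> \<partial>M) \<longlonglongrightarrow> (\<integral>\<omega>. indicator A \<omega> *\<^sub>R (1::complex) \<partial>M)"
    proof (rule stable_limit_of_generator[OF _ _ _ Y_M _ _ _ _ A[unfolded G(2)], where K="exp (t\<^sup>2 * C / 2)"])
      show "Int_stable (\<Union>n\<in>{1..}. sets (F n))"
      proof (rule Int_stableI, clarsimp)
        fix A B i j assume AB: "Suc 0 \<le> i" "A \<in> sets (F i)" "Suc 0 \<le> j" "B \<in> sets (F j)"
        have "A \<in> sets (F (max i j))" "B \<in> sets (F (max i j))"
          using AB filt[of i "max i j"] filt[of j "max i j"] by (auto simp: subalgebra_def)
        then show "\<exists>k\<in>{Suc 0..}. A \<inter> B \<in> sets (F k)" using AB by (intro bexI[of _ "max i j"]) auto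
      qed
      show "(\<Union>n\<in>{1..}. sets (F n)) \<subseteq> events" using subalg by (auto simp: subalgebra_def)
      have "space M \<in> sets (F 1)" using subalg[of 1] sets.top[of "F 1"] by (simp add: subalgebra_def)
      then show "space M \<in> (\<Union>n\<in>{1..}. sets (F n))" by auto
      show "(\<lambda>n. \<integral>\<omega>. indicator B \<omega> *\<^sub>R Y C n \<omega> \<partial>M) \<longlonglongrightarrow> (\<integral>\<omega>. indicator B \<omega> *\<^sub>R (1::complex) \<partial>M)"
        if "B \<in> (\<Union>n\<in>{1..}. sets (F n))" for B
        using that exp_mart_limit[OF _ _ C a] unfolding Y_def by auto
      show "norm (Y C n \<omega>) \<le> exp (t\<^sup>2 * C / 2)" if "\<omega> \<in> space M" for n \<omega> by (rule Y_b[OF that C])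
    qed (use C in auto)
  next
    show "norm (Y C n \<omega>) \<le> exp (t\<^sup>2 * C / 2)" if "\<omega> \<in> space M" for n \<omega> by (rule Y_b[OF that C])
  qed (use C in \<open>auto intro: Y_b\<close>)
  \<comment> \<open>The test function cut off to the region where the limiting variance is below
    \<open>C\<close>.\<close>
  define f' where "f' C \<omega> = f \<omega> * of_bool (\<Lambda> \<omega> < C)" for C \<omega>
  have f'_G[measurable]: "f' C \<in> borel_measurable G" for C unfolding f'_def by measurable
  have f'_M[measurable]: "f' C \<in> borel_measurable M" for C by (rule measurable_from_subalg[OF G(1) f'_G])
  have f'_b: "norm (f' C \<omega>) \<le> norm (f \<omega>)" for C \<omega> by (simp add: f'_def norm_mult)
  have f'_int: "integrable M (f' C)" for C
    by (rule Bochner_Integration.integrable_bound[OF f(1)]) (use f'_b in auto)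
  have ie: "norm (iexp x) = 1" for x by (rule norm_exp_i_times)
  define Z :: "'a \<Rightarrow> complex" where "Z \<omega> = of_real (exp (- (t\<^sup>2 * \<Lambda> \<omega> / 2)))" for \<omega>
  have Z_G[measurable]: "Z \<in> borel_measurable G" unfolding Z_def by measurable
  have Z_M[measurable]: "Z \<in> borel_measurable M" by (rule measurable_from_subalg[OF G(1) Z_G])
  have Z_b: "norm (Z \<omega>) \<le> 1" if "\<omega> \<in> space M" for \<omega> using \<Lambda>(2)[OF that] by (simp add: Z_def)
  have fx_int: "integrable M (\<lambda>\<omega>. g \<omega> * x \<omega>)"
    if "integrable M g" "x \<in> borel_measurable M" "\<And>\<omega>. \<omega> \<in> space M \<Longrightarrow> norm (x \<omega>) \<le> K" for g x :: "'a \<Rightarrow> complex" and K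
  proof (rule Bochner_Integration.integrable_bound)
    show "integrable M (\<lambda>\<omega>. K * norm (g \<omega>))" using that by auto
    show "AE \<omega> in M. norm (g \<omega> * x \<omega>) \<le> norm (K * norm (g \<omega>))"
    proof (rule AE_I2)
      fix \<omega> assume "\<omega> \<in> space M"
      then have "norm (g \<omega> * x \<omega>) \<le> K * norm (g \<omega>)"
        using mult_left_mono[OF that(3), of \<omega> "norm (g \<omega>)"] by (simp add: norm_mult mult.commute)
      then show "norm (g \<omega> * x \<omega>) \<le> norm (K * norm (g \<omega>))" by simp
    qed
  qed (use that in auto)
  have iU_M: "(\<lambda>\<omega>. iexp (t * U n \<omega>)) \<in> borel_measurable M" for n using U_M[of n] by measurable
  have local: "(\<lambda>n. \<integral>\<omega>. f' C \<omega> * iexp (t * U n \<omega>) \<partial>M) \<longlonglongrightarrow> (\<integral>\<omega>. f' C \<omega> * Z \<omega> \<partial>M)" if C: "0 \<le> C" for C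
  proof -
    define H where "H n \<omega> = f' C \<omega> * iexp (t * U n \<omega>) - f' C \<omega> * Z \<omega> * Y C n \<omega>" for n \<omega>
    have H_M: "H n \<in> borel_measurable M" for n
      unfolding H_def using iU_M[of n] Y_M[of C n] by measurable
    have fZ: "integrable M (\<lambda>\<omega>. f' C \<omega> * Z \<omega>)" by (rule fx_int[OF f'_int Z_M Z_b])
    have "(\<lambda>n. \<integral>\<omega>. H n \<omega> \<partial>M) \<longlonglongrightarrow> 0"
    proof (rule integral_tendsto_zero_of_L1[where u="\<lambda>n \<omega>. V n \<omega> / (a n)\<^sup>2 - \<Lambda> \<omega>"])
      show "integrable M (\<lambda>\<omega>. V n \<omega> / (a n)\<^sup>2 - \<Lambda> \<omega>)" for n
        unfolding V_def by (intro Bochner_Integration.integrable_diff integrable_divide Bochner_Integration.integrable_sum integrable_q \<Lambda>(3)) auto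
      show "(\<lambda>n. \<integral>\<omega>. norm (V n \<omega> / (a n)\<^sup>2 - \<Lambda> \<omega>) \<partial>M) \<longlonglongrightarrow> 0" using V_lim by simp
      show "integrable M (\<lambda>\<omega>. norm (f \<omega>) * (1 + exp (t\<^sup>2 * C / 2)))" using f(1) by auto
      show "AE \<omega> in M. norm (H n \<omega>) \<le> norm (f \<omega>) * (1 + exp (t\<^sup>2 * C / 2))" for n
      proof (rule AE_I2)
        fix \<omega> assume \<omega>: "\<omega> \<in> space M"
        have "norm (H n \<omega>) \<le> norm (f' C \<omega> * iexp (t * U n \<omega>)) + norm (f' C \<omega> * Z \<omega> * Y C n \<omega>)"
          unfolding H_def by (rule norm_triangle_ineq4)
        also have "\<dots> = norm (f' C \<omega>) * 1 + norm (f' C \<omega>) * (norm (Z \<omega>) * norm (Y C n \<omega>))"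
          by (simp add: norm_mult)
        also have "\<dots> \<le> norm (f \<omega>) * 1 + norm (f \<omega>) * (1 * exp (t\<^sup>2 * C / 2))"
          using f'_b[of C \<omega>] Z_b[OF \<omega>] Y_b[OF \<omega> C, of n] by (intro add_mono mult_mono) auto
        finally show "norm (H n \<omega>) \<le> norm (f \<omega>) * (1 + exp (t\<^sup>2 * C / 2))" by (simp add: distrib_left)
      qed
      have "(\<lambda>n. H (r n) \<omega>) \<longlonglongrightarrow> 0"
        if \<omega>: "\<omega> \<in> space M" and r: "strict_mono r" and lim: "(\<lambda>n. V (r n) \<omega> / (a (r n))\<^sup>2 - \<Lambda> \<omega>) \<longlonglongrightarrow> 0" for \<omega> r
      proof (cases "\<Lambda> \<omega> < C")
        case False
        then show ?thesis by (simp add: H_def f'_def)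
      next
        case True
        let ?R = "\<lambda>n. V (r n) \<omega> / (a (r n))\<^sup>2"
        have R: "?R \<longlonglongrightarrow> \<Lambda> \<omega>" using lim by (simp add: LIM_zero_iff)
        have ev: "\<forall>\<^sub>F n in sequentially. ?R n < C" using R True by (rule order_tendstoD(2))
        have pos: "\<forall>\<^sub>F n in sequentially. 0 < a (r n)"
          using a r by (intro eventually_subseq[OF r]) (simp add: filterlim_at_top_dense)
        have "(\<lambda>n. norm (f \<omega>) * \<bar>1 - exp (- (t\<^sup>2 * (\<Lambda> \<omega> - ?R n) / 2))\<bar>) \<longlonglongrightarrow> norm (f \<omega>) * \<bar>1 - exp (- (t\<^sup>2 * (\<Lambda> \<omega> - \<Lambda> \<omega>) / 2))\<bar>"
          by (intro tendsto_intros R) auto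
        then have z: "(\<lambda>n. norm (f \<omega>) * \<bar>1 - exp (- (t\<^sup>2 * (\<Lambda> \<omega> - ?R n) / 2))\<bar>) \<longlonglongrightarrow> 0" by simp
        show ?thesis
        proof (rule Lim_null_comparison[OF _ z])
          show "\<forall>\<^sub>F n in sequentially. norm (H (r n) \<omega>) \<le> norm (f \<omega>) * \<bar>1 - exp (- (t\<^sup>2 * (\<Lambda> \<omega> - ?R n) / 2))\<bar>"
            using ev pos
          proof eventually_elim
            case (elim n)
            let ?k = "r n"
            have "V ?k \<omega> \<le> C * (a ?k)\<^sup>2" using elim by (simp add: field_simps)
            note st = stopped_eq[OF \<omega> this]
            have 1: "(t / a ?k)\<^sup>2 * V ?k \<omega> / 2 = t\<^sup>2 * ?R n / 2" by (simp add: power_divide)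
            have 2: "t / a ?k * (\<Sum>i\<in>{1..<?k}. D (Suc i) \<omega>) = t * U ?k \<omega>" by (simp add: U_def)
            have "Z \<omega> * Y C ?k \<omega> = of_real (exp (- (t\<^sup>2 * \<Lambda> \<omega> / 2)) * exp (t\<^sup>2 * ?R n / 2)) * iexp (t * U ?k \<omega>)"
              unfolding Z_def Y_def exp_mart_def st 1 2 by simp
            also have "exp (- (t\<^sup>2 * \<Lambda> \<omega> / 2)) * exp (t\<^sup>2 * ?R n / 2) = exp (- (t\<^sup>2 * (\<Lambda> \<omega> - ?R n) / 2))"
              unfolding exp_add[symmetric] by (simp add: algebra_simps diff_divide_distrib)
            finally have "H ?k \<omega> = f \<omega> * (iexp (t * U ?k \<omega>) * of_real (1 - exp (- (t\<^sup>2 * (\<Lambda> \<omega> - ?R n) / 2))))"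
              using True by (simp add: H_def f'_def algebra_simps)
            then show ?case by (simp only: norm_mult ie norm_of_real mult_1 order_refl)
          qed
        qed
      qed
      then show "AE \<omega> in M. \<forall>r. strict_mono r \<longrightarrow> (\<lambda>n. V (r n) \<omega> / (a (r n))\<^sup>2 - \<Lambda> \<omega>) \<longlonglongrightarrow> 0 \<longrightarrow> (\<lambda>n. H (r n) \<omega>) \<longlonglongrightarrow> 0"
        by simp
    qed (rule H_M)
    moreover have "(\<integral>\<omega>. H n \<omega> \<partial>M) = (\<integral>\<omega>. f' C \<omega> * iexp (t * U n \<omega>) \<partial>M) - (\<integral>\<omega>. f' C \<omega> * Z \<omega> * Y C n \<omega> \<partial>M)" for n
    proof -
      have nb: "norm (iexp (t * U n \<omega>)) \<le> 1" if "\<omega> \<in> space M" for \<omega> by (simp only: ie order_refl)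
      have "integrable M (\<lambda>\<omega>. f' C \<omega> * iexp (t * U n \<omega>))"
        by (rule fx_int[OF f'_int iU_M nb])
      moreover have "integrable M (\<lambda>\<omega>. f' C \<omega> * Z \<omega> * Y C n \<omega>)"
        by (rule fx_int[OF fZ Y_M Y_b[OF _ C]])
      ultimately show ?thesis unfolding H_def by (rule Bochner_Integration.integral_diff)
    qed
    ultimately have d: "(\<lambda>n. (\<integral>\<omega>. f' C \<omega> * iexp (t * U n \<omega>) \<partial>M) - (\<integral>\<omega>. f' C \<omega> * Z \<omega> * Y C n \<omega> \<partial>M)) \<longlonglongrightarrow> 0" by simp
    have "(\<lambda>\<omega>. f' C \<omega> * Z \<omega>) \<in> borel_measurable G" by measurable
    from tendsto_add[OF d Y_lim[OF fZ this C]] show ?thesis by simp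
  qed
  have tail: "(\<lambda>k. \<integral>\<omega>. norm (f \<omega> - f' (real k) \<omega>) \<partial>M) \<longlonglongrightarrow> (\<integral>\<omega>. 0 \<partial>M)"
  proof (rule integral_dominated_convergence[where w="\<lambda>\<omega>. norm (f \<omega>)"])
    show "AE \<omega> in M. (\<lambda>k. norm (f \<omega> - f' (real k) \<omega>)) \<longlonglongrightarrow> 0"
    proof (rule AE_I2)
      fix \<omega>
      obtain k0 :: nat where "\<Lambda> \<omega> < real k0" using reals_Archimedean2 by blast
      have "\<forall>\<^sub>F k in sequentially. norm (f \<omega> - f' (real k) \<omega>) = 0"
        using eventually_ge_at_top[of k0] by eventually_elim (use \<open>\<Lambda> \<omega> < real k0\<close> in \<open>simp add: f'_def\<close>)
      then show "(\<lambda>k. norm (f \<omega> - f' (real k) \<omega>)) \<longlonglongrightarrow> 0" by (rule tendsto_eventually)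
    qed
    show "AE \<omega> in M. norm (norm (f \<omega> - f' (real k) \<omega>)) \<le> norm (f \<omega>)" for k
      by (simp add: f'_def)
  qed (use f(1) in auto)
  have est: "dist (\<integral>\<omega>. f \<omega> * x \<omega> \<partial>M) (\<integral>\<omega>. f' C \<omega> * x \<omega> \<partial>M) \<le> (\<integral>\<omega>. norm (f \<omega> - f' C \<omega>) \<partial>M)"
    if x: "x \<in> borel_measurable M" "\<And>\<omega>. \<omega> \<in> space M \<Longrightarrow> norm (x \<omega>) \<le> 1" for x C
  proof -
    note i = fx_int[OF f(1) x] fx_int[OF f'_int x]
    have eq: "(\<integral>\<omega>. f \<omega> * x \<omega> \<partial>M) - (\<integral>\<omega>. f' C \<omega> * x \<omega> \<partial>M) = (\<integral>\<omega>. (f \<omega> - f' C \<omega>) * x \<omega> \<partial>M)"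
      using i by (simp add: left_diff_distrib)
    have "norm (\<integral>\<omega>. (f \<omega> - f' C \<omega>) * x \<omega> \<partial>M) \<le> (\<integral>\<omega>. norm ((f \<omega> - f' C \<omega>) * x \<omega>) \<partial>M)"
      by (rule integral_norm_bound)
    also have "\<dots> \<le> (\<integral>\<omega>. norm (f \<omega> - f' C \<omega>) \<partial>M)"
    proof (rule integral_mono)
      show "integrable M (\<lambda>\<omega>. norm ((f \<omega> - f' C \<omega>) * x \<omega>))"
        using i by (simp add: left_diff_distrib)
      show "norm ((f \<omega> - f' C \<omega>) * x \<omega>) \<le> norm (f \<omega> - f' C \<omega>)" if "\<omega> \<in> space M" for \<omega>
        using mult_left_mono[OF x(2)[OF that], of "norm (f \<omega> - f' C \<omega>)"] by (simp add: norm_mult)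
    qed (use f(1) f'_int in auto)
    finally show ?thesis unfolding dist_norm eq .
  qed
  have "(\<lambda>n. \<integral>\<omega>. f \<omega> * iexp (t * U n \<omega>) \<partial>M) \<longlonglongrightarrow> (\<integral>\<omega>. f \<omega> * Z \<omega> \<partial>M)"
  proof (rule tendsto_by_approximation)
    fix e :: real assume "0 < e"
    then have "\<forall>\<^sub>F k in sequentially. (\<integral>\<omega>. norm (f \<omega> - f' (real k) \<omega>) \<partial>M) < e"
      using order_tendstoD(2)[OF tail] by simp
    then obtain k where k: "(\<integral>\<omega>. norm (f \<omega> - f' (real k) \<omega>) \<partial>M) < e" using eventually_happens by force
    show "\<exists>b L. b \<longlonglongrightarrow> L \<and> dist L (\<integral>\<omega>. f \<omega> * Z \<omega> \<partial>M) \<le> e \<and>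
        (\<forall>\<^sub>F n in sequentially. dist (\<integral>\<omega>. f \<omega> * iexp (t * U n \<omega>) \<partial>M) (b n) \<le> e)"
    proof (intro exI conjI)
      show "(\<lambda>n. \<integral>\<omega>. f' (real k) \<omega> * iexp (t * U n \<omega>) \<partial>M) \<longlonglongrightarrow> (\<integral>\<omega>. f' (real k) \<omega> * Z \<omega> \<partial>M)"
        by (rule local) simp
      show "dist (\<integral>\<omega>. f' (real k) \<omega> * Z \<omega> \<partial>M) (\<integral>\<omega>. f \<omega> * Z \<omega> \<partial>M) \<le> e"
        using est[OF Z_M Z_b, of "real k"] k by (simp add: dist_commute)
      have nb: "norm (iexp (t * U n \<omega>)) \<le> 1" for n \<omega> by (simp only: ie order_refl)
      show "\<forall>\<^sub>F n in sequentially. dist (\<integral>\<omega>. f \<omega> * iexp (t * U n \<omega>) \<partial>M) (\<integral>\<omega>. f' (real k) \<omega> * iexp (t * U n \<omega>) \<partial>M) \<le> e"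
        by (intro always_eventually allI order_trans[OF est[OF iU_M nb] less_imp_le[OF k]])
    qed
  qed
  then show ?thesis unfolding Z_def U_def .
qed

end


section \<open>Negligible perturbations, characteristic functions on events and stable convergence\<close>

context prob_space
begin

text \<open>Convergence to 0 in probability, through the bounded metric \<open>min 1
  \<bar>x\<bar>\<close>; sums, products and the comparison of characteristic functions then
  become inequalities between expectations.\<close>
definition null_in_prob :: "(nat \<Rightarrow> 'a \<Rightarrow> real) \<Rightarrow> bool" where
  "null_in_prob Z \<longleftrightarrow> (\<forall>n. Z n \<in> borel_measurable M) \<and> (\<lambda>n. \<integral>\<omega>. min 1 \<bar>Z n \<omega>\<bar> \<partial>M) \<longlonglongrightarrow> 0"

lemma integrable_min1: "Z \<in> borel_measurable M \<Longrightarrow> integrable M (\<lambda>\<omega>. min 1 \<bar>Z \<omega> :: real\<bar>)"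
  by (rule integrable_const_bound[where B=1]) auto

lemma null_in_prob_of_L1_subseq:
  fixes u :: "nat \<Rightarrow> 'a \<Rightarrow> real"
  assumes u: "\<And>n. integrable M (u n)" "(\<lambda>n. \<integral>x. \<bar>u n x\<bar> \<partial>M) \<longlonglongrightarrow> 0"
    and Z: "\<And>n. Z n \<in> borel_measurable M"
    and lim: "AE x in M. \<forall>r::nat \<Rightarrow> nat. strict_mono r \<longrightarrow> (\<lambda>n. u (r n) x) \<longlonglongrightarrow> 0 \<longrightarrow> (\<lambda>n. Z (r n) x) \<longlonglongrightarrow> 0"
  shows "null_in_prob Z"
  unfolding null_in_prob_def
proof (intro conjI allI Z)
  show "(\<lambda>n. \<integral>\<omega>. min 1 \<bar>Z n \<omega>\<bar> \<partial>M) \<longlonglongrightarrow> 0"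
  proof (rule integral_tendsto_zero_of_L1[where u=u and B="\<lambda>_. 1"])
    show "(\<lambda>n. \<integral>x. norm (u n x) \<partial>M) \<longlonglongrightarrow> 0" using u(2) by simp
    show "AE x in M. \<forall>r::nat \<Rightarrow> nat. strict_mono r \<longrightarrow> (\<lambda>n. u (r n) x) \<longlonglongrightarrow> 0 \<longrightarrow> (\<lambda>n. min 1 \<bar>Z (r n) x\<bar>) \<longlonglongrightarrow> 0"
      using lim
    proof eventually_elim
      case (elim x)
      show ?case
      proof (intro allI impI)
        fix r :: "nat \<Rightarrow> nat" assume r: "strict_mono r" "(\<lambda>n. u (r n) x) \<longlonglongrightarrow> 0"
        then have "(\<lambda>n. Z (r n) x) \<longlonglongrightarrow> 0" using elim by blast
        then have "(\<lambda>n. min 1 \<bar>Z (r n) x\<bar>) \<longlonglongrightarrow> min 1 \<bar>0\<bar>" by (intro tendsto_intros)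
        then show "(\<lambda>n. min 1 \<bar>Z (r n) x\<bar>) \<longlonglongrightarrow> 0" by simp
      qed
    qed
  qed (use u Z in auto)
qed

lemma null_in_prob_add:
  assumes "null_in_prob X" "null_in_prob Y" shows "null_in_prob (\<lambda>n \<omega>. X n \<omega> + Y n \<omega>)"
proof -
  have [measurable]: "X n \<in> borel_measurable M" "Y n \<in> borel_measurable M" for n
    using assms by (auto simp: null_in_prob_def)
  have "(\<lambda>n. \<integral>\<omega>. min 1 \<bar>X n \<omega> + Y n \<omega>\<bar> \<partial>M) \<longlonglongrightarrow> 0"
  proof (rule tendsto_sandwich[OF _ _ tendsto_const])
    show "(\<lambda>n. (\<integral>\<omega>. min 1 \<bar>X n \<omega>\<bar> \<partial>M) + (\<integral>\<omega>. min 1 \<bar>Y n \<omega>\<bar> \<partial>M)) \<longlonglongrightarrow> 0"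
      using tendsto_add[of _ 0 sequentially _ 0] assms by (auto simp: null_in_prob_def)
    have "(\<integral>\<omega>. min 1 \<bar>X n \<omega> + Y n \<omega>\<bar> \<partial>M) \<le> (\<integral>\<omega>. min 1 \<bar>X n \<omega>\<bar> + min 1 \<bar>Y n \<omega>\<bar> \<partial>M)" for n
      by (intro integral_mono Bochner_Integration.integrable_add integrable_min1) auto
    also have "\<dots> n = (\<integral>\<omega>. min 1 \<bar>X n \<omega>\<bar> \<partial>M) + (\<integral>\<omega>. min 1 \<bar>Y n \<omega>\<bar> \<partial>M)" for n
      by (intro Bochner_Integration.integral_add integrable_min1) auto
    finally show "\<forall>\<^sub>F n in sequentially. (\<integral>\<omega>. min 1 \<bar>X n \<omega> + Y n \<omega>\<bar> \<partial>M) \<le> (\<integral>\<omega>. min 1 \<bar>X n \<omega>\<bar> \<partial>M) + (\<integral>\<omega>. min 1 \<bar>Y n \<omega>\<bar> \<partial>M)"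
      by simp
  qed simp
  then show ?thesis by (simp add: null_in_prob_def)
qed

lemma min1_mult_bound:
  fixes z u K :: real assumes "1 \<le> K" shows "min 1 \<bar>z * u\<bar> \<le> K * min 1 \<bar>z\<bar> + \<bar>u\<bar> / K"
proof (cases "\<bar>u\<bar> \<le> K")
  case True
  have "min 1 \<bar>z * u\<bar> \<le> min K (\<bar>z\<bar> * K)"
    using assms mult_left_mono[OF True, of "\<bar>z\<bar>"] by (auto simp: abs_mult)
  also have "\<dots> = K * min 1 \<bar>z\<bar>" using assms by (auto simp: min_def mult.commute)
  finally show ?thesis using assms by (smt (verit) divide_nonneg_nonneg)
next
  case False
  then have "1 \<le> \<bar>u\<bar> / K" using assms by (simp add: field_simps)
  moreover have "0 \<le> K * min 1 \<bar>z\<bar>" using assms by (intro mult_nonneg_nonneg) auto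
  ultimately show ?thesis by linarith
qed

text \<open>Split according to \<open>\<bar>U\<bar> \<le> K\<close>, where the first factor decides, and
  \<open>\<bar>U\<bar> > K\<close>, which has probability at most \<open>B / K\<close> by
  Markov's inequality.\<close>
lemma expectation_min1_mult:
  fixes Z U :: "'a \<Rightarrow> real"
  assumes Z: "Z \<in> borel_measurable M" and U: "integrable M U" "(\<integral>\<omega>. \<bar>U \<omega>\<bar> \<partial>M) \<le> B" and K: "1 \<le> K"
  shows "(\<integral>\<omega>. min 1 \<bar>Z \<omega> * U \<omega>\<bar> \<partial>M) \<le> K * (\<integral>\<omega>. min 1 \<bar>Z \<omega>\<bar> \<partial>M) + B / K"
proof -
  have [measurable]: "Z \<in> borel_measurable M" "U \<in> borel_measurable M" using Z U by auto
  have "(\<integral>\<omega>. min 1 \<bar>Z \<omega> * U \<omega>\<bar> \<partial>M) \<le> (\<integral>\<omega>. K * min 1 \<bar>Z \<omega>\<bar> + \<bar>U \<omega>\<bar> / K \<partial>M)"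
    using U min1_mult_bound[OF K]
    by (intro integral_mono Bochner_Integration.integrable_add integrable_mult_right integrable_min1) auto
  also have "\<dots> = K * (\<integral>\<omega>. min 1 \<bar>Z \<omega>\<bar> \<partial>M) + (\<integral>\<omega>. \<bar>U \<omega>\<bar> \<partial>M) / K"
    using U integrable_min1[of Z] by (subst Bochner_Integration.integral_add) auto
  also have "\<dots> \<le> K * (\<integral>\<omega>. min 1 \<bar>Z \<omega>\<bar> \<partial>M) + B / K"
    using U(2) K by (simp add: divide_right_mono)
  finally show ?thesis .
qed

lemma null_in_prob_mult_tight:
  assumes Z: "null_in_prob Z" and U: "\<And>n. integrable M (U n)" "\<And>n. (\<integral>\<omega>. \<bar>U n \<omega>\<bar> \<partial>M) \<le> B"
  shows "null_in_prob (\<lambda>n \<omega>. Z n \<omega> * U n \<omega>)"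
proof -
  have [measurable]: "Z n \<in> borel_measurable M" "U n \<in> borel_measurable M" for n
    using assms by (auto simp: null_in_prob_def)
  have "(\<lambda>n. \<integral>\<omega>. min 1 \<bar>Z n \<omega> * U n \<omega>\<bar> \<partial>M) \<longlonglongrightarrow> 0"
  proof (rule tendsto_by_approximation)
    fix e :: real assume "0 < e"
    define K where "K = max 1 (2 * B / e)"
    have K: "1 \<le> K" by (simp add: K_def)
    have BK: "B / K \<le> e / 2"
    proof -
      have "2 * B / e \<le> K" by (simp add: K_def)
      then show ?thesis using \<open>0 < e\<close> K by (simp add: field_simps)
    qed
    have "(\<lambda>n. K * (\<integral>\<omega>. min 1 \<bar>Z n \<omega>\<bar> \<partial>M)) \<longlonglongrightarrow> K * 0"
      using Z unfolding null_in_prob_def by (intro tendsto_intros) auto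
    then have "\<forall>\<^sub>F n in sequentially. K * (\<integral>\<omega>. min 1 \<bar>Z n \<omega>\<bar> \<partial>M) < e / 2"
      using \<open>0 < e\<close> by (intro order_tendstoD(2)[where y="K*0"]) auto
    then have "\<forall>\<^sub>F n in sequentially. dist (\<integral>\<omega>. min 1 \<bar>Z n \<omega> * U n \<omega>\<bar> \<partial>M) 0 \<le> e"
    proof eventually_elim
      case (elim n)
      have "0 \<le> (\<integral>\<omega>. min 1 \<bar>Z n \<omega> * U n \<omega>\<bar> \<partial>M)" by (intro Bochner_Integration.integral_nonneg) auto
      moreover have "(\<integral>\<omega>. min 1 \<bar>Z n \<omega> * U n \<omega>\<bar> \<partial>M) \<le> K * (\<integral>\<omega>. min 1 \<bar>Z n \<omega>\<bar> \<partial>M) + B / K"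
        by (rule expectation_min1_mult[OF _ U(1,2) K]) measurable
      ultimately show ?case unfolding dist_real_def using elim BK by linarith
    qed
    then show "\<exists>a L. a \<longlonglongrightarrow> L \<and> dist L 0 \<le> e \<and>
        (\<forall>\<^sub>F n in sequentially. dist (\<integral>\<omega>. min 1 \<bar>Z n \<omega> * U n \<omega>\<bar> \<partial>M) (a n) \<le> e)"
      using \<open>0 < e\<close> by (intro exI[of _ "\<lambda>_. 0::real"] exI[of _ "0::real"]) auto
  qed
  then show ?thesis by (simp add: null_in_prob_def)
qed

lemma iexp_diff_bound: "norm (iexp x - iexp y) \<le> 2 * min 1 \<bar>x - y\<bar>"
proof -
  have n1: "norm (iexp z) = 1" for z by (rule norm_exp_i_times)
  have a: "norm (iexp x - iexp y) \<le> 2"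
    using norm_triangle_ineq4[of "iexp x" "iexp y"] n1[of x] n1[of y] by linarith
  have e: "iexp x - iexp y = iexp y * (iexp (x - y) - 1)"
  proof -
    have "iexp y * iexp (x - y) = iexp x" unfolding exp_add[symmetric] by (simp add: algebra_simps)
    then show ?thesis by (simp add: algebra_simps)
  qed
  have b: "norm (iexp (x - y) - 1) \<le> \<bar>x - y\<bar>"
    using iexp_approx1[of "x - y" 0] by simp
  have "norm (iexp x - iexp y) = norm (iexp (x - y) - 1)" unfolding e norm_mult n1 by simp
  moreover have "\<bar>x - y\<bar> \<le> 2 * \<bar>x - y\<bar>" by simp
  ultimately show ?thesis using a b by (cases "1 \<le> \<bar>x - y\<bar>") linarith+
qed

lemma set_char_diff_bound:
  fixes X Y :: "'a \<Rightarrow> real"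
  assumes [measurable]: "X \<in> borel_measurable M" "Y \<in> borel_measurable M" "A \<in> events"
  shows "dist (\<integral>\<omega>. indicator A \<omega> *\<^sub>R iexp (X \<omega>) \<partial>M) (\<integral>\<omega>. indicator A \<omega> *\<^sub>R iexp (Y \<omega>) \<partial>M)
    \<le> 2 * (\<integral>\<omega>. min 1 \<bar>X \<omega> - Y \<omega>\<bar> \<partial>M)"
proof -
  have n1: "norm (iexp z) = 1" for z by (rule norm_exp_i_times)
  have i: "integrable M (\<lambda>\<omega>. indicator A \<omega> *\<^sub>R iexp (Z \<omega>))" if [measurable]: "Z \<in> borel_measurable M" for Z :: "'a \<Rightarrow> real"
  proof (rule integrable_const_bound[where B=1])
    show "AE \<omega> in M. norm (indicator A \<omega> *\<^sub>R iexp (Z \<omega>)) \<le> 1"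
      by (rule AE_I2) (simp only: norm_scaleR n1, simp add: indicator_def)
  qed measurable
  have eq: "(\<integral>\<omega>. indicator A \<omega> *\<^sub>R iexp (X \<omega>) \<partial>M) - (\<integral>\<omega>. indicator A \<omega> *\<^sub>R iexp (Y \<omega>) \<partial>M)
    = (\<integral>\<omega>. indicator A \<omega> *\<^sub>R iexp (X \<omega>) - indicator A \<omega> *\<^sub>R iexp (Y \<omega>) \<partial>M)"
    by (rule Bochner_Integration.integral_diff[symmetric]; rule i; measurable)
  have "norm (\<integral>\<omega>. indicator A \<omega> *\<^sub>R iexp (X \<omega>) - indicator A \<omega> *\<^sub>R iexp (Y \<omega>) \<partial>M)
    \<le> (\<integral>\<omega>. norm (indicator A \<omega> *\<^sub>R iexp (X \<omega>) - indicator A \<omega> *\<^sub>R iexp (Y \<omega>)) \<partial>M)" by (rule integral_norm_bound)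
  also have "\<dots> \<le> (\<integral>\<omega>. 2 * min 1 \<bar>X \<omega> - Y \<omega>\<bar> \<partial>M)"
  proof (rule integral_mono)
    show "norm (indicator A \<omega> *\<^sub>R iexp (X \<omega>) - indicator A \<omega> *\<^sub>R iexp (Y \<omega>)) \<le> 2 * min 1 \<bar>X \<omega> - Y \<omega>\<bar>" for \<omega>
      using iexp_diff_bound[of "X \<omega>" "Y \<omega>"] by (cases "\<omega> \<in> A") simp_all
    show "integrable M (\<lambda>\<omega>. norm (indicator A \<omega> *\<^sub>R iexp (X \<omega>) - indicator A \<omega> *\<^sub>R iexp (Y \<omega>)))"
      by (intro integrable_norm Bochner_Integration.integrable_diff i; measurable)
    show "integrable M (\<lambda>\<omega>. 2 * min 1 \<bar>X \<omega> - Y \<omega>\<bar>)" by (intro integrable_mult_right integrable_min1) measurable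
  qed
  finally show ?thesis by (simp add: dist_norm eq)
qed

lemma slutsky_set_char:
  assumes X: "\<And>n. X n \<in> borel_measurable M" "\<And>n. Y n \<in> borel_measurable M" and A: "A \<in> events"
    and null: "null_in_prob (\<lambda>n \<omega>. X n \<omega> - Y n \<omega>)"
    and lim: "(\<lambda>n. \<integral>\<omega>. indicator A \<omega> *\<^sub>R iexp (Y n \<omega>) \<partial>M) \<longlonglongrightarrow> l"
  shows "(\<lambda>n. \<integral>\<omega>. indicator A \<omega> *\<^sub>R iexp (X n \<omega>) \<partial>M) \<longlonglongrightarrow> l"
proof -
  have "(\<lambda>n. (\<integral>\<omega>. indicator A \<omega> *\<^sub>R iexp (X n \<omega>) \<partial>M) - (\<integral>\<omega>. indicator A \<omega> *\<^sub>R iexp (Y n \<omega>) \<partial>M)) \<longlonglongrightarrow> 0"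
  proof (rule Lim_null_comparison)
    have "(\<lambda>n. 2 * (\<integral>\<omega>. min 1 \<bar>X n \<omega> - Y n \<omega>\<bar> \<partial>M)) \<longlonglongrightarrow> 2 * 0"
      using null unfolding null_in_prob_def by (intro tendsto_intros) auto
    then show "(\<lambda>n. 2 * (\<integral>\<omega>. min 1 \<bar>X n \<omega> - Y n \<omega>\<bar> \<partial>M)) \<longlonglongrightarrow> 0" by simp
    show "\<forall>\<^sub>F n in sequentially. norm ((\<integral>\<omega>. indicator A \<omega> *\<^sub>R iexp (X n \<omega>) \<partial>M) - (\<integral>\<omega>. indicator A \<omega> *\<^sub>R iexp (Y n \<omega>) \<partial>M))
        \<le> 2 * (\<integral>\<omega>. min 1 \<bar>X n \<omega> - Y n \<omega>\<bar> \<partial>M)"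
      using set_char_diff_bound[OF X A] by (simp add: dist_norm)
  qed
  from tendsto_add[OF this lim] show ?thesis by simp
qed

text \<open>The limit on every event of \<open>G\<close> allows the constant \<open>t\<close> to be
  replaced by a \<open>G\<close>-measurable random variable: for a simple \<open>W\<close> the
  event \<open>A\<close> is split along the level sets of \<open>W\<close>, and in general
  \<open>W\<close> is approximated by simple functions. Tightness of \<open>U\<close> makes
  this approximation uniform in \<open>n\<close>.\<close>
lemma random_multiplier:
  fixes U :: "nat \<Rightarrow> 'a \<Rightarrow> real" and W \<Lambda> :: "'a \<Rightarrow> real"
  assumes G: "subalgebra M G" and A: "A \<in> sets G" and W: "W \<in> borel_measurable G"
    and \<Lambda>: "\<Lambda> \<in> borel_measurable G" "\<And>\<omega>. \<omega> \<in> space M \<Longrightarrow> 0 \<le> \<Lambda> \<omega>"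
    and U: "\<And>n. integrable M (U n)" "\<And>n. (\<integral>\<omega>. \<bar>U n \<omega>\<bar> \<partial>M) \<le> B"
    and lim: "\<And>A t. A \<in> sets G \<Longrightarrow> (\<lambda>n. \<integral>\<omega>. indicator A \<omega> *\<^sub>R iexp (t * U n \<omega>) \<partial>M)
       \<longlonglongrightarrow> (\<integral>\<omega>. indicator A \<omega> *\<^sub>R complex_of_real (exp (- (t\<^sup>2 * \<Lambda> \<omega> / 2))) \<partial>M)"
  shows "(\<lambda>n. \<integral>\<omega>. indicator A \<omega> *\<^sub>R iexp (W \<omega> * U n \<omega>) \<partial>M)
       \<longlonglongrightarrow> (\<integral>\<omega>. indicator A \<omega> *\<^sub>R complex_of_real (exp (- ((W \<omega>)\<^sup>2 * \<Lambda> \<omega> / 2))) \<partial>M)"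
proof -
  have GM: "g \<in> borel_measurable M" if "g \<in> borel_measurable G" for g :: "'a \<Rightarrow> real"
    using measurable_from_subalg[OF G that] .
  have GS: "S \<in> events" if "S \<in> sets G" for S using G that by (auto simp: subalgebra_def)
  have [measurable]: "A \<in> events" "W \<in> borel_measurable M" "\<Lambda> \<in> borel_measurable M" "\<And>n. U n \<in> borel_measurable M"
    by (rule GS[OF A], rule GM[OF W], rule GM[OF \<Lambda>(1)], rule borel_measurable_integrable[OF U(1)])
  have spG: "space G = space M" using G by (simp add: subalgebra_def)
  define \<phi> where "\<phi> w \<omega> = complex_of_real (exp (- (w\<^sup>2 * \<Lambda> \<omega> / 2)))" for w \<omega>
  have \<phi>_b: "norm (\<phi> w \<omega>) \<le> 1" if "\<omega> \<in> space M" for w \<omega> using \<Lambda>(2)[OF that] by (simp add: \<phi>_def)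
  have simple: "(\<lambda>n. \<integral>\<omega>. indicator A \<omega> *\<^sub>R iexp (s \<omega> * U n \<omega>) \<partial>M) \<longlonglongrightarrow> (\<integral>\<omega>. indicator A \<omega> *\<^sub>R \<phi> (s \<omega>) \<omega> \<partial>M)"
    if s: "simple_function G s" for s :: "'a \<Rightarrow> real"
  proof -
    let ?R = "s ` space M" let ?B = "\<lambda>w. A \<inter> (s -` {w} \<inter> space M)"
    have fin: "finite ?R" using simple_functionD(1)[OF s] by (simp add: spG)
    have BG: "?B w \<in> sets G" for w using A simple_functionD(2)[OF s, of "{w}"] by (simp add: spG)
    then have BM: "?B w \<in> events" for w by (rule GS)
    have split: "(\<integral>\<omega>. indicator A \<omega> *\<^sub>R g (s \<omega>) \<omega> \<partial>M) = (\<Sum>w\<in>?R. \<integral>\<omega>. indicator (?B w) \<omega> *\<^sub>R g w \<omega> \<partial>M)"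
      if g: "\<And>w. g w \<in> borel_measurable M" "\<And>w \<omega>. \<omega> \<in> space M \<Longrightarrow> norm (g w \<omega>) \<le> 1" for g :: "real \<Rightarrow> 'a \<Rightarrow> complex"
    proof -
      have "(\<integral>\<omega>. indicator A \<omega> *\<^sub>R g (s \<omega>) \<omega> \<partial>M) = (\<integral>\<omega>. (\<Sum>w\<in>?R. indicator (?B w) \<omega> *\<^sub>R g w \<omega>) \<partial>M)"
      proof (rule Bochner_Integration.integral_cong[OF refl])
        fix \<omega> assume \<omega>: "\<omega> \<in> space M"
        have "(\<Sum>w\<in>?R. indicator (?B w) \<omega> *\<^sub>R g w \<omega>) = (\<Sum>w\<in>?R. if w = s \<omega> then indicator A \<omega> *\<^sub>R g (s \<omega>) \<omega> else 0)"
          using \<omega> by (intro sum.cong) (auto simp: indicator_def)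
        also have "\<dots> = indicator A \<omega> *\<^sub>R g (s \<omega>) \<omega>" using fin \<omega> by (simp add: sum.delta)
        finally show "indicator A \<omega> *\<^sub>R g (s \<omega>) \<omega> = (\<Sum>w\<in>?R. indicator (?B w) \<omega> *\<^sub>R g w \<omega>)" by simp
      qed
      also have "\<dots> = (\<Sum>w\<in>?R. \<integral>\<omega>. indicator (?B w) \<omega> *\<^sub>R g w \<omega> \<partial>M)"
      proof (rule Bochner_Integration.integral_sum)
        fix w
        show "integrable M (\<lambda>\<omega>. indicator (?B w) \<omega> *\<^sub>R g w \<omega>)"
          by (rule integrable_mult_indicator[OF BM], rule integrable_const_bound[where B=1]) (use g in auto)
      qed
      finally show ?thesis .
    qed
    have gm1: "(\<lambda>\<omega>. iexp (w * U n \<omega>)) \<in> borel_measurable M" for w n by measurable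
    have gb1: "norm (iexp (w * U n \<omega>)) \<le> 1" for w n \<omega> by (simp only: norm_exp_i_times order_refl)
    have gm2: "\<phi> w \<in> borel_measurable M" for w unfolding \<phi>_def by measurable
    have e1: "(\<integral>\<omega>. indicator A \<omega> *\<^sub>R iexp (s \<omega> * U n \<omega>) \<partial>M) = (\<Sum>w\<in>?R. \<integral>\<omega>. indicator (?B w) \<omega> *\<^sub>R iexp (w * U n \<omega>) \<partial>M)" for n
      by (rule split[of "\<lambda>w \<omega>. iexp (w * U n \<omega>)", OF gm1 gb1])
    have e2: "(\<integral>\<omega>. indicator A \<omega> *\<^sub>R \<phi> (s \<omega>) \<omega> \<partial>M) = (\<Sum>w\<in>?R. \<integral>\<omega>. indicator (?B w) \<omega> *\<^sub>R \<phi> w \<omega> \<partial>M)"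
      by (rule split[OF gm2 \<phi>_b])
    show ?thesis unfolding e1 e2 unfolding \<phi>_def by (intro tendsto_sum lim BG)
  qed
  obtain s where s: "\<And>i. simple_function G (s i)" "\<And>\<omega>. \<omega> \<in> space M \<Longrightarrow> (\<lambda>i. s i \<omega>) \<longlonglongrightarrow> W \<omega>"
    using borel_measurable_implies_sequence_metric[OF W, of 0] unfolding spG by blast
  have [measurable]: "s i \<in> borel_measurable M" for i using s(1) GM borel_measurable_simple_function by blast
  have c1: "(\<lambda>i. \<integral>\<omega>. min 1 \<bar>W \<omega> - s i \<omega>\<bar> \<partial>M) \<longlonglongrightarrow> (\<integral>\<omega>. 0 \<partial>M)"
  proof (rule integral_dominated_convergence[where w="\<lambda>_. 1"])
    show "AE \<omega> in M. (\<lambda>i. min 1 \<bar>W \<omega> - s i \<omega>\<bar>) \<longlonglongrightarrow> 0"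
    proof (rule AE_I2)
      fix \<omega> assume "\<omega> \<in> space M"
      then have "(\<lambda>i. min 1 \<bar>W \<omega> - s i \<omega>\<bar>) \<longlonglongrightarrow> min 1 \<bar>W \<omega> - W \<omega>\<bar>" by (intro tendsto_intros s(2))
      then show "(\<lambda>i. min 1 \<bar>W \<omega> - s i \<omega>\<bar>) \<longlonglongrightarrow> 0" by simp
    qed
  qed auto
  have c2: "(\<lambda>i. \<integral>\<omega>. indicator A \<omega> *\<^sub>R \<phi> (s i \<omega>) \<omega> \<partial>M) \<longlonglongrightarrow> (\<integral>\<omega>. indicator A \<omega> *\<^sub>R \<phi> (W \<omega>) \<omega> \<partial>M)"
  proof (rule integral_dominated_convergence[where w="\<lambda>_. 1"])
    show "AE \<omega> in M. (\<lambda>i. indicator A \<omega> *\<^sub>R \<phi> (s i \<omega>) \<omega>) \<longlonglongrightarrow> indicator A \<omega> *\<^sub>R \<phi> (W \<omega>) \<omega>"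
    proof (rule AE_I2)
      fix \<omega> assume "\<omega> \<in> space M"
      then show "(\<lambda>i. indicator A \<omega> *\<^sub>R \<phi> (s i \<omega>) \<omega>) \<longlonglongrightarrow> indicator A \<omega> *\<^sub>R \<phi> (W \<omega>) \<omega>"
        unfolding \<phi>_def by (intro tendsto_intros s(2)) simp_all
    qed
    show "AE \<omega> in M. norm (indicator A \<omega> *\<^sub>R \<phi> (s i \<omega>) \<omega>) \<le> 1" for i
      using \<phi>_b by (intro AE_I2) (simp add: indicator_def)
  qed (auto simp: \<phi>_def)
  show ?thesis unfolding \<phi>_def[symmetric]
  proof (rule tendsto_by_approximation)
    fix e :: real assume "0 < e"
    \<comment> \<open>Beyond the level \<open>K\<close> the tight sequence has probability at most \<open>e /
      4\<close>.\<close>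
    define K where "K = max 1 (4 * B / e)"
    have K: "1 \<le> K" by (simp add: K_def)
    have BK: "B / K \<le> e / 4"
    proof -
      have "4 * B / e \<le> K" by (simp add: K_def)
      then show ?thesis using \<open>0 < e\<close> K by (simp add: field_simps)
    qed
    have "(\<lambda>i. K * (\<integral>\<omega>. min 1 \<bar>W \<omega> - s i \<omega>\<bar> \<partial>M)) \<longlonglongrightarrow> K * 0" using c1 by (intro tendsto_intros) simp
    then have "\<forall>\<^sub>F i in sequentially. K * (\<integral>\<omega>. min 1 \<bar>W \<omega> - s i \<omega>\<bar> \<partial>M) < e / 4"
      using \<open>0 < e\<close> by (intro order_tendstoD(2)[where y="K*0"]) auto
    moreover have "\<forall>\<^sub>F i in sequentially. dist (\<integral>\<omega>. indicator A \<omega> *\<^sub>R \<phi> (s i \<omega>) \<omega> \<partial>M) (\<integral>\<omega>. indicator A \<omega> *\<^sub>R \<phi> (W \<omega>) \<omega> \<partial>M) < e"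
      by (rule tendstoD[OF c2 \<open>0 < e\<close>])
    ultimately have "\<forall>\<^sub>F i in sequentially. K * (\<integral>\<omega>. min 1 \<bar>W \<omega> - s i \<omega>\<bar> \<partial>M) < e / 4 \<and>
      dist (\<integral>\<omega>. indicator A \<omega> *\<^sub>R \<phi> (s i \<omega>) \<omega> \<partial>M) (\<integral>\<omega>. indicator A \<omega> *\<^sub>R \<phi> (W \<omega>) \<omega> \<partial>M) < e"
      by (rule eventually_conj)
    then obtain i where i: "K * (\<integral>\<omega>. min 1 \<bar>W \<omega> - s i \<omega>\<bar> \<partial>M) < e / 4"
      "dist (\<integral>\<omega>. indicator A \<omega> *\<^sub>R \<phi> (s i \<omega>) \<omega> \<partial>M) (\<integral>\<omega>. indicator A \<omega> *\<^sub>R \<phi> (W \<omega>) \<omega> \<partial>M) < e"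
      using eventually_happens'[OF sequentially_bot] by blast
    show "\<exists>a L. a \<longlonglongrightarrow> L \<and> dist L (\<integral>\<omega>. indicator A \<omega> *\<^sub>R \<phi> (W \<omega>) \<omega> \<partial>M) \<le> e \<and>
        (\<forall>\<^sub>F n in sequentially. dist (\<integral>\<omega>. indicator A \<omega> *\<^sub>R iexp (W \<omega> * U n \<omega>) \<partial>M) (a n) \<le> e)"
    proof (intro exI conjI)
      show "(\<lambda>n. \<integral>\<omega>. indicator A \<omega> *\<^sub>R iexp (s i \<omega> * U n \<omega>) \<partial>M) \<longlonglongrightarrow> (\<integral>\<omega>. indicator A \<omega> *\<^sub>R \<phi> (s i \<omega>) \<omega> \<partial>M)"
        by (rule simple[OF s(1)])
      show "dist (\<integral>\<omega>. indicator A \<omega> *\<^sub>R \<phi> (s i \<omega>) \<omega> \<partial>M) (\<integral>\<omega>. indicator A \<omega> *\<^sub>R \<phi> (W \<omega>) \<omega> \<partial>M) \<le> e"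
        using i(2) by simp
      show "\<forall>\<^sub>F n in sequentially. dist (\<integral>\<omega>. indicator A \<omega> *\<^sub>R iexp (W \<omega> * U n \<omega>) \<partial>M)
          (\<integral>\<omega>. indicator A \<omega> *\<^sub>R iexp (s i \<omega> * U n \<omega>) \<partial>M) \<le> e"
      proof (intro always_eventually allI)
        fix n
        have "dist (\<integral>\<omega>. indicator A \<omega> *\<^sub>R iexp (W \<omega> * U n \<omega>) \<partial>M) (\<integral>\<omega>. indicator A \<omega> *\<^sub>R iexp (s i \<omega> * U n \<omega>) \<partial>M)
          \<le> 2 * (\<integral>\<omega>. min 1 \<bar>W \<omega> * U n \<omega> - s i \<omega> * U n \<omega>\<bar> \<partial>M)"
          by (rule set_char_diff_bound) measurable
        moreover have "(\<integral>\<omega>. min 1 \<bar>W \<omega> * U n \<omega> - s i \<omega> * U n \<omega>\<bar> \<partial>M) = (\<integral>\<omega>. min 1 \<bar>(W \<omega> - s i \<omega>) * U n \<omega>\<bar> \<partial>M)"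
          by (simp only: left_diff_distrib)
        moreover have "(\<integral>\<omega>. min 1 \<bar>(W \<omega> - s i \<omega>) * U n \<omega>\<bar> \<partial>M) \<le> K * (\<integral>\<omega>. min 1 \<bar>W \<omega> - s i \<omega>\<bar> \<partial>M) + B / K"
          by (rule expectation_min1_mult[OF _ U(1,2) K]) measurable
        ultimately show "dist (\<integral>\<omega>. indicator A \<omega> *\<^sub>R iexp (W \<omega> * U n \<omega>) \<partial>M) (\<integral>\<omega>. indicator A \<omega> *\<^sub>R iexp (s i \<omega> * U n \<omega>) \<partial>M) \<le> e"
          using i(1) BK by linarith
      qed
    qed
  qed
qed

text \<open>For an event of positive probability this is the continuity theorem for characteristic
  functions under the conditional probability given \<open>A\<close>.\<close>
lemma set_char_imp_set_expectation:
  fixes X :: "nat \<Rightarrow> 'a \<Rightarrow> real" and h :: "real \<Rightarrow> real"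
  assumes [measurable]: "\<And>n. X n \<in> borel_measurable M" "Y \<in> borel_measurable M" and A[measurable]: "A \<in> events"
    and lim: "\<And>t. (\<lambda>n. \<integral>\<omega>. indicator A \<omega> *\<^sub>R iexp (t * X n \<omega>) \<partial>M) \<longlonglongrightarrow> (\<integral>\<omega>. indicator A \<omega> *\<^sub>R iexp (t * Y \<omega>) \<partial>M)"
    and h: "continuous_on UNIV h" "\<And>x. \<bar>h x\<bar> \<le> K"
  shows "(\<lambda>n. \<integral>\<omega>. indicator A \<omega> *\<^sub>R h (X n \<omega>) \<partial>M) \<longlonglongrightarrow> (\<integral>\<omega>. indicator A \<omega> *\<^sub>R h (Y \<omega>) \<partial>M)"
proof (cases "prob A = 0")
  case True
  then have "AE \<omega> in M. \<omega> \<notin> A" using A prob_eq_0 by blast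
  then have "(\<integral>\<omega>. indicator A \<omega> *\<^sub>R g \<omega> \<partial>M) = (\<integral>\<omega>. 0 \<partial>M)" if [measurable]: "g \<in> borel_measurable M" for g :: "'a \<Rightarrow> real"
    by (intro integral_cong_AE) (auto elim!: eventually_mono)
  moreover have [measurable]: "h \<in> borel_measurable borel" using h(1) by (rule borel_measurable_continuous_onI)
  ultimately show ?thesis by simp
next
  case False
  define p where "p = prob A"
  have p: "0 < p" using False by (simp add: p_def zero_less_measure_iff)
  define Q where "Q = density M (\<lambda>\<omega>. ennreal (indicator A \<omega> / p))"
  have Qint: "(\<integral>\<omega>. g \<omega> \<partial>Q) = (1 / p) *\<^sub>R (\<integral>\<omega>. indicator A \<omega> *\<^sub>R g \<omega> \<partial>M)"
    if [measurable]: "g \<in> borel_measurable M" for g :: "'a \<Rightarrow> 'b::{banach, second_countable_topology}"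
  proof -
    have "(\<integral>\<omega>. g \<omega> \<partial>Q) = (\<integral>\<omega>. (indicator A \<omega> / p) *\<^sub>R g \<omega> \<partial>M)"
      unfolding Q_def using p by (intro integral_density) auto
    also have "\<dots> = (\<integral>\<omega>. (1 / p) *\<^sub>R (indicator A \<omega> *\<^sub>R g \<omega>) \<partial>M)" by simp
    finally show ?thesis by (simp only: integral_scaleR_right)
  qed
  have "prob_space Q"
  proof
    have "(\<integral>\<^sup>+ \<omega>. ennreal (indicator A \<omega> / p) \<partial>M) = (\<integral>\<^sup>+ \<omega>. ennreal (1 / p) * indicator A \<omega> \<partial>M)"
      by (intro nn_integral_cong) (simp add: indicator_def)
    also have "\<dots> = ennreal (1 / p) * ennreal p"
      by (simp add: nn_integral_cmult emeasure_eq_measure p_def)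
    also have "\<dots> = 1" using p by (simp add: ennreal_mult[symmetric])
    finally show "emeasure Q (space Q) = 1" unfolding Q_def by (simp add: emeasure_density cong: nn_integral_cong)
  qed
  then interpret Q: prob_space Q .
  have Qm: "g \<in> borel_measurable Q \<longleftrightarrow> g \<in> borel_measurable M" for g :: "'a \<Rightarrow> real" by (simp add: Q_def)
  have rd: "real_distribution (distr Q borel g)" if "g \<in> borel_measurable M" for g
    using that Qm by (intro Q.real_distribution_distr) simp
  have cf: "char (distr Q borel g) t = (1 / p) *\<^sub>R (\<integral>\<omega>. indicator A \<omega> *\<^sub>R iexp (t * g \<omega>) \<partial>M)" if [measurable]: "g \<in> borel_measurable M" for g t
  proof -
    have "char (distr Q borel g) t = (\<integral>\<omega>. iexp (t * g \<omega>) \<partial>Q)"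
      unfolding char_def using that Qm by (subst integral_distr) auto
    then show ?thesis by (subst (asm) Qint) auto
  qed
  have eh: "(\<integral>x. h x \<partial>distr Q borel g) = (1 / p) *\<^sub>R (\<integral>\<omega>. indicator A \<omega> *\<^sub>R h (g \<omega>) \<partial>M)" if [measurable]: "g \<in> borel_measurable M" for g
  proof -
    have [measurable]: "h \<in> borel_measurable borel" using h(1) by (rule borel_measurable_continuous_onI)
    have "(\<integral>x. h x \<partial>distr Q borel g) = (\<integral>\<omega>. h (g \<omega>) \<partial>Q)"
      using that Qm by (subst integral_distr) auto
    then show ?thesis by (subst (asm) Qint) auto
  qed
  have "weak_conv_m (\<lambda>n. distr Q borel (X n)) (distr Q borel Y)"
  proof (rule levy_continuity)
    show "(\<lambda>n. char (distr Q borel (X n)) t) \<longlonglongrightarrow> char (distr Q borel Y) t" for t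
      unfolding cf[OF assms(1)] cf[OF assms(2)] by (intro tendsto_intros lim)
  qed (auto intro: rd)
  then have "(\<lambda>n. \<integral>x. h x \<partial>distr Q borel (X n)) \<longlonglongrightarrow> (\<integral>x. h x \<partial>distr Q borel Y)"
    by (intro weak_conv_imp_integral_bdd_continuous_conv[where B=K])
       (use h in \<open>auto intro: rd simp: continuous_on_eq_continuous_at\<close>)
  from tendsto_scaleR[OF tendsto_const[of p] this] show ?thesis
    unfolding eh[OF assms(1)] eh[OF assms(2)] using p by simp
qed

text \<open>Testing against an integrable \<open>f\<close> and conditioning on \<open>G\<close> amounts
  to testing against the \<open>G\<close>-measurable conditional expectation of
  \<open>f\<close>, and such test functions are approximated by combinations of indicators of
  events of \<open>G\<close>.\<close>
lemma stably_convergesI: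
  assumes G: "subalgebra M G" and X[measurable]: "\<And>n. X n \<in> borel_measurable M" and Y[measurable]: "Y \<in> borel_measurable M"
    and lim: "\<And>A t. A \<in> sets G \<Longrightarrow> (\<lambda>n. \<integral>\<omega>. indicator A \<omega> *\<^sub>R iexp (t * X n \<omega>) \<partial>M) \<longlonglongrightarrow> (\<integral>\<omega>. indicator A \<omega> *\<^sub>R iexp (t * Y \<omega>) \<partial>M)"
  shows "stably_converges M G X Y"
  unfolding stably_converges_def
proof (intro conjI allI impI G X Y)
  fix f :: "'a \<Rightarrow> real" and h :: "real \<Rightarrow> real"
  assume f: "integrable M f" and hc: "continuous_on UNIV h" and hb: "bounded (range h)"
  obtain K where K: "\<And>x. \<bar>h x\<bar> \<le> K" using hb by (auto simp: bounded_iff)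
  have [measurable]: "h \<in> borel_measurable borel" using hc by (rule borel_measurable_continuous_onI)
  have "finite_measure_subalgebra M G" by unfold_locales (rule G)
  then interpret sigma_finite_subalgebra M G by (rule finite_measure_subalgebra_is_sigma_finite)
  let ?g = "real_cond_exp M G f"
  have g: "integrable M ?g" "?g \<in> borel_measurable G" using real_cond_exp_int[OF f] by auto
  have eq: "(\<integral>\<omega>. f \<omega> * real_cond_exp M G (\<lambda>\<omega>. h (Z \<omega>)) \<omega> \<partial>M) = (\<integral>\<omega>. ?g \<omega> * h (Z \<omega>) \<partial>M)"
    if Z[measurable]: "Z \<in> borel_measurable M" for Z
  proof -
    have hZ: "integrable M (\<lambda>\<omega>. h (Z \<omega>))" using K by (intro integrable_const_bound[where B=K]) auto
    let ?c = "real_cond_exp M G (\<lambda>\<omega>. h (Z \<omega>))"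
    have K0: "0 \<le> K" using K[of 0] by simp
    have cb: "AE \<omega> in M. \<bar>?c \<omega>\<bar> \<le> K"
    proof -
      have 1: "AE \<omega> in M. ?c \<omega> \<le> K" by (rule real_cond_exp_le_c[OF hZ]) (use K in \<open>auto simp: abs_le_iff\<close>)
      have 2: "AE \<omega> in M. - K \<le> ?c \<omega>" by (rule real_cond_exp_ge_c[OF hZ]) (use K in \<open>auto simp: abs_le_iff minus_le_iff\<close>)
      show ?thesis using 1 2 by eventually_elim auto
    qed
    have [measurable]: "f \<in> borel_measurable M" "?g \<in> borel_measurable M" using f g by auto
    have i1: "integrable M (\<lambda>\<omega>. ?c \<omega> * f \<omega>)"
    proof (rule Bochner_Integration.integrable_bound)
      show "integrable M (\<lambda>\<omega>. K * \<bar>f \<omega>\<bar>)" using f by auto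
      show "AE \<omega> in M. norm (?c \<omega> * f \<omega>) \<le> norm (K * \<bar>f \<omega>\<bar>)"
        using cb by eventually_elim (use K0 in \<open>auto simp: abs_mult intro: mult_right_mono\<close>)
    qed auto
    have i2: "integrable M (\<lambda>\<omega>. ?g \<omega> * h (Z \<omega>))"
    proof (rule Bochner_Integration.integrable_bound)
      show "integrable M (\<lambda>\<omega>. K * \<bar>?g \<omega>\<bar>)" using g by auto
      show "AE \<omega> in M. norm (?g \<omega> * h (Z \<omega>)) \<le> norm (K * \<bar>?g \<omega>\<bar>)"
      proof (rule AE_I2)
        fix \<omega>
        show "norm (?g \<omega> * h (Z \<omega>)) \<le> norm (K * \<bar>?g \<omega>\<bar>)"
          using mult_left_mono[OF K[of "Z \<omega>"], of "\<bar>?g \<omega>\<bar>"] K0 by (simp add: abs_mult mult.commute)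
      qed
    qed auto
    have "(\<integral>\<omega>. ?c \<omega> * ?g \<omega> \<partial>M) = (\<integral>\<omega>. ?c \<omega> * f \<omega> \<partial>M)"
      by (rule real_cond_exp_intg(2)[OF i1]) (use f in auto)
    moreover have "(\<integral>\<omega>. ?g \<omega> * ?c \<omega> \<partial>M) = (\<integral>\<omega>. ?g \<omega> * h (Z \<omega>) \<partial>M)"
      by (rule real_cond_exp_intg(2)[OF i2 g(2)]) auto
    ultimately show ?thesis by (simp add: mult.commute)
  qed
  have "(\<lambda>n. \<integral>\<omega>. ?g \<omega> * h (X n \<omega>) \<partial>M) \<longlonglongrightarrow> (\<integral>\<omega>. ?g \<omega> * h (Y \<omega>) \<partial>M)"
  proof (rule stable_limit_of_sets[OF G _ _ _ _ _ g, where K=K])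
    show "(\<lambda>n. \<integral>\<omega>. indicator A \<omega> *\<^sub>R h (X n \<omega>) \<partial>M) \<longlonglongrightarrow> (\<integral>\<omega>. indicator A \<omega> *\<^sub>R h (Y \<omega>) \<partial>M)"
      if A: "A \<in> sets G" for A
      using G A by (intro set_char_imp_set_expectation[OF X Y _ lim[OF A] hc K]) (auto simp: subalgebra_def)
  qed (use K in auto)
  then show "(\<lambda>n. \<integral>\<omega>. f \<omega> * real_cond_exp M G (\<lambda>\<omega>. h (X n \<omega>)) \<omega> \<partial>M)
       \<longlonglongrightarrow> (\<integral>\<omega>. f \<omega> * real_cond_exp M G (\<lambda>\<omega>. h (Y \<omega>)) \<omega> \<partial>M)"
    unfolding eq[OF X] eq[OF Y] .
qed

text \<open>The pair \<open>(W, indicator A)\<close> is \<open>G\<close>-measurable, hence independent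
  of \<open>N\<close>: integrating \<open>N\<close> out first leaves the normal characteristic
  function at \<open>W\<close>.\<close>
lemma set_char_independent_normal:
  fixes W N :: "'a \<Rightarrow> real"
  assumes G: "subalgebra M G" and A: "A \<in> sets G" and W: "W \<in> borel_measurable G"
    and N: "distributed M lborel N std_normal_density" and indep: "indep_of_field M N G"
  shows "(\<integral>\<omega>. indicator A \<omega> *\<^sub>R iexp (W \<omega> * N \<omega>) \<partial>M)
    = (\<integral>\<omega>. indicator A \<omega> *\<^sub>R complex_of_real (exp (- ((W \<omega>)\<^sup>2 / 2))) \<partial>M)"
proof -
  have N_M[measurable]: "N \<in> borel_measurable M" using distributed_measurable[OF N] by simp
  have spG: "space G = space M" using G by (simp add: subalgebra_def)
  note [measurable] = A W
  let ?B = "borel :: (real \<times> real) measure"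
  define X where "X \<omega> = (W \<omega>, indicator A \<omega> :: real)" for \<omega>
  define Y where "Y \<omega> = (N \<omega>, 0 :: real)" for \<omega>
  have XG: "X \<in> measurable G ?B" unfolding X_def borel_prod[symmetric] by measurable
  have XM[measurable]: "X \<in> measurable M ?B" by (rule measurable_from_subalg[OF G XG])
  let ?N = "vimage_algebra (space M) N borel"
  have "N \<in> measurable ?N borel" by (rule measurable_vimage_algebra1) simp
  then have YN: "Y \<in> measurable ?N ?B" unfolding Y_def borel_prod[symmetric] by measurable
  have YM[measurable]: "Y \<in> measurable M ?B" unfolding Y_def borel_prod[symmetric] by measurable
  have ind: "indep_set (sets ?N) (sets G)" using indep by (simp add: indep_of_field_def)
  have iv: "indep_var ?B X ?B Y"
  proof -
    have s1: "sigma_sets (space M) {X -` S \<inter> space M | S. S \<in> sets ?B} \<subseteq> sets G"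
      unfolding spG[symmetric] using measurable_sets[OF XG] by (intro sets.sigma_sets_subset) auto
    have s2: "sigma_sets (space M) {Y -` S \<inter> space M | S. S \<in> sets ?B} \<subseteq> sets ?N"
      using measurable_sets[OF YN] by (intro sets.sigma_sets_subset[of _ ?N, unfolded space_vimage_algebra]) auto
    have "indep_set (sets G) (sets ?N)"
    proof -
      have "prob (a \<inter> b) = prob a * prob b" if "a \<in> sets G" "b \<in> sets ?N" for a b
      proof -
        have "prob (b \<inter> a) = prob b * prob a" using ind that unfolding indep_sets2_eq by blast
        then show ?thesis by (simp only: Int_commute[of a b] mult.commute[of "prob a"])
      qed
      then show ?thesis using ind unfolding indep_sets2_eq by blast
    qed
    note i = this[unfolded indep_sets2_eq]
    have "indep_set (sigma_sets (space M) {X -` S \<inter> space M | S. S \<in> sets ?B})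
        (sigma_sets (space M) {Y -` S \<inter> space M | S. S \<in> sets ?B})"
      unfolding indep_sets2_eq
      by (intro conjI ballI subset_trans[OF s1 conjunct1[OF i]] subset_trans[OF s2 conjunct1[OF conjunct2[OF i]]]
          conjunct2[OF conjunct2[OF i], rule_format] subsetD[OF s1] subsetD[OF s2])
    then show ?thesis unfolding indep_var_eq using XM YM by blast
  qed
  have dist: "distr M ?B X \<Otimes>\<^sub>M distr M ?B Y = distr M (?B \<Otimes>\<^sub>M ?B) (\<lambda>\<omega>. (X \<omega>, Y \<omega>))"
    using iv unfolding indep_var_distribution_eq by simp
  interpret DX: prob_space "distr M ?B X" by (rule prob_space_distr[OF XM])
  interpret DY: prob_space "distr M ?B Y" by (rule prob_space_distr[OF YM])
  interpret P: pair_sigma_finite "distr M ?B X" "distr M ?B Y" ..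
  interpret PP: pair_prob_space "distr M ?B X" "distr M ?B Y" ..
  define F where "F = (\<lambda>(u :: real \<times> real, v :: real \<times> real). indicator {1} (snd u) *\<^sub>R iexp (fst u * fst v))"
  have F_m[measurable]: "F \<in> borel_measurable (?B \<Otimes>\<^sub>M ?B)" unfolding F_def borel_prod[symmetric] by measurable
  have F_b: "norm (F z) \<le> 1" for z
    unfolding F_def by (cases z) (simp only: case_prod_conv norm_scaleR norm_exp_i_times, simp add: indicator_def)
  have indA: "indicator {1} (snd (X \<omega>)) = (indicator A \<omega> :: real)" for \<omega> by (simp add: X_def indicator_def)
  have "(\<integral>\<omega>. indicator A \<omega> *\<^sub>R iexp (W \<omega> * N \<omega>) \<partial>M) = (\<integral>\<omega>. F (X \<omega>, Y \<omega>) \<partial>M)"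
    by (simp only: F_def case_prod_conv indA) (simp add: X_def Y_def)
  also have "\<dots> = (\<integral>z. F z \<partial>distr M (?B \<Otimes>\<^sub>M ?B) (\<lambda>\<omega>. (X \<omega>, Y \<omega>)))"
    by (rule integral_distr[symmetric]) measurable
  also have "\<dots> = (\<integral>z. F z \<partial>(distr M ?B X \<Otimes>\<^sub>M distr M ?B Y))" unfolding dist ..
  also have "\<dots> = (\<integral>u. (\<integral>v. F (u, v) \<partial>distr M ?B Y) \<partial>distr M ?B X)"
  proof (rule P.integral_fst'[symmetric])
    show "integrable (distr M ?B X \<Otimes>\<^sub>M distr M ?B Y) F"
      by (rule PP.integrable_const_bound[where B=1]) (use F_b F_m in auto)
  qed
  also have "\<dots> = (\<integral>u. indicator {1} (snd u) *\<^sub>R complex_of_real (exp (- ((fst u)\<^sup>2 / 2))) \<partial>distr M ?B X)"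
  proof (rule Bochner_Integration.integral_cong[OF refl])
    fix u :: "real \<times> real"
    have "(\<lambda>v. F (u, v)) \<in> borel_measurable ?B" by measurable
    then have "(\<integral>v. F (u, v) \<partial>distr M ?B Y) = (\<integral>\<omega>. F (u, Y \<omega>) \<partial>M)"
      by (rule integral_distr[OF YM])
    also have "\<dots> = indicator {1} (snd u) *\<^sub>R (\<integral>\<omega>. iexp (fst u * N \<omega>) \<partial>M)"
      by (simp only: F_def Y_def case_prod_conv fst_conv integral_scaleR_right)
    also have "(\<integral>\<omega>. iexp (fst u * N \<omega>) \<partial>M) = (\<integral>x. iexp (fst u * x) \<partial>distr M borel N)"
      by (rule integral_distr[OF N_M, symmetric]) measurable
    also have "distr M borel N = density lborel std_normal_density"
      using distributed_distr_eq_density[OF N] by (simp cong: distr_cong)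
    also have "(\<integral>x. iexp (fst u * x) \<partial>std_normal_distribution) = complex_of_real (exp (- ((fst u)\<^sup>2 / 2)))"
      using fun_cong[OF char_std_normal_distribution, of "fst u"] by (simp add: char_def)
    finally show "(\<integral>v. F (u, v) \<partial>distr M ?B Y) = indicator {1} (snd u) *\<^sub>R complex_of_real (exp (- ((fst u)\<^sup>2 / 2)))" .
  qed
  also have "\<dots> = (\<integral>\<omega>. indicator {1} (snd (X \<omega>)) *\<^sub>R complex_of_real (exp (- ((fst (X \<omega>))\<^sup>2 / 2))) \<partial>M)"
    by (rule integral_distr[OF XM]) (unfold borel_prod[symmetric], measurable)
  also have "\<dots> = (\<integral>\<omega>. indicator A \<omega> *\<^sub>R complex_of_real (exp (- ((W \<omega>)\<^sup>2 / 2))) \<partial>M)"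
    by (simp only: indA) (simp add: X_def)
  finally show ?thesis .
qed

end


section \<open>Ratios of mixed Ewens--Pitman weights\<close>

text \<open>The complement of the support is a union of open null sets, and by the Lindelof property
  countably many of them suffice.\<close>
lemma AE_in_measure_support:
  fixes \<mu> :: "'a::second_countable_topology measure"
  assumes \<mu>: "sets \<mu> = sets borel" and S: "measure_support \<mu> \<subseteq> S"
  shows "AE x in \<mu>. x \<in> S"
proof -
  define \<F> where "\<F> = {U. open U \<and> emeasure \<mu> U = 0}"
  obtain \<F>' where F: "\<F>' \<subseteq> \<F>" "countable \<F>'" "\<Union>\<F>' = \<Union>\<F>"
    by (rule Lindelof[of \<F>]) (auto simp: \<F>_def)
  have nul: "(\<Union>U\<in>\<F>'. U) \<in> null_sets \<mu>"
    using F by (intro null_sets_UN') (auto simp: \<F>_def \<mu> null_sets_def)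
  have "- S \<subseteq> \<Union>\<F>"
  proof
    fix x assume "x \<in> - S"
    then have "x \<notin> measure_support \<mu>" using S by blast
    then obtain U where "open U" "x \<in> U" "emeasure \<mu> U = 0"
      unfolding measure_support_def by (auto simp: zero_less_iff_neq_zero)
    then show "x \<in> \<Union>\<F>" unfolding \<F>_def by blast
  qed
  then show ?thesis using F(3) by (intro AE_I'[OF nul]) blast
qed

locale bounded_weights = real_distribution \<mu> for \<mu> :: "real measure" +
  fixes \<alpha> lo hi :: real
  assumes \<alpha>: "0 < \<alpha>" "\<alpha> < 1" and supp: "measure_support \<mu> \<subseteq> {lo..hi}"
    and lo: "- \<alpha> < lo" "lo \<le> 0" and hi: "0 \<le> hi"
begin

lemma AE_theta: "AE \<theta> in \<mu>. lo \<le> \<theta> \<and> \<theta> \<le> hi"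
  using AE_in_measure_support[OF events_eq_borel supp] by simp

lemma factor_pos:
  assumes "lo \<le> \<theta>" "1 \<le> i" shows "0 < \<theta> + real i * \<alpha>" "0 < \<theta> + real i"
proof -
  have "\<alpha> \<le> real i * \<alpha>" using assms(2) \<alpha> by simp
  then show 1: "0 < \<theta> + real i * \<alpha>" using assms lo by linarith
  have "real i * \<alpha> \<le> real i" using \<alpha> by (simp add: mult_left_le)
  then show "0 < \<theta> + real i" using 1 by linarith
qed

text \<open>All factors in the numerator and in the denominator of the weight are positive and
  increasing in \<open>\<theta>\<close>, so the extreme parameters give deterministic bounds.\<close>
lemma weight_bounds:
  assumes "lo \<le> \<theta>" "\<theta> \<le> hi"
  shows "(\<Prod>i\<in>{1..<k}. lo + real i * \<alpha>) / (\<Prod>i\<in>{1..<n}. hi + real i) \<le> ewens_pitman_weight \<alpha> \<theta> n k"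
    "ewens_pitman_weight \<alpha> \<theta> n k \<le> (\<Prod>i\<in>{1..<k}. hi + real i * \<alpha>) / (\<Prod>i\<in>{1..<n}. lo + real i)"
    "0 < ewens_pitman_weight \<alpha> \<theta> n k"
    "0 < (\<Prod>i\<in>{1..<k}. lo + real i * \<alpha>) / (\<Prod>i\<in>{1..<n}. hi + real i)"
proof -
  have num: "0 < (\<Prod>i\<in>{1..<k}. x + real i * \<alpha>)" "(\<Prod>i\<in>{1..<k}. x + real i * \<alpha>) \<le> (\<Prod>i\<in>{1..<k}. y + real i * \<alpha>)"
    if "lo \<le> x" "x \<le> y" for x y
    using factor_pos(1)[OF that(1)] that by (auto intro!: prod_pos prod_mono simp: less_imp_le)
  have den: "0 < (\<Prod>i\<in>{1..<n}. x + real i)" "(\<Prod>i\<in>{1..<n}. x + real i) \<le> (\<Prod>i\<in>{1..<n}. y + real i)"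
    if "lo \<le> x" "x \<le> y" for x y
    using factor_pos(2)[OF that(1)] that by (auto intro!: prod_pos prod_mono simp: less_imp_le)
  note l = order_refl[of lo] and lt = assms and lh = order_trans[OF assms]
  show "(\<Prod>i\<in>{1..<k}. lo + real i * \<alpha>) / (\<Prod>i\<in>{1..<n}. hi + real i) \<le> ewens_pitman_weight \<alpha> \<theta> n k"
    unfolding ewens_pitman_weight_def
    by (rule frac_le[OF less_imp_le[OF num(1)[OF lt]] num(2)[OF l lt(1)] den(1)[OF lt] den(2)[OF lt]])
  show "ewens_pitman_weight \<alpha> \<theta> n k \<le> (\<Prod>i\<in>{1..<k}. hi + real i * \<alpha>) / (\<Prod>i\<in>{1..<n}. lo + real i)"
    unfolding ewens_pitman_weight_def
    by (rule frac_le[OF less_imp_le[OF num(1)[OF lh order_refl]] num(2)[OF lt] den(1)[OF l lt(1)] den(2)[OF l lt(1)]])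
  show "0 < ewens_pitman_weight \<alpha> \<theta> n k"
    unfolding ewens_pitman_weight_def by (rule divide_pos_pos[OF num(1)[OF lt] den(1)[OF lt]])
  show "0 < (\<Prod>i\<in>{1..<k}. lo + real i * \<alpha>) / (\<Prod>i\<in>{1..<n}. hi + real i)"
    by (rule divide_pos_pos[OF num(1)[OF l lt(1)] den(1)[OF lh order_refl]])
qed

lemma integrable_weight: "integrable \<mu> (\<lambda>\<theta>. ewens_pitman_weight \<alpha> \<theta> n k)"
proof (rule integrable_const_bound)
  show "AE \<theta> in \<mu>. norm (ewens_pitman_weight \<alpha> \<theta> n k) \<le> (\<Prod>i\<in>{1..<k}. hi + real i * \<alpha>) / (\<Prod>i\<in>{1..<n}. lo + real i)"
    using AE_theta by eventually_elim (use weight_bounds(2,3)[of _ n k] in \<open>auto simp: less_imp_le\<close>)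
  show "(\<lambda>\<theta>. ewens_pitman_weight \<alpha> \<theta> n k) \<in> borel_measurable \<mu>"
    unfolding ewens_pitman_weight_def by measurable
qed

lemma gibbs_weight_pos: "0 < gibbs_weight \<alpha> \<mu> n k"
proof -
  have lh: "lo \<le> hi" using lo hi by simp
  have "(\<Prod>i\<in>{1..<k}. lo + real i * \<alpha>) / (\<Prod>i\<in>{1..<n}. hi + real i) \<le> gibbs_weight \<alpha> \<mu> n k"
    unfolding gibbs_weight_def
    by (rule integral_ge_const[OF integrable_weight])
      (use AE_theta in eventually_elim, use weight_bounds(1) in blast)
  then show ?thesis using weight_bounds(4)[of lo k n] lh by linarith
qed

lemma weight_Suc: "1 \<le> n \<Longrightarrow> ewens_pitman_weight \<alpha> \<theta> (Suc n) k = ewens_pitman_weight \<alpha> \<theta> n k / (\<theta> + real n)"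
  by (simp add: ewens_pitman_weight_def)

lemma weight_Suc_Suc: "1 \<le> n \<Longrightarrow> 1 \<le> k \<Longrightarrow> lo \<le> \<theta> \<Longrightarrow>
    ewens_pitman_weight \<alpha> \<theta> (Suc n) (Suc k) = ewens_pitman_weight \<alpha> \<theta> n k - (real n - real k * \<alpha>) * ewens_pitman_weight \<alpha> \<theta> (Suc n) k"
proof -
  assume n: "1 \<le> n" and k: "1 \<le> k" and "lo \<le> \<theta>"
  then have pos: "0 < \<theta> + real n" using factor_pos(2)[of \<theta> n] by simp
  have "ewens_pitman_weight \<alpha> \<theta> (Suc n) (Suc k) = ewens_pitman_weight \<alpha> \<theta> n k * ((\<theta> + real k * \<alpha>) / (\<theta> + real n))"
    using n k by (simp add: ewens_pitman_weight_def)
  then show ?thesis unfolding weight_Suc[OF n] using pos by (simp add: field_simps)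
qed

text \<open>In one step, a block of size \<open>j\<close> is joined with probability \<open>w n k * (j -
  \<alpha>)\<close>. For the Ewens--Pitman model \<open>w n k = 1 / (n + \<theta>)\<close>;
  the whole analysis rests on the fact that the mixture over \<open>\<theta>\<close> changes
  this only to second order in \<open>1 / n\<close>, uniformly in \<open>k\<close>.\<close>
definition w :: "nat \<Rightarrow> nat \<Rightarrow> real" where "w n k = gibbs_weight \<alpha> \<mu> (Suc n) k / gibbs_weight \<alpha> \<mu> n k"
definition p_new :: "nat \<Rightarrow> nat \<Rightarrow> real" where "p_new n k = gibbs_weight \<alpha> \<mu> (Suc n) (Suc k) / gibbs_weight \<alpha> \<mu> n k"

text \<open>The mixture inherits from each \<open>\<theta>\<close> the recursion of Gibbs weights, which
  says that the transition probabilities add up to 1.\<close>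
lemma p_new_eq: assumes "1 \<le> n" "1 \<le> k" shows "p_new n k = 1 - (real n - real k * \<alpha>) * w n k"
proof -
  have "gibbs_weight \<alpha> \<mu> (Suc n) (Suc k)
     = (\<integral>\<theta>. ewens_pitman_weight \<alpha> \<theta> n k - (real n - real k * \<alpha>) * ewens_pitman_weight \<alpha> \<theta> (Suc n) k \<partial>\<mu>)"
    unfolding gibbs_weight_def
  proof (rule integral_cong_AE)
    show "AE \<theta> in \<mu>. ewens_pitman_weight \<alpha> \<theta> (Suc n) (Suc k) =
        ewens_pitman_weight \<alpha> \<theta> n k - (real n - real k * \<alpha>) * ewens_pitman_weight \<alpha> \<theta> (Suc n) k"
      using AE_theta by eventually_elim (use weight_Suc_Suc[OF assms] in blast)
  qed (unfold ewens_pitman_weight_def, measurable)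
  also have "\<dots> = gibbs_weight \<alpha> \<mu> n k - (real n - real k * \<alpha>) * gibbs_weight \<alpha> \<mu> (Suc n) k"
    unfolding gibbs_weight_def by (simp add: integrable_weight)
  finally show ?thesis unfolding p_new_def w_def using gibbs_weight_pos[of n k] by (simp add: field_simps)
qed

text \<open>The ratio \<open>w n k\<close> is an average of \<open>1 / (n + \<theta>)\<close> over the
  bounded support of \<open>\<mu>\<close>.\<close>
lemma w_bounds: assumes n: "1 \<le> n" shows "1 / (real n + hi) \<le> w n k" "w n k \<le> 1 / (real n + lo)"
proof -
  have n0: "0 < real n + lo" using factor_pos(2)[of lo n] n by simp
  have h0: "0 < real n + hi" using n hi by simp
  have "(\<integral>\<theta>. ewens_pitman_weight \<alpha> \<theta> n k / (real n + hi) \<partial>\<mu>) \<le> gibbs_weight \<alpha> \<mu> (Suc n) k"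
    unfolding gibbs_weight_def
  proof (rule integral_mono_AE)
    show "AE \<theta> in \<mu>. ewens_pitman_weight \<alpha> \<theta> n k / (real n + hi) \<le> ewens_pitman_weight \<alpha> \<theta> (Suc n) k"
      using AE_theta
    proof eventually_elim
      case (elim \<theta>)
      then show ?case unfolding weight_Suc[OF n]
        using weight_bounds(3)[of \<theta> n k] n0 by (intro divide_left_mono) auto
    qed
  qed (use integrable_weight in auto)
  moreover have "gibbs_weight \<alpha> \<mu> (Suc n) k \<le> (\<integral>\<theta>. ewens_pitman_weight \<alpha> \<theta> n k / (real n + lo) \<partial>\<mu>)"
    unfolding gibbs_weight_def
  proof (rule integral_mono_AE)
    show "AE \<theta> in \<mu>. ewens_pitman_weight \<alpha> \<theta> (Suc n) k \<le> ewens_pitman_weight \<alpha> \<theta> n k / (real n + lo)"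
      using AE_theta
    proof eventually_elim
      case (elim \<theta>)
      then show ?case unfolding weight_Suc[OF n]
        using weight_bounds(3)[of \<theta> n k] n0 by (intro divide_left_mono) auto
    qed
  qed (use integrable_weight in auto)
  ultimately show "1 / (real n + hi) \<le> w n k" "w n k \<le> 1 / (real n + lo)"
    using gibbs_weight_pos[of n k] n0 h0 unfolding w_def gibbs_weight_def[symmetric] integral_divide_zero
    by (simp_all add: field_simps)
qed

lemma w_pos: "1 \<le> n \<Longrightarrow> 0 < w n k"
  using w_bounds(1)[of n k] hi by (smt (verit) divide_pos_pos of_nat_1 of_nat_mono)

definition weight_error :: real where "weight_error = hi + \<bar>lo\<bar> / (1 + lo)"

lemma weight_error_nonneg: "0 \<le> weight_error" unfolding weight_error_def
  by (rule add_nonneg_nonneg[OF hi divide_nonneg_nonneg[OF abs_ge_zero]]) (use lo \<alpha> in linarith)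

lemma w_near: assumes n: "1 \<le> n" shows "\<bar>w n k - 1 / real n\<bar> \<le> weight_error / (real n)\<^sup>2"
proof -
  have l: "0 < 1 + lo" using lo \<alpha> by simp
  have n1: "1 \<le> real n" using n by simp
  have nl: "real n * (1 + lo) \<le> real n + lo" 
    using mult_left_mono_neg[OF n1 lo(2)] by (simp add: algebra_simps)
  have nl0: "0 < real n * (1 + lo)" using n1 l by simp
  have hb: "1 / real n - 1 / (real n + hi) \<le> weight_error / (real n)\<^sup>2"
  proof -
    have "1 / real n - 1 / (real n + hi) = hi / (real n * (real n + hi))" using n1 hi by (simp add: field_simps)
    also have "\<dots> \<le> hi / (real n * real n)" using n1 hi by (intro divide_left_mono mult_left_mono) auto
    also have "\<dots> \<le> weight_error / (real n)\<^sup>2" unfolding power2_eq_square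
      using l by (intro divide_right_mono) (auto simp: weight_error_def)
    finally show ?thesis .
  qed
  have lb: "1 / (real n + lo) - 1 / real n \<le> weight_error / (real n)\<^sup>2"
  proof -
    have "1 / (real n + lo) - 1 / real n = \<bar>lo\<bar> / (real n * (real n + lo))" using n1 lo nl nl0 by (simp add: field_simps)
    also have "\<dots> \<le> \<bar>lo\<bar> / (real n * (real n * (1 + lo)))" using n1 nl nl0 l by (intro divide_left_mono mult_left_mono mult_pos_pos) auto
    also have "\<dots> = \<bar>lo\<bar> / (1 + lo) / (real n)\<^sup>2" by (simp add: power2_eq_square field_simps)
    also have "\<dots> \<le> weight_error / (real n)\<^sup>2" using hi by (intro divide_right_mono) (auto simp: weight_error_def)
    finally show ?thesis .
  qed
  show ?thesis using hb lb w_bounds[OF n, of k] by linarith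
qed

lemma p_new_bounds:
  assumes n: "1 \<le> n" and k: "1 \<le> k" "k \<le> n"
  shows "(lo + real k * \<alpha>) / (real n + lo) \<le> p_new n k" "0 < p_new n k" "\<bar>p_new n k - real k * \<alpha> / real n\<bar> \<le> weight_error / real n"
proof -
  have n0: "0 < real n + lo" using factor_pos(2)[of lo n] n by simp
  have ka: "real k * \<alpha> \<le> real n" using k \<alpha> mult_mono[of "real k" "real n" \<alpha> 1] by simp
  have "(real n - real k * \<alpha>) * w n k \<le> (real n - real k * \<alpha>) * (1 / (real n + lo))"
    using w_bounds(2)[OF n, of k] ka by (intro mult_left_mono) auto
  moreover have "1 - (real n - real k * \<alpha>) * (1 / (real n + lo)) = (lo + real k * \<alpha>) / (real n + lo)"
    using n0 by (simp add: field_simps)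
  ultimately show 1: "(lo + real k * \<alpha>) / (real n + lo) \<le> p_new n k" unfolding p_new_eq[OF n k(1)] by linarith
  have "0 < (lo + real k * \<alpha>) / (real n + lo)" using factor_pos(1)[of lo k] k(1) n0 by (intro divide_pos_pos) auto
  then show "0 < p_new n k" using 1 by linarith
  have "p_new n k - real k * \<alpha> / real n = (real n - real k * \<alpha>) * (1 / real n - w n k)"
    unfolding p_new_eq[OF n k(1)] using n by (simp add: field_simps)
  then have "\<bar>p_new n k - real k * \<alpha> / real n\<bar> = \<bar>real n - real k * \<alpha>\<bar> * \<bar>w n k - 1 / real n\<bar>"
    by (simp add: abs_mult abs_minus_commute)
  also have "\<dots> \<le> real n * (weight_error / (real n)\<^sup>2)"
    using ka w_near[OF n, of k] \<alpha> by (intro mult_mono) auto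
  also have "\<dots> = weight_error / real n" using n by (simp add: power2_eq_square)
  finally show "\<bar>p_new n k - real k * \<alpha> / real n\<bar> \<le> weight_error / real n" .
qed

end


section \<open>The Gibbs partition as a chain of block sizes\<close>

text \<open>Size of the block of \<open>m\<close> without \<open>m\<close> itself. When \<open>m\<close>
  is the element added last, this is the size of the block that it joined, and 0 stands for a
  new block.\<close>
definition last_size :: "nat \<Rightarrow> nat set set \<Rightarrow> nat" where
  "last_size m P = card (\<Union>{U \<in> P. m \<in> U}) - 1"

text \<open>Counting the blocks larger than \<open>j\<close>, rather than those of size
  \<open>j\<close>, makes every count nondecreasing along the chain: joining a block of size
  \<open>j\<close> increases the count with index \<open>j\<close> by one and no other.\<close>
definition blocks_larger :: "nat \<Rightarrow> nat set set \<Rightarrow> nat" where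
  "blocks_larger j P = card {U \<in> P. j < card U}"

lemma partition_blocks:
  assumes "partition_on {1..n} P"
  shows "finite P" "\<And>U. U \<in> P \<Longrightarrow> finite U" "\<And>U. U \<in> P \<Longrightarrow> U \<subseteq> {1..n}" "\<And>U. U \<in> P \<Longrightarrow> U \<noteq> {}"
    "\<And>U. U \<in> P \<Longrightarrow> 1 \<le> card U" "\<And>U. U \<in> P \<Longrightarrow> card U \<le> n" "(\<Sum>U\<in>P. card U) = n" "card P \<le> n" "1 \<le> n \<Longrightarrow> 1 \<le> card P"
proof -
  show fP: "finite P" by (rule finite_elements[OF finite_atLeastAtMost assms])
  show sub: "U \<subseteq> {1..n}" if "U \<in> P" for U
    by (subst partition_onD1[OF assms]) (rule Union_upper[OF that])
  show fin: "finite U" if "U \<in> P" for U by (rule finite_subset[OF sub[OF that]]) simp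
  show ne: "U \<noteq> {}" if "U \<in> P" for U using partition_onD3[OF assms] that by metis
  show ge: "1 \<le> card U" if "U \<in> P" for U using fin[OF that] ne[OF that] by (simp add: Suc_le_eq card_gt_0_iff)
  show "card U \<le> n" if "U \<in> P" for U using card_mono[OF _ sub[OF that]] by simp
  show s: "(\<Sum>U\<in>P. card U) = n" using product_partition[OF assms fin] by simp
  have "(\<Sum>U\<in>P. 1) \<le> (\<Sum>U\<in>P. card U)" by (rule sum_mono[OF ge])
  then show "card P \<le> n" using s by simp
  show "1 \<le> card P" if "1 \<le> n"
  proof -
    have "\<Union>P \<noteq> {}" unfolding partition_onD1[OF assms, symmetric] using that by simp
    then have "P \<noteq> {}" by blast
    then show ?thesis using fP by (simp add: Suc_le_eq card_gt_0_iff)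
  qed
qed

lemma last_size_new:
  assumes "partition_on {1..n} P" shows "last_size (Suc n) (new_block (Suc n) P) = 0"
proof -
  have "{U \<in> new_block (Suc n) P. Suc n \<in> U} = {{Suc n}}"
    using partition_blocks(3)[OF assms] by (fastforce simp: new_block_def)
  then show ?thesis by (simp add: last_size_def)
qed

lemma last_block_join:
  assumes "partition_on {1..n} P" "U \<in> P"
  shows "{V \<in> join_block (Suc n) U P. Suc n \<in> V} = {insert (Suc n) U}"
  using partition_blocks(3)[OF assms(1)] by (fastforce simp: join_block_def)

lemma not_in_block: assumes "partition_on {1..n} P" "U \<in> P" shows "Suc n \<notin> U"
  using partition_blocks(3)[OF assms] by auto

lemma last_size_join:
  assumes "partition_on {1..n} P" "U \<in> P" shows "last_size (Suc n) (join_block (Suc n) U P) = card U"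
  using not_in_block[OF assms] partition_blocks(2)[OF assms]
  unfolding last_size_def last_block_join[OF assms] by simp

lemma join_ne_new:
  assumes "partition_on {1..n} P" "U \<in> P" shows "join_block (Suc n) U P \<noteq> new_block (Suc n) P"
  using last_size_new[OF assms(1)] last_size_join[OF assms] partition_blocks(5)[OF assms] by auto

lemma join_inj:
  assumes "partition_on {1..n} P" "U \<in> P" "V \<in> P" "join_block (Suc n) U P = join_block (Suc n) V P"
  shows "U = V"
proof -
  have "insert (Suc n) U = insert (Suc n) V"
    using last_block_join[OF assms(1,2), unfolded assms(4) last_block_join[OF assms(1,3)]] by blast
  then show ?thesis using not_in_block[OF assms(1,2)] not_in_block[OF assms(1,3)] by (metis insert_ident)
qed

lemma blocks_larger_new:
  assumes "partition_on {1..n} P"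
  shows "blocks_larger j (new_block (Suc n) P) = blocks_larger j P + of_bool (j = 0)"
proof -
  have nin: "{Suc n} \<notin> P" using not_in_block[OF assms, of "{Suc n}"] by blast
  have "{U \<in> new_block (Suc n) P. j < card U} = (if j = 0 then insert {Suc n} {U \<in> P. j < card U} else {U \<in> P. j < card U})"
    by (auto simp: new_block_def)
  then show ?thesis unfolding blocks_larger_def
    using nin partition_blocks(1)[OF assms] by auto
qed

lemma blocks_larger_join:
  assumes P: "partition_on {1..n} P" and U: "U \<in> P"
  shows "blocks_larger j (join_block (Suc n) U P) = blocks_larger j P + of_bool (j = card U)"
proof -
  have fP: "finite P" by (rule partition_blocks(1)[OF P])
  have cU: "card (insert (Suc n) U) = Suc (card U)"
    using not_in_block[OF P U] partition_blocks(2)[OF P U] by simp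
  have nin: "insert (Suc n) U \<notin> P" using not_in_block[OF P, of "insert (Suc n) U"] by blast
  let ?A = "{V \<in> P - {U}. j < card V}"
  have fA: "finite ?A" "insert (Suc n) U \<notin> ?A" "U \<notin> ?A" using fP nin by auto
  have "{V \<in> join_block (Suc n) U P. j < card V} = (if j < Suc (card U) then insert (insert (Suc n) U) ?A else ?A)"
    using cU by (auto simp: join_block_def)
  moreover have "{V \<in> P. j < card V} = (if j < card U then insert U ?A else ?A)" using U by auto
  ultimately show ?thesis unfolding blocks_larger_def using fA by (auto simp: less_Suc_eq)
qed

locale bounded_gibbs = bounded_weights \<mu> \<alpha> lo hi + gp: gibbs_partition M \<alpha> \<mu> \<pi>
  for M :: "'a measure" and \<alpha> :: real and \<mu> :: "real measure" and \<pi> :: "nat \<Rightarrow> 'a \<Rightarrow> nat set set" and lo hi :: real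
begin

lemma part: "1 \<le> n \<Longrightarrow> \<omega> \<in> space M \<Longrightarrow> partition_on {1..n} (\<pi> n \<omega>)"
  using measurable_space[OF gp.partition_valued] by simp

definition s :: "nat \<Rightarrow> 'a \<Rightarrow> nat" where "s n \<omega> = last_size n (\<pi> n \<omega>)"
definition c :: "nat \<Rightarrow> nat \<Rightarrow> 'a \<Rightarrow> real" where "c j n \<omega> = real (blocks_larger j (\<pi> n \<omega>))"

lemma step_cases:
  assumes "1 \<le> n" "\<omega> \<in> space M"
  obtains "\<pi> (Suc n) \<omega> = new_block (Suc n) (\<pi> n \<omega>)" "s (Suc n) \<omega> = 0"
  | U where "U \<in> \<pi> n \<omega>" "\<pi> (Suc n) \<omega> = join_block (Suc n) U (\<pi> n \<omega>)" "s (Suc n) \<omega> = card U"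
  using gp.extends[OF assms] last_size_new[OF part[OF assms]] last_size_join[OF part[OF assms]]
  unfolding s_def by metis

lemma c_Suc: assumes "1 \<le> n" "\<omega> \<in> space M" shows "c j (Suc n) \<omega> = c j n \<omega> + of_bool (s (Suc n) \<omega> = j)"
  using step_cases[OF assms]
proof cases
  case 1
  then show ?thesis using blocks_larger_new[OF part[OF assms], of j] by (auto simp: c_def)
next
  case (2 U)
  then show ?thesis using blocks_larger_join[OF part[OF assms] 2(1), of j] by (auto simp: c_def)
qed

lemma c_eq_sum: assumes "1 \<le> n" "\<omega> \<in> space M"
  shows "c j n \<omega> = of_bool (j = 0) + (\<Sum>i\<in>{1..<n}. of_bool (s (Suc i) \<omega> = j))"
  using assms(1)
proof (induction n rule: nat_induct_at_least)
  case base
  have p1: "\<pi> 1 \<omega> = {{1}}" using gp.initial[OF assms(2)] .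
  have "{U \<in> {{1::nat}}. j < card U} = (if j = 0 then {{1}} else {})" by auto
  then have "blocks_larger j {{1}} = of_bool (j = 0)" unfolding blocks_larger_def by (cases "j = 0") simp_all
  then show ?case unfolding c_def p1 by simp
next
  case (Suc n)
  show ?case unfolding c_Suc[OF Suc(1) assms(2)] Suc.IH using Suc(1) by simp
qed

text \<open>A functional that is additive along the chain depends on the final partition only. Initially
  there is one block, created without a step, which explains the correction at index 0.\<close>
lemma sum_increments: assumes "1 \<le> n" "\<omega> \<in> space M"
  shows "(\<Sum>i\<in>{1..<n}. f (s (Suc i) \<omega>)) = (\<Sum>j<n. (c j n \<omega> - of_bool (j = 0)) * (f j :: real))"
proof -
  have sb: "s (Suc i) \<omega> < n" if "i \<in> {1..<n}" for i
  proof -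
    have i: "1 \<le> i" using that by simp
    show ?thesis using step_cases[OF i assms(2)]
    proof cases
      case (2 U)
      then show ?thesis using partition_blocks(6)[OF part[OF i assms(2)] 2(1)] that by simp
    qed (use that in simp)
  qed
  have "(\<Sum>i\<in>{1..<n}. f (s (Suc i) \<omega>)) = (\<Sum>i\<in>{1..<n}. \<Sum>j<n. of_bool (s (Suc i) \<omega> = j) * f j)"
  proof (rule sum.cong[OF refl])
    fix i assume "i \<in> {1..<n}"
    then have lt: "s (Suc i) \<omega> < n" by (rule sb)
    have "(\<Sum>j<n. of_bool (s (Suc i) \<omega> = j) * f j) = (\<Sum>j<n. if j = s (Suc i) \<omega> then f (s (Suc i) \<omega>) else 0)"
      by (intro sum.cong) auto
    also have "\<dots> = f (s (Suc i) \<omega>)" using lt by (subst sum.delta) auto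
    finally show "f (s (Suc i) \<omega>) = (\<Sum>j<n. of_bool (s (Suc i) \<omega> = j) * f j)" ..
  qed
  also have "\<dots> = (\<Sum>j<n. \<Sum>i\<in>{1..<n}. of_bool (s (Suc i) \<omega> = j) * f j)" by (rule sum.swap)
  also have "\<dots> = (\<Sum>j<n. (\<Sum>i\<in>{1..<n}. of_bool (s (Suc i) \<omega> = j)) * f j)" by (simp add: sum_distrib_right)
  finally show ?thesis using c_eq_sum[OF assms] by simp
qed

lemma c_nonneg: "0 \<le> c j n \<omega>" by (simp add: c_def)

lemma c0_eq_card: assumes "1 \<le> n" "\<omega> \<in> space M" shows "c 0 n \<omega> = real (card (\<pi> n \<omega>))"
proof -
  have "{U \<in> \<pi> n \<omega>. 0 < card U} = \<pi> n \<omega>" using partition_blocks(5)[OF part[OF assms]] by force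
  then show ?thesis by (simp add: c_def blocks_larger_def)
qed

lemma c_le_c0: assumes "1 \<le> n" "\<omega> \<in> space M" shows "c j n \<omega> \<le> c 0 n \<omega>"
  unfolding c_def blocks_larger_def of_nat_le_iff
  using partition_blocks(1)[OF part[OF assms]] by (intro card_mono) auto

lemma c0_bounds: assumes "1 \<le> n" "\<omega> \<in> space M" shows "1 \<le> c 0 n \<omega>" "c 0 n \<omega> \<le> real n"
  using partition_blocks(8,9)[OF part[OF assms]] assms unfolding c0_eq_card[OF assms] by auto

text \<open>Conditional expectation, given the partition \<open>P\<close> of \<open>{1..n}\<close>, of
  \<open>h\<close> applied to the size of the block that \<open>Suc n\<close> joins.\<close>
definition step_mean :: "nat \<Rightarrow> nat set set \<Rightarrow> (nat \<Rightarrow> real) \<Rightarrow> real" where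
  "step_mean n P h = p_new n (card P) * h 0 + (\<Sum>U\<in>P. w n (card P) * (real (card U) - \<alpha>) * h (card U))"

lemma finite_parts: "finite {P. partition_on {1..n::nat} P}"
  by (rule finitely_many_partition_on) simp

lemma measurable_pi_fun: "1 \<le> n \<Longrightarrow> (\<lambda>\<omega>. f (\<pi> n \<omega>)) \<in> borel_measurable M" for f :: "nat set set \<Rightarrow> 'b::topological_space"
  by (rule measurable_compose[OF gp.partition_valued]) auto

lemma event_eq: "1 \<le> n \<Longrightarrow> {\<omega> \<in> space M. \<pi> n \<omega> = P} \<in> gp.events"
proof -
  assume n: "1 \<le> n"
  have "(\<lambda>\<omega>. of_bool (\<pi> n \<omega> = P) :: real) \<in> borel_measurable M" by (rule measurable_pi_fun[OF n])
  then have "(\<lambda>\<omega>. of_bool (\<pi> n \<omega> = P) :: real) -` {1} \<inter> space M \<in> gp.events" by (rule measurable_sets) simp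
  moreover have "(\<lambda>\<omega>. of_bool (\<pi> n \<omega> = P) :: real) -` {1} \<inter> space M = {\<omega> \<in> space M. \<pi> n \<omega> = P}" by auto
  ultimately show ?thesis by simp
qed

lemma event_eq2: "1 \<le> n \<Longrightarrow> {\<omega> \<in> space M. \<pi> (Suc n) \<omega> = Q \<and> \<pi> n \<omega> = P} \<in> gp.events"
proof -
  assume n: "1 \<le> n"
  have "{\<omega> \<in> space M. \<pi> (Suc n) \<omega> = Q \<and> \<pi> n \<omega> = P} = {\<omega> \<in> space M. \<pi> (Suc n) \<omega> = Q} \<inter> {\<omega> \<in> space M. \<pi> n \<omega> = P}" by auto
  then show ?thesis using event_eq[of "Suc n" Q] event_eq[OF n, of P] n by auto
qed

lemma bounded_pi_fun: "\<exists>K. \<forall>\<omega>\<in>space M. \<bar>f (\<pi> n \<omega>) :: real\<bar> \<le> K" if "1 \<le> n"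
proof -
  let ?S = "(\<lambda>P. \<bar>f P\<bar>) ` {P. partition_on {1..n} P}"
  have "\<bar>f (\<pi> n \<omega>)\<bar> \<le> Max ?S" if "\<omega> \<in> space M" for \<omega>
    using part[OF \<open>1 \<le> n\<close> that] finite_parts by (intro Max_ge) auto
  then show ?thesis by blast
qed

lemma integrable_pi_fun: assumes "1 \<le> n" shows "integrable M (\<lambda>\<omega>. f (\<pi> n \<omega>) :: real)"
proof -
  obtain K where "\<And>\<omega>. \<omega> \<in> space M \<Longrightarrow> \<bar>f (\<pi> n \<omega>)\<bar> \<le> K" using bounded_pi_fun[OF assms, of f] by blast
  then show ?thesis using measurable_pi_fun[OF assms] by (intro gp.integrable_const_bound[where B=K]) auto
qed

lemma transition:
  assumes n: "1 \<le> n" and P: "partition_on {1..n} P"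
  shows "gp.prob {\<omega> \<in> space M. \<pi> (Suc n) \<omega> = new_block (Suc n) P \<and> \<pi> n \<omega> = P}
      = gp.prob {\<omega> \<in> space M. \<pi> n \<omega> = P} * p_new n (card P)"
    "U \<in> P \<Longrightarrow> gp.prob {\<omega> \<in> space M. \<pi> (Suc n) \<omega> = join_block (Suc n) U P \<and> \<pi> n \<omega> = P}
      = gp.prob {\<omega> \<in> space M. \<pi> n \<omega> = P} * (w n (card P) * (real (card U) - \<alpha>))"
proof -
  let ?p = "gp.prob {\<omega> \<in> space M. \<pi> n \<omega> = P}"
  have z: "gp.prob {\<omega> \<in> space M. \<pi> (Suc n) \<omega> = Q \<and> \<pi> n \<omega> = P} = 0" if "?p = 0" for Q
  proof -
    have "gp.prob {\<omega> \<in> space M. \<pi> (Suc n) \<omega> = Q \<and> \<pi> n \<omega> = P} \<le> ?p"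
      by (rule gp.finite_measure_mono[OF _ event_eq[OF n]]) auto
    then show ?thesis using that measure_nonneg[of M] by (metis order_antisym)
  qed
  have pos: "?p = 0 \<or> 0 < ?p" using measure_nonneg[of M "{\<omega> \<in> space M. \<pi> n \<omega> = P}"] by linarith
  show "gp.prob {\<omega> \<in> space M. \<pi> (Suc n) \<omega> = new_block (Suc n) P \<and> \<pi> n \<omega> = P} = ?p * p_new n (card P)"
    using pos z gp.prob_new[OF n P] by (auto simp: cond_prob_def p_new_def field_simps)
  assume U: "U \<in> P"
  show "gp.prob {\<omega> \<in> space M. \<pi> (Suc n) \<omega> = join_block (Suc n) U P \<and> \<pi> n \<omega> = P} = ?p * (w n (card P) * (real (card U) - \<alpha>))"
    using pos z gp.prob_join[OF n P _ U] by (auto simp: cond_prob_def w_def field_simps)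
qed

lemma step_on_state:
  assumes n: "1 \<le> n" and P: "partition_on {1..n} P"
  shows "(\<integral>\<omega>. of_bool (\<pi> n \<omega> = P) * h (s (Suc n) \<omega>) \<partial>M) = gp.prob {\<omega> \<in> space M. \<pi> n \<omega> = P} * step_mean n P h"
proof -
  let ?E = "\<lambda>Q. {\<omega> \<in> space M. \<pi> (Suc n) \<omega> = Q \<and> \<pi> n \<omega> = P}"
  let ?new = "new_block (Suc n) P" and ?join = "\<lambda>U. join_block (Suc n) U P"
  have fP: "finite P" by (rule partition_blocks(1)[OF P])
  have pt: "of_bool (\<pi> n \<omega> = P) * h (s (Suc n) \<omega>)
      = h 0 * indicator (?E ?new) \<omega> + (\<Sum>U\<in>P. h (card U) * indicator (?E (?join U)) \<omega>)" if \<omega>: "\<omega> \<in> space M" for \<omega>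
  proof (cases "\<pi> n \<omega> = P")
    case False
    then show ?thesis by (simp add: indicator_def)
  next
    case True
    show ?thesis using step_cases[OF n \<omega>]
    proof cases
      case 1
      have "(\<Sum>U\<in>P. h (card U) * indicator (?E (?join U)) \<omega>) = 0"
        using 1(1) join_ne_new[OF P] True by (intro sum.neutral) (auto simp: indicator_def)
      then show ?thesis using 1 True \<omega> by (simp add: indicator_def)
    next
      case (2 U)
      then have U: "U \<in> P" using True by simp
      have "(\<Sum>V\<in>P. h (card V) * indicator (?E (?join V)) \<omega>) = (\<Sum>V\<in>P. if V = U then h (card U) else 0)"
        using 2 join_inj[OF P _ U] True \<omega> by (intro sum.cong) (auto simp: indicator_def)
      also have "\<dots> = h (card U)" using fP U by simp
      finally show ?thesis using 2 True join_ne_new[OF P U] by (simp add: indicator_def)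
    qed
  qed
  have ii: "integrable M (\<lambda>\<omega>. x * indicator (?E Q) \<omega>)" for x :: real and Q
    using event_eq2[OF n] by (intro integrable_mult_right gp.integrable_const_bound[where B=1]) (auto simp: indicator_def)
  have "(\<integral>\<omega>. of_bool (\<pi> n \<omega> = P) * h (s (Suc n) \<omega>) \<partial>M)
     = (\<integral>\<omega>. h 0 * indicator (?E ?new) \<omega> + (\<Sum>U\<in>P. h (card U) * indicator (?E (?join U)) \<omega>) \<partial>M)"
    by (rule Bochner_Integration.integral_cong[OF refl pt])
  also have "\<dots> = h 0 * gp.prob (?E ?new) + (\<Sum>U\<in>P. h (card U) * gp.prob (?E (?join U)))"
    using ii event_eq2[OF n] by (subst Bochner_Integration.integral_add) (auto simp: Bochner_Integration.integral_sum)
  also have "\<dots> = gp.prob {\<omega> \<in> space M. \<pi> n \<omega> = P} * step_mean n P h"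
    unfolding step_mean_def distrib_left sum_distrib_left transition(1)[OF n P]
    by (intro arg_cong2[where f="(+)"] sum.cong) (auto simp: transition(2)[OF n P])
  finally show ?thesis .
qed

text \<open>The conditional distribution of the next step, in integrated form. The state space at time
  \<open>n\<close> is finite, so the identity follows by summing over the states.\<close>
lemma step_expectation:
  assumes n: "1 \<le> n"
  shows "(\<integral>\<omega>. H (\<pi> n \<omega>) (s (Suc n) \<omega>) \<partial>M) = (\<integral>\<omega>. step_mean n (\<pi> n \<omega>) (H (\<pi> n \<omega>)) \<partial>M)"
proof -
  let ?S = "{P. partition_on {1..n} P}"
  let ?s = "last_size (Suc n)"
  have split: "x (\<pi> n \<omega>) = (\<Sum>P\<in>?S. of_bool (\<pi> n \<omega> = P) * x P)" if "\<omega> \<in> space M" for x :: "nat set set \<Rightarrow> real" and \<omega>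
  proof -
    have "(\<Sum>P\<in>?S. of_bool (\<pi> n \<omega> = P) * x P) = (\<Sum>P\<in>?S. if P = \<pi> n \<omega> then x (\<pi> n \<omega>) else 0)"
      by (intro sum.cong) auto
    also have "\<dots> = x (\<pi> n \<omega>)" using part[OF n that] finite_parts[of n] by (subst sum.delta) auto
    finally show ?thesis ..
  qed
  have i1: "integrable M (\<lambda>\<omega>. of_bool (\<pi> n \<omega> = P) * h (s (Suc n) \<omega>))" for P and h :: "nat \<Rightarrow> real"
  proof -
    have i: "integrable M (\<lambda>\<omega>. h (s (Suc n) \<omega>))" unfolding s_def
      by (rule integrable_pi_fun[where f="\<lambda>P. h (?s P)"]) simp
    have "integrable M (\<lambda>\<omega>. indicator {\<omega> \<in> space M. \<pi> n \<omega> = P} \<omega> *\<^sub>R h (s (Suc n) \<omega>))"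
      by (rule integrable_mult_indicator[OF event_eq[OF n] i])
    then show ?thesis by (rule Bochner_Integration.integrable_cong[THEN iffD1, rotated 2]) (auto simp: indicator_def)
  qed
  have "(\<integral>\<omega>. H (\<pi> n \<omega>) (s (Suc n) \<omega>) \<partial>M) = (\<integral>\<omega>. (\<Sum>P\<in>?S. of_bool (\<pi> n \<omega> = P) * H P (s (Suc n) \<omega>)) \<partial>M)"
  proof (rule Bochner_Integration.integral_cong[OF refl])
    fix \<omega> assume "\<omega> \<in> space M"
    then show "H (\<pi> n \<omega>) (s (Suc n) \<omega>) = (\<Sum>P\<in>?S. of_bool (\<pi> n \<omega> = P) * H P (s (Suc n) \<omega>))"
      by (rule split[of _ "\<lambda>P. H P (s (Suc n) \<omega>)"])
  qed
  also have "\<dots> = (\<Sum>P\<in>?S. (\<integral>\<omega>. of_bool (\<pi> n \<omega> = P) * H P (s (Suc n) \<omega>) \<partial>M))"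
    by (rule Bochner_Integration.integral_sum[OF i1])
  also have "\<dots> = (\<Sum>P\<in>?S. gp.prob {\<omega> \<in> space M. \<pi> n \<omega> = P} * step_mean n P (H P))"
    by (intro sum.cong[OF refl] step_on_state n) simp
  also have "\<dots> = (\<Sum>P\<in>?S. (\<integral>\<omega>. step_mean n P (H P) * indicator {\<omega> \<in> space M. \<pi> n \<omega> = P} \<omega> \<partial>M))"
    using event_eq[OF n] by (simp add: mult.commute)
  also have "\<dots> = (\<integral>\<omega>. (\<Sum>P\<in>?S. step_mean n P (H P) * indicator {\<omega> \<in> space M. \<pi> n \<omega> = P} \<omega>) \<partial>M)"
    using event_eq[OF n] by (intro Bochner_Integration.integral_sum[symmetric] integrable_mult_right gp.integrable_const_bound[where B=1]) (auto simp: indicator_def)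
  also have "\<dots> = (\<integral>\<omega>. step_mean n (\<pi> n \<omega>) (H (\<pi> n \<omega>)) \<partial>M)"
  proof (rule Bochner_Integration.integral_cong[OF refl])
    fix \<omega> assume \<omega>: "\<omega> \<in> space M"
    show "(\<Sum>P\<in>?S. step_mean n P (H P) * indicator {\<omega> \<in> space M. \<pi> n \<omega> = P} \<omega>) = step_mean n (\<pi> n \<omega>) (H (\<pi> n \<omega>))"
      unfolding split[OF \<omega>, of "\<lambda>P. step_mean n P (H P)"] using \<omega> by (intro sum.cong) (auto simp: indicator_def)
  qed
  finally show ?thesis .
qed

end


section \<open>Martingale differences of functionals of the joined block\<close>

context bounded_gibbs
begin

abbreviation F :: "nat \<Rightarrow> 'a measure" where "F \<equiv> partition_field M \<pi>"
abbreviation G :: "'a measure" where "G \<equiv> partition_field_inf M \<pi>"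

lemma space_F: "space (F n) = space M" by (simp add: partition_field_def)

lemma sets_F: "sets (F n) = {\<pi> n -` A \<inter> space M | A. True}"
  by (simp add: partition_field_def sets_vimage_algebra2)

lemma measurable_F_pi_fun: "(\<lambda>\<omega>. f (\<pi> n \<omega>)) \<in> borel_measurable (F n)" for f :: "nat set set \<Rightarrow> 'b::topological_space"
  unfolding partition_field_def
  by (rule measurable_compose[OF measurable_vimage_algebra1]) auto

text \<open>A set of \<open>F n\<close> is a preimage under \<open>\<pi> n\<close>, so an \<open>F
  n\<close>-measurable function is constant on the level sets of the partition.\<close>
lemma F_factor:
  fixes W :: "'a \<Rightarrow> real"
  assumes "W \<in> borel_measurable (F n)"
  obtains \<phi> where "\<And>\<omega>. \<omega> \<in> space M \<Longrightarrow> W \<omega> = \<phi> (\<pi> n \<omega>)"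
proof -
  have eq: "W \<omega> = W \<omega>'" if "\<omega> \<in> space M" "\<omega>' \<in> space M" "\<pi> n \<omega> = \<pi> n \<omega>'" for \<omega> \<omega>'
  proof -
    have "W -` {W \<omega>} \<inter> space (F n) \<in> sets (F n)" using assms by (rule measurable_sets) simp
    then obtain A where "W -` {W \<omega>} \<inter> space M = \<pi> n -` A \<inter> space M" unfolding sets_F space_F by auto
    then have "\<omega>' \<in> W -` {W \<omega>}" using that by (metis IntE IntI vimageI vimage_eq insertI1)
    then show ?thesis by simp
  qed
  show ?thesis
  proof (rule that[of "\<lambda>P. W (SOME \<omega>. \<omega> \<in> space M \<and> \<pi> n \<omega> = P)"])
    fix \<omega> assume \<omega>: "\<omega> \<in> space M"
    then have "(SOME \<omega>'. \<omega>' \<in> space M \<and> \<pi> n \<omega>' = \<pi> n \<omega>) \<in> space M \<and> \<pi> n (SOME \<omega>'. \<omega>' \<in> space M \<and> \<pi> n \<omega>' = \<pi> n \<omega>) = \<pi> n \<omega>"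
      by (intro someI[of "\<lambda>\<omega>'. \<omega>' \<in> space M \<and> \<pi> n \<omega>' = \<pi> n \<omega>"]) simp
    then show "W \<omega> = W (SOME \<omega>'. \<omega>' \<in> space M \<and> \<pi> n \<omega>' = \<pi> n \<omega>)"
      by (intro eq[OF \<omega>]) auto
  qed
qed

lemma subalgebra_F: "1 \<le> n \<Longrightarrow> subalgebra M (F n)"
proof -
  assume n: "1 \<le> n"
  have "\<pi> n -` A \<inter> space M \<in> gp.events" for A
  proof -
    have "(\<lambda>\<omega>. of_bool (\<pi> n \<omega> \<in> A) :: real) -` {1} \<inter> space M \<in> gp.events"
      by (rule measurable_sets[OF measurable_pi_fun[OF n]]) simp
    moreover have "(\<lambda>\<omega>. of_bool (\<pi> n \<omega> \<in> A) :: real) -` {1} \<inter> space M = \<pi> n -` A \<inter> space M" by auto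
    ultimately show ?thesis by simp
  qed
  then show ?thesis by (auto simp: subalgebra_def space_F sets_F)
qed

text \<open>The partition at an earlier time is the trace of the later one; this is what makes the
  fields generated by single partitions a filtration.\<close>
lemma restrict_pi:
  assumes n: "1 \<le> n" and \<omega>: "\<omega> \<in> space M"
  shows "\<pi> n \<omega> = (\<lambda>U. U - {Suc n}) ` \<pi> (Suc n) \<omega> - {{}}"
proof -
  note P = part[OF assms]
  have id: "U - {Suc n} = U" if "U \<in> \<pi> n \<omega>" for U using not_in_block[OF P that] by blast
  have ne: "{} \<notin> \<pi> n \<omega>" using partition_onD3[OF P] .
  show ?thesis using step_cases[OF n \<omega>]
  proof cases
    case 1
    have "(\<lambda>U. U - {Suc n}) ` \<pi> n \<omega> = \<pi> n \<omega>" using id by (metis (no_types, lifting) image_cong image_ident)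
    then show ?thesis using ne unfolding 1(1) new_block_def by auto
  next
    case (2 U)
    have "(\<lambda>U. U - {Suc n}) ` (\<pi> n \<omega> - {U}) = (\<lambda>U. U) ` (\<pi> n \<omega> - {U})"
      by (intro image_cong refl id) simp
    then have a: "(\<lambda>U. U - {Suc n}) ` (\<pi> n \<omega> - {U}) = \<pi> n \<omega> - {U}" by simp
    have b: "insert (Suc n) U - {Suc n} = U" using id[OF 2(1)] by auto
    show ?thesis using ne 2(1) unfolding 2(2) join_block_def image_insert a b by auto
  qed
qed

lemma F_mono: assumes "1 \<le> m" "m \<le> n" shows "subalgebra (F n) (F m)"
  using assms(2)
proof (induction n rule: dec_induct)
  case base
  show ?case by (simp add: subalgebra_def)
next
  case (step n)
  then have n: "1 \<le> n" using assms(1) by simp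
  have "sets (F n) \<subseteq> sets (F (Suc n))"
  proof
    fix B assume "B \<in> sets (F n)"
    then obtain A where B: "B = \<pi> n -` A \<inter> space M" unfolding sets_F by blast
    have "B = \<pi> (Suc n) -` {Q. (\<lambda>U. U - {Suc n}) ` Q - {{}} \<in> A} \<inter> space M"
      unfolding B using restrict_pi[OF n] by auto
    then show "B \<in> sets (F (Suc n))" unfolding sets_F by blast
  qed
  then show ?case using step.IH by (auto simp: subalgebra_def space_F)
qed

lemma sets_G: "sets G = sigma_sets (space M) (\<Union>n\<in>{1..}. sets (F n))"
  unfolding partition_field_inf_def
  by (rule sets_measure_of) (auto simp: sets_F)

lemma space_G: "space G = space M"
  unfolding partition_field_inf_def by (rule space_measure_of) (auto simp: sets_F)

lemma subalgebra_G: "subalgebra M G"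
proof -
  have "(\<Union>n\<in>{1..}. sets (F n)) \<subseteq> gp.events" using subalgebra_F by (auto simp: subalgebra_def)
  then have "sigma_sets (space M) (\<Union>n\<in>{1..}. sets (F n)) \<subseteq> gp.events" by (rule sets.sigma_sets_subset)
  then show ?thesis by (simp add: subalgebra_def space_G sets_G)
qed

lemma F_sub_G: "1 \<le> n \<Longrightarrow> subalgebra G (F n)"
  unfolding subalgebra_def space_F space_G sets_G by (auto intro: sigma_sets.Basic)

lemma measurable_G_pi_fun: "1 \<le> n \<Longrightarrow> (\<lambda>\<omega>. f (\<pi> n \<omega>)) \<in> borel_measurable G" for f :: "nat set set \<Rightarrow> 'b::topological_space"
  by (rule measurable_from_subalg[OF F_sub_G measurable_F_pi_fun])

lemma sum_block_excess: assumes "partition_on {1..n} P" shows "(\<Sum>U\<in>P. real (card U) - \<alpha>) = real n - real (card P) * \<alpha>"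
proof -
  have "(\<Sum>U\<in>P. real (card U)) = real n" using partition_blocks(7)[OF assms] by (metis of_nat_sum)
  then show ?thesis by (simp add: sum_subtractf)
qed

lemma cond_const: assumes "1 \<le> n" "partition_on {1..n} P" shows "step_mean n P (\<lambda>_. x) = x"
proof -
  have "(\<Sum>U\<in>P. w n (card P) * (real (card U) - \<alpha>) * x) = w n (card P) * x * (\<Sum>U\<in>P. real (card U) - \<alpha>)"
    unfolding sum_distrib_left by (intro sum.cong) auto
  then have sm: "(\<Sum>U\<in>P. w n (card P) * (real (card U) - \<alpha>) * x) = w n (card P) * x * (real n - real (card P) * \<alpha>)"
    unfolding sum_block_excess[OF assms(2)] .
  show ?thesis unfolding step_mean_def sm p_new_eq[OF assms(1) partition_blocks(9)[OF assms(2,1)]]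
    by (simp add: algebra_simps)
qed

lemma cond_add: "step_mean n P (\<lambda>j. f j + g j) = step_mean n P f + step_mean n P g"
  unfolding step_mean_def by (simp add: distrib_left sum.distrib)

lemma cond_mult: "step_mean n P (\<lambda>j. x * f j) = x * step_mean n P f"
  unfolding step_mean_def by (simp add: distrib_left sum_distrib_left ac_simps)

lemma block_prob_nonneg:
  assumes "1 \<le> n" "partition_on {1..n} P" "U \<in> P" shows "0 \<le> w n (card P) * (real (card U) - \<alpha>)"
  using w_pos[OF assms(1)] partition_blocks(5)[OF assms(2,3)] \<alpha>
  by (intro mult_nonneg_nonneg) (auto simp: less_imp_le)

lemma cond_mono:
  assumes "1 \<le> n" "partition_on {1..n} P" "\<And>j. f j \<le> g j"
  shows "step_mean n P f \<le> step_mean n P g"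
  unfolding step_mean_def using p_new_bounds(2)[OF assms(1) partition_blocks(9)[OF assms(2,1)] partition_blocks(8)[OF assms(2)]]
  by (intro add_mono mult_left_mono sum_mono assms(3) block_prob_nonneg[OF assms(1,2)]) auto

lemma cond_abs_le:
  assumes "1 \<le> n" "partition_on {1..n} P" "\<And>j. \<bar>f j\<bar> \<le> K"
  shows "\<bar>step_mean n P f\<bar> \<le> K"
proof -
  have "step_mean n P f \<le> step_mean n P (\<lambda>_. K)" "step_mean n P (\<lambda>_. - K) \<le> step_mean n P f"
    using assms(3) by (auto intro!: cond_mono[OF assms(1,2)] simp: abs_le_iff minus_le_iff)
  then show ?thesis unfolding cond_const[OF assms(1,2)] by linarith
qed

lemma cond_variance:
  assumes "1 \<le> n" "partition_on {1..n} P"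
  shows "step_mean n P (\<lambda>j. (f j - step_mean n P f)\<^sup>2) = step_mean n P (\<lambda>j. (f j)\<^sup>2) - (step_mean n P f)\<^sup>2"
proof -
  let ?b = "step_mean n P f"
  have "(\<lambda>j. (f j - ?b)\<^sup>2) = (\<lambda>j. (f j)\<^sup>2 + ((- 2 * ?b) * f j + ?b\<^sup>2))"
    by (auto simp: fun_eq_iff power2_eq_square algebra_simps)
  then show ?thesis
    by (simp only: cond_add cond_mult cond_const[OF assms]) (simp add: power2_eq_square)
qed

definition mdiff :: "(nat \<Rightarrow> real) \<Rightarrow> nat \<Rightarrow> 'a \<Rightarrow> real" where
  "mdiff \<delta> n \<omega> = \<delta> (s n \<omega>) - step_mean (n - 1) (\<pi> (n - 1) \<omega>) \<delta>"
definition mvar :: "(nat \<Rightarrow> real) \<Rightarrow> nat \<Rightarrow> 'a \<Rightarrow> real" where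
  "mvar \<delta> n \<omega> = step_mean n (\<pi> n \<omega>) (\<lambda>j. (\<delta> j - step_mean n (\<pi> n \<omega>) \<delta>)\<^sup>2)"

lemma martingale_differences:
  assumes \<delta>: "\<And>j. \<bar>\<delta> j\<bar> \<le> K"
  shows "bounded_martingale_differences M F (mdiff \<delta>) (mvar \<delta>) (2 * K)"
proof -
  have K: "0 \<le> K" using \<delta>[of 0] by linarith
  have diff: "(\<delta> j - step_mean n P \<delta>)\<^sup>2 \<le> (2 * K)\<^sup>2" "\<bar>\<delta> j - step_mean n P \<delta>\<bar> \<le> 2 * K" if "1 \<le> n" "partition_on {1..n} P" for n P j
  proof -
    show 1: "\<bar>\<delta> j - step_mean n P \<delta>\<bar> \<le> 2 * K" using \<delta>[of j] cond_abs_le[OF that, where f=\<delta>, OF \<delta>] by linarith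
    show "(\<delta> j - step_mean n P \<delta>)\<^sup>2 \<le> (2 * K)\<^sup>2" using power_mono[OF 1, of 2] by simp
  qed
  show ?thesis
  proof
    fix n :: nat assume n: "1 \<le> n"
    show "subalgebra M (F n)" by (rule subalgebra_F[OF n])
    have "(\<lambda>\<omega>. \<delta> (s (Suc n) \<omega>)) \<in> borel_measurable (F (Suc n))"
      unfolding s_def by (rule measurable_F_pi_fun)
    moreover have "(\<lambda>\<omega>. step_mean n (\<pi> n \<omega>) \<delta>) \<in> borel_measurable (F (Suc n))"
      using n by (intro measurable_from_subalg[OF F_mono measurable_F_pi_fun]) auto
    ultimately show "mdiff \<delta> (Suc n) \<in> borel_measurable (F (Suc n))"
      unfolding mdiff_def diff_Suc_1 by (rule borel_measurable_diff)
    show "mvar \<delta> n \<in> borel_measurable (F n)" unfolding mvar_def by (rule measurable_F_pi_fun)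
    fix W :: "'a \<Rightarrow> real" and B assume W: "W \<in> borel_measurable (F n)" and "\<And>\<omega>. \<omega> \<in> space M \<Longrightarrow> \<bar>W \<omega>\<bar> \<le> B"
    obtain \<phi> where \<phi>: "\<And>\<omega>. \<omega> \<in> space M \<Longrightarrow> W \<omega> = \<phi> (\<pi> n \<omega>)" using F_factor[OF W] by blast
    have "(\<integral>\<omega>. W \<omega> * mdiff \<delta> (Suc n) \<omega> \<partial>M) = (\<integral>\<omega>. \<phi> (\<pi> n \<omega>) * (\<delta> (s (Suc n) \<omega>) - step_mean n (\<pi> n \<omega>) \<delta>) \<partial>M)"
      by (rule Bochner_Integration.integral_cong) (auto simp: \<phi> mdiff_def)
    also have "\<dots> = (\<integral>\<omega>. step_mean n (\<pi> n \<omega>) (\<lambda>j. \<phi> (\<pi> n \<omega>) * (\<delta> j - step_mean n (\<pi> n \<omega>) \<delta>)) \<partial>M)"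
      by (rule step_expectation[OF n, where H="\<lambda>P j. \<phi> P * (\<delta> j - step_mean n P \<delta>)"])
    also have "\<dots> = (\<integral>\<omega>. 0 \<partial>M)"
    proof (rule Bochner_Integration.integral_cong[OF refl])
      fix \<omega> assume "\<omega> \<in> space M"
      note P = part[OF n this]
      show "step_mean n (\<pi> n \<omega>) (\<lambda>j. \<phi> (\<pi> n \<omega>) * (\<delta> j - step_mean n (\<pi> n \<omega>) \<delta>)) = 0"
        using cond_add[of n "\<pi> n \<omega>" \<delta> "\<lambda>_. - step_mean n (\<pi> n \<omega>) \<delta>"] unfolding cond_mult cond_const[OF n P] by simp
    qed
    finally show "(\<integral>\<omega>. W \<omega> * mdiff \<delta> (Suc n) \<omega> \<partial>M) = 0" by simp
    have "(\<integral>\<omega>. W \<omega> * (mdiff \<delta> (Suc n) \<omega>)\<^sup>2 \<partial>M) = (\<integral>\<omega>. \<phi> (\<pi> n \<omega>) * (\<delta> (s (Suc n) \<omega>) - step_mean n (\<pi> n \<omega>) \<delta>)\<^sup>2 \<partial>M)"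
      by (rule Bochner_Integration.integral_cong) (auto simp: \<phi> mdiff_def)
    also have "\<dots> = (\<integral>\<omega>. step_mean n (\<pi> n \<omega>) (\<lambda>j. \<phi> (\<pi> n \<omega>) * (\<delta> j - step_mean n (\<pi> n \<omega>) \<delta>)\<^sup>2) \<partial>M)"
      by (rule step_expectation[OF n, where H="\<lambda>P j. \<phi> P * (\<delta> j - step_mean n P \<delta>)\<^sup>2"])
    also have "\<dots> = (\<integral>\<omega>. W \<omega> * mvar \<delta> n \<omega> \<partial>M)"
      by (rule Bochner_Integration.integral_cong[OF refl]) (simp add: cond_mult \<phi> mvar_def)
    finally show "(\<integral>\<omega>. W \<omega> * (mdiff \<delta> (Suc n) \<omega>)\<^sup>2 \<partial>M) = (\<integral>\<omega>. W \<omega> * mvar \<delta> n \<omega> \<partial>M)" .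
  next
    fix m n :: nat assume "1 \<le> m" "m \<le> n"
    then show "subalgebra (F n) (F m)" by (rule F_mono)
  next
    fix n :: nat and \<omega> assume n: "1 \<le> n" and \<omega>: "\<omega> \<in> space M"
    note P = part[OF n \<omega>]
    show "\<bar>mdiff \<delta> (Suc n) \<omega>\<bar> \<le> 2 * K" unfolding mdiff_def diff_Suc_1 by (rule diff(2)[OF n P])
    have "step_mean n (\<pi> n \<omega>) (\<lambda>_. 0) \<le> mvar \<delta> n \<omega>" unfolding mvar_def by (rule cond_mono[OF n P]) simp
    then show "0 \<le> mvar \<delta> n \<omega>" unfolding cond_const[OF n P] .
    have "mvar \<delta> n \<omega> \<le> step_mean n (\<pi> n \<omega>) (\<lambda>_. (2 * K)\<^sup>2)" unfolding mvar_def by (rule cond_mono[OF n P diff(1)[OF n P]])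
    then show "mvar \<delta> n \<omega> \<le> (2 * K)\<^sup>2" unfolding cond_const[OF n P] .
  qed
qed

lemma w_le: assumes "1 \<le> n" shows "w n k \<le> (1 + weight_error) / real n"
proof -
  have "w n k \<le> 1 / real n + weight_error / (real n)\<^sup>2" using w_near[OF assms, of k] by linarith
  also have "weight_error / (real n)\<^sup>2 \<le> weight_error / real n"
    using assms weight_error_nonneg by (intro divide_left_mono) (auto simp: power2_eq_square)
  finally show ?thesis by (simp add: add_divide_distrib)
qed

text \<open>The probability of joining a given block of size \<open>j\<close> is proportional to
  \<open>j - \<alpha>\<close>. If \<open>(\<delta> j)\<^sup>2\<close> compensates this factor,
  only the number of blocks remains, and the conditional variance is \<open>O(c 0 n /
  n)\<close>.\<close>
lemma mvar_le:
  assumes n: "1 \<le> n" and \<omega>: "\<omega> \<in> space M" and K: "(\<delta> 0)\<^sup>2 \<le> K" "\<And>j. 1 \<le> j \<Longrightarrow> (\<delta> j)\<^sup>2 * (real j - \<alpha>) \<le> K"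
  shows "step_mean n (\<pi> n \<omega>) (\<lambda>j. (\<delta> j)\<^sup>2) \<le> K * (2 + 2 * weight_error) * (c 0 n \<omega> / real n)" "mvar \<delta> n \<omega> \<le> K * (2 + 2 * weight_error) * (c 0 n \<omega> / real n)"
proof -
  let ?P = "\<pi> n \<omega>"
  note P = part[OF n \<omega>]
  let ?k = "card ?P"
  have k: "1 \<le> ?k" "?k \<le> n" using partition_blocks(8,9)[OF P] n by auto
  have K0: "0 \<le> K" using K(1) zero_le_power2 order_trans by blast
  have n0: "0 < real n" using n by simp
  have p: "p_new n ?k \<le> (1 + weight_error) * (real ?k / real n)"
  proof -
    have "p_new n ?k \<le> real ?k * \<alpha> / real n + weight_error / real n" using p_new_bounds(3)[OF n k] by linarith
    also have "\<dots> = (real ?k * \<alpha> + weight_error) / real n" by (simp add: add_divide_distrib)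
    also have "\<dots> \<le> ((1 + weight_error) * real ?k) / real n"
    proof (intro divide_right_mono)
      have "real ?k * \<alpha> \<le> real ?k" using \<alpha> by (simp add: mult_left_le)
      moreover have "weight_error * 1 \<le> weight_error * real ?k" using k(1) weight_error_nonneg by (intro mult_left_mono) auto
      ultimately show "real ?k * \<alpha> + weight_error \<le> (1 + weight_error) * real ?k" by (simp add: distrib_right)
    qed (use n0 in simp)
    finally show ?thesis by simp
  qed
  have p0: "0 \<le> p_new n ?k" using p_new_bounds(2)[OF n k] by simp
  have "(\<Sum>U\<in>?P. w n ?k * (real (card U) - \<alpha>) * (\<delta> (card U))\<^sup>2) \<le> (\<Sum>U\<in>?P. (1 + weight_error) / real n * K)"
  proof (rule sum_mono)
    fix U assume U: "U \<in> ?P"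
    have "w n ?k * ((\<delta> (card U))\<^sup>2 * (real (card U) - \<alpha>)) \<le> (1 + weight_error) / real n * K"
      using w_le[OF n, of ?k] w_pos[OF n, of ?k] K(2)[OF partition_blocks(5)[OF P U]] partition_blocks(5)[OF P U] \<alpha> weight_error_nonneg
      by (intro mult_mono mult_nonneg_nonneg) auto
    then show "w n ?k * (real (card U) - \<alpha>) * (\<delta> (card U))\<^sup>2 \<le> (1 + weight_error) / real n * K" by (simp add: ac_simps)
  qed
  moreover have "p_new n ?k * (\<delta> 0)\<^sup>2 \<le> (1 + weight_error) * (real ?k / real n) * K"
    using p p0 K(1) weight_error_nonneg by (intro mult_mono) auto
  ultimately have "step_mean n ?P (\<lambda>j. (\<delta> j)\<^sup>2) \<le> (1 + weight_error) * (real ?k / real n) * K + real ?k * ((1 + weight_error) / real n * K)"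
    unfolding step_mean_def sum_constant by linarith
  also have "\<dots> = K * (2 + 2 * weight_error) * (c 0 n \<omega> / real n)" unfolding c0_eq_card[OF n \<omega>] by (simp add: algebra_simps add_divide_distrib)
  finally show 1: "step_mean n ?P (\<lambda>j. (\<delta> j)\<^sup>2) \<le> K * (2 + 2 * weight_error) * (c 0 n \<omega> / real n)" .
  have "mvar \<delta> n \<omega> \<le> step_mean n ?P (\<lambda>j. (\<delta> j)\<^sup>2)" unfolding mvar_def cond_variance[OF n P] by simp
  with 1 show "mvar \<delta> n \<omega> \<le> K * (2 + 2 * weight_error) * (c 0 n \<omega> / real n)" by linarith
qed

lemma integrable_c: "1 \<le> n \<Longrightarrow> integrable M (c j n)"
  unfolding c_def by (rule integrable_pi_fun)

end


section \<open>Growth of the number of blocks and of compensated sums\<close>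

lemma sum_inverse_upper: "1 \<le> n \<Longrightarrow> (\<Sum>i\<in>{1..<n}. 1 / real i) \<le> 1 + ln (real n)"
proof -
  have H: "(\<Sum>i\<in>{1..<Suc n}. 1 / real i) \<le> 1 + ln (real n)" if "1 \<le> n" for n
    using that
  proof (induction n rule: nat_induct_at_least)
    case (Suc n)
    have "ln (real n / real (Suc n)) \<le> real n / real (Suc n) - 1" using Suc(1) by (intro ln_le_minus_one) auto
    then have "1 / real (Suc n) \<le> ln (real (Suc n)) - ln (real n)" using Suc(1) by (simp add: ln_div field_simps)
    then show ?case using Suc by (simp add: sum.atLeastLessThan_Suc)
  qed simp
  assume "1 \<le> n"
  have "(\<Sum>i\<in>{1..<n}. 1 / real i) \<le> (\<Sum>i\<in>{1..<Suc n}. 1 / real i)" by (intro sum_mono2) auto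
  then show ?thesis using H[OF \<open>1 \<le> n\<close>] by linarith
qed

lemma sum_inverse_lower: "1 \<le> n \<Longrightarrow> ln (real n) \<le> (\<Sum>i\<in>{1..<n}. 1 / real i)"
proof (induction n rule: nat_induct_at_least)
  case (Suc n)
  have "ln (real (Suc n) / real n) \<le> real (Suc n) / real n - 1" using Suc(1) by (intro ln_le_minus_one) auto
  then have "ln (real (Suc n)) - ln (real n) \<le> 1 / real n" using Suc(1) by (simp add: ln_div field_simps)
  then show ?case using Suc by (simp add: sum.atLeastLessThan_Suc)
qed simp

lemma sum_powr_tail:
  fixes a :: real assumes a: "0 < a" and m: "1 \<le> m"
  shows "(\<Sum>i\<in>{m..<n}. real i powr (- 1 - a)) \<le> 2 powr (1 + a) / a * real m powr (- a)"
proof -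
  let ?T = "2 powr (1 + a) / a"
  have T: "0 \<le> ?T" using a by simp
  have step: "real i powr (- 1 - a) \<le> ?T * (real i powr (- a) - real (Suc i) powr (- a))" if i: "1 \<le> i" for i
  proof -
    define x where "x = real i"
    have x: "1 \<le> x" using i by (simp add: x_def)
    define u where "u = 1 / (x + 1)"
    have u: "0 < u" "u < 1" "1 - u = x / (x + 1)" using x by (auto simp: u_def field_simps)
    have "1 + a * u \<le> exp (a * u)" by (rule exp_ge_add_one_self)
    also have "exp (a * u) \<le> exp (- a * ln (1 - u))"
      using u a ln_le_minus_one[of "1 - u"] mult_left_mono[of u "- ln (1 - u)" a] by simp
    also have "\<dots> = (x / (x + 1)) powr (- a)" using u x unfolding powr_def by simp
    also have "\<dots> = x powr (- a) / (x + 1) powr (- a)" using x by (simp add: powr_divide)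
    finally have "(1 + a * u) * (x + 1) powr (- a) \<le> x powr (- a)" using x by (simp add: field_simps)
    then have 1: "a * (u * (x + 1) powr (- a)) \<le> x powr (- a) - (x + 1) powr (- a)" by (simp add: algebra_simps)
    have 2: "u * (x + 1) powr (- a) = (x + 1) powr (- 1 - a)"
      using x by (simp add: u_def powr_diff powr_minus_divide)
    have "(2 * x) powr (- 1 - a) \<le> (x + 1) powr (- 1 - a)" using x a by (intro powr_mono2') auto
    then have "2 powr (- 1 - a) * x powr (- 1 - a) \<le> (x + 1) powr (- 1 - a)" using x by (simp add: powr_mult)
    then have "2 powr (1 + a) * (2 powr (- 1 - a) * x powr (- 1 - a)) \<le> 2 powr (1 + a) * (x + 1) powr (- 1 - a)"
      by (intro mult_left_mono) auto
    moreover have "2 powr (1 + a) * (2 powr (- 1 - a) * x powr (- 1 - a)) = x powr (- 1 - a)"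
      by (simp only: mult.assoc[symmetric] powr_add[symmetric]) simp
    ultimately have 3: "x powr (- 1 - a) \<le> 2 powr (1 + a) * (x + 1) powr (- 1 - a)" by simp
    have "2 powr (1 + a) * (x + 1) powr (- 1 - a) = ?T * (a * (u * (x + 1) powr (- a)))"
      unfolding 2 using a by simp
    also have "\<dots> \<le> ?T * (x powr (- a) - (x + 1) powr (- a))" by (rule mult_left_mono[OF 1 T])
    finally show ?thesis using 3 by (simp add: x_def add.commute)
  qed
  have "(\<Sum>i\<in>{m..<n}. real i powr (- 1 - a)) \<le> (\<Sum>i\<in>{m..<n}. ?T * (real i powr (- a) - real (Suc i) powr (- a)))"
    using m by (intro sum_mono step) auto
  also have "\<dots> = ?T * (\<Sum>i\<in>{m..<n}. real i powr (- a) - real (Suc i) powr (- a))" by (simp add: sum_distrib_left)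
  also have "\<dots> \<le> ?T * real m powr (- a)"
  proof (rule mult_left_mono[OF _ T])
    show "(\<Sum>i\<in>{m..<n}. real i powr (- a) - real (Suc i) powr (- a)) \<le> real m powr (- a)"
    proof (cases "m \<le> n")
      case True
      then have "(\<Sum>i\<in>{m..<n}. real i powr (- a) - real (Suc i) powr (- a)) = real m powr (- a) - real n powr (- a)"
        by (induction n rule: dec_induct) auto
      then show ?thesis by simp
    qed simp
  qed
  finally show ?thesis .
qed

lemma powr_near_linear:
  fixes a x :: real assumes a: "0 < a" "a < 1" and x: "0 \<le> x" "x \<le> 1"
  shows "\<bar>1 + a * x - (1 + x) powr a\<bar> \<le> a * x\<^sup>2"
proof -
  have "(1 + x) powr a * 1 powr (1 - a) \<le> a * (1 + x) + (1 - a) * 1"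
    using a x by (intro Youngs_inequality_0) auto
  then have up: "(1 + x) powr a \<le> 1 + a * x" by (simp add: algebra_simps)
  have "1 + a * ln (1 + x) \<le> exp (a * ln (1 + x))" by (rule exp_ge_add_one_self)
  moreover have "x - x\<^sup>2 \<le> ln (1 + x)" using x by (rule ln_one_plus_pos_lower_bound)
  then have "a * (x - x\<^sup>2) \<le> a * ln (1 + x)" using a by (intro mult_left_mono) auto
  moreover have "(1 + x) powr a = exp (a * ln (1 + x))" using x by (simp add: powr_def)
  moreover have "a * (x - x\<^sup>2) = a * x - a * x\<^sup>2" by (simp add: algebra_simps)
  ultimately have "1 + a * x - a * x\<^sup>2 \<le> (1 + x) powr a" by linarith
  then show ?thesis using up by simp
qed

lemma (in prob_space) L1_le_sqrt_L2:
  assumes [measurable]: "X \<in> borel_measurable M" and i: "integrable M (\<lambda>\<omega>. (X \<omega> :: real)\<^sup>2)"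
  shows "(\<integral>\<omega>. \<bar>X \<omega>\<bar> \<partial>M) \<le> sqrt (\<integral>\<omega>. (X \<omega>)\<^sup>2 \<partial>M)"
proof -
  have iX: "integrable M (\<lambda>\<omega>. \<bar>X \<omega>\<bar>)"
  proof (rule Bochner_Integration.integrable_bound)
    show "integrable M (\<lambda>\<omega>. 1 + (X \<omega>)\<^sup>2)" using i by auto
    have "\<bar>x\<bar> \<le> 1 + x\<^sup>2" for x :: real
      using sum_power2_ge_zero[of "\<bar>x\<bar> - 1" 0] by (simp add: power2_eq_square algebra_simps abs_mult_self_eq)
    then show "AE \<omega> in M. norm \<bar>X \<omega>\<bar> \<le> norm (1 + (X \<omega>)\<^sup>2)" by (simp add: abs_of_nonneg add_nonneg_nonneg)
  qed simp
  have "0 \<le> variance (\<lambda>\<omega>. \<bar>X \<omega>\<bar>)" by (intro Bochner_Integration.integral_nonneg) auto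
  also have "variance (\<lambda>\<omega>. \<bar>X \<omega>\<bar>) = (\<integral>\<omega>. \<bar>X \<omega>\<bar>\<^sup>2 \<partial>M) - (\<integral>\<omega>. \<bar>X \<omega>\<bar> \<partial>M)\<^sup>2"
    using iX i by (intro variance_eq) auto
  finally show ?thesis by (intro real_le_rsqrt) simp
qed

context bounded_gibbs
begin

definition block_growth :: real where "block_growth = (1 + weight_error / \<alpha>) * exp 1"

lemma block_growth_nonneg: "0 \<le> block_growth" using weight_error_nonneg \<alpha> by (simp add: block_growth_def)

lemma cond_new: assumes "1 \<le> n" "\<omega> \<in> space M" shows "step_mean n (\<pi> n \<omega>) (\<lambda>j. of_bool (j = 0)) = p_new n (card (\<pi> n \<omega>))"
proof -
  have "(\<Sum>U\<in>\<pi> n \<omega>. w n (card (\<pi> n \<omega>)) * (real (card U) - \<alpha>) * of_bool (card U = 0)) = 0"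
    using partition_blocks(5)[OF part[OF assms]] by (intro sum.neutral) force
  then show ?thesis by (simp add: step_mean_def)
qed

lemma p_new_near:
  assumes "1 \<le> n" "\<omega> \<in> space M"
  shows "\<bar>p_new n (card (\<pi> n \<omega>)) - \<alpha> * c 0 n \<omega> / real n\<bar> \<le> weight_error / real n"
  using p_new_bounds(3)[OF assms(1) partition_blocks(9)[OF part[OF assms] assms(1)] partition_blocks(8)[OF part[OF assms]]]
  unfolding c0_eq_card[OF assms] by (simp add: mult.commute)

text \<open>A new block appears with probability \<open>\<alpha> c 0 n / n + O(1 / n)\<close>. Shifting
  the expectation by \<open>weight_error / \<alpha>\<close> absorbs the additive error, and
  the shifted expectation grows at most by the factor \<open>1 + \<alpha> / n \<le> exp
  (\<alpha> / n)\<close>.\<close>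
lemma expected_blocks: assumes "1 \<le> n" shows "(\<integral>\<omega>. c 0 n \<omega> \<partial>M) \<le> block_growth * real n powr \<alpha>"
proof -
  have "(\<integral>\<omega>. c 0 n \<omega> \<partial>M) + weight_error / \<alpha> \<le> (1 + weight_error / \<alpha>) * exp (\<alpha> * (\<Sum>i\<in>{1..<n}. 1 / real i))"
    using assms
  proof (induction n rule: nat_induct_at_least)
    case base
    have "(\<integral>\<omega>. c 0 1 \<omega> \<partial>M) = (\<integral>\<omega>. 1 \<partial>M)"
      by (rule Bochner_Integration.integral_cong[OF refl]) (use c_eq_sum[of 1 _ 0] in simp)
    then show ?case by (simp add: gp.prob_space)
  next
    case (Suc n)
    let ?E = "\<integral>\<omega>. c 0 n \<omega> \<partial>M"
    have i: "integrable M (\<lambda>\<omega>. of_bool (s (Suc n) \<omega> = 0) :: real)" "integrable M (\<lambda>\<omega>. p_new n (card (\<pi> n \<omega>)))"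
      unfolding s_def using Suc(1) integrable_pi_fun[of "Suc n" "\<lambda>P. of_bool (last_size (Suc n) P = 0)"] by (auto intro: integrable_pi_fun)
    have "(\<integral>\<omega>. c 0 (Suc n) \<omega> \<partial>M) = (\<integral>\<omega>. c 0 n \<omega> + of_bool (s (Suc n) \<omega> = 0) \<partial>M)"
      by (rule Bochner_Integration.integral_cong[OF refl]) (simp add: c_Suc[OF Suc(1)])
    also have "\<dots> = ?E + (\<integral>\<omega>. of_bool (s (Suc n) \<omega> = 0) \<partial>M)" using i integrable_c[OF Suc(1)] by simp
    also have "(\<integral>\<omega>. of_bool (s (Suc n) \<omega> = 0) \<partial>M) = (\<integral>\<omega>. step_mean n (\<pi> n \<omega>) (\<lambda>j. of_bool (j = 0)) \<partial>M)"
      by (rule step_expectation[OF Suc(1), where H="\<lambda>_ j. of_bool (j = 0)"])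
    also have "\<dots> = (\<integral>\<omega>. p_new n (card (\<pi> n \<omega>)) \<partial>M)"
      by (rule Bochner_Integration.integral_cong[OF refl]) (rule cond_new[OF Suc(1)])
    also have "(\<integral>\<omega>. p_new n (card (\<pi> n \<omega>)) \<partial>M) \<le> (\<integral>\<omega>. \<alpha> / real n * c 0 n \<omega> + weight_error / real n \<partial>M)"
    proof (rule integral_mono[OF i(2)])
      show "p_new n (card (\<pi> n \<omega>)) \<le> \<alpha> / real n * c 0 n \<omega> + weight_error / real n" if "\<omega> \<in> space M" for \<omega>
        using p_new_near[OF Suc(1) that] by (simp add: field_simps)
    qed (use integrable_c[OF Suc(1)] in auto)
    also have "\<dots> = \<alpha> / real n * ?E + weight_error / real n" using integrable_c[OF Suc(1)] by (simp add: gp.prob_space)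
    finally have "(\<integral>\<omega>. c 0 (Suc n) \<omega> \<partial>M) \<le> ?E + (\<alpha> / real n * ?E + weight_error / real n)" by simp
    moreover have "(?E + weight_error / \<alpha>) * (1 + \<alpha> * (1 / real n)) = ?E + weight_error / \<alpha> + (\<alpha> / real n * ?E + weight_error / real n)"
      using Suc(1) \<alpha> by (simp add: field_simps)
    ultimately have "(\<integral>\<omega>. c 0 (Suc n) \<omega> \<partial>M) + weight_error / \<alpha> \<le> (?E + weight_error / \<alpha>) * (1 + \<alpha> * (1 / real n))" by linarith
    also have "\<dots> \<le> ((1 + weight_error / \<alpha>) * exp (\<alpha> * (\<Sum>i\<in>{1..<n}. 1 / real i))) * exp (\<alpha> * (1 / real n))"
      using Suc.IH \<alpha> weight_error_nonneg by (intro mult_mono exp_ge_add_one_self) auto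
    also have "\<dots> = (1 + weight_error / \<alpha>) * exp (\<alpha> * (\<Sum>i\<in>{1..<Suc n}. 1 / real i))"
      using Suc(1) by (simp add: exp_add[symmetric] distrib_left)
    finally show ?case .
  qed
  also have "\<dots> \<le> (1 + weight_error / \<alpha>) * (exp 1 * real n powr \<alpha>)"
  proof (rule mult_left_mono)
    have "\<alpha> * (\<Sum>i\<in>{1..<n}. 1 / real i) \<le> \<alpha> * (1 + ln (real n))"
      using sum_inverse_upper[OF assms] \<alpha> by (intro mult_left_mono) auto
    also have "\<dots> \<le> 1 + \<alpha> * ln (real n)" using \<alpha> by (simp add: distrib_left)
    finally have "exp (\<alpha> * (\<Sum>i\<in>{1..<n}. 1 / real i)) \<le> exp (1 + \<alpha> * ln (real n))" by simp
    also have "\<dots> = exp 1 * real n powr \<alpha>" using assms by (simp add: exp_add powr_def)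
    finally show "exp (\<alpha> * (\<Sum>i\<in>{1..<n}. 1 / real i)) \<le> exp 1 * real n powr \<alpha>" .
  qed (use weight_error_nonneg \<alpha> in auto)
  also have "\<dots> = block_growth * real n powr \<alpha>" by (simp add: block_growth_def)
  finally show ?thesis using weight_error_nonneg \<alpha> divide_nonneg_pos[of weight_error \<alpha>] by linarith
qed

text \<open>By orthogonality only the expected conditional variances matter, and these are \<open>O(i
  powr (\<alpha> - 1))\<close> because the number of blocks is \<open>O(i powr
  \<alpha>)\<close> in mean.\<close>
lemma compensated_L2:
  assumes \<delta>: "\<And>j. \<bar>\<delta> j\<bar> \<le> B" and K: "(\<delta> 0)\<^sup>2 \<le> K" "\<And>j. 1 \<le> j \<Longrightarrow> (\<delta> j)\<^sup>2 * (real j - \<alpha>) \<le> K" and m: "1 \<le> m"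
  shows "(\<integral>\<omega>. (\<Sum>i\<in>{m..<n}. d i * mdiff \<delta> (Suc i) \<omega>)\<^sup>2 \<partial>M) \<le> K * (2 + 2 * weight_error) * block_growth * (\<Sum>i\<in>{m..<n}. (d i)\<^sup>2 * real i powr (\<alpha> - 1))"
    "integrable M (\<lambda>\<omega>. (\<Sum>i\<in>{m..<n}. d i * mdiff \<delta> (Suc i) \<omega>)\<^sup>2)"
    "(\<lambda>\<omega>. \<Sum>i\<in>{m..<n}. d i * mdiff \<delta> (Suc i) \<omega>) \<in> borel_measurable M"
proof -
  interpret D: bounded_martingale_differences M F "mdiff \<delta>" "mvar \<delta>" "2 * B"
    by (rule martingale_differences[OF \<delta>])
  have K0: "0 \<le> K" using K(1) zero_le_power2 order_trans by blast
  have mv: "(\<integral>\<omega>. mvar \<delta> i \<omega> \<partial>M) \<le> K * (2 + 2 * weight_error) * block_growth * real i powr (\<alpha> - 1)" if i: "1 \<le> i" for i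
  proof -
    have "(\<integral>\<omega>. mvar \<delta> i \<omega> \<partial>M) \<le> (\<integral>\<omega>. K * (2 + 2 * weight_error) * (c 0 i \<omega> / real i) \<partial>M)"
      using mvar_le(2)[OF i _ K] integrable_c[OF i] D.integrable_q[OF i] by (intro integral_mono) auto
    also have "\<dots> = K * (2 + 2 * weight_error) * ((\<integral>\<omega>. c 0 i \<omega> \<partial>M) / real i)" by simp
    also have "\<dots> \<le> K * (2 + 2 * weight_error) * (block_growth * real i powr \<alpha> / real i)"
      using expected_blocks[OF i] K0 weight_error_nonneg by (intro mult_left_mono divide_right_mono) auto
    also have "\<dots> = K * (2 + 2 * weight_error) * block_growth * real i powr (\<alpha> - 1)" using i by (simp add: powr_diff)
    finally show ?thesis .
  qed
  have "(\<integral>\<omega>. (\<Sum>i\<in>{m..<n}. d i * mdiff \<delta> (Suc i) \<omega>)\<^sup>2 \<partial>M) = (\<Sum>i\<in>{m..<n}. (d i)\<^sup>2 * (\<integral>\<omega>. mvar \<delta> i \<omega> \<partial>M))"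
    by (rule D.second_moment_sum[OF m])
  also have "\<dots> \<le> (\<Sum>i\<in>{m..<n}. (d i)\<^sup>2 * (K * (2 + 2 * weight_error) * block_growth * real i powr (\<alpha> - 1)))"
    using m by (intro sum_mono mult_left_mono mv) auto
  also have "\<dots> = K * (2 + 2 * weight_error) * block_growth * (\<Sum>i\<in>{m..<n}. (d i)\<^sup>2 * real i powr (\<alpha> - 1))"
    unfolding sum_distrib_left by (intro sum.cong) auto
  finally show "(\<integral>\<omega>. (\<Sum>i\<in>{m..<n}. d i * mdiff \<delta> (Suc i) \<omega>)\<^sup>2 \<partial>M) \<le> K * (2 + 2 * weight_error) * block_growth * (\<Sum>i\<in>{m..<n}. (d i)\<^sup>2 * real i powr (\<alpha> - 1))" .
  show mS: "(\<lambda>\<omega>. \<Sum>i\<in>{m..<n}. d i * mdiff \<delta> (Suc i) \<omega>) \<in> borel_measurable M"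
    using m by (intro borel_measurable_sum borel_measurable_times D.measurable_DM) auto
  show "integrable M (\<lambda>\<omega>. (\<Sum>i\<in>{m..<n}. d i * mdiff \<delta> (Suc i) \<omega>)\<^sup>2)"
  proof (rule D.integrable_bounded[where B="(\<Sum>i\<in>{m..<n}. \<bar>d i\<bar> * (2 * B))\<^sup>2"])
    show "(\<lambda>\<omega>. (\<Sum>i\<in>{m..<n}. d i * mdiff \<delta> (Suc i) \<omega>)\<^sup>2) \<in> borel_measurable M" using mS by (rule borel_measurable_power)
    fix \<omega> assume "\<omega> \<in> space M"
    then have "\<bar>\<Sum>i\<in>{m..<n}. d i * mdiff \<delta> (Suc i) \<omega>\<bar> \<le> (\<Sum>i\<in>{m..<n}. \<bar>d i\<bar> * (2 * B))"
      using m D.D_bound by (intro order_trans[OF sum_abs] sum_mono) (auto simp: abs_mult intro!: mult_left_mono)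
    from power_mono[OF this, of 2] show "norm ((\<Sum>i\<in>{m..<n}. d i * mdiff \<delta> (Suc i) \<omega>)\<^sup>2) \<le> (\<Sum>i\<in>{m..<n}. \<bar>d i\<bar> * (2 * B))\<^sup>2" by simp
  qed
qed

lemma sum_powr_le: assumes "1 \<le> n" shows "(\<Sum>i\<in>{1..<n}. real i powr (\<alpha> - 1)) \<le> real n powr \<alpha> / \<alpha>"
proof -
  have H: "(\<Sum>i\<in>{1..<Suc k}. real i powr (\<alpha> - 1)) \<le> real k powr \<alpha> / \<alpha>" for k
  proof (induction k)
    case (Suc k)
    define x where "x = real (Suc k)"
    have x: "0 < x" "real k = x - 1" "1 \<le> x" by (auto simp: x_def)
    have "(1 - 1 / x) powr \<alpha> * 1 powr (1 - \<alpha>) \<le> \<alpha> * (1 - 1 / x) + (1 - \<alpha>) * 1"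
    proof (cases "k = 0")
      case False
      then have "1 < x" by (simp add: x_def)
      then show ?thesis using \<alpha> by (intro Youngs_inequality_0) auto
    qed (use \<alpha> in \<open>simp add: x_def\<close>)
    then have "(1 - 1 / x) powr \<alpha> * x powr \<alpha> \<le> (1 - \<alpha> * (1 / x)) * x powr \<alpha>"
      by (intro mult_right_mono) (auto simp: algebra_simps)
    moreover have "(1 - 1 / x) powr \<alpha> * x powr \<alpha> = real k powr \<alpha>"
    proof -
      have "(1 - 1 / x) * x = real k" using x by (simp add: left_diff_distrib)
      then show ?thesis using x powr_mult[of "1 - 1 / x" x \<alpha>] by simp
    qed
    moreover have "(1 - \<alpha> * (1 / x)) * x powr \<alpha> = x powr \<alpha> - \<alpha> * x powr (\<alpha> - 1)"
      using x by (simp add: powr_diff algebra_simps)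
    ultimately have "x powr (\<alpha> - 1) \<le> (x powr \<alpha> - real k powr \<alpha>) / \<alpha>" using \<alpha> by (simp add: field_simps)
    moreover have "(\<Sum>i\<in>{1..<Suc (Suc k)}. real i powr (\<alpha> - 1)) = (\<Sum>i\<in>{1..<Suc k}. real i powr (\<alpha> - 1)) + x powr (\<alpha> - 1)"
      unfolding x_def by (rule sum.atLeastLessThan_Suc) simp
    ultimately show ?case using Suc.IH unfolding x_def[symmetric] diff_divide_distrib by linarith
  qed simp
  have "(\<Sum>i\<in>{1..<n}. real i powr (\<alpha> - 1)) \<le> (\<Sum>i\<in>{1..<Suc n}. real i powr (\<alpha> - 1))" by (intro sum_mono2) auto
  then show ?thesis using H[of n] by linarith
qed

text \<open>Fluctuations of additive functionals are at most of the order \<open>n powr (\<alpha> /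
  2)\<close>, the square root of the number of blocks.\<close>
lemma compensated_L1:
  assumes \<delta>: "\<And>j. \<bar>\<delta> j\<bar> \<le> B" and K: "(\<delta> 0)\<^sup>2 \<le> K" "\<And>j. 1 \<le> j \<Longrightarrow> (\<delta> j)\<^sup>2 * (real j - \<alpha>) \<le> K" and n: "1 \<le> n"
  shows "(\<integral>\<omega>. \<bar>\<Sum>i\<in>{1..<n}. mdiff \<delta> (Suc i) \<omega>\<bar> \<partial>M) \<le> sqrt (K * (2 + 2 * weight_error) * block_growth / \<alpha>) * real n powr (\<alpha> / 2)"
    "integrable M (\<lambda>\<omega>. \<Sum>i\<in>{1..<n}. mdiff \<delta> (Suc i) \<omega>)"
proof -
  let ?S = "\<lambda>\<omega>. \<Sum>i\<in>{1..<n}. mdiff \<delta> (Suc i) \<omega>"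
  let ?C = "K * (2 + 2 * weight_error) * block_growth"
  have K0: "0 \<le> K" using K(1) zero_le_power2 order_trans by blast
  then have C0: "0 \<le> ?C" using weight_error_nonneg block_growth_nonneg by simp
  note L = compensated_L2[OF \<delta> K le_refl, where d="\<lambda>_. 1" and n=n, unfolded mult_1 power_one]
  have "(\<integral>\<omega>. \<bar>?S \<omega>\<bar> \<partial>M) \<le> sqrt (\<integral>\<omega>. (?S \<omega>)\<^sup>2 \<partial>M)" by (rule gp.L1_le_sqrt_L2[OF L(3,2)])
  also have "\<dots> \<le> sqrt (?C * (real n powr \<alpha> / \<alpha>))"
    using L(1) mult_left_mono[OF sum_powr_le[OF n] C0] by simp
  also have "\<dots> = sqrt (?C / \<alpha>) * sqrt (real n powr \<alpha>)" by (simp add: real_sqrt_mult[symmetric])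
  also have "sqrt (real n powr \<alpha>) = real n powr (\<alpha> / 2)" using n by (simp add: powr_half_sqrt[symmetric] powr_powr)
  finally show "(\<integral>\<omega>. \<bar>?S \<omega>\<bar> \<partial>M) \<le> sqrt (?C / \<alpha>) * real n powr (\<alpha> / 2)" .
  interpret D: bounded_martingale_differences M F "mdiff \<delta>" "mvar \<delta>" "2 * B"
    by (rule martingale_differences[OF \<delta>])
  show "integrable M ?S"
  proof (intro Bochner_Integration.integrable_sum)
    fix i assume "i \<in> {1..<n}"
    then have i: "1 \<le> i" by simp
    show "integrable M (mdiff \<delta> (Suc i))" by (rule D.integrable_bounded[OF D.measurable_DM[OF i]]) (use D.D_bound[OF i] in auto)
  qed
qed

end


section \<open>Existence of the \<open>\<alpha>\<close>-diversity\<close>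

text \<open>A monotone \<open>f\<close> is squeezed between its values at consecutive points of the
  subsequence. As the ratio of these points tends to 1, the normalization by \<open>n powr
  a\<close> changes by a factor close to 1.\<close>
lemma regular_variation_from_subsequence:
  fixes f :: "nat \<Rightarrow> real" and g :: "nat \<Rightarrow> nat"
  assumes a: "0 < a" and mono: "\<And>m n. 1 \<le> m \<Longrightarrow> m \<le> n \<Longrightarrow> f m \<le> f n" and pos: "\<And>n. 1 \<le> n \<Longrightarrow> 0 \<le> f n"
    and g: "strict_mono g" "\<And>j. 1 \<le> g j" "(\<lambda>j. real (g (Suc j)) / real (g j)) \<longlonglongrightarrow> 1"
    and lim: "(\<lambda>j. f (g j) / real (g j) powr a) \<longlonglongrightarrow> L"
  shows "(\<lambda>n. f n / real n powr a) \<longlonglongrightarrow> L"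
proof (rule tendstoI)
  fix e :: real assume e: "0 < e"
  let ?x = "\<lambda>j. f (g j) / real (g j) powr a" and ?\<rho> = "\<lambda>j. (real (g (Suc j)) / real (g j)) powr a"
  have gp: "0 < real (g j)" for j using g(2)[of j] by simp
  have "?\<rho> \<longlonglongrightarrow> 1 powr a" by (intro tendsto_intros g(3)) simp
  then have \<rho>: "?\<rho> \<longlonglongrightarrow> 1" by simp
  have up: "(\<lambda>j. ?x (Suc j) * ?\<rho> j) \<longlonglongrightarrow> L * 1" by (intro tendsto_mult LIMSEQ_Suc lim \<rho>)
  have lo: "(\<lambda>j. ?x j / ?\<rho> j) \<longlonglongrightarrow> L / 1" by (intro tendsto_divide lim \<rho>) simp
  have "\<forall>\<^sub>F j in sequentially. dist (?x (Suc j) * ?\<rho> j) L < e" using tendstoD[OF up e] by simp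
  moreover have "\<forall>\<^sub>F j in sequentially. dist (?x j / ?\<rho> j) L < e" using tendstoD[OF lo e] by simp
  ultimately have "\<forall>\<^sub>F j in sequentially. dist (?x (Suc j) * ?\<rho> j) L < e \<and> dist (?x j / ?\<rho> j) L < e" by (rule eventually_conj)
  then obtain J where J: "\<And>j. J \<le> j \<Longrightarrow> dist (?x (Suc j) * ?\<rho> j) L < e \<and> dist (?x j / ?\<rho> j) L < e"
    unfolding eventually_sequentially by blast
  have "dist (f n / real n powr a) L < e" if n: "g J \<le> n" for n
  proof -
    have ex: "\<exists>i. n < g i" using strict_mono_imp_increasing[OF g(1), of "Suc n"] by (intro exI[of _ "Suc n"]) linarith
    define i where "i = (LEAST i. n < g i)"
    have i: "n < g i" unfolding i_def by (rule LeastI_ex[OF ex])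
    have "g J < g i" using i n by (rule le_less_trans[rotated])
    then have "J < i" by (simp only: strict_mono_less[OF g(1)])
    then obtain j where j: "i = Suc j" "J \<le> j" by (cases i) auto
    have nj: "g j \<le> n" 
    proof -
      have "j < (LEAST i. n < g i)" using j(1) unfolding i_def by simp
      then show ?thesis using not_less_Least by (simp only: not_less[symmetric])
    qed
    have ni: "n \<le> g (Suc j)" using i j(1) by simp
    have n1: "1 \<le> n" using g(2)[of j] nj by linarith
    have pw: "real (g j) powr a \<le> real n powr a" "real n powr a \<le> real (g (Suc j)) powr a" "0 < real n powr a" "0 < real (g j) powr a"
      using nj ni n1 a g(2)[of j] by (auto intro!: powr_mono2)
    have eq: "?\<rho> j = real (g (Suc j)) powr a / real (g j) powr a" using gp by (simp add: powr_divide less_imp_le)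
    have "f n / real n powr a \<le> f (g (Suc j)) / real (g j) powr a"
      using order_trans[OF pos[OF n1] mono[OF n1 ni]] by (intro frac_le mono n1 ni pw)
    also have "\<dots> = ?x (Suc j) * ?\<rho> j" unfolding eq using pw gp[of "Suc j"] by simp
    finally have 1: "f n / real n powr a \<le> ?x (Suc j) * ?\<rho> j" .
    have "?x j / ?\<rho> j = f (g j) / real (g (Suc j)) powr a" unfolding eq using pw by simp
    also have "\<dots> \<le> f n / real n powr a" by (intro frac_le mono g(2) nj pw pos n1)
    finally have 2: "?x j / ?\<rho> j \<le> f n / real n powr a" .
    show ?thesis using J[OF j(2)] 1 2 unfolding dist_real_def abs_less_iff by linarith
  qed
  then show "\<forall>\<^sub>F n in sequentially. dist (f n / real n powr a) L < e" unfolding eventually_sequentially by blast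
qed

lemma (in prob_space) AE_convergent_of_summable_L1:
  fixes X :: "nat \<Rightarrow> 'a \<Rightarrow> real"
  assumes X: "\<And>j. integrable M (X j)" and s: "summable (\<lambda>j. \<integral>\<omega>. \<bar>X (Suc j) \<omega> - X j \<omega>\<bar> \<partial>M)"
  shows "AE \<omega> in M. convergent (\<lambda>j. X j \<omega>)"
proof -
  let ?d = "\<lambda>j \<omega>. \<bar>X (Suc j) \<omega> - X j \<omega>\<bar>"
  have [measurable]: "X j \<in> borel_measurable M" for j using X by auto
  have di: "integrable M (?d j)" for j using X by auto
  have "(\<integral>\<^sup>+\<omega>. (\<Sum>j. ennreal (?d j \<omega>)) \<partial>M) = (\<Sum>j. \<integral>\<^sup>+\<omega>. ennreal (?d j \<omega>) \<partial>M)"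
    by (rule nn_integral_suminf) measurable
  also have "\<dots> = (\<Sum>j. ennreal (\<integral>\<omega>. ?d j \<omega> \<partial>M))" using di by (simp add: nn_integral_eq_integral)
  also have "\<dots> = ennreal (\<Sum>j. \<integral>\<omega>. ?d j \<omega> \<partial>M)" using s by (intro suminf_ennreal2) auto
  finally have "(\<integral>\<^sup>+\<omega>. (\<Sum>j. ennreal (?d j \<omega>)) \<partial>M) \<noteq> \<infinity>" by simp
  then have "AE \<omega> in M. (\<Sum>j. ennreal (?d j \<omega>)) \<noteq> \<infinity>" by (intro nn_integral_PInf_AE) auto
  then show ?thesis
  proof eventually_elim
    case (elim \<omega>)
    then have "summable (\<lambda>j. ?d j \<omega>)" by (intro summable_suminf_not_top) auto
    then have "summable (\<lambda>j. X (Suc j) \<omega> - X j \<omega>)" by (rule summable_rabs_cancel)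
    then have "convergent (\<lambda>n. \<Sum>j<n. X (Suc j) \<omega> - X j \<omega>)" by (simp add: summable_iff_convergent)
    moreover have "(\<lambda>n. \<Sum>j<n. X (Suc j) \<omega> - X j \<omega>) = (\<lambda>n. X n \<omega> - X 0 \<omega>)"
      by (intro ext) (rule sum_lessThan_telescope)
    ultimately have "convergent (\<lambda>n. X n \<omega> - X 0 \<omega>)" by (simp only:)
    then show ?case by (simp add: convergent_diff_const_right_iff)
  qed
qed

context bounded_gibbs
begin

definition r :: "nat \<Rightarrow> 'a \<Rightarrow> real" where "r n \<omega> = c 0 n \<omega> / real n powr \<alpha>"

lemma integrable_r: "1 \<le> n \<Longrightarrow> integrable M (r n)"
  unfolding r_def using integrable_c by auto

definition is_new :: "nat \<Rightarrow> real" where "is_new j = of_bool (j = 0)"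

text \<open>In \<open>c 0 n / n powr \<alpha>\<close> the mean growth \<open>\<alpha> c 0 n / n\<close>
  of the number of blocks cancels against that of \<open>n powr \<alpha>\<close>; a martingale
  difference and a summable error are left.\<close>
lemma r_increment:
  assumes i: "1 \<le> i" and \<omega>: "\<omega> \<in> space M"
  shows "\<bar>r (Suc i) \<omega> - r i \<omega> - 1 / real (Suc i) powr \<alpha> * mdiff is_new (Suc i) \<omega>\<bar> \<le> (c 0 i \<omega> * (\<alpha> / (real i)\<^sup>2) + weight_error / real i) / real i powr \<alpha>"
proof -
  let ?p = "p_new i (card (\<pi> i \<omega>))" and ?c = "c 0 i \<omega>" and ?B = "(1 + 1 / real i) powr \<alpha>"
  have i0: "0 < real i" using i by simp
  have md: "mdiff is_new (Suc i) \<omega> = of_bool (s (Suc i) \<omega> = 0) - ?p"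
    unfolding mdiff_def is_new_def diff_Suc_1 cond_new[OF i \<omega>] ..
  have B: "1 \<le> ?B" using i0 \<alpha> by (intro ge_one_powr_ge_zero) auto
  have "real (Suc i) = real i * (1 + 1 / real i)" using i0 by (simp add: field_simps)
  then have pw: "real (Suc i) powr \<alpha> = real i powr \<alpha> * ?B" using i0 by (simp only:) (simp add: powr_mult)
  have ia: "0 < real i powr \<alpha>" using i0 by simp
  have "r (Suc i) \<omega> - r i \<omega> - 1 / real (Suc i) powr \<alpha> * mdiff is_new (Suc i) \<omega> = (?c + ?p) / (real i powr \<alpha> * ?B) - ?c / real i powr \<alpha>"
    unfolding r_def md c_Suc[OF i \<omega>] pw by (simp add: diff_divide_distrib add_divide_distrib)
  also have "\<dots> = (?c * (1 + \<alpha> * (1 / real i) - ?B) + (?p - \<alpha> * ?c / real i)) / (real i powr \<alpha> * ?B)"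
    using ia B by (simp add: field_simps)
  finally have "\<bar>r (Suc i) \<omega> - r i \<omega> - 1 / real (Suc i) powr \<alpha> * mdiff is_new (Suc i) \<omega>\<bar>
      = \<bar>?c * (1 + \<alpha> * (1 / real i) - ?B) + (?p - \<alpha> * ?c / real i)\<bar> / (real i powr \<alpha> * ?B)"
    using ia B by simp
  also have "\<dots> \<le> (?c * (\<alpha> / (real i)\<^sup>2) + weight_error / real i) / (real i powr \<alpha> * 1)"
  proof (rule frac_le)
    have "\<bar>1 + \<alpha> * (1 / real i) - ?B\<bar> \<le> \<alpha> * (1 / real i)\<^sup>2" using i by (intro powr_near_linear \<alpha>) auto
    from mult_left_mono[OF this c_nonneg[of 0 i \<omega>]]
    have "\<bar>?c * (1 + \<alpha> * (1 / real i) - ?B)\<bar> \<le> ?c * (\<alpha> / (real i)\<^sup>2)"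
      by (simp add: abs_mult c_nonneg power_divide)
    then show "\<bar>?c * (1 + \<alpha> * (1 / real i) - ?B) + (?p - \<alpha> * ?c / real i)\<bar> \<le> ?c * (\<alpha> / (real i)\<^sup>2) + weight_error / real i"
      by (rule order_trans[OF abs_triangle_ineq add_mono[OF _ p_new_near[OF i \<omega>]]])
    show "real i powr \<alpha> * 1 \<le> real i powr \<alpha> * ?B" using B ia by (intro mult_left_mono) auto
  qed (use ia \<alpha> weight_error_nonneg c_nonneg in auto)
  finally show ?thesis by simp
qed

definition diversity_rate :: real where
  "diversity_rate = sqrt ((2 + 2 * weight_error) * block_growth * (2 powr (1 + \<alpha>) / \<alpha>)) + (block_growth + weight_error) * (2 powr (1 + \<alpha>) / \<alpha>)"

lemma diversity_rate_nonneg: "0 \<le> diversity_rate"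
  unfolding diversity_rate_def using weight_error_nonneg block_growth_nonneg \<alpha> by (intro add_nonneg_nonneg real_sqrt_ge_zero mult_nonneg_nonneg) auto

text \<open>The martingale part is bounded in \<open>L\<^sup>2\<close> by the tail of \<open>i powr (- 1
  - \<alpha>)\<close>, the remaining part in \<open>L\<^sup>1\<close> by the same tail.\<close>
lemma r_L1_cauchy:
  assumes m: "1 \<le> m" and mn: "m \<le> n"
  shows "(\<integral>\<omega>. \<bar>r n \<omega> - r m \<omega>\<bar> \<partial>M) \<le> diversity_rate * real m powr (- \<alpha> / 2)"
proof -
  let ?d = "\<lambda>i. 1 / real (Suc i) powr \<alpha>" let ?T = "2 powr (1 + \<alpha>) / \<alpha>"
  let ?e = "\<lambda>i \<omega>. r (Suc i) \<omega> - r i \<omega> - ?d i * mdiff is_new (Suc i) \<omega>"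
  let ?S = "\<lambda>\<omega>. \<Sum>i\<in>{m..<n}. ?d i * mdiff is_new (Suc i) \<omega>"
  have T: "0 \<le> ?T" using \<alpha> by simp
  have nb: "\<bar>is_new j\<bar> \<le> 1" for j by (simp add: is_new_def)
  have nK: "(is_new 0)\<^sup>2 \<le> 1" "\<And>j. 1 \<le> j \<Longrightarrow> (is_new j)\<^sup>2 * (real j - \<alpha>) \<le> 1" by (auto simp: is_new_def)
  note L = compensated_L2[OF nb nK m, where d="?d" and n=n]
  interpret D: bounded_martingale_differences M F "mdiff is_new" "mvar is_new" "2 * 1"
    by (rule martingale_differences[OF nb])
  have Di: "integrable M (mdiff is_new (Suc i))" if "1 \<le> i" for i
    by (rule D.integrable_bounded[OF D.measurable_DM[OF that]]) (use D.D_bound[OF that] in auto)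
  have ei: "integrable M (?e i)" if "1 \<le> i" for i using integrable_r[of i] integrable_r[of "Suc i"] Di[OF that] that by auto
  have ea: "integrable M (\<lambda>\<omega>. \<bar>?e i \<omega>\<bar>)" if "i \<in> {m..<n}" for i
    by (rule integrable_abs[OF ei]) (use m that in simp)
  have Si: "integrable M ?S" using m Di by (intro Bochner_Integration.integrable_sum integrable_mult_right) auto
  have id: "r n \<omega> - r m \<omega> = ?S \<omega> + (\<Sum>i\<in>{m..<n}. ?e i \<omega>)" for \<omega>
    using mn by (induction n rule: dec_induct) (simp_all add: sum.atLeastLessThan_Suc)
  have "(\<integral>\<omega>. \<bar>?S \<omega>\<bar> \<partial>M) \<le> sqrt (\<integral>\<omega>. (?S \<omega>)\<^sup>2 \<partial>M)" by (rule gp.L1_le_sqrt_L2[OF L(3,2)])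
  also have "\<dots> \<le> sqrt ((2 + 2 * weight_error) * block_growth * (?T * real m powr (- \<alpha>)))"
  proof (rule real_sqrt_le_mono)
    have "(\<Sum>i\<in>{m..<n}. (?d i)\<^sup>2 * real i powr (\<alpha> - 1)) \<le> (\<Sum>i\<in>{m..<n}. real i powr (- 1 - \<alpha>))"
    proof (rule sum_mono)
      fix i assume "i \<in> {m..<n}"
      then have i: "0 < real i" using m by simp
      have "?d i \<le> 1 / real i powr \<alpha>" using i \<alpha> by (intro divide_left_mono powr_mono2) auto
      then have "(?d i)\<^sup>2 \<le> (1 / real i powr \<alpha>)\<^sup>2" by (intro power_mono) auto
      then have "(?d i)\<^sup>2 * real i powr (\<alpha> - 1) \<le> (1 / real i powr \<alpha>)\<^sup>2 * real i powr (\<alpha> - 1)" by (intro mult_right_mono) auto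
      also have "\<dots> = real i powr (- \<alpha>) * (real i powr (- \<alpha>) * real i powr (\<alpha> - 1))"
        by (simp add: powr_minus_divide power2_eq_square)
      also have "\<dots> = real i powr (- \<alpha> + (- \<alpha> + (\<alpha> - 1)))" by (simp only: powr_add)
      also have "- \<alpha> + (- \<alpha> + (\<alpha> - 1)) = - 1 - \<alpha>" by simp
      finally show "(?d i)\<^sup>2 * real i powr (\<alpha> - 1) \<le> real i powr (- 1 - \<alpha>)" .
    qed
    also have "\<dots> \<le> ?T * real m powr (- \<alpha>)" by (rule sum_powr_tail[OF \<alpha>(1) m])
    finally have "1 * (2 + 2 * weight_error) * block_growth * (\<Sum>i\<in>{m..<n}. (?d i)\<^sup>2 * real i powr (\<alpha> - 1)) \<le> (2 + 2 * weight_error) * block_growth * (?T * real m powr (- \<alpha>))"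
      using weight_error_nonneg block_growth_nonneg by (simp only: mult_1) (intro mult_left_mono mult_nonneg_nonneg, auto)
    then show "(\<integral>\<omega>. (?S \<omega>)\<^sup>2 \<partial>M) \<le> (2 + 2 * weight_error) * block_growth * (?T * real m powr (- \<alpha>))" using L(1) by linarith
  qed
  also have "\<dots> = sqrt ((2 + 2 * weight_error) * block_growth * ?T) * sqrt (real m powr (- \<alpha>))"
    by (simp only: real_sqrt_mult mult.assoc)
  also have "sqrt (real m powr (- \<alpha>)) = real m powr (- \<alpha> / 2)" using m by (simp add: powr_half_sqrt[symmetric] powr_powr)
  finally have E1: "(\<integral>\<omega>. \<bar>?S \<omega>\<bar> \<partial>M) \<le> sqrt ((2 + 2 * weight_error) * block_growth * ?T) * real m powr (- \<alpha> / 2)" .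
  have Ee: "(\<integral>\<omega>. \<bar>?e i \<omega>\<bar> \<partial>M) \<le> (block_growth + weight_error) * real i powr (- 1 - \<alpha>)" if i: "1 \<le> i" for i
  proof -
    have i0: "0 < real i" "1 \<le> real i" using i by auto
    have "(\<integral>\<omega>. \<bar>?e i \<omega>\<bar> \<partial>M) \<le> (\<integral>\<omega>. (c 0 i \<omega> * (\<alpha> / (real i)\<^sup>2) + weight_error / real i) / real i powr \<alpha> \<partial>M)"
      using ei[OF i] integrable_c[OF i] r_increment[OF i] by (intro integral_mono) auto
    also have "\<dots> = ((\<integral>\<omega>. c 0 i \<omega> \<partial>M) * (\<alpha> / (real i)\<^sup>2) + weight_error / real i) / real i powr \<alpha>"
      using integrable_c[OF i] by (simp add: gp.prob_space)
    also have "\<dots> \<le> (block_growth * real i powr \<alpha> * (1 / (real i)\<^sup>2) + weight_error / real i) / real i powr \<alpha>"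
      using expected_blocks[OF i] \<alpha> i0 block_growth_nonneg
      by (intro divide_right_mono add_mono mult_mono order_refl mult_nonneg_nonneg) (auto intro!: divide_right_mono)
    also have "\<dots> = block_growth * real i powr (- 2) + weight_error * real i powr (- 1 - \<alpha>)"
    proof -
      have "real i powr (- 2) = 1 / (real i)\<^sup>2" using i0 by (simp add: powr_minus_divide powr_numeral)
      moreover have "real i powr (- 1 - \<alpha>) = 1 / real i / real i powr \<alpha>" using i0 by (simp add: powr_diff powr_minus_divide)
      ultimately show ?thesis using i0 by (simp add: add_divide_distrib)
    qed
    also have "\<dots> \<le> block_growth * real i powr (- 1 - \<alpha>) + weight_error * real i powr (- 1 - \<alpha>)"
      using i0 \<alpha> block_growth_nonneg weight_error_nonneg by (intro add_mono mult_left_mono powr_mono) auto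
    finally show ?thesis by (simp add: distrib_right)
  qed
  have "(\<Sum>i\<in>{m..<n}. \<integral>\<omega>. \<bar>?e i \<omega>\<bar> \<partial>M) \<le> (\<Sum>i\<in>{m..<n}. (block_growth + weight_error) * real i powr (- 1 - \<alpha>))"
    using m by (intro sum_mono Ee) auto
  also have "\<dots> = (block_growth + weight_error) * (\<Sum>i\<in>{m..<n}. real i powr (- 1 - \<alpha>))" by (simp add: sum_distrib_left)
  also have "\<dots> \<le> (block_growth + weight_error) * (?T * real m powr (- \<alpha>))"
    using block_growth_nonneg weight_error_nonneg by (intro mult_left_mono sum_powr_tail \<alpha> m) auto
  also have "\<dots> \<le> (block_growth + weight_error) * (?T * real m powr (- \<alpha> / 2))"
    using block_growth_nonneg weight_error_nonneg T \<alpha> m by (intro mult_left_mono powr_mono) auto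
  finally have E2: "(\<Sum>i\<in>{m..<n}. \<integral>\<omega>. \<bar>?e i \<omega>\<bar> \<partial>M) \<le> (block_growth + weight_error) * ?T * real m powr (- \<alpha> / 2)" by (simp only: mult.assoc)
  have "(\<integral>\<omega>. \<bar>r n \<omega> - r m \<omega>\<bar> \<partial>M) \<le> (\<integral>\<omega>. \<bar>?S \<omega>\<bar> + (\<Sum>i\<in>{m..<n}. \<bar>?e i \<omega>\<bar>) \<partial>M)"
  proof (rule integral_mono)
    show "integrable M (\<lambda>\<omega>. \<bar>r n \<omega> - r m \<omega>\<bar>)" using integrable_r m mn by auto
    show "integrable M (\<lambda>\<omega>. \<bar>?S \<omega>\<bar> + (\<Sum>i\<in>{m..<n}. \<bar>?e i \<omega>\<bar>))"
      by (intro Bochner_Integration.integrable_add Bochner_Integration.integrable_sum integrable_abs[OF Si] ea)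
    show "\<bar>r n \<omega> - r m \<omega>\<bar> \<le> \<bar>?S \<omega>\<bar> + (\<Sum>i\<in>{m..<n}. \<bar>?e i \<omega>\<bar>)" for \<omega>
      unfolding id by (rule order_trans[OF abs_triangle_ineq add_left_mono[OF sum_abs]])
  qed
  also have "\<dots> = (\<integral>\<omega>. \<bar>?S \<omega>\<bar> \<partial>M) + (\<integral>\<omega>. (\<Sum>i\<in>{m..<n}. \<bar>?e i \<omega>\<bar>) \<partial>M)"
    by (intro Bochner_Integration.integral_add Bochner_Integration.integrable_sum integrable_abs[OF Si] ea)
  also have "(\<integral>\<omega>. (\<Sum>i\<in>{m..<n}. \<bar>?e i \<omega>\<bar>) \<partial>M) = (\<Sum>i\<in>{m..<n}. \<integral>\<omega>. \<bar>?e i \<omega>\<bar> \<partial>M)"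
    by (intro Bochner_Integration.integral_sum ea)
  finally show ?thesis using E1 E2 unfolding diversity_rate_def distrib_right by linarith
qed

definition S :: "'a \<Rightarrow> real" where "S = alpha_diversity \<alpha> \<pi>"

lemma S_eq: "\<omega> \<in> space M \<Longrightarrow> (\<lambda>n. r n \<omega>) \<longlonglongrightarrow> l \<longleftrightarrow> (\<lambda>n. real n powr (- \<alpha>) * real (card (\<pi> n \<omega>))) \<longlonglongrightarrow> l"
proof (rule filterlim_cong[OF refl refl])
  assume \<omega>: "\<omega> \<in> space M"
  show "\<forall>\<^sub>F n in sequentially. r n \<omega> = real n powr (- \<alpha>) * real (card (\<pi> n \<omega>))"
    using eventually_ge_at_top[of 1]
  proof eventually_elim
    case (elim n)
    show ?case unfolding r_def c0_eq_card[OF elim \<omega>] by (simp add: powr_minus_divide)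
  qed
qed

text \<open>The polynomial rate in \<open>r_L1_cauchy\<close> is summable along \<open>j ^ p\<close> for
  a large power \<open>p\<close>. This gives almost sure convergence along a subsequence whose
  ratios tend to 1, and monotonicity of the number of blocks fills the gaps.\<close>
lemma AE_r_tendsto: "AE \<omega> in M. (\<lambda>n. r n \<omega>) \<longlonglongrightarrow> S \<omega>"
proof -
  \<comment> \<open>The choice of \<open>p\<close> makes \<open>(j ^ p) powr (- \<alpha> / 2)\<close> at most
    \<open>j powr (- 2)\<close>.\<close>
  obtain p :: nat where p: "4 / \<alpha> < real p" using reals_Archimedean2 by blast
  have p0: "0 < p" using p \<alpha> by (metis divide_pos_pos of_nat_0_less_iff order.strict_trans zero_less_numeral)
  define g where "g j = Suc j ^ p" for j
  have g1: "1 \<le> g j" for j by (simp add: g_def)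
  have gm: "strict_mono g" unfolding strict_mono_def g_def using p0 by (auto intro!: power_strict_mono)
  have "summable (\<lambda>j. \<integral>\<omega>. \<bar>r (g (Suc j)) \<omega> - r (g j) \<omega>\<bar> \<partial>M)"
  proof (rule summable_comparison_test')
    have "summable (\<lambda>j. 1 / real (Suc j) ^ 2)" using inverse_power_summable[of 2, where ?'a=real] summable_Suc_iff[of "\<lambda>j. 1 / real j ^ 2"]
      by (simp add: inverse_eq_divide)
    then show "summable (\<lambda>j. diversity_rate * (1 / real (Suc j) ^ 2))" by (rule summable_mult)
    fix j :: nat
    have "(\<integral>\<omega>. \<bar>r (g (Suc j)) \<omega> - r (g j) \<omega>\<bar> \<partial>M) \<le> diversity_rate * real (g j) powr (- \<alpha> / 2)"
      using strict_mono_less_eq[OF gm] by (intro r_L1_cauchy g1) auto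
    also have "\<dots> \<le> diversity_rate * (1 / real (Suc j) ^ 2)"
    proof (rule mult_left_mono[OF _ diversity_rate_nonneg])
      have "real (g j) powr (- \<alpha> / 2) = real (Suc j) powr (real p * (- \<alpha> / 2))"
        by (simp add: g_def powr_realpow[symmetric] powr_powr del: of_nat_Suc)
      also have "\<dots> \<le> real (Suc j) powr (- 2)"
        using p \<alpha> by (intro powr_mono) (auto simp: field_simps)
      also have "\<dots> = 1 / real (Suc j) ^ 2" by (simp add: powr_minus_divide powr_numeral del: of_nat_Suc)
      finally show "real (g j) powr (- \<alpha> / 2) \<le> 1 / real (Suc j) ^ 2" .
    qed
    finally show "norm (\<integral>\<omega>. \<bar>r (g (Suc j)) \<omega> - r (g j) \<omega>\<bar> \<partial>M) \<le> diversity_rate * (1 / real (Suc j) ^ 2)"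
      by simp
  qed
  then have "AE \<omega> in M. convergent (\<lambda>j. r (g j) \<omega>)"
    by (intro gp.AE_convergent_of_summable_L1[where X="\<lambda>j. r (g j)"] integrable_r g1)
  moreover have "(\<lambda>n. r n \<omega>) \<longlonglongrightarrow> S \<omega>" if \<omega>: "\<omega> \<in> space M" and cv: "convergent (\<lambda>j. r (g j) \<omega>)" for \<omega>
  proof -
    obtain L where L: "(\<lambda>j. r (g j) \<omega>) \<longlonglongrightarrow> L" using cv by (auto simp: convergent_def)
    have "(\<lambda>n. c 0 n \<omega> / real n powr \<alpha>) \<longlonglongrightarrow> L"
    proof (rule regular_variation_from_subsequence[OF \<alpha>(1) _ c_nonneg gm g1])
      show "c 0 m \<omega> \<le> c 0 n \<omega>" if "1 \<le> m" "m \<le> n" for m n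
        using that(2)
      proof (induction n rule: dec_induct)
        case (step n)
        then show ?case using c_Suc[of n \<omega> 0] that(1) \<omega> by simp
      qed simp
      have "(\<lambda>j. real (Suc (Suc j)) / real (Suc j)) \<longlonglongrightarrow> 1"
      proof -
        have "(\<lambda>j. 1 + inverse (real (Suc j))) \<longlonglongrightarrow> 1 + 0" by (intro tendsto_intros LIMSEQ_inverse_real_of_nat)
        moreover have "1 + inverse (real (Suc j)) = real (Suc (Suc j)) / real (Suc j)" for j by (simp add: field_simps)
        ultimately show ?thesis by simp
      qed
      then have "(\<lambda>j. (real (Suc (Suc j)) / real (Suc j)) ^ p) \<longlonglongrightarrow> 1 ^ p" by (rule tendsto_power)
      then show "(\<lambda>j. real (g (Suc j)) / real (g j)) \<longlonglongrightarrow> 1" by (simp add: g_def power_divide del: of_nat_Suc)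
      show "(\<lambda>j. c 0 (g j) \<omega> / real (g j) powr \<alpha>) \<longlonglongrightarrow> L" using L by (simp add: r_def)
    qed
    then have rL: "(\<lambda>n. r n \<omega>) \<longlonglongrightarrow> L" by (simp add: r_def)
    then have "S \<omega> = L" unfolding S_def alpha_diversity_def S_eq[OF \<omega>] by (rule limI)
    then show ?thesis using rL by simp
  qed
  ultimately show ?thesis by (auto elim!: eventually_mono[rotated] intro: AE_mp)
qed

lemma S_measurable_G: "S \<in> borel_measurable G"
proof -
  have m: "(\<lambda>\<omega>. real n powr (- \<alpha>) * real (card (\<pi> n \<omega>))) \<in> borel_measurable G" for n
  proof (cases "n = 0")
    case True
    have "(\<lambda>\<omega>. real n powr (- \<alpha>) * real (card (\<pi> n \<omega>))) = (\<lambda>_. 0)" unfolding True by (intro ext) simp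
    then show ?thesis by (simp only: borel_measurable_const)
  next
    case False
    then have n: "1 \<le> n" by simp
    have fG: "(\<lambda>\<omega>. f (\<pi> n \<omega>)) \<in> borel_measurable G" for f :: "nat set set \<Rightarrow> real" by (rule measurable_G_pi_fun[OF n])
    have "(\<lambda>\<omega>. real (card (\<pi> n \<omega>))) \<in> borel_measurable G" by (rule fG)
    then show ?thesis by (intro borel_measurable_times borel_measurable_const)
  qed
  show ?thesis unfolding S_def alpha_diversity_def[abs_def] by (rule borel_measurable_lim_metric[OF m])
qed

lemma S_measurable: "S \<in> borel_measurable M"
  by (rule measurable_from_subalg[OF subalgebra_G S_measurable_G])

lemma r_L1_limit:
  assumes m: "1 \<le> m"
  shows "integrable M (\<lambda>\<omega>. r m \<omega> - S \<omega>)" "(\<integral>\<omega>. \<bar>r m \<omega> - S \<omega>\<bar> \<partial>M) \<le> diversity_rate * real m powr (- \<alpha> / 2)"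
proof -
  have [measurable]: "S \<in> borel_measurable M" by (rule S_measurable)
  have rm: "r n \<in> borel_measurable M" if "1 \<le> n" for n using integrable_r[OF that] by auto
  note [measurable] = rm[OF m]
  have rms[measurable]: "r (Suc n) \<in> borel_measurable M" for n by (rule rm) simp
  let ?C = "diversity_rate * real m powr (- \<alpha> / 2)"
  have C: "0 \<le> ?C" using diversity_rate_nonneg by simp
  have "(\<integral>\<^sup>+\<omega>. ennreal \<bar>r m \<omega> - S \<omega>\<bar> \<partial>M) = (\<integral>\<^sup>+\<omega>. liminf (\<lambda>n. ennreal \<bar>r m \<omega> - r (Suc n) \<omega>\<bar>) \<partial>M)"
  proof (rule nn_integral_cong_AE)
    show "AE \<omega> in M. ennreal \<bar>r m \<omega> - S \<omega>\<bar> = liminf (\<lambda>n. ennreal \<bar>r m \<omega> - r (Suc n) \<omega>\<bar>)"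
      using AE_r_tendsto
    proof eventually_elim
      case (elim \<omega>)
      have "(\<lambda>n. ennreal \<bar>r m \<omega> - r (Suc n) \<omega>\<bar>) \<longlonglongrightarrow> ennreal \<bar>r m \<omega> - S \<omega>\<bar>"
        by (intro tendsto_ennrealI tendsto_intros LIMSEQ_Suc elim)
      then show ?case by (rule lim_imp_Liminf[OF trivial_limit_sequentially, symmetric])
    qed
  qed
  also have "\<dots> \<le> liminf (\<lambda>n. \<integral>\<^sup>+\<omega>. ennreal \<bar>r m \<omega> - r (Suc n) \<omega>\<bar> \<partial>M)"
    by (rule nn_integral_liminf) measurable
  also have "\<dots> \<le> ennreal ?C"
  proof (rule order_trans[OF Liminf_le_Limsup], simp, rule Limsup_bounded)
    show "\<forall>\<^sub>F n in sequentially. (\<integral>\<^sup>+\<omega>. ennreal \<bar>r m \<omega> - r (Suc n) \<omega>\<bar> \<partial>M) \<le> ennreal ?C"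
      using eventually_ge_at_top[of m]
    proof eventually_elim
      case (elim n)
      have "(\<integral>\<^sup>+\<omega>. ennreal \<bar>r m \<omega> - r (Suc n) \<omega>\<bar> \<partial>M) = ennreal (\<integral>\<omega>. \<bar>r m \<omega> - r (Suc n) \<omega>\<bar> \<partial>M)"
        using integrable_r[OF m] integrable_r[of "Suc n"] by (intro nn_integral_eq_integral) auto
      also have "\<dots> \<le> ennreal ?C"
        using r_L1_cauchy[OF m, of "Suc n"] elim by (intro ennreal_leI) (simp add: abs_minus_commute)
      finally show ?case .
    qed
  qed
  finally have le: "(\<integral>\<^sup>+\<omega>. ennreal \<bar>r m \<omega> - S \<omega>\<bar> \<partial>M) \<le> ennreal ?C" .
  show i: "integrable M (\<lambda>\<omega>. r m \<omega> - S \<omega>)"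
  proof (rule integrableI_bounded)
    show "(\<integral>\<^sup>+\<omega>. ennreal (norm (r m \<omega> - S \<omega>)) \<partial>M) < \<infinity>"
      using le_less_trans[OF le ennreal_less_top] by simp
  qed measurable
  show "(\<integral>\<omega>. \<bar>r m \<omega> - S \<omega>\<bar> \<partial>M) \<le> ?C"
  proof -
    have "(\<integral>\<^sup>+\<omega>. ennreal \<bar>r m \<omega> - S \<omega>\<bar> \<partial>M) = ennreal (\<integral>\<omega>. \<bar>r m \<omega> - S \<omega>\<bar> \<partial>M)"
      by (rule nn_integral_eq_integral[OF integrable_abs[OF i]]) simp
    then show ?thesis using le C by (simp only: ennreal_le_iff)
  qed
qed

lemma integrable_S: "integrable M S"
  using Bochner_Integration.integrable_diff[OF integrable_r[of 1] r_L1_limit(1)[of 1]] by simp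

end


section \<open>Positivity of the \<open>\<alpha>\<close>-diversity\<close>

context bounded_gibbs
begin

lemma c0_mono: assumes "1 \<le> m" "m \<le> n" "\<omega> \<in> space M" shows "c 0 m \<omega> \<le> c 0 n \<omega>"
  using assms(2)
proof (induction n rule: dec_induct)
  case (step n)
  then show ?case using c_Suc[of n \<omega> 0] assms by simp
qed simp

lemma measurable_F_c: "c j n \<in> borel_measurable (F n)"
  unfolding c_def by (rule measurable_F_pi_fun[where f="\<lambda>P. real (blocks_larger j P)"])

lemma weighted_step:
  assumes n: "1 \<le> n" and W: "W \<in> borel_measurable (F n)"
  shows "(\<integral>\<omega>. W \<omega> * f (c 0 (Suc n) \<omega>) \<partial>M)
    = (\<integral>\<omega>. W \<omega> * (f (c 0 n \<omega>) - p_new n (card (\<pi> n \<omega>)) * (f (c 0 n \<omega>) - f (c 0 n \<omega> + 1))) \<partial>M)"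
proof -
  obtain \<phi> where \<phi>: "\<And>\<omega>. \<omega> \<in> space M \<Longrightarrow> W \<omega> = \<phi> (\<pi> n \<omega>)" using F_factor[OF W] by blast
  let ?y = "\<lambda>P. f (real (blocks_larger 0 P))" and ?x = "\<lambda>P. f (real (blocks_larger 0 P) + 1)"
  have "(\<integral>\<omega>. W \<omega> * f (c 0 (Suc n) \<omega>) \<partial>M)
     = (\<integral>\<omega>. \<phi> (\<pi> n \<omega>) * (?y (\<pi> n \<omega>) - (?y (\<pi> n \<omega>) - ?x (\<pi> n \<omega>)) * of_bool (s (Suc n) \<omega> = 0)) \<partial>M)"
  proof (rule Bochner_Integration.integral_cong[OF refl])
    fix \<omega> assume \<omega>: "\<omega> \<in> space M"
    show "W \<omega> * f (c 0 (Suc n) \<omega>) = \<phi> (\<pi> n \<omega>) * (?y (\<pi> n \<omega>) - (?y (\<pi> n \<omega>) - ?x (\<pi> n \<omega>)) * of_bool (s (Suc n) \<omega> = 0))"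
      unfolding c_Suc[OF n \<omega>] \<phi>[OF \<omega>] by (cases "s (Suc n) \<omega> = 0") (simp_all add: c_def)
  qed
  also have "\<dots> = (\<integral>\<omega>. step_mean n (\<pi> n \<omega>) (\<lambda>j. \<phi> (\<pi> n \<omega>) * (?y (\<pi> n \<omega>) - (?y (\<pi> n \<omega>) - ?x (\<pi> n \<omega>)) * of_bool (j = 0))) \<partial>M)"
    by (rule step_expectation[OF n, where H="\<lambda>P j. \<phi> P * (?y P - (?y P - ?x P) * of_bool (j = 0))"])
  also have "\<dots> = (\<integral>\<omega>. W \<omega> * (f (c 0 n \<omega>) - p_new n (card (\<pi> n \<omega>)) * (f (c 0 n \<omega>) - f (c 0 n \<omega> + 1))) \<partial>M)"
  proof (rule Bochner_Integration.integral_cong[OF refl])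
    fix \<omega> assume \<omega>: "\<omega> \<in> space M"
    let ?P = "\<pi> n \<omega>"
    have e: "(\<lambda>j. ?y ?P - (?y ?P - ?x ?P) * of_bool (j = 0)) = (\<lambda>j. ?y ?P + (- (?y ?P - ?x ?P)) * of_bool (j = 0))" by auto
    show "step_mean n ?P (\<lambda>j. \<phi> ?P * (?y ?P - (?y ?P - ?x ?P) * of_bool (j = 0)))
        = W \<omega> * (f (c 0 n \<omega>) - p_new n (card ?P) * (f (c 0 n \<omega>) - f (c 0 n \<omega> + 1)))"
      unfolding cond_mult e cond_add cond_const[OF n part[OF n \<omega>]] cond_new[OF n \<omega>] \<phi>[OF \<omega>] c_def by (simp add: algebra_simps)
  qed
  finally show ?thesis .
qed

text \<open>With a single block, a second one is created with probability at least \<open>(lo +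
  \<alpha>) / n\<close>, and these probabilities have a divergent sum.\<close>
lemma single_block_prob: assumes "1 \<le> n" shows "(\<integral>\<omega>. of_bool (c 0 n \<omega> < 2) \<partial>M) \<le> real n powr (- (lo + \<alpha>))"
proof -
  let ?q = "\<lambda>n. (\<integral>\<omega>. of_bool (c 0 n \<omega> < 2) \<partial>M) :: real"
  have \<kappa>: "0 < lo + \<alpha>" using lo by simp
  have "?q n \<le> exp (- (lo + \<alpha>) * (\<Sum>i\<in>{1..<n}. 1 / real i))"
    using assms
  proof (induction n rule: nat_induct_at_least)
    case base
    show ?case by (rule gp.integral_le_const) (auto intro!: gp.integrable_const_bound[where B=1] measurable_pi_fun simp: c_def)
  next
    case (Suc n)
    have n0: "0 < real n + lo" using factor_pos(2)[of lo n] Suc(1) by simp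
    have "?q (Suc n) = (\<integral>\<omega>. 1 * (of_bool (c 0 n \<omega> < 2) - p_new n (card (\<pi> n \<omega>)) * (of_bool (c 0 n \<omega> < 2) - of_bool (c 0 n \<omega> + 1 < 2))) \<partial>M)"
      using weighted_step[OF Suc(1), of "\<lambda>_. 1" "\<lambda>x. of_bool (x < 2)"] by simp
    also have "\<dots> \<le> (\<integral>\<omega>. (1 - (lo + \<alpha>) * (1 / real n)) * of_bool (c 0 n \<omega> < 2) \<partial>M)"
    proof (rule integral_mono)
      show "integrable M (\<lambda>\<omega>. 1 * (of_bool (c 0 n \<omega> < 2) - p_new n (card (\<pi> n \<omega>)) * (of_bool (c 0 n \<omega> < 2) - of_bool (c 0 n \<omega> + 1 < 2))) :: real)"
        unfolding c_def by (rule integrable_pi_fun[OF Suc(1), where f="\<lambda>P. 1 * (of_bool (real (blocks_larger 0 P) < 2) - p_new n (card P) * (of_bool (real (blocks_larger 0 P) < 2) - of_bool (real (blocks_larger 0 P) + 1 < 2)))"])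
      show "integrable M (\<lambda>\<omega>. (1 - (lo + \<alpha>) * (1 / real n)) * of_bool (c 0 n \<omega> < 2))"
        unfolding c_def by (rule integrable_pi_fun[OF Suc(1), where f="\<lambda>P. (1 - (lo + \<alpha>) * (1 / real n)) * of_bool (real (blocks_larger 0 P) < 2)"])
      fix \<omega> assume \<omega>: "\<omega> \<in> space M"
      note k = partition_blocks(8,9)[OF part[OF Suc(1) \<omega>]]
      have "(lo + \<alpha>) * (1 / real n) \<le> p_new n (card (\<pi> n \<omega>))"
      proof -
        have "(lo + \<alpha>) / real n \<le> (lo + real (card (\<pi> n \<omega>)) * \<alpha>) / (real n + lo)"
        proof (rule frac_le)
          have "1 * \<alpha> \<le> real (card (\<pi> n \<omega>)) * \<alpha>" using k Suc(1) \<alpha> by (intro mult_right_mono) auto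
          then show "lo + \<alpha> \<le> lo + real (card (\<pi> n \<omega>)) * \<alpha>" "0 \<le> lo + real (card (\<pi> n \<omega>)) * \<alpha>" using \<kappa> by linarith+
        qed (use n0 lo in auto)
        also have "\<dots> \<le> p_new n (card (\<pi> n \<omega>))" using k Suc(1) by (intro p_new_bounds(1)) auto
        finally show ?thesis by simp
      qed
      moreover have "\<not> c 0 n \<omega> + 1 < 2" using c0_bounds(1)[OF Suc(1) \<omega>] by simp
      ultimately show "1 * (of_bool (c 0 n \<omega> < 2) - p_new n (card (\<pi> n \<omega>)) * (of_bool (c 0 n \<omega> < 2) - of_bool (c 0 n \<omega> + 1 < 2)))
          \<le> (1 - (lo + \<alpha>) * (1 / real n)) * of_bool (c 0 n \<omega> < 2)"
        by (cases "c 0 n \<omega> < 2") auto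
    qed
    also have "\<dots> = (1 - (lo + \<alpha>) * (1 / real n)) * ?q n" by simp
    also have "\<dots> \<le> exp (- (lo + \<alpha>) * (1 / real n)) * exp (- (lo + \<alpha>) * (\<Sum>i\<in>{1..<n}. 1 / real i))"
    proof (rule mult_mono[OF _ Suc.IH])
      show "1 - (lo + \<alpha>) * (1 / real n) \<le> exp (- (lo + \<alpha>) * (1 / real n))"
        using exp_ge_add_one_self[of "- (lo + \<alpha>) * (1 / real n)"] by linarith
      show "0 \<le> ?q n" by (intro Bochner_Integration.integral_nonneg) auto
    qed simp
    also have "\<dots> = exp (- (lo + \<alpha>) * (\<Sum>i\<in>{1..<Suc n}. 1 / real i))"
      unfolding exp_add[symmetric] sum.atLeastLessThan_Suc[OF Suc(1)] by (simp add: algebra_simps)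
    finally show ?case .
  qed
  also have "\<dots> \<le> exp (- (lo + \<alpha>) * ln (real n))"
    using mult_left_mono[OF sum_inverse_lower[OF assms], of "lo + \<alpha>"] \<kappa> by simp
  also have "\<dots> = real n powr (- (lo + \<alpha>))" using assms by (simp add: powr_def)
  finally show ?thesis .
qed

text \<open>The shift \<open>b = lo / \<alpha> - 1\<close> is chosen such that a new block appears with
  probability at least \<open>\<alpha> (k + 1 + b) / n\<close> when there are \<open>k\<close>
  blocks. Since \<open>1 / (k + b) - 1 / (k + 1 + b) = 1 / ((k + b) (k + 1 + b))\<close>, the
  mean of \<open>1 / (k + b)\<close> then decreases by the factor \<open>1 - \<alpha> /
  n\<close>. As \<open>b > - 2\<close> only, the shifted count is positive from the second
  block on; hence the restriction to the event that two blocks are present at time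
  \<open>m\<close>.\<close>
lemma inverse_block_moment:
  assumes m: "1 \<le> m"
  obtains B where "0 \<le> B" "\<And>n. m \<le> n \<Longrightarrow> (\<integral>\<omega>. of_bool (2 \<le> c 0 m \<omega>) * (1 / (c 0 n \<omega> + (lo / \<alpha> - 1))) \<partial>M) \<le> B * real n powr (- \<alpha>)"
proof -
  define b where "b = lo / \<alpha> - 1"
  have b: "0 < 2 + b" using lo \<alpha> by (simp add: b_def field_simps)
  let ?W = "\<lambda>\<omega>. of_bool (2 \<le> c 0 m \<omega>) :: real"
  let ?X = "\<lambda>n. \<integral>\<omega>. ?W \<omega> * (1 / (c 0 n \<omega> + b)) \<partial>M"
  have WF: "?W \<in> borel_measurable (F n)" if "m \<le> n" for n
    using measurable_from_subalg[OF F_mono[OF m that] measurable_F_c[of 0 m]] by measurable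
  have Wi: "integrable M (\<lambda>\<omega>. ?W \<omega> * f (\<pi> n \<omega>))" if "m \<le> n" for n and f :: "nat set set \<Rightarrow> real"
  proof -
    have n1: "1 \<le> n" using m that by simp
    have i: "integrable M (\<lambda>\<omega>. f (\<pi> n \<omega>))" by (rule integrable_pi_fun[OF n1])
    have [measurable]: "?W \<in> borel_measurable M" by (rule measurable_from_subalg[OF subalgebra_F[OF m] WF[OF order_refl]])
    have [measurable]: "(\<lambda>\<omega>. f (\<pi> n \<omega>)) \<in> borel_measurable M" using i by (rule borel_measurable_integrable)
    have [measurable]: "(\<lambda>\<omega>. ?W \<omega> * f (\<pi> n \<omega>)) \<in> borel_measurable M" by (rule borel_measurable_times; fact)
    show ?thesis by (rule Bochner_Integration.integrable_bound[OF i]) (simp, simp add: of_bool_def)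
  qed
  have main: "?X n \<le> 1 / (2 + b) * exp (- \<alpha> * (\<Sum>i\<in>{m..<n}. 1 / real i))" if "m \<le> n" for n
    using that
  proof (induction n rule: dec_induct)
    case base
    have "?X m \<le> 1 / (2 + b)"
    proof (rule gp.integral_le_const)
      show "integrable M (\<lambda>\<omega>. ?W \<omega> * (1 / (c 0 m \<omega> + b)))"
        using Wi[OF order_refl, of "\<lambda>P. 1 / (real (blocks_larger 0 P) + b)"] by (simp only: c_def)
      show "AE \<omega> in M. ?W \<omega> * (1 / (c 0 m \<omega> + b)) \<le> 1 / (2 + b)"
        using b by (intro AE_I2) (auto simp: of_bool_def intro!: divide_left_mono)
    qed
    then show ?case by simp
  next
    case (step n)
    have n: "1 \<le> n" using m step.hyps by simp
    have n0: "0 < real n + lo" using factor_pos(2)[of lo n] n by simp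
    have "?X (Suc n) = (\<integral>\<omega>. ?W \<omega> * (1 / (c 0 n \<omega> + b) - p_new n (card (\<pi> n \<omega>)) * (1 / (c 0 n \<omega> + b) - 1 / (c 0 n \<omega> + 1 + b))) \<partial>M)"
      by (rule weighted_step[OF n WF[OF step.hyps(1)], where f="\<lambda>x. 1 / (x + b)"])
    also have "\<dots> \<le> (\<integral>\<omega>. (1 - \<alpha> * (1 / real n)) * (?W \<omega> * (1 / (c 0 n \<omega> + b))) \<partial>M)"
    proof (rule integral_mono)
      show "integrable M (\<lambda>\<omega>. ?W \<omega> * (1 / (c 0 n \<omega> + b) - p_new n (card (\<pi> n \<omega>)) * (1 / (c 0 n \<omega> + b) - 1 / (c 0 n \<omega> + 1 + b))))"
        using Wi[OF step.hyps(1), of "\<lambda>P. 1 / (real (blocks_larger 0 P) + b) - p_new n (card P) * (1 / (real (blocks_larger 0 P) + b) - 1 / (real (blocks_larger 0 P) + 1 + b))"]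
        by (simp only: c_def)
      show "integrable M (\<lambda>\<omega>. (1 - \<alpha> * (1 / real n)) * (?W \<omega> * (1 / (c 0 n \<omega> + b))))"
        using Wi[OF step.hyps(1), of "\<lambda>P. 1 / (real (blocks_larger 0 P) + b)"] by (simp only: c_def integrable_mult_right)
      fix \<omega> assume \<omega>: "\<omega> \<in> space M"
      show "?W \<omega> * (1 / (c 0 n \<omega> + b) - p_new n (card (\<pi> n \<omega>)) * (1 / (c 0 n \<omega> + b) - 1 / (c 0 n \<omega> + 1 + b)))
          \<le> (1 - \<alpha> * (1 / real n)) * (?W \<omega> * (1 / (c 0 n \<omega> + b)))"
      proof (cases "2 \<le> c 0 m \<omega>")
        case True
        let ?k = "c 0 n \<omega>" and ?p = "p_new n (card (\<pi> n \<omega>))"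
        have k2: "2 \<le> ?k" using True c0_mono[OF m step.hyps(1) \<omega>] by linarith
        then have kb: "0 < ?k + b" "0 < ?k + 1 + b" using b by auto
        note kk = partition_blocks(8,9)[OF part[OF n \<omega>]]
        have "\<alpha> * (?k + 1 + b) = lo + real (card (\<pi> n \<omega>)) * \<alpha>"
          unfolding c0_eq_card[OF n \<omega>] b_def using \<alpha> by (simp add: field_simps)
        then have "\<alpha> * (?k + 1 + b) / (real n + lo) = (lo + real (card (\<pi> n \<omega>)) * \<alpha>) / (real n + lo)" by (simp only:)
        also have "\<dots> \<le> ?p" using kk n by (intro p_new_bounds(1)) auto
        finally have pl: "\<alpha> * (?k + 1 + b) / (real n + lo) \<le> ?p" .
        have "\<alpha> * (?k + 1 + b) / real n \<le> \<alpha> * (?k + 1 + b) / (real n + lo)"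
          using n0 lo kb \<alpha> n by (intro divide_left_mono mult_nonneg_nonneg mult_pos_pos) auto
        then have "\<alpha> * (?k + 1 + b) / real n \<le> ?p" using pl by linarith
        then have a: "\<alpha> * (1 / real n) \<le> ?p * (1 / (?k + 1 + b))" using kb by (simp add: field_simps)
        have "1 / (?k + b) - 1 / (?k + 1 + b) = 1 / (?k + b) * (1 / (?k + 1 + b))" using kb by (simp add: field_simps)
        moreover have "y - ?p * (y * z) = (1 - ?p * z) * y" for y z by (simp add: algebra_simps)
        ultimately have "1 / (?k + b) - ?p * (1 / (?k + b) - 1 / (?k + 1 + b)) = (1 - ?p * (1 / (?k + 1 + b))) * (1 / (?k + b))"
          by (simp only:)
        also have "\<dots> \<le> (1 - \<alpha> * (1 / real n)) * (1 / (?k + b))" using a kb by (intro mult_right_mono) auto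
        finally show ?thesis using True by simp
      qed simp
    qed
    also have "\<dots> = (1 - \<alpha> * (1 / real n)) * ?X n" by (rule integral_mult_right_zero)
    also have "\<dots> \<le> exp (- \<alpha> * (1 / real n)) * (1 / (2 + b) * exp (- \<alpha> * (\<Sum>i\<in>{m..<n}. 1 / real i)))"
    proof (rule mult_mono[OF _ step.IH])
      show "1 - \<alpha> * (1 / real n) \<le> exp (- \<alpha> * (1 / real n))"
        using exp_ge_add_one_self[of "- \<alpha> * (1 / real n)"] by linarith
      show "0 \<le> ?X n"
      proof (intro Bochner_Integration.integral_nonneg)
        fix \<omega> assume \<omega>: "\<omega> \<in> space M"
        show "0 \<le> ?W \<omega> * (1 / (c 0 n \<omega> + b))" using b c0_mono[OF m step.hyps(1) \<omega>] by (cases "2 \<le> c 0 m \<omega>") auto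
      qed
    qed simp
    also have "\<dots> = 1 / (2 + b) * exp (- \<alpha> * (\<Sum>i\<in>{m..<Suc n}. 1 / real i))"
      unfolding sum.atLeastLessThan_Suc[OF step.hyps(1)] distrib_left exp_add by simp
    finally show ?case .
  qed
  let ?B = "1 / (2 + b) * exp (\<alpha> * (1 + ln (real m)))"
  have "?X n \<le> ?B * real n powr (- \<alpha>)" if mn: "m \<le> n" for n
  proof -
    have n: "1 \<le> n" using m mn by simp
    have split: "(\<Sum>i\<in>{1..<n}. 1 / real i) = (\<Sum>i\<in>{1..<m}. 1 / real i) + (\<Sum>i\<in>{m..<n}. 1 / real i)"
      using sum.atLeastLessThan_concat[OF m mn, of "\<lambda>i. 1 / real i"] by simp
    have "ln (real n) - (1 + ln (real m)) \<le> (\<Sum>i\<in>{m..<n}. 1 / real i)"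
      using sum_inverse_upper[OF m] sum_inverse_lower[OF n] split by linarith
    then have "\<alpha> * (ln (real n) - (1 + ln (real m))) \<le> \<alpha> * (\<Sum>i\<in>{m..<n}. 1 / real i)" using \<alpha> by (intro mult_left_mono) auto
    then have "- \<alpha> * (\<Sum>i\<in>{m..<n}. 1 / real i) \<le> \<alpha> * (1 + ln (real m)) + (- \<alpha>) * ln (real n)" by (simp add: algebra_simps)
    then have "exp (- \<alpha> * (\<Sum>i\<in>{m..<n}. 1 / real i)) \<le> exp (\<alpha> * (1 + ln (real m))) * real n powr (- \<alpha>)"
      using n by (simp add: powr_def exp_add[symmetric])
    then have "1 / (2 + b) * exp (- \<alpha> * (\<Sum>i\<in>{m..<n}. 1 / real i)) \<le> 1 / (2 + b) * (exp (\<alpha> * (1 + ln (real m))) * real n powr (- \<alpha>))"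
      using b by (intro mult_left_mono) auto
    then show ?thesis using main[OF mn] by (simp only: mult.assoc)
  qed
  note bound = this
  show ?thesis
  proof (rule that[of ?B])
    show "0 \<le> ?B" using b by simp
  qed (unfold b_def, rule bound[unfolded b_def])
qed

lemma tendsto_powr_neg: "0 < a \<Longrightarrow> (\<lambda>n. real n powr (- a)) \<longlonglongrightarrow> 0"
  by (rule tendsto_neg_powr) (auto simp: filterlim_real_sequentially)

text \<open>If \<open>S \<le> 0\<close>, then either \<open>r n\<close> is small, so that the inverse
  moment is large, or \<open>r n\<close> is far from its limit. Both are unlikely by
  \<open>inverse_block_moment\<close> and \<open>r_L1_limit\<close>, with a threshold
  \<open>e\<close> that is sent to 0 after \<open>n\<close> has been sent to infinity.\<close>
lemma AE_S_pos: "AE \<omega> in M. 0 < S \<omega>"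
proof -
  have [measurable]: "S \<in> borel_measurable M" by (rule S_measurable)
  have cM: "c 0 n \<in> borel_measurable M" if "1 \<le> n" for n using integrable_c[OF that] by auto
  have pos_after: "AE \<omega> in M. \<not> (2 \<le> c 0 m \<omega> \<and> S \<omega> \<le> 0)" if m: "1 \<le> m" for m
  proof -
    note [measurable] = cM[OF m]
    let ?A = "{\<omega> \<in> space M. 2 \<le> c 0 m \<omega> \<and> S \<omega> \<le> 0}"
    have Am[measurable]: "?A \<in> gp.events" by measurable
    obtain B where B: "0 \<le> B" "\<And>n. m \<le> n \<Longrightarrow> (\<integral>\<omega>. of_bool (2 \<le> c 0 m \<omega>) * (1 / (c 0 n \<omega> + (lo / \<alpha> - 1))) \<partial>M) \<le> B * real n powr (- \<alpha>)"
      by (fact inverse_block_moment[OF m])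
    have est: "gp.prob ?A \<le> e * B + diversity_rate * real n powr (- (\<alpha> / 2)) / e" if e: "0 < e" and mn: "m \<le> n" for e n
    proof -
      have n: "1 \<le> n" using m mn by simp
      have npos: "0 < real n powr \<alpha>" using n by simp
      note [measurable] = cM[OF n]
      let ?Y = "\<lambda>\<omega>. of_bool (2 \<le> c 0 m \<omega>) * (1 / (c 0 n \<omega> + (lo / \<alpha> - 1))) :: real"
      have b: "0 < 2 + (lo / \<alpha> - 1)" "lo / \<alpha> - 1 \<le> 0" using lo \<alpha> by (auto simp: field_simps)
      have Y0: "0 \<le> ?Y \<omega>" if "\<omega> \<in> space M" for \<omega> using b c0_mono[OF m mn that] by (cases "2 \<le> c 0 m \<omega>") auto
      have Yi: "integrable M ?Y"
      proof (rule gp.integrable_const_bound[where B="1 / (2 + (lo / \<alpha> - 1))"])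
        show "AE \<omega> in M. norm (?Y \<omega>) \<le> 1 / (2 + (lo / \<alpha> - 1))"
        proof (rule AE_I2)
          fix \<omega> assume \<omega>: "\<omega> \<in> space M"
          have "?Y \<omega> \<le> 1 / (2 + (lo / \<alpha> - 1))"
            using b c0_mono[OF m mn \<omega>] by (cases "2 \<le> c 0 m \<omega>") (auto intro!: divide_left_mono mult_pos_pos)
          then show "norm (?Y \<omega>) \<le> 1 / (2 + (lo / \<alpha> - 1))" 
            unfolding real_norm_def abs_of_nonneg[OF Y0[OF \<omega>]] .
        qed
      qed measurable
      have "gp.prob ?A = (\<integral>\<omega>. indicator ?A \<omega> \<partial>M)" by simp
      also have "\<dots> \<le> (\<integral>\<omega>. e * real n powr \<alpha> * ?Y \<omega> + \<bar>r n \<omega> - S \<omega>\<bar> / e \<partial>M)"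
      proof (rule integral_mono)
        show "integrable M (indicator ?A :: 'a \<Rightarrow> real)" by (simp add: gp.emeasure_eq_measure)
        show "integrable M (\<lambda>\<omega>. e * real n powr \<alpha> * ?Y \<omega> + \<bar>r n \<omega> - S \<omega>\<bar> / e)"
          using Yi r_L1_limit(1)[OF n] by (intro Bochner_Integration.integrable_add integrable_mult_right integrable_divide integrable_abs)
        fix \<omega> assume \<omega>: "\<omega> \<in> space M"
        show "indicator ?A \<omega> \<le> e * real n powr \<alpha> * ?Y \<omega> + \<bar>r n \<omega> - S \<omega>\<bar> / e"
        proof (cases "\<omega> \<in> ?A")
          case True
          then have A: "2 \<le> c 0 m \<omega>" "S \<omega> \<le> 0" by auto
          then have c2: "2 \<le> c 0 n \<omega>" using c0_mono[OF m mn \<omega>] by linarith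
          show ?thesis
          proof (cases "r n \<omega> \<le> e")
            case True
            then have "c 0 n \<omega> \<le> e * real n powr \<alpha>" using npos by (simp add: r_def field_simps)
            then have "1 \<le> e * real n powr \<alpha> * (1 / c 0 n \<omega>)" using c2 by (simp add: field_simps)
            also have "\<dots> \<le> e * real n powr \<alpha> * (1 / (c 0 n \<omega> + (lo / \<alpha> - 1)))"
              using e npos c2 b by (intro mult_left_mono divide_left_mono mult_pos_pos) auto
            finally have "1 \<le> e * real n powr \<alpha> * ?Y \<omega>" using A by simp
            moreover have "0 \<le> \<bar>r n \<omega> - S \<omega>\<bar> / e" using e by simp
            ultimately show ?thesis using \<open>\<omega> \<in> ?A\<close> by simp
          next
            case False
            then have "1 \<le> \<bar>r n \<omega> - S \<omega>\<bar> / e" using A e by (simp add: field_simps)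
            moreover have "0 \<le> e * real n powr \<alpha> * ?Y \<omega>" by (rule mult_nonneg_nonneg[OF mult_nonneg_nonneg[OF less_imp_le[OF e] less_imp_le[OF npos]] Y0[OF \<omega>]])
            ultimately show ?thesis using \<open>\<omega> \<in> ?A\<close> by simp
          qed
        next
          case False
          have "0 \<le> e * real n powr \<alpha> * ?Y \<omega>" by (rule mult_nonneg_nonneg[OF mult_nonneg_nonneg[OF less_imp_le[OF e] less_imp_le[OF npos]] Y0[OF \<omega>]])
          then show ?thesis using False e by simp
        qed
      qed
      also have "\<dots> = e * real n powr \<alpha> * (\<integral>\<omega>. ?Y \<omega> \<partial>M) + (\<integral>\<omega>. \<bar>r n \<omega> - S \<omega>\<bar> \<partial>M) / e"
        by (simp only: Bochner_Integration.integral_add[OF integrable_mult_right[OF Yi] integrable_divide[OF integrable_abs[OF r_L1_limit(1)[OF n]]]]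
            integral_mult_right_zero integral_divide_zero)
      also have "\<dots> \<le> e * real n powr \<alpha> * (B * real n powr (- \<alpha>)) + (diversity_rate * real n powr (- \<alpha> / 2)) / e"
        using B(2)[OF mn] r_L1_limit(2)[OF n] e npos by (intro add_mono mult_left_mono divide_right_mono) auto
      also have "\<dots> = e * B + diversity_rate * real n powr (- (\<alpha> / 2)) / e"
        using npos by (simp add: powr_minus_divide)
      finally show ?thesis .
    qed
    have "gp.prob ?A \<le> e * B" if e: "0 < e" for e
    proof (rule LIMSEQ_le_const)
      have "(\<lambda>n. e * B + diversity_rate * real n powr (- (\<alpha> / 2)) / e) \<longlonglongrightarrow> e * B + diversity_rate * 0 / e"
        using \<alpha> e by (intro tendsto_intros tendsto_powr_neg) auto
      then show "(\<lambda>n. e * B + diversity_rate * real n powr (- (\<alpha> / 2)) / e) \<longlonglongrightarrow> e * B" by simp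
      show "\<exists>N. \<forall>n\<ge>N. gp.prob ?A \<le> e * B + diversity_rate * real n powr (- (\<alpha> / 2)) / e" using est[OF e] by blast
    qed
    then have le: "gp.prob ?A \<le> e * B" if "0 < e" for e using that .
    have "gp.prob ?A \<le> 0"
    proof (rule field_le_epsilon)
      fix e :: real assume "0 < e"
      then have "gp.prob ?A \<le> e / (B + 1) * B" using B(1) by (intro le) auto
      also have "\<dots> \<le> e" using B(1) \<open>0 < e\<close> by (simp add: field_simps)
      finally show "gp.prob ?A \<le> 0 + e" by simp
    qed
    then have "gp.prob ?A = 0" using measure_nonneg[of M ?A] by linarith
    then have "AE \<omega> in M. \<omega> \<notin> ?A" using gp.prob_eq_0[OF Am] by simp
    then show ?thesis using AE_space by eventually_elim simp
  qed
  have "AE \<omega> in M. \<not> (\<forall>n. c 0 (Suc n) \<omega> < 2)"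
  proof -
    note [measurable] = cM[of "Suc _", simplified]
    let ?A = "{\<omega> \<in> space M. \<forall>n. c 0 (Suc n) \<omega> < 2}"
    have Am[measurable]: "?A \<in> gp.events" by measurable
    have "gp.prob ?A \<le> real (Suc n) powr (- (lo + \<alpha>))" for n
    proof -
      have "gp.prob ?A = (\<integral>\<omega>. indicator ?A \<omega> \<partial>M)" by simp
      also have "\<dots> \<le> (\<integral>\<omega>. of_bool (c 0 (Suc n) \<omega> < 2) \<partial>M)"
        by (intro integral_mono) (auto simp: gp.emeasure_eq_measure indicator_def intro!: gp.integrable_const_bound[where B=1])
      also have "\<dots> \<le> real (Suc n) powr (- (lo + \<alpha>))" by (rule single_block_prob) simp
      finally show ?thesis .
    qed
    then have "gp.prob ?A \<le> 0"
      using lo by (intro LIMSEQ_le_const[OF LIMSEQ_Suc[OF tendsto_powr_neg[of "lo + \<alpha>"]]]) auto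
    then have "gp.prob ?A = 0" using measure_nonneg[of M ?A] by linarith
    then have "AE \<omega> in M. \<omega> \<notin> ?A" using gp.prob_eq_0[OF Am] by simp
    then show ?thesis using AE_space by eventually_elim simp
  qed
  moreover have "AE \<omega> in M. \<forall>n. \<not> (2 \<le> c 0 (Suc n) \<omega> \<and> S \<omega> \<le> 0)"
    unfolding AE_all_countable using pos_after by simp
  ultimately show ?thesis
  proof eventually_elim
    case (elim \<omega>)
    then obtain n where "\<not> c 0 (Suc n) \<omega> < 2" by blast
    then have "\<not> S \<omega> \<le> 0" using elim(2) by (auto simp: not_less)
    then show ?case by simp
  qed
qed

end


section \<open>Proportions of blocks by size\<close>

text \<open>Dominated convergence for series, also known as Tannery's theorem.\<close>
lemma weighted_sum_tendsto_zero:
  fixes e :: "nat \<Rightarrow> nat \<Rightarrow> real" and \<beta> :: "nat \<Rightarrow> real"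
  assumes \<beta>: "summable \<beta>" "\<And>j. 0 \<le> \<beta> j"
    and e: "\<And>j. (\<lambda>n. e j n) \<longlonglongrightarrow> 0" "\<And>j n. 0 \<le> e j n" "\<And>j n. e j n \<le> K"
  shows "(\<lambda>n. \<Sum>j<n. \<beta> j * e j n) \<longlonglongrightarrow> 0"
proof -
  have "(\<lambda>n. \<Sum>j. if j < n then \<beta> j * e j n else 0) \<longlonglongrightarrow> (\<Sum>j. 0)"
  proof (rule tannerys_theorem[where M="\<lambda>j. K * \<beta> j", THEN conjunct2, THEN conjunct2])
    show "((\<lambda>n. if j < n then \<beta> j * e j n else 0) \<longlongrightarrow> 0) sequentially" for j
    proof (rule Lim_transform_eventually)
      have "(\<lambda>n. \<beta> j * e j n) \<longlonglongrightarrow> \<beta> j * 0" by (intro tendsto_intros e(1))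
      then show "(\<lambda>n. \<beta> j * e j n) \<longlonglongrightarrow> 0" by simp
      show "\<forall>\<^sub>F n in sequentially. \<beta> j * e j n = (if j < n then \<beta> j * e j n else 0)"
        using eventually_gt_at_top[of j] by eventually_elim simp
    qed
    show "\<forall>\<^sub>F (j, n) in at_top \<times>\<^sub>F sequentially. norm (if j < n then \<beta> j * e j n else 0) \<le> K * \<beta> j"
    proof (rule always_eventually, clarify)
      fix j n
      have "0 \<le> K" using e(2,3)[of 0 0] by linarith
      then show "norm (if j < n then \<beta> j * e j n else 0) \<le> K * \<beta> j"
        using \<beta>(2)[of j] e(2,3)[of j n] mult_right_mono[OF e(3)[of j n] \<beta>(2)[of j]] by (simp add: abs_mult mult.commute)
    qed
  qed (use \<beta>(1) in auto)
  moreover have "(\<Sum>j. if j < n then \<beta> j * e j n else 0) = (\<Sum>j<n. \<beta> j * e j n)" for n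
    by (subst suminf_finite[of "{..<n}"]) auto
  ultimately show ?thesis by simp
qed

text \<open>Tail of the Sibuya distribution, \<open>\<Sum>i>j. sibuya_prob a i\<close>; as a limit, the
  proportion of blocks larger than \<open>j\<close>.\<close>
definition tail_prob :: "real \<Rightarrow> nat \<Rightarrow> real" where "tail_prob a j = (\<Prod>l\<in>{1..<Suc j}. (real l - a) / real l)"

lemma tail_prob_Suc: "tail_prob a (Suc j) = tail_prob a j * ((real (Suc j) - a) / real (Suc j))"
  by (simp add: tail_prob_def)

lemma tail_prob_0: "tail_prob a 0 = 1" by (simp add: tail_prob_def)

lemma tail_prob_bounds: assumes "0 < a" "a < 1" shows "0 < tail_prob a j" "tail_prob a j \<le> 1"
proof -
  show "0 < tail_prob a j" unfolding tail_prob_def using assms by (intro prod_pos) auto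
  show "tail_prob a j \<le> 1" unfolding tail_prob_def using assms by (intro prod_le_1) auto
qed

context bounded_gibbs
begin

abbreviation T :: "nat \<Rightarrow> real" where "T \<equiv> tail_prob \<alpha>"

lemma cond_join:
  assumes n: "1 \<le> n" and j: "1 \<le> j" and \<omega>: "\<omega> \<in> space M"
  shows "step_mean n (\<pi> n \<omega>) (\<lambda>i. of_bool (i = j)) = w n (card (\<pi> n \<omega>)) * (real j - \<alpha>) * (c (j - 1) n \<omega> - c j n \<omega>)"
proof -
  let ?P = "\<pi> n \<omega>" and ?k = "card (\<pi> n \<omega>)"
  have fP: "finite ?P" by (rule partition_blocks(1)[OF part[OF n \<omega>]])
  have "(\<Sum>U\<in>?P. w n ?k * (real (card U) - \<alpha>) * of_bool (card U = j)) = (\<Sum>U\<in>{U\<in>?P. card U = j}. w n ?k * (real j - \<alpha>))"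
    by (rule sum.mono_neutral_cong_right[OF fP]) auto
  also have "\<dots> = w n ?k * (real j - \<alpha>) * real (card {U\<in>?P. card U = j})" by simp
  also have "real (card {U\<in>?P. card U = j}) = c (j - 1) n \<omega> - c j n \<omega>"
  proof -
    have "{U \<in> ?P. j - 1 < card U} = {U\<in>?P. card U = j} \<union> {U \<in> ?P. j < card U}" using j by auto
    then have "card {U \<in> ?P. j - 1 < card U} = card {U\<in>?P. card U = j} + card {U \<in> ?P. j < card U}"
      by (simp only:) (rule card_Un_disjoint, use fP in auto)
    then show ?thesis unfolding c_def blocks_larger_def by simp
  qed
  finally show ?thesis using j unfolding step_mean_def by simp
qed

text \<open>A weighted Cesaro argument: increments of smaller order than \<open>n powr (\<alpha> -
  1)\<close> add up to smaller order than \<open>n powr \<alpha>\<close>.\<close>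
lemma cesaro_powr:
  assumes y: "\<And>n. N \<le> n \<Longrightarrow> y (Suc n) \<le> y n + \<eta> n * real n powr (\<alpha> - 1)" "\<And>n. 0 \<le> (y n :: real)" and \<eta>: "\<eta> \<longlonglongrightarrow> 0"
  shows "(\<lambda>n. y n / real n powr \<alpha>) \<longlonglongrightarrow> 0"
proof (rule tendsto_by_approximation)
  fix e :: real assume e: "0 < e"
  have "\<forall>\<^sub>F n in sequentially. \<eta> n < e * \<alpha>" using order_tendstoD(2)[OF \<eta>, of "e * \<alpha>"] e \<alpha> by simp
  then obtain N' where N': "\<And>n. N' \<le> n \<Longrightarrow> \<eta> n < e * \<alpha>" unfolding eventually_sequentially by blast
  define m where "m = max (max N N') 1"
  have "y n \<le> y m + e * \<alpha> * (\<Sum>i\<in>{m..<n}. real i powr (\<alpha> - 1))" if "m \<le> n" for n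
    using that
  proof (induction n rule: dec_induct)
    case (step n)
    have "y (Suc n) \<le> y n + \<eta> n * real n powr (\<alpha> - 1)" using y(1)[of n] step.hyps by (simp add: m_def)
    also have "\<eta> n * real n powr (\<alpha> - 1) \<le> e * \<alpha> * real n powr (\<alpha> - 1)"
      using N'[of n] step.hyps by (intro mult_right_mono) (auto simp: m_def)
    finally show ?case using step.IH step.hyps by (simp add: distrib_left)
  qed simp
  moreover have "(\<Sum>i\<in>{m..<n}. real i powr (\<alpha> - 1)) \<le> real n powr \<alpha> / \<alpha>" if "m \<le> n" for n
  proof -
    have "1 \<le> n" using that by (simp add: m_def)
    have "(\<Sum>i\<in>{m..<n}. real i powr (\<alpha> - 1)) \<le> (\<Sum>i\<in>{1..<n}. real i powr (\<alpha> - 1))" by (intro sum_mono2) (auto simp: m_def)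
    then show ?thesis using sum_powr_le[OF \<open>1 \<le> n\<close>] by linarith
  qed
  ultimately have bd: "y n \<le> y m + e * real n powr \<alpha>" if "m \<le> n" for n
  proof -
    have "e * \<alpha> * (\<Sum>i\<in>{m..<n}. real i powr (\<alpha> - 1)) \<le> e * \<alpha> * (real n powr \<alpha> / \<alpha>)"
      using \<open>\<And>n. m \<le> n \<Longrightarrow> (\<Sum>i\<in>{m..<n}. real i powr (\<alpha> - 1)) \<le> real n powr \<alpha> / \<alpha>\<close>[OF that] e \<alpha> by (intro mult_left_mono) auto
    then show ?thesis using \<open>\<And>n. m \<le> n \<Longrightarrow> y n \<le> y m + e * \<alpha> * (\<Sum>i\<in>{m..<n}. real i powr (\<alpha> - 1))\<close>[OF that] \<alpha> by simp
  qed
  show "\<exists>a L. a \<longlonglongrightarrow> L \<and> dist L 0 \<le> e \<and> (\<forall>\<^sub>F n in sequentially. dist (y n / real n powr \<alpha>) (a n) \<le> e)"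
  proof (intro exI conjI)
    have up: "(\<lambda>n. y m * real n powr (- \<alpha>)) \<longlonglongrightarrow> 0" by (rule tendsto_mult_right_zero[OF tendsto_powr_neg[OF \<alpha>(1)]])
    show "(\<lambda>n. min (y n / real n powr \<alpha>) (y m * real n powr (- \<alpha>))) \<longlonglongrightarrow> 0"
      by (rule tendsto_sandwich[OF _ _ tendsto_const up]) (auto simp: y(2))
    show "\<forall>\<^sub>F n in sequentially. dist (y n / real n powr \<alpha>) (min (y n / real n powr \<alpha>) (y m * real n powr (- \<alpha>))) \<le> e"
      using eventually_ge_at_top[of m]
    proof eventually_elim
      case (elim n)
      have "0 < real n powr \<alpha>" using elim by (simp add: m_def)
      then have "y n / real n powr \<alpha> \<le> y m * real n powr (- \<alpha>) + e"
        using bd[OF elim] by (simp add: powr_minus_divide field_simps)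
      then show ?case using e by (auto simp: dist_real_def min_def)
    qed
  qed (use e in simp)
qed

lemma powr_increment: "1 \<le> n \<Longrightarrow> \<bar>real (Suc n) powr \<alpha> - real n powr \<alpha> * (1 + \<alpha> / real n)\<bar> \<le> real n powr (\<alpha> - 1) / real n"
proof -
  assume n: "1 \<le> n"
  have n0: "0 < real n" using n by simp
  have "real (Suc n) = real n * (1 + 1 / real n)" using n0 by (simp add: field_simps)
  then have pw: "real (Suc n) powr \<alpha> = real n powr \<alpha> * (1 + 1 / real n) powr \<alpha>" using n0 by (simp only:) (simp add: powr_mult)
  have "\<bar>1 + \<alpha> * (1 / real n) - (1 + 1 / real n) powr \<alpha>\<bar> \<le> \<alpha> * (1 / real n)\<^sup>2" using n by (intro powr_near_linear \<alpha>) auto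
  also have "\<dots> \<le> 1 * (1 / real n)\<^sup>2" using \<alpha> by (intro mult_right_mono) auto
  finally have "\<bar>(1 + 1 / real n) powr \<alpha> - (1 + \<alpha> / real n)\<bar> \<le> (1 / real n)\<^sup>2" by (simp add: abs_minus_commute)
  from mult_left_mono[OF this, of "real n powr \<alpha>"]
  have "\<bar>real n powr \<alpha> * ((1 + 1 / real n) powr \<alpha> - (1 + \<alpha> / real n))\<bar> \<le> real n powr \<alpha> * (1 / real n)\<^sup>2" by (simp add: abs_mult)
  also have "\<dots> = real n powr (\<alpha> - 1) / real n" using n0 by (simp add: powr_diff power2_eq_square)
  finally show ?thesis unfolding pw by (simp add: right_diff_distrib)
qed

lemma integrable_c_error: "1 \<le> n \<Longrightarrow> integrable M (\<lambda>\<omega>. c j n \<omega> / real n powr \<alpha> - T j * S \<omega>)"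
  using integrable_c integrable_S by auto

text \<open>Induction on the size. The count \<open>c (Suc i)\<close> grows when a block of size
  \<open>j = Suc i\<close> is joined, with probability close to \<open>(j - \<alpha>) (c i n -
  c j n) / n\<close>. If \<open>c i n\<close> behaves like \<open>T i * S * n powr
  \<alpha>\<close>, then \<open>T j * S * n powr \<alpha>\<close> solves this linear recursion
  to leading order, because \<open>T i * (j - \<alpha>) = T j * j\<close>. The deviation
  \<open>u\<close> from the compensated count contracts by the factor \<open>1 - (j -
  \<alpha>) / n\<close> up to errors of smaller order, and \<open>cesaro_powr\<close> applies
  to its mean.\<close>
theorem block_counts_L1: "(\<lambda>n. \<integral>\<omega>. \<bar>c j n \<omega> / real n powr \<alpha> - T j * S \<omega>\<bar> \<partial>M) \<longlonglongrightarrow> 0"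
proof (induction j)
  case 0
  show ?case
  proof (rule tendsto_sandwich[OF _ _ tendsto_const])
    have "(\<lambda>n. diversity_rate * real n powr (- (\<alpha> / 2))) \<longlonglongrightarrow> 0"
      using \<alpha> by (intro tendsto_mult_right_zero tendsto_powr_neg) simp
    then show "(\<lambda>n. diversity_rate * real n powr (- \<alpha> / 2)) \<longlonglongrightarrow> 0" by simp
    show "\<forall>\<^sub>F n in sequentially. (\<integral>\<omega>. \<bar>c 0 n \<omega> / real n powr \<alpha> - T 0 * S \<omega>\<bar> \<partial>M) \<le> diversity_rate * real n powr (- \<alpha> / 2)"
      using eventually_ge_at_top[of 1] by eventually_elim (use r_L1_limit(2) in \<open>simp add: r_def tail_prob_0\<close>)
  qed simp
next
  case (Suc i)
  define j where "j = Suc i"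
  have j: "1 \<le> j" "j - 1 = i" by (auto simp: j_def)
  define \<delta> :: "nat \<Rightarrow> real" where "\<delta> l = of_bool (l = j)" for l
  define E where "E n \<omega> = (\<Sum>l\<in>{1..<n}. mdiff \<delta> (Suc l) \<omega>)" for n \<omega>
  define u where "u n \<omega> = c j n \<omega> - E n \<omega> - T j * S \<omega> * real n powr \<alpha>" for n \<omega>
  let ?g = "real j - \<alpha>"
  have g: "0 < ?g" "?g \<le> real j" using j \<alpha> by auto
  have \<delta>b: "\<bar>\<delta> l\<bar> \<le> 1" for l by (simp add: \<delta>_def)
  have \<delta>K: "(\<delta> 0)\<^sup>2 \<le> real j" "\<And>l. 1 \<le> l \<Longrightarrow> (\<delta> l)\<^sup>2 * (real l - \<alpha>) \<le> real j" using j g by (auto simp: \<delta>_def)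
  define CE where "CE = sqrt (real j * (2 + 2 * weight_error) * block_growth / \<alpha>)"
  have E1: "(\<integral>\<omega>. \<bar>E n \<omega>\<bar> \<partial>M) \<le> CE * real n powr (\<alpha> / 2)" if "1 \<le> n" for n
    unfolding E_def CE_def by (rule compensated_L1(1)[OF \<delta>b \<delta>K that])
  have Ei: "integrable M (E n)" if "1 \<le> n" for n
    unfolding E_def by (rule compensated_L1(2)[OF \<delta>b \<delta>K that])
  have ui: "integrable M (u n)" if "1 \<le> n" for n
    unfolding u_def using integrable_c[OF that] Ei[OF that] integrable_S by (intro Bochner_Integration.integrable_diff integrable_mult_left integrable_mult_right) auto
  let ?err = "\<lambda>n \<omega>. c i n \<omega> / real n powr \<alpha> - T i * S \<omega>"
  define \<eta> where "\<eta> n = real j * (\<integral>\<omega>. \<bar>?err n \<omega>\<bar> \<partial>M) + real j * CE * real n powr (- (\<alpha> / 2)) + (real j * weight_error * block_growth + (\<integral>\<omega>. \<bar>S \<omega>\<bar> \<partial>M)) * (1 / real n)" for n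
  have \<eta>0: "\<eta> \<longlonglongrightarrow> 0"
  proof -
    have "\<eta> \<longlonglongrightarrow> real j * 0 + real j * CE * 0 + (real j * weight_error * block_growth + (\<integral>\<omega>. \<bar>S \<omega>\<bar> \<partial>M)) * 0"
      unfolding \<eta>_def using \<alpha> by (intro tendsto_add tendsto_mult tendsto_const Suc.IH tendsto_powr_neg lim_1_over_n) auto
    then show ?thesis by simp
  qed
  have step: "\<bar>u (Suc n) \<omega>\<bar> \<le> \<bar>u n \<omega>\<bar> + (real j / real n * (real n powr \<alpha> * \<bar>?err n \<omega>\<bar> + \<bar>E n \<omega>\<bar>) + real j * weight_error / (real n)\<^sup>2 * c 0 n \<omega>
      + \<bar>S \<omega>\<bar> * (real n powr (\<alpha> - 1) / real n))"
    if n: "j \<le> n" and \<omega>: "\<omega> \<in> space M" for n \<omega>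
  proof -
    have n1: "1 \<le> n" using n j by simp
    then have n0: "0 < real n" by simp
    let ?w = "w n (card (\<pi> n \<omega>))" and ?N = "c i n \<omega> - c j n \<omega>"
    let ?na = "real n powr \<alpha>" and ?d = "real (Suc n) powr \<alpha> - real n powr \<alpha> * (1 + \<alpha> / real n)"
    have md: "mdiff \<delta> (Suc n) \<omega> = of_bool (s (Suc n) \<omega> = j) - ?w * ?g * ?N"
      unfolding mdiff_def diff_Suc_1 \<delta>_def cond_join[OF n1 j(1) \<omega>] j(2) ..
    have Es: "E (Suc n) \<omega> = E n \<omega> + mdiff \<delta> (Suc n) \<omega>" unfolding E_def by (rule sum.atLeastLessThan_Suc[OF n1])
    have TT: "T i * ?g = T j * real j" unfolding j_def tail_prob_Suc by simp
    have "u (Suc n) \<omega> = u n \<omega> + ?w * ?g * ?N - T j * S \<omega> * (real (Suc n) powr \<alpha> - ?na)"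
      unfolding u_def c_Suc[OF n1 \<omega>] Es md by (simp add: algebra_simps)
    \<comment> \<open>The contraction, followed by the error inherited from size \<open>i\<close>, the martingale
      part, the error of the weights and the discretization error of \<open>n powr
      \<alpha>\<close>.\<close>
    also have "\<dots> = u n \<omega> * (1 - ?g / real n) + (?g / real n * (?na * ?err n \<omega>) + - (?g / real n * E n \<omega>))
        + ((?w - 1 / real n) * ?g * ?N + - (T j * S \<omega> * ?d))"
    proof -
      have "?w * ?g * ?N = (?w - 1 / real n) * ?g * ?N + ?g / real n * ?N" by (simp add: algebra_simps)
      moreover have "?g / real n * ?N = ?g / real n * (?na * ?err n \<omega>) - ?g / real n * (u n \<omega> + E n \<omega>) + S \<omega> * ?na / real n * (T i * ?g - T j * ?g)"
        unfolding u_def using n0 by (simp add: field_simps)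
      moreover have "S \<omega> * ?na / real n * (T i * ?g - T j * ?g) = T j * S \<omega> * (?na * (\<alpha> / real n))"
        unfolding TT by (simp add: algebra_simps)
      moreover have "u + W - K * (A - na) = u * (1 - g) + (R + - (g * E)) + (P + - (K * (A - na * (1 + a))))"
        if "W = P + N" "N = R - g * (u + E) + Q" "Q = K * (na * a)" for u W K A na g R E P a N Q :: real
        using that by (simp add: algebra_simps)
      ultimately show ?thesis by blast
    qed
    finally have eq: "u (Suc n) \<omega> = u n \<omega> * (1 - ?g / real n) + (?g / real n * (?na * ?err n \<omega>) + - (?g / real n * E n \<omega>))
        + ((?w - 1 / real n) * ?g * ?N + - (T j * S \<omega> * ?d))" .
    have gn: "0 \<le> ?g / real n" "?g / real n \<le> 1" "?g / real n \<le> real j / real n"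
      using g n n0 by (auto simp: divide_right_mono)
    have a1: "\<bar>u n \<omega> * (1 - ?g / real n)\<bar> \<le> \<bar>u n \<omega>\<bar>"
      using gn by (simp add: abs_mult mult_left_le)
    have a2: "\<bar>?g / real n * (?na * ?err n \<omega>)\<bar> \<le> real j / real n * (?na * \<bar>?err n \<omega>\<bar>)"
      unfolding abs_mult using gn by (intro mult_mono) auto
    have a3: "\<bar>- (?g / real n * E n \<omega>)\<bar> \<le> real j / real n * \<bar>E n \<omega>\<bar>"
      unfolding abs_minus abs_mult using gn by (intro mult_mono) auto
    have a4: "\<bar>(?w - 1 / real n) * ?g * ?N\<bar> \<le> weight_error / (real n)\<^sup>2 * real j * c 0 n \<omega>"
      unfolding abs_mult using w_near[OF n1] g c_le_c0[OF n1 \<omega>, of i] c_le_c0[OF n1 \<omega>, of j] c_nonneg[of i n \<omega>] c_nonneg[of j n \<omega>] weight_error_nonneg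
      by (intro mult_mono mult_nonneg_nonneg) auto
    have a5: "\<bar>- (T j * S \<omega> * ?d)\<bar> \<le> \<bar>S \<omega>\<bar> * (real n powr (\<alpha> - 1) / real n)"
    proof -
      have "\<bar>T j * S \<omega>\<bar> \<le> \<bar>S \<omega>\<bar>" using tail_prob_bounds[OF \<alpha>, of j] by (simp add: abs_mult mult_left_le_one_le)
      then show ?thesis unfolding abs_minus abs_mult[of "T j * S \<omega>"] using powr_increment[OF n1] by (intro mult_mono) auto
    qed
    have "\<bar>u (Suc n) \<omega>\<bar> \<le> \<bar>u n \<omega> * (1 - ?g / real n)\<bar> + (\<bar>?g / real n * (?na * ?err n \<omega>)\<bar> + \<bar>- (?g / real n * E n \<omega>)\<bar>)
        + (\<bar>(?w - 1 / real n) * ?g * ?N\<bar> + \<bar>- (T j * S \<omega> * ?d)\<bar>)"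
      unfolding eq by (intro order_trans[OF abs_triangle_ineq] add_mono order_refl abs_triangle_ineq)
    also have "\<dots> \<le> \<bar>u n \<omega>\<bar> + (real j / real n * (?na * \<bar>?err n \<omega>\<bar>) + real j / real n * \<bar>E n \<omega>\<bar>)
        + (weight_error / (real n)\<^sup>2 * real j * c 0 n \<omega> + \<bar>S \<omega>\<bar> * (real n powr (\<alpha> - 1) / real n))"
      by (intro add_mono a1 a2 a3 a4 a5)
    also have "\<dots> = \<bar>u n \<omega>\<bar> + (real j / real n * (?na * \<bar>?err n \<omega>\<bar> + \<bar>E n \<omega>\<bar>) + real j * weight_error / (real n)\<^sup>2 * c 0 n \<omega>
      + \<bar>S \<omega>\<bar> * (real n powr (\<alpha> - 1) / real n))" by (simp add: distrib_left mult.commute)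
    finally show ?thesis .
  qed
  have u_lim: "(\<lambda>n. (\<integral>\<omega>. \<bar>u n \<omega>\<bar> \<partial>M) / real n powr \<alpha>) \<longlonglongrightarrow> 0"
  proof (rule cesaro_powr[OF _ _ \<eta>0])
    fix n assume n: "j \<le> n"
    then have n1: "1 \<le> n" using j by simp
    then have n0: "0 < real n" by simp
    have na: "0 < real n powr \<alpha>" using n0 by simp
    note ii = integrable_abs[OF integrable_c_error[OF n1, of i]] integrable_abs[OF Ei[OF n1]] integrable_abs[OF ui[OF n1]] integrable_c[OF n1, of 0] integrable_abs[OF integrable_S]
    have "(\<integral>\<omega>. \<bar>u (Suc n) \<omega>\<bar> \<partial>M) \<le> (\<integral>\<omega>. \<bar>u n \<omega>\<bar> + (real j / real n * (real n powr \<alpha> * \<bar>?err n \<omega>\<bar> + \<bar>E n \<omega>\<bar>) + real j * weight_error / (real n)\<^sup>2 * c 0 n \<omega>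
      + \<bar>S \<omega>\<bar> * (real n powr (\<alpha> - 1) / real n)) \<partial>M)"
      by (intro integral_mono step[OF n] Bochner_Integration.integrable_add integrable_mult_right integrable_mult_left ii integrable_abs[OF ui]) simp
    also have "\<dots> = (\<integral>\<omega>. \<bar>u n \<omega>\<bar> \<partial>M) + (real j / real n * (real n powr \<alpha> * (\<integral>\<omega>. \<bar>?err n \<omega>\<bar> \<partial>M) + (\<integral>\<omega>. \<bar>E n \<omega>\<bar> \<partial>M)) + real j * weight_error / (real n)\<^sup>2 * (\<integral>\<omega>. c 0 n \<omega> \<partial>M)
      + (\<integral>\<omega>. \<bar>S \<omega>\<bar> \<partial>M) * (real n powr (\<alpha> - 1) / real n))"
      by (simp only: Bochner_Integration.integral_add integral_mult_right_zero integral_mult_left_zero Bochner_Integration.integrable_add integrable_mult_right integrable_mult_left ii)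
    also have "\<dots> \<le> (\<integral>\<omega>. \<bar>u n \<omega>\<bar> \<partial>M) + (real j / real n * (real n powr \<alpha> * (\<integral>\<omega>. \<bar>?err n \<omega>\<bar> \<partial>M) + CE * real n powr (\<alpha> / 2)) + real j * weight_error / (real n)\<^sup>2 * (block_growth * real n powr \<alpha>)
      + (\<integral>\<omega>. \<bar>S \<omega>\<bar> \<partial>M) * (real n powr (\<alpha> - 1) / real n))"
      using E1[OF n1] expected_blocks[OF n1] weight_error_nonneg by (intro add_mono mult_left_mono order_refl) auto
    also have "\<dots> = (\<integral>\<omega>. \<bar>u n \<omega>\<bar> \<partial>M) + \<eta> n * real n powr (\<alpha> - 1)"
    proof -
      have p1: "real n powr (\<alpha> / 2) = real n powr (- (\<alpha> / 2)) * real n powr \<alpha>" unfolding powr_add[symmetric] by simp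
      have p2: "real n powr (\<alpha> - 1) = real n powr \<alpha> / real n" using n0 by (simp add: powr_diff)
      show ?thesis unfolding \<eta>_def p1 p2 using n0 by (simp add: field_simps power2_eq_square)
    qed
    finally show "(\<integral>\<omega>. \<bar>u (Suc n) \<omega>\<bar> \<partial>M) \<le> (\<integral>\<omega>. \<bar>u n \<omega>\<bar> \<partial>M) + \<eta> n * real n powr (\<alpha> - 1)" .
  qed simp
  show ?case unfolding j_def[symmetric]
  proof (rule tendsto_sandwich[OF _ _ tendsto_const])
    have "(\<lambda>n. (\<integral>\<omega>. \<bar>u n \<omega>\<bar> \<partial>M) / real n powr \<alpha> + CE * real n powr (- (\<alpha> / 2))) \<longlonglongrightarrow> 0 + CE * 0"
      using \<alpha> by (intro tendsto_add tendsto_mult tendsto_const u_lim tendsto_powr_neg) auto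
    then show "(\<lambda>n. (\<integral>\<omega>. \<bar>u n \<omega>\<bar> \<partial>M) / real n powr \<alpha> + CE * real n powr (- (\<alpha> / 2))) \<longlonglongrightarrow> 0" by simp
    show "\<forall>\<^sub>F n in sequentially. (\<integral>\<omega>. \<bar>c j n \<omega> / real n powr \<alpha> - T j * S \<omega>\<bar> \<partial>M) \<le> (\<integral>\<omega>. \<bar>u n \<omega>\<bar> \<partial>M) / real n powr \<alpha> + CE * real n powr (- (\<alpha> / 2))"
      using eventually_ge_at_top[of 1]
    proof eventually_elim
      case (elim n)
      have na: "0 < real n powr \<alpha>" using elim by simp
      have "(\<integral>\<omega>. \<bar>c j n \<omega> / real n powr \<alpha> - T j * S \<omega>\<bar> \<partial>M) \<le> (\<integral>\<omega>. \<bar>u n \<omega>\<bar> / real n powr \<alpha> + \<bar>E n \<omega>\<bar> / real n powr \<alpha> \<partial>M)"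
      proof (intro integral_mono Bochner_Integration.integrable_add integrable_divide integrable_abs ui[OF elim] Ei[OF elim] integrable_c_error[OF elim])
        fix \<omega>
        have "c j n \<omega> / real n powr \<alpha> - T j * S \<omega> = (u n \<omega> + E n \<omega>) / real n powr \<alpha>" unfolding u_def using na by (simp add: field_simps)
        then have "\<bar>c j n \<omega> / real n powr \<alpha> - T j * S \<omega>\<bar> = \<bar>u n \<omega> + E n \<omega>\<bar> / real n powr \<alpha>" using na by simp
        also have "\<dots> \<le> (\<bar>u n \<omega>\<bar> + \<bar>E n \<omega>\<bar>) / real n powr \<alpha>" using na by (intro divide_right_mono abs_triangle_ineq) auto
        finally show "\<bar>c j n \<omega> / real n powr \<alpha> - T j * S \<omega>\<bar> \<le> \<bar>u n \<omega>\<bar> / real n powr \<alpha> + \<bar>E n \<omega>\<bar> / real n powr \<alpha>" by (simp add: add_divide_distrib)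
      qed
      also have "\<dots> = (\<integral>\<omega>. \<bar>u n \<omega>\<bar> \<partial>M) / real n powr \<alpha> + (\<integral>\<omega>. \<bar>E n \<omega>\<bar> \<partial>M) / real n powr \<alpha>"
        using ui[OF elim] Ei[OF elim] by simp
      also have "(\<integral>\<omega>. \<bar>E n \<omega>\<bar> \<partial>M) / real n powr \<alpha> \<le> CE * real n powr (\<alpha> / 2) / real n powr \<alpha>"
        using E1[OF elim] na by (intro divide_right_mono) auto
      also have "CE * real n powr (\<alpha> / 2) / real n powr \<alpha> = CE * real n powr (- (\<alpha> / 2))"
      proof -
        have "real n powr (\<alpha> / 2) = real n powr (- (\<alpha> / 2)) * real n powr \<alpha>" unfolding powr_add[symmetric] by simp
        then show ?thesis using na by simp
      qed
      finally show ?case by simp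
    qed
  qed simp
qed

end


section \<open>The central limit theorem for the score\<close>

context bounded_gibbs
begin

text \<open>Change of the quasi-score at the true parameter when the new element joins a block of size
  \<open>j\<close>, with \<open>j = 0\<close> for a new block. The score and the observed
  information are therefore additive along the chain.\<close>
definition score_weight :: "nat \<Rightarrow> real" where "score_weight j = (if j = 0 then 1 / \<alpha> else - (1 / (real j - \<alpha>)))"
definition score :: "nat \<Rightarrow> 'a \<Rightarrow> real" where "score n \<omega> = (\<Sum>i\<in>{1..<n}. score_weight (s (Suc i) \<omega>))"
definition obs_info :: "nat \<Rightarrow> 'a \<Rightarrow> real" where "obs_info n \<omega> = (\<Sum>i\<in>{1..<n}. (score_weight (s (Suc i) \<omega>))\<^sup>2)"
definition info :: real where "info = (\<Sum>j. T j * (score_weight j)\<^sup>2)"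
definition score_bound :: real where "score_bound = 1 / \<alpha> + 1 / (1 - \<alpha>)"

lemma integral_constant: "(\<integral>\<omega>. x \<partial>M) = (x :: real)"
  by (simp add: gp.prob_space)

lemma score_weight_bounds:
  "\<bar>score_weight j\<bar> \<le> score_bound" "(score_weight j)\<^sup>2 \<le> score_bound\<^sup>2"
  "1 \<le> j \<Longrightarrow> (score_weight j)\<^sup>2 * (real j - \<alpha>) \<le> score_bound" "(score_weight 0)\<^sup>2 \<le> score_bound\<^sup>2 + score_bound"
  "1 \<le> j \<Longrightarrow> ((score_weight j)\<^sup>2)\<^sup>2 * (real j - \<alpha>) \<le> score_bound\<^sup>2 * score_bound" "((score_weight 0)\<^sup>2)\<^sup>2 \<le> (score_bound\<^sup>2)\<^sup>2 + score_bound\<^sup>2 * score_bound"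
proof -
  have p: "0 < 1 / \<alpha>" "0 < 1 / (1 - \<alpha>)" "0 < score_bound" using \<alpha> by (auto simp: score_bound_def add_pos_pos)
  have inv: "1 / (real j - \<alpha>) \<le> 1 / (1 - \<alpha>)" "0 < real j - \<alpha>" if "1 \<le> j" for j
    using \<alpha> that by (auto intro!: divide_left_mono)
  show b: "\<bar>score_weight j\<bar> \<le> score_bound" for j
  proof (cases "j = 0")
    case True
    then show ?thesis using p by (simp add: score_weight_def score_bound_def)
  next
    case False
    then have "\<bar>score_weight j\<bar> = 1 / (real j - \<alpha>)" using inv(2)[of j] by (simp add: score_weight_def)
    then show ?thesis using inv(1)[of j] False p unfolding score_bound_def by linarith
  qed
  show b2: "(score_weight j)\<^sup>2 \<le> score_bound\<^sup>2" for j using power_mono[OF b[of j], of 2] by simp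
  show 3: "(score_weight j)\<^sup>2 * (real j - \<alpha>) \<le> score_bound" if "1 \<le> j" for j
  proof -
    have "(score_weight j)\<^sup>2 * (real j - \<alpha>) = 1 / (real j - \<alpha>)" using inv(2)[OF that] that by (simp add: score_weight_def power2_eq_square)
    then show ?thesis using inv(1)[OF that] p unfolding score_bound_def by linarith
  qed
  show "(score_weight 0)\<^sup>2 \<le> score_bound\<^sup>2 + score_bound" using b2[of 0] p by linarith
  show "((score_weight j)\<^sup>2)\<^sup>2 * (real j - \<alpha>) \<le> score_bound\<^sup>2 * score_bound" if "1 \<le> j" for j
  proof -
    have "(score_weight j)\<^sup>2 * ((score_weight j)\<^sup>2 * (real j - \<alpha>)) \<le> score_bound\<^sup>2 * score_bound"
      by (rule mult_mono[OF b2 3[OF that]]) (use inv(2)[OF that] in auto)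
    then show ?thesis by (simp add: power2_eq_square mult.assoc)
  qed
  have "((score_weight 0)\<^sup>2)\<^sup>2 \<le> (score_bound\<^sup>2)\<^sup>2" by (rule power_mono[OF b2 zero_le_power2])
  then show "((score_weight 0)\<^sup>2)\<^sup>2 \<le> (score_bound\<^sup>2)\<^sup>2 + score_bound\<^sup>2 * score_bound" using p by (smt (verit) mult_pos_pos zero_less_power)
qed

lemma summable_weights: "summable (\<lambda>j. (score_weight j)\<^sup>2)"
proof (rule summable_comparison_test')
  show "summable (\<lambda>j. 1 / (1 - \<alpha>)\<^sup>2 * inverse ((real j) ^ 2))"
    by (intro summable_mult inverse_power_summable) simp
  fix j :: nat assume j: "1 \<le> j"
  have "real j * (1 - \<alpha>) \<le> real j - \<alpha>" using j \<alpha> by (simp add: algebra_simps)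
  then have "(real j * (1 - \<alpha>))\<^sup>2 \<le> (real j - \<alpha>)\<^sup>2" using \<alpha> by (intro power_mono) auto
  then have "1 / (real j - \<alpha>)\<^sup>2 \<le> 1 / (real j * (1 - \<alpha>))\<^sup>2" using j \<alpha> by (intro divide_left_mono mult_pos_pos) (auto intro!: zero_less_power)
  moreover have "norm ((score_weight j)\<^sup>2) = 1 / (real j - \<alpha>)\<^sup>2" using j by (simp add: score_weight_def power_divide)
  moreover have "1 / (real j * (1 - \<alpha>))\<^sup>2 = 1 / (1 - \<alpha>)\<^sup>2 * inverse ((real j) ^ 2)"
    by (simp only: power_mult_distrib) (simp add: divide_inverse)
  ultimately show "norm ((score_weight j)\<^sup>2) \<le> 1 / (1 - \<alpha>)\<^sup>2 * inverse ((real j) ^ 2)" by linarith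
qed

lemma summable_info: "summable (\<lambda>j. T j * (score_weight j)\<^sup>2)"
  by (rule summable_comparison_test'[OF summable_weights, of 0])
    (use tail_prob_bounds[OF \<alpha>] in \<open>auto simp: abs_mult less_imp_le mult_left_le_one_le\<close>)

lemma info_pos: "0 < info"
proof -
  have "0 < (\<Sum>j<1. T j * (score_weight j)\<^sup>2)" using \<alpha> by (simp add: tail_prob_0 score_weight_def)
  also have "\<dots> \<le> info" unfolding info_def
    using tail_prob_bounds[OF \<alpha>] by (intro sum_le_suminf summable_info) (auto simp: less_imp_le)
  finally show ?thesis .
qed

lemma measurable_sum_increments: "(\<lambda>\<omega>. \<Sum>i\<in>{1..<n}. f (s (Suc i) \<omega>) :: real) \<in> borel_measurable M" "integrable M (\<lambda>\<omega>. \<Sum>i\<in>{1..<n}. f (s (Suc i) \<omega>) :: real)"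
proof -
  have i: "integrable M (\<lambda>\<omega>. f (s (Suc i) \<omega>))" for i
    unfolding s_def by (rule integrable_pi_fun[where f="\<lambda>P. f (last_size (Suc i) P)"]) simp
  then show "integrable M (\<lambda>\<omega>. \<Sum>i\<in>{1..<n}. f (s (Suc i) \<omega>))" by (intro Bochner_Integration.integrable_sum)
  then show "(\<lambda>\<omega>. \<Sum>i\<in>{1..<n}. f (s (Suc i) \<omega>)) \<in> borel_measurable M" by (rule borel_measurable_integrable)
qed

text \<open>The observed information is a combination of the counts \<open>c j n\<close> with summable
  coefficients \<open>(score_weight j)\<^sup>2\<close>. Each count converges in mean and all
  normalized errors have a common bound, so the limits may be summed.\<close>
lemma obs_info_L1: "(\<lambda>n. \<integral>\<omega>. \<bar>obs_info n \<omega> / real n powr \<alpha> - info * S \<omega>\<bar> \<partial>M) \<longlonglongrightarrow> 0"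
proof -
  let ?b = "\<lambda>j. (score_weight j)\<^sup>2" and ?e = "\<lambda>j n. \<integral>\<omega>. \<bar>c j n \<omega> / real n powr \<alpha> - T j * S \<omega>\<bar> \<partial>M"
  let ?tail = "\<lambda>n. \<Sum>i. T (i + n) * ?b (i + n)"
  let ?ES = "\<integral>\<omega>. \<bar>S \<omega>\<bar> \<partial>M"
  have T01: "0 \<le> T j" "T j \<le> 1" for j using tail_prob_bounds[OF \<alpha>, of j] by auto
  have e_bd: "?e j n \<le> block_growth + ?ES" for j n
  proof (cases "1 \<le> n")
    case True
    have na: "0 < real n powr \<alpha>" using True by simp
    have "?e j n \<le> (\<integral>\<omega>. c 0 n \<omega> / real n powr \<alpha> + \<bar>S \<omega>\<bar> \<partial>M)"
    proof (intro integral_mono integrable_abs integrable_c_error[OF True] Bochner_Integration.integrable_add integrable_divide integrable_c[OF True] integrable_S)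
      fix \<omega> assume \<omega>: "\<omega> \<in> space M"
      have "\<bar>c j n \<omega> / real n powr \<alpha>\<bar> \<le> c 0 n \<omega> / real n powr \<alpha>" using c_le_c0[OF True \<omega>, of j] c_nonneg[of j n \<omega>] by (simp add: divide_right_mono)
      moreover have "\<bar>T j * S \<omega>\<bar> \<le> \<bar>S \<omega>\<bar>" using T01[of j] by (simp add: abs_mult mult_left_le_one_le)
      ultimately show "\<bar>c j n \<omega> / real n powr \<alpha> - T j * S \<omega>\<bar> \<le> c 0 n \<omega> / real n powr \<alpha> + \<bar>S \<omega>\<bar>"
        using abs_triangle_ineq4[of "c j n \<omega> / real n powr \<alpha>" "T j * S \<omega>"] by linarith
    qed
    also have "\<dots> = (\<integral>\<omega>. c 0 n \<omega> \<partial>M) / real n powr \<alpha> + ?ES" using integrable_c[OF True] integrable_S by simp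
    also have "(\<integral>\<omega>. c 0 n \<omega> \<partial>M) / real n powr \<alpha> \<le> block_growth" using expected_blocks[OF True] na by (simp add: field_simps)
    finally show ?thesis by simp
  next
    case False
    then have n: "n = 0" by simp
    have "?e j n = (\<integral>\<omega>. T j * \<bar>S \<omega>\<bar> \<partial>M)"
      unfolding n by (rule Bochner_Integration.integral_cong[OF refl]) (use T01[of j] in \<open>simp add: abs_mult\<close>)
    also have "\<dots> = T j * ?ES" by (rule integral_mult_right_zero)
    also have "\<dots> \<le> ?ES" using T01[of j] by (simp add: mult_left_le_one_le)
    finally show ?thesis using block_growth_nonneg by simp
  qed
  have main: "(\<lambda>n. \<Sum>j<n. ?b j * ?e j n) \<longlonglongrightarrow> 0"
    by (rule weighted_sum_tendsto_zero[OF summable_weights _ block_counts_L1 _ e_bd]) auto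
  have tl: "?tail \<longlonglongrightarrow> 0"
    using suminf_exist_split2[OF summable_info] by simp
  have tail0: "0 \<le> ?tail n" for n
    by (rule suminf_nonneg[OF summable_ignore_initial_segment[OF summable_info]]) (use T01 in auto)
  have na0: "(\<lambda>n. ?b 0 * real n powr (- \<alpha>)) \<longlonglongrightarrow> 0" by (rule tendsto_mult_right_zero[OF tendsto_powr_neg[OF \<alpha>(1)]])
  have rhs: "(\<lambda>n. (\<Sum>j<n. ?b j * ?e j n) + (?b 0 * real n powr (- \<alpha>) + ?tail n * ?ES)) \<longlonglongrightarrow> 0"
    using tendsto_add[OF main tendsto_add[OF na0 tendsto_mult_left_zero[OF tl]]] by simp
  show ?thesis
  proof (rule tendsto_sandwich[OF _ _ tendsto_const rhs])
    show "\<forall>\<^sub>F n in sequentially. (\<integral>\<omega>. \<bar>obs_info n \<omega> / real n powr \<alpha> - info * S \<omega>\<bar> \<partial>M) \<le> (\<Sum>j<n. ?b j * ?e j n) + (?b 0 * real n powr (- \<alpha>) + ?tail n * ?ES)"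
      using eventually_ge_at_top[of 1]
    proof eventually_elim
      case (elim n)
      note ei = integrable_abs[OF integrable_c_error[OF elim]]
      have "(\<integral>\<omega>. \<bar>obs_info n \<omega> / real n powr \<alpha> - info * S \<omega>\<bar> \<partial>M)
        \<le> (\<integral>\<omega>. (\<Sum>j<n. ?b j * \<bar>c j n \<omega> / real n powr \<alpha> - T j * S \<omega>\<bar>) + (?b 0 * real n powr (- \<alpha>) + ?tail n * \<bar>S \<omega>\<bar>) \<partial>M)"
      proof (rule integral_mono)
        show "integrable M (\<lambda>\<omega>. \<bar>obs_info n \<omega> / real n powr \<alpha> - info * S \<omega>\<bar>)"
          unfolding obs_info_def by (intro integrable_abs Bochner_Integration.integrable_diff integrable_divide integrable_mult_right integrable_S measurable_sum_increments(2))
        show "integrable M (\<lambda>\<omega>. (\<Sum>j<n. ?b j * \<bar>c j n \<omega> / real n powr \<alpha> - T j * S \<omega>\<bar>) + (?b 0 * real n powr (- \<alpha>) + ?tail n * \<bar>S \<omega>\<bar>))"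
          by (intro Bochner_Integration.integrable_add Bochner_Integration.integrable_sum integrable_mult_right ei integrable_abs integrable_S gp.integrable_const)
        fix \<omega> assume \<omega>: "\<omega> \<in> space M"
        have "obs_info n \<omega> = (\<Sum>j<n. (c j n \<omega> - of_bool (j = 0)) * ?b j)"
          unfolding obs_info_def by (rule sum_increments[OF elim \<omega>, where f="?b"])
        also have "\<dots> = (\<Sum>j<n. c j n \<omega> * ?b j) - (\<Sum>j<n. if j = 0 then ?b 0 else 0)"
          unfolding sum_subtractf[symmetric] by (intro sum.cong) (auto simp: left_diff_distrib)
        also have "(\<Sum>j<n. if j = 0 then ?b 0 else 0) = ?b 0" using elim by simp
        finally have o: "obs_info n \<omega> = (\<Sum>j<n. c j n \<omega> * ?b j) - ?b 0" .
        have i: "info = ?tail n + (\<Sum>j<n. T j * ?b j)" unfolding info_def by (rule suminf_split_initial_segment[OF summable_info])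
        have "obs_info n \<omega> / real n powr \<alpha> - info * S \<omega> = (\<Sum>j<n. ?b j * (c j n \<omega> / real n powr \<alpha> - T j * S \<omega>)) - (?b 0 * real n powr (- \<alpha>) + ?tail n * S \<omega>)"
        proof -
          have "(\<Sum>j<n. ?b j * (c j n \<omega> / real n powr \<alpha> - T j * S \<omega>)) = (\<Sum>j<n. c j n \<omega> * ?b j) / real n powr \<alpha> - (\<Sum>j<n. T j * ?b j) * S \<omega>"
            unfolding sum_divide_distrib sum_distrib_right sum_subtractf[symmetric] by (intro sum.cong) (auto simp: algebra_simps)
          then show ?thesis unfolding o i by (simp add: powr_minus_divide diff_divide_distrib distrib_right)
        qed
        then have "\<bar>obs_info n \<omega> / real n powr \<alpha> - info * S \<omega>\<bar> \<le> (\<Sum>j<n. \<bar>?b j * (c j n \<omega> / real n powr \<alpha> - T j * S \<omega>)\<bar>) + (\<bar>?b 0 * real n powr (- \<alpha>)\<bar> + \<bar>?tail n * S \<omega>\<bar>)"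
          by (simp only:) (rule order_trans[OF abs_triangle_ineq4 add_mono[OF sum_abs abs_triangle_ineq]])
        then show "\<bar>obs_info n \<omega> / real n powr \<alpha> - info * S \<omega>\<bar> \<le> (\<Sum>j<n. ?b j * \<bar>c j n \<omega> / real n powr \<alpha> - T j * S \<omega>\<bar>) + (?b 0 * real n powr (- \<alpha>) + ?tail n * \<bar>S \<omega>\<bar>)"
          using tail0[of n] by (simp add: abs_mult)
      qed
      also have "\<dots> = (\<Sum>j<n. ?b j * ?e j n) + (?b 0 * real n powr (- \<alpha>) + ?tail n * ?ES)"
        by (simp only: Bochner_Integration.integral_add Bochner_Integration.integral_sum Bochner_Integration.integrable_add Bochner_Integration.integrable_sum integrable_mult_right ei integrable_abs[OF integrable_S] gp.integrable_const integral_mult_right_zero integral_constant)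
      finally show ?case .
    qed
  qed (simp add: Bochner_Integration.integral_nonneg)
qed

text \<open>For the joining probabilities \<open>(j - \<alpha>) / n\<close> the score is a martingale:
  each block contributes \<open>(j - \<alpha>) * (- 1 / (j - \<alpha>)) = - 1\<close>, and
  this cancels against the contribution of a new block. What is left is the deviation of
  \<open>w\<close> from \<open>1 / n\<close>.\<close>
lemma cond_score:
  assumes n: "1 \<le> n" and \<omega>: "\<omega> \<in> space M"
  shows "step_mean n (\<pi> n \<omega>) score_weight = (1 - w n (card (\<pi> n \<omega>)) * real n) / \<alpha>" "\<bar>step_mean n (\<pi> n \<omega>) score_weight\<bar> \<le> weight_error / \<alpha> * (1 / real n)"
proof -
  let ?P = "\<pi> n \<omega>" let ?k = "card ?P"
  note P = part[OF n \<omega>]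
  have "(\<Sum>U\<in>?P. w n ?k * (real (card U) - \<alpha>) * score_weight (card U)) = (\<Sum>U\<in>?P. - w n ?k)"
  proof (rule sum.cong[OF refl])
    fix U assume U: "U \<in> ?P"
    have "1 \<le> real (card U)" "card U \<noteq> 0" using partition_blocks(5)[OF P U] by auto
    then show "w n ?k * (real (card U) - \<alpha>) * score_weight (card U) = - w n ?k" using \<alpha> by (simp add: score_weight_def)
  qed
  then have "step_mean n ?P score_weight = p_new n ?k * (1 / \<alpha>) - real ?k * w n ?k" unfolding step_mean_def by (simp add: score_weight_def)
  also have "\<dots> = (1 - w n ?k * real n) / \<alpha>"
    unfolding p_new_eq[OF n partition_blocks(9)[OF P n]] using \<alpha> by (simp add: field_simps)
  finally show 1: "step_mean n ?P score_weight = (1 - w n ?k * real n) / \<alpha>" .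
  have "1 - w n ?k * real n = - (real n * (w n ?k - 1 / real n))" using n by (simp add: right_diff_distrib)
  then have "\<bar>1 - w n ?k * real n\<bar> = real n * \<bar>w n ?k - 1 / real n\<bar>" by (simp add: abs_mult)
  also have "\<dots> \<le> real n * (weight_error / (real n)\<^sup>2)" by (intro mult_left_mono w_near[OF n]) simp
  also have "\<dots> = weight_error / real n" using n by (simp add: power2_eq_square)
  finally show "\<bar>step_mean n ?P score_weight\<bar> \<le> weight_error / \<alpha> * (1 / real n)" unfolding 1 using \<alpha> by (simp add: abs_divide field_simps)
qed

sublocale D: bounded_martingale_differences M F "mdiff score_weight" "mvar score_weight" "2 * score_bound"
  by (rule martingale_differences[OF score_weight_bounds(1)])

definition rate :: "nat \<Rightarrow> real" where "rate n = real n powr (\<alpha> / 2)"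

lemma rate_square: "(rate n)\<^sup>2 = real n powr \<alpha>"
  by (simp add: rate_def power2_eq_square powr_add[symmetric])

lemma rate_at_top: "filterlim rate at_top sequentially"
  unfolding rate_def using \<alpha> by (intro filterlim_compose[OF real_powr_at_top filterlim_real_sequentially]) simp

text \<open>Replacing squares by their conditional means changes the sum by a compensated sum, which is
  of the order \<open>n powr (\<alpha> / 2)\<close>; the squares of the conditional means are
  summable.\<close>
lemma variance_L1: "(\<lambda>n. \<integral>\<omega>. \<bar>D.V n \<omega> / (rate n)\<^sup>2 - info * S \<omega>\<bar> \<partial>M) \<longlonglongrightarrow> 0"
proof -
  let ?sq = "\<lambda>j. (score_weight j)\<^sup>2"
  let ?E = "\<lambda>n \<omega>. \<Sum>i\<in>{1..<n}. mdiff ?sq (Suc i) \<omega>"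
  have sqb: "\<bar>?sq j\<bar> \<le> score_bound\<^sup>2" for j using score_weight_bounds(2)[of j] by simp
  define K where "K = (score_bound\<^sup>2)\<^sup>2 + score_bound\<^sup>2 * score_bound"
  have Bs0: "0 \<le> score_bound" using score_weight_bounds(1)[of 0] by linarith
  have K1: "(?sq 0)\<^sup>2 \<le> K" using score_weight_bounds(6) by (simp add: K_def)
  have K2: "(?sq j)\<^sup>2 * (real j - \<alpha>) \<le> K" if "1 \<le> j" for j
    using score_weight_bounds(5)[OF that] zero_le_power2[of "score_bound\<^sup>2"] unfolding K_def by linarith
  define CE where "CE = sqrt (K * (2 + 2 * weight_error) * block_growth / \<alpha>)"
  have E1: "(\<integral>\<omega>. \<bar>?E n \<omega>\<bar> \<partial>M) \<le> CE * real n powr (\<alpha> / 2)" if "1 \<le> n" for n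
    unfolding CE_def by (rule compensated_L1(1)[OF sqb K1 K2 that])
  have Ei: "integrable M (?E n)" if "1 \<le> n" for n by (rule compensated_L1(2)[OF sqb K1 K2 that])
  define C2 where "C2 = 4 * (weight_error / \<alpha>)\<^sup>2"
  have pt: "\<bar>D.V n \<omega> - obs_info n \<omega>\<bar> \<le> \<bar>?E n \<omega>\<bar> + C2" if n: "1 \<le> n" and \<omega>: "\<omega> \<in> space M" for n \<omega>
  proof -
    have t: "mvar score_weight i \<omega> = ?sq (s (Suc i) \<omega>) - mdiff ?sq (Suc i) \<omega> - (step_mean i (\<pi> i \<omega>) score_weight)\<^sup>2" if "i \<in> {1..<n}" for i
    proof -
      have i: "1 \<le> i" using that by simp
      show ?thesis unfolding mvar_def cond_variance[OF i part[OF i \<omega>]] mdiff_def by simp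
    qed
    have eq: "D.V n \<omega> = obs_info n \<omega> - ?E n \<omega> - (\<Sum>i\<in>{1..<n}. (step_mean i (\<pi> i \<omega>) score_weight)\<^sup>2)"
      unfolding D.V_def obs_info_def sum_subtractf[symmetric] by (rule sum.cong[OF refl t])
    have "(\<Sum>i\<in>{1..<n}. (step_mean i (\<pi> i \<omega>) score_weight)\<^sup>2) \<le> (\<Sum>i\<in>{1..<n}. (weight_error / \<alpha>)\<^sup>2 * real i powr (- 1 - 1))"
    proof (rule sum_mono)
      fix i assume "i \<in> {1..<n}"
      then have i: "1 \<le> i" by simp
      have "\<bar>step_mean i (\<pi> i \<omega>) score_weight\<bar>\<^sup>2 \<le> (weight_error / \<alpha> * (1 / real i))\<^sup>2" by (rule power_mono[OF cond_score(2)[OF i \<omega>]]) simp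
      also have "\<dots> = (weight_error / \<alpha>)\<^sup>2 * real i powr (- 1 - 1)" using i by (simp add: power_mult_distrib power_divide powr_minus_divide)
      finally show "(step_mean i (\<pi> i \<omega>) score_weight)\<^sup>2 \<le> (weight_error / \<alpha>)\<^sup>2 * real i powr (- 1 - 1)" by simp
    qed
    also have "\<dots> = (weight_error / \<alpha>)\<^sup>2 * (\<Sum>i\<in>{1..<n}. real i powr (- 1 - 1))" by (simp add: sum_distrib_left)
    also have "\<dots> \<le> (weight_error / \<alpha>)\<^sup>2 * 4" using sum_powr_tail[of 1 1 n] by (intro mult_left_mono) auto
    finally have le: "(\<Sum>i\<in>{1..<n}. (step_mean i (\<pi> i \<omega>) score_weight)\<^sup>2) \<le> C2" by (simp add: C2_def)
    have "0 \<le> (\<Sum>i\<in>{1..<n}. (step_mean i (\<pi> i \<omega>) score_weight)\<^sup>2)" by (intro sum_nonneg) auto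
    then show ?thesis unfolding eq using le by linarith
  qed
  have rhs: "(\<lambda>n. (\<integral>\<omega>. \<bar>obs_info n \<omega> / real n powr \<alpha> - info * S \<omega>\<bar> \<partial>M) + (CE * real n powr (- (\<alpha> / 2)) + C2 * real n powr (- \<alpha>))) \<longlonglongrightarrow> 0 + (0 + 0)"
    using \<alpha> by (intro tendsto_add obs_info_L1 tendsto_mult_right_zero tendsto_powr_neg) auto
  show ?thesis unfolding rate_square
  proof (rule tendsto_sandwich[OF _ _ tendsto_const])
    show "(\<lambda>n. (\<integral>\<omega>. \<bar>obs_info n \<omega> / real n powr \<alpha> - info * S \<omega>\<bar> \<partial>M) + (CE * real n powr (- (\<alpha> / 2)) + C2 * real n powr (- \<alpha>))) \<longlonglongrightarrow> 0"
      using rhs by simp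
    show "\<forall>\<^sub>F n in sequentially. (\<integral>\<omega>. \<bar>D.V n \<omega> / real n powr \<alpha> - info * S \<omega>\<bar> \<partial>M) \<le> (\<integral>\<omega>. \<bar>obs_info n \<omega> / real n powr \<alpha> - info * S \<omega>\<bar> \<partial>M) + (CE * real n powr (- (\<alpha> / 2)) + C2 * real n powr (- \<alpha>))"
      using eventually_ge_at_top[of 1]
    proof eventually_elim
      case (elim n)
      have na: "0 < real n powr \<alpha>" using elim by simp
      have oi: "integrable M (\<lambda>\<omega>. \<bar>obs_info n \<omega> / real n powr \<alpha> - info * S \<omega>\<bar>)"
        unfolding obs_info_def by (intro integrable_abs Bochner_Integration.integrable_diff integrable_divide integrable_mult_right integrable_S measurable_sum_increments(2))
      have Vi: "integrable M (D.V n)"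
        unfolding D.V_def[abs_def] by (intro Bochner_Integration.integrable_sum D.integrable_q) auto
      have "(\<integral>\<omega>. \<bar>D.V n \<omega> / real n powr \<alpha> - info * S \<omega>\<bar> \<partial>M) \<le> (\<integral>\<omega>. \<bar>obs_info n \<omega> / real n powr \<alpha> - info * S \<omega>\<bar> + (\<bar>?E n \<omega>\<bar> + C2) / real n powr \<alpha> \<partial>M)"
      proof (rule integral_mono)
        show "integrable M (\<lambda>\<omega>. \<bar>D.V n \<omega> / real n powr \<alpha> - info * S \<omega>\<bar>)"
          by (intro integrable_abs Bochner_Integration.integrable_diff integrable_divide integrable_mult_right integrable_S Vi)
        show "integrable M (\<lambda>\<omega>. \<bar>obs_info n \<omega> / real n powr \<alpha> - info * S \<omega>\<bar> + (\<bar>?E n \<omega>\<bar> + C2) / real n powr \<alpha>)"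
          by (intro Bochner_Integration.integrable_add oi integrable_divide integrable_abs Ei[OF elim] gp.integrable_const)
        fix \<omega> assume \<omega>: "\<omega> \<in> space M"
        have "\<bar>D.V n \<omega> / real n powr \<alpha> - info * S \<omega>\<bar> \<le> \<bar>obs_info n \<omega> / real n powr \<alpha> - info * S \<omega>\<bar> + \<bar>(D.V n \<omega> - obs_info n \<omega>) / real n powr \<alpha>\<bar>"
          by (simp add: diff_divide_distrib)
        also have "\<bar>(D.V n \<omega> - obs_info n \<omega>) / real n powr \<alpha>\<bar> \<le> (\<bar>?E n \<omega>\<bar> + C2) / real n powr \<alpha>"
          using pt[OF elim \<omega>] na by (simp add: abs_divide divide_right_mono)
        finally show "\<bar>D.V n \<omega> / real n powr \<alpha> - info * S \<omega>\<bar> \<le> \<bar>obs_info n \<omega> / real n powr \<alpha> - info * S \<omega>\<bar> + (\<bar>?E n \<omega>\<bar> + C2) / real n powr \<alpha>" by simp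
      qed
      also have "\<dots> = (\<integral>\<omega>. \<bar>obs_info n \<omega> / real n powr \<alpha> - info * S \<omega>\<bar> \<partial>M) + ((\<integral>\<omega>. \<bar>?E n \<omega>\<bar> \<partial>M) + C2) / real n powr \<alpha>"
        by (simp only: Bochner_Integration.integral_add[OF oi integrable_divide[OF Bochner_Integration.integrable_add[OF integrable_abs[OF Ei[OF elim]] gp.integrable_const]]]
            integral_divide_zero Bochner_Integration.integral_add[OF integrable_abs[OF Ei[OF elim]] gp.integrable_const] integral_constant)
      also have "((\<integral>\<omega>. \<bar>?E n \<omega>\<bar> \<partial>M) + C2) / real n powr \<alpha> \<le> (CE * real n powr (\<alpha> / 2) + C2) / real n powr \<alpha>"
        using E1[OF elim] na by (intro divide_right_mono add_right_mono) auto
      also have "(CE * real n powr (\<alpha> / 2) + C2) / real n powr \<alpha> = CE * real n powr (- (\<alpha> / 2)) + C2 * real n powr (- \<alpha>)"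
      proof -
        have "real n powr (\<alpha> / 2) = real n powr (- (\<alpha> / 2)) * real n powr \<alpha>" unfolding powr_add[symmetric] by simp
        then show ?thesis using na by (simp add: add_divide_distrib powr_minus_divide[of _ \<alpha>])
      qed
      finally show ?case by simp
    qed
  qed (simp add: Bochner_Integration.integral_nonneg)
qed

text \<open>The martingale part of the normalized score.\<close>
definition U :: "nat \<Rightarrow> 'a \<Rightarrow> real" where "U n \<omega> = (\<Sum>i\<in>{1..<n}. mdiff score_weight (Suc i) \<omega>) / rate n"

lemma U_tight:
  shows "integrable M (U n)" "(\<integral>\<omega>. \<bar>U n \<omega>\<bar> \<partial>M) \<le> sqrt ((score_bound\<^sup>2 + score_bound) * (2 + 2 * weight_error) * block_growth / \<alpha>)"
proof -
  have Bs0: "0 \<le> score_bound" using score_weight_bounds(1)[of 0] by linarith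
  have K2: "(score_weight j)\<^sup>2 * (real j - \<alpha>) \<le> score_bound\<^sup>2 + score_bound" if "1 \<le> j" for j
    using score_weight_bounds(3)[OF that] zero_le_power2[of score_bound] by linarith
  note L1 = compensated_L1(1)[OF score_weight_bounds(1) score_weight_bounds(4) K2]
    and L2 = compensated_L1(2)[OF score_weight_bounds(1) score_weight_bounds(4) K2]
  let ?C = "sqrt ((score_bound\<^sup>2 + score_bound) * (2 + 2 * weight_error) * block_growth / \<alpha>)"
  have C0: "0 \<le> ?C" using Bs0 weight_error_nonneg block_growth_nonneg \<alpha> by (intro real_sqrt_ge_zero divide_nonneg_nonneg mult_nonneg_nonneg add_nonneg_nonneg) auto
  show "integrable M (U n)"
  proof (cases "1 \<le> n")
    case True
    have "integrable M (\<lambda>\<omega>. \<Sum>i\<in>{1..<n}. mdiff score_weight (Suc i) \<omega>)"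
      by (rule L2) (use True in auto)
    then show ?thesis unfolding U_def[abs_def] by (rule integrable_divide)
  next
    case False
    then have "U n = (\<lambda>_. 0)" by (auto simp: U_def fun_eq_iff)
    then show ?thesis by simp
  qed
  show "(\<integral>\<omega>. \<bar>U n \<omega>\<bar> \<partial>M) \<le> ?C"
  proof (cases "1 \<le> n")
    case True
    have r0: "0 < rate n" using True by (simp add: rate_def)
    have L: "(\<integral>\<omega>. \<bar>\<Sum>i\<in>{1..<n}. mdiff score_weight (Suc i) \<omega>\<bar> \<partial>M) \<le> ?C * rate n"
      unfolding rate_def by (rule L1) (use True in auto)
    have "(\<integral>\<omega>. \<bar>U n \<omega>\<bar> \<partial>M) = (\<integral>\<omega>. \<bar>\<Sum>i\<in>{1..<n}. mdiff score_weight (Suc i) \<omega>\<bar> / rate n \<partial>M)"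
      unfolding U_def using r0 by simp
    also have "\<dots> = (\<integral>\<omega>. \<bar>\<Sum>i\<in>{1..<n}. mdiff score_weight (Suc i) \<omega>\<bar> \<partial>M) / rate n" by (rule integral_divide_zero)
    also have "\<dots> \<le> ?C * rate n / rate n" using L r0 by (intro divide_right_mono) auto
    finally show ?thesis using r0 by simp
  next
    case False
    then have "U n = (\<lambda>_. 0)" by (auto simp: U_def fun_eq_iff)
    then show ?thesis using C0 by simp
  qed
qed

theorem score_martingale_clt:
  assumes A: "A \<in> sets G"
  shows "(\<lambda>n. \<integral>\<omega>. indicator A \<omega> *\<^sub>R iexp (t * U n \<omega>) \<partial>M)
    \<longlonglongrightarrow> (\<integral>\<omega>. indicator A \<omega> *\<^sub>R complex_of_real (exp (- (t\<^sup>2 * (info * max 0 (S \<omega>)) / 2))) \<partial>M)"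
proof -
  have AM: "A \<in> gp.events" using A subalgebra_G by (auto simp: subalgebra_def)
  have Sm[measurable]: "S \<in> borel_measurable G" by (rule S_measurable_G)
  have eqA: "(\<integral>\<omega>. \<bar>D.V n \<omega> / (rate n)\<^sup>2 - info * max 0 (S \<omega>)\<bar> \<partial>M) = (\<integral>\<omega>. \<bar>D.V n \<omega> / (rate n)\<^sup>2 - info * S \<omega>\<bar> \<partial>M)" for n
  proof (rule integral_cong_AE)
    have VM: "D.V n \<in> borel_measurable M" unfolding D.V_def[abs_def] by (intro borel_measurable_sum D.measurable_qM) auto
    have [measurable]: "S \<in> borel_measurable M" by (rule S_measurable)
    show "(\<lambda>\<omega>. \<bar>D.V n \<omega> / (rate n)\<^sup>2 - info * max 0 (S \<omega>)\<bar>) \<in> borel_measurable M" "(\<lambda>\<omega>. \<bar>D.V n \<omega> / (rate n)\<^sup>2 - info * S \<omega>\<bar>) \<in> borel_measurable M"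
      using VM by measurable
    show "AE \<omega> in M. \<bar>D.V n \<omega> / (rate n)\<^sup>2 - info * max 0 (S \<omega>)\<bar> = \<bar>D.V n \<omega> / (rate n)\<^sup>2 - info * S \<omega>\<bar>"
      using AE_S_pos by eventually_elim simp
  qed
  have fi: "integrable M (\<lambda>\<omega>. of_real (indicator A \<omega>) :: complex)"
    using AM by (intro D.integrable_bounded[where B=1]) (auto simp: indicator_def)
  have fG: "(\<lambda>\<omega>. of_real (indicator A \<omega>) :: complex) \<in> borel_measurable G"
    using A by measurable
  have \<Lambda>G: "(\<lambda>\<omega>. info * max 0 (S \<omega>)) \<in> borel_measurable G" by measurable
  have "(\<lambda>n. \<integral>\<omega>. of_real (indicator A \<omega>) * iexp (t * ((\<Sum>i\<in>{1..<n}. mdiff score_weight (Suc i) \<omega>) / rate n)) \<partial>M)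
     \<longlonglongrightarrow> (\<integral>\<omega>. of_real (indicator A \<omega>) * of_real (exp (- (t\<^sup>2 * (info * max 0 (S \<omega>)) / 2))) \<partial>M)"
  proof (rule D.stable_martingale_clt[OF subalgebra_G sets_G rate_at_top \<Lambda>G _ _ _ fi fG])
    show "0 \<le> info * max 0 (S \<omega>)" for \<omega> using info_pos by simp
    show "integrable M (\<lambda>\<omega>. info * max 0 (S \<omega>))"
      using integrable_S by (intro integrable_mult_right integrable_max) auto
    show "(\<lambda>n. \<integral>\<omega>. \<bar>D.V n \<omega> / (rate n)\<^sup>2 - info * max 0 (S \<omega>)\<bar> \<partial>M) \<longlonglongrightarrow> 0" unfolding eqA by (rule variance_L1)
  qed
  then show ?thesis unfolding U_def scaleR_conv_of_real .
qed

text \<open>By \<open>cond_score\<close> the drift is bounded by a harmonic sum.\<close>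
lemma score_decomposition:
  assumes \<omega>: "\<omega> \<in> space M" and n: "1 \<le> n"
  shows "\<bar>score n \<omega> / rate n - U n \<omega>\<bar> \<le> weight_error / \<alpha> * ((1 + ln (real n)) / rate n)"
proof -
  have r0: "0 < rate n" using n by (simp add: rate_def)
  have t: "score_weight (s (Suc i) \<omega>) - mdiff score_weight (Suc i) \<omega> = step_mean i (\<pi> i \<omega>) score_weight" for i by (simp add: mdiff_def)
  have eq: "score n \<omega> / rate n - U n \<omega> = (\<Sum>i\<in>{1..<n}. step_mean i (\<pi> i \<omega>) score_weight) / rate n"
    unfolding score_def U_def diff_divide_distrib[symmetric] sum_subtractf[symmetric] t ..
  have "\<bar>\<Sum>i\<in>{1..<n}. step_mean i (\<pi> i \<omega>) score_weight\<bar> \<le> (\<Sum>i\<in>{1..<n}. weight_error / \<alpha> * (1 / real i))"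
    by (rule order_trans[OF sum_abs sum_mono[OF cond_score(2)[OF _ \<omega>]]]) simp
  also have "\<dots> = weight_error / \<alpha> * (\<Sum>i\<in>{1..<n}. 1 / real i)" by (simp only: sum_distrib_left)
  also have "\<dots> \<le> weight_error / \<alpha> * (1 + ln (real n))" using weight_error_nonneg \<alpha> by (intro mult_left_mono sum_inverse_upper n) auto
  finally have "\<bar>\<Sum>i\<in>{1..<n}. step_mean i (\<pi> i \<omega>) score_weight\<bar> / rate n \<le> weight_error / \<alpha> * (1 + ln (real n)) / rate n"
    using r0 by (intro divide_right_mono) auto
  then show ?thesis unfolding eq abs_divide using r0 by simp
qed

lemma drift_rate: "(\<lambda>n. weight_error / \<alpha> * ((1 + ln (real n)) / rate n)) \<longlonglongrightarrow> 0"
proof -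
  have "(\<lambda>n. real n powr (- (\<alpha> / 2))) \<longlonglongrightarrow> 0" using \<alpha> by (intro tendsto_powr_neg) simp
  moreover have "(\<lambda>n. ln (real n) / real n powr (\<alpha> / 2)) \<longlonglongrightarrow> 0" using \<alpha> by (intro lim_ln_over_power) simp
  ultimately have "(\<lambda>n. real n powr (- (\<alpha> / 2)) + ln (real n) / real n powr (\<alpha> / 2)) \<longlonglongrightarrow> 0 + 0" by (rule tendsto_add)
  then have "(\<lambda>n. (1 + ln (real n)) / rate n) \<longlonglongrightarrow> 0" by (simp add: rate_def powr_minus_divide add_divide_distrib)
  then show ?thesis by (rule tendsto_mult_right_zero)
qed

end


section \<open>The Fisher information of the Sibuya law\<close>

lemma tendsto_log_over_power: "0 < a \<Longrightarrow> (\<lambda>n. (1 + ln (real n)) / real n powr a) \<longlonglongrightarrow> 0"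
proof -
  assume a: "0 < a"
  have "(\<lambda>n. real n powr (- a) + ln (real n) / real n powr a) \<longlonglongrightarrow> 0 + 0"
    by (intro tendsto_add lim_ln_over_power[OF a] tendsto_neg_powr) (use a in \<open>auto simp: filterlim_real_sequentially\<close>)
  then show ?thesis by (simp add: powr_minus_divide add_divide_distrib)
qed

lemma sibuya_prob_Suc: "sibuya_prob a (Suc m) = tail_prob a m * a / real (Suc m)"
proof (induction m)
  case 0
  then show ?case by (simp add: sibuya_prob_def tail_prob_0)
next
  case (Suc m)
  have "sibuya_prob a (Suc (Suc m)) = sibuya_prob a (Suc m) * (real (Suc m) - a) / real (Suc (Suc m))"
    by (simp add: sibuya_prob_def mult_ac del: of_nat_Suc)
  then show ?case unfolding Suc.IH tail_prob_Suc by simp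
qed

lemma sibuya_prob_tail: "sibuya_prob a (Suc m) = tail_prob a m - tail_prob a (Suc m)"
proof -
  have "(real (Suc m) - a) / real (Suc m) = 1 - a / real (Suc m)" by (simp only: diff_divide_distrib) simp
  then show ?thesis unfolding sibuya_prob_Suc tail_prob_Suc by (simp add: right_diff_distrib)
qed

text \<open>Each factor satisfies \<open>1 - a / l \<le> exp (- a / l)\<close>, and the harmonic sum
  exceeds the logarithm.\<close>
lemma tail_prob_decay: assumes a: "0 < a" "a < 1" shows "tail_prob a j \<le> real (Suc j) powr (- a)"
proof -
  have "tail_prob a j \<le> exp (- a * (\<Sum>l\<in>{1..<Suc j}. 1 / real l))"
  proof (induction j)
    case (Suc j)
    have "(real (Suc j) - a) / real (Suc j) = 1 + - (a / real (Suc j))" by (simp only: diff_divide_distrib) simp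
    then have "(real (Suc j) - a) / real (Suc j) \<le> exp (- (a / real (Suc j)))" using exp_ge_add_one_self[of "- (a / real (Suc j))"] by linarith
    then have "tail_prob a (Suc j) \<le> exp (- a * (\<Sum>l\<in>{1..<Suc j}. 1 / real l)) * exp (- (a / real (Suc j)))"
      unfolding tail_prob_Suc using a by (intro mult_mono Suc.IH) auto
    also have "\<dots> = exp (- a * (\<Sum>l\<in>{1..<Suc (Suc j)}. 1 / real l))"
      by (simp add: exp_add[symmetric] distrib_left)
    finally show ?case .
  qed (simp add: tail_prob_0)
  also have "\<dots> \<le> exp (- a * ln (real (Suc j)))"
    using sum_inverse_lower[of "Suc j"] a by simp
  also have "\<dots> = real (Suc j) powr (- a)" by (simp add: powr_def)
  finally show ?thesis .
qed

context bounded_gibbs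
begin

text \<open>Score of one observation of size \<open>Suc m\<close> from the Sibuya law: such a block has
  been created and then joined at the sizes \<open>1, \<dots>, m\<close>.\<close>
definition sibuya_score :: "nat \<Rightarrow> real" where "sibuya_score m = (\<Sum>i<Suc m. score_weight i)"

lemma deriv_ln_sibuya: "deriv (\<lambda>a. ln (sibuya_prob a (Suc m))) \<alpha> = sibuya_score m"
proof (rule DERIV_imp_deriv)
  have e: "ln (sibuya_prob a (Suc m)) = ln a + (\<Sum>i\<in>{1..<Suc m}. ln (real i - a)) - ln (fact (Suc m))" if "a \<in> {0<..<1}" for a
  proof -
    have p: "0 < (\<Prod>i\<in>{1..<Suc m}. real i - a)" using that by (intro prod_pos) auto
    have "ln (\<Prod>i\<in>{1..<Suc m}. real i - a) = (\<Sum>i\<in>{1..<Suc m}. ln (real i - a))" by (rule ln_prod) (use that in auto)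
    moreover have "ln (x * y / z) = ln x + ln y - ln z" if "0 < x" "0 < y" "0 < z" for x y z :: real
      using that by (simp add: ln_div ln_mult)
    ultimately show ?thesis unfolding sibuya_prob_def using p that by (metis fact_gt_zero greaterThanLessThan_iff)
  qed
  have d: "((\<lambda>a. ln a + (\<Sum>i\<in>{1..<Suc m}. ln (real i - a)) - ln (fact (Suc m))) has_field_derivative
      1 / \<alpha> + (\<Sum>i\<in>{1..<Suc m}. - 1 / (real i - \<alpha>)) - 0) (at \<alpha>)"
  proof (intro DERIV_diff DERIV_add DERIV_sum DERIV_const)
    show "(ln has_field_derivative 1 / \<alpha>) (at \<alpha>)" using \<alpha> by (auto intro!: derivative_eq_intros)
    fix i assume "i \<in> {1..<Suc m}"
    then show "((\<lambda>a. ln (real i - a)) has_field_derivative - 1 / (real i - \<alpha>)) (at \<alpha>)"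
      using \<alpha> by (auto intro!: derivative_eq_intros)
  qed
  have "{..<Suc m} = insert 0 {1..<Suc m}" by auto
  then have "sibuya_score m = score_weight 0 + (\<Sum>i\<in>{1..<Suc m}. score_weight i)" unfolding sibuya_score_def by simp
  also have "(\<Sum>i\<in>{1..<Suc m}. score_weight i) = (\<Sum>i\<in>{1..<Suc m}. - 1 / (real i - \<alpha>))"
    by (intro sum.cong) (auto simp: score_weight_def)
  finally have s: "1 / \<alpha> + (\<Sum>i\<in>{1..<Suc m}. - 1 / (real i - \<alpha>)) - 0 = sibuya_score m" by (simp add: score_weight_def)
  show "((\<lambda>a. ln (sibuya_prob a (Suc m))) has_field_derivative sibuya_score m) (at \<alpha>)"
    by (rule has_field_derivative_transform_within_open[OF d[unfolded s], of "{0<..<1}"]) (use \<alpha> e in auto)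
qed

lemma sibuya_score_Suc: "sibuya_score (Suc m) = sibuya_score m - 1 / (real (Suc m) - \<alpha>)"
  by (simp add: sibuya_score_def score_weight_def)

text \<open>Summation by parts turns the sum of squared scores weighted by \<open>sibuya_prob\<close>
  into one of squared increments weighted by the tails. The cross terms sum up in closed form
  because the Sibuya score has mean zero, with partial sums \<open>T J * (1 / \<alpha> -
  sibuya_score J)\<close>.\<close>
lemma fisher_partial_sum:
  "(\<Sum>m<Suc J. sibuya_prob \<alpha> (Suc m) * (sibuya_score m)\<^sup>2)
    = (\<Sum>j<Suc J. T j * (score_weight j)\<^sup>2) - (2 / \<alpha> * (T J * (1 / \<alpha> - sibuya_score J)) + T (Suc J) * (sibuya_score J)\<^sup>2)"
proof (induction J)
  case 0
  show ?case unfolding sibuya_prob_tail by (simp add: sibuya_score_def score_weight_def tail_prob_0 algebra_simps)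
next
  case (Suc J)
  define u where "u = 1 / (real (Suc J) - \<alpha>)"
  have d: "real (Suc J) - \<alpha> \<noteq> 0" using \<alpha> by simp
  have TJ: "T J = T (Suc J) * (1 + \<alpha> * u)"
  proof -
    have "1 + \<alpha> * u = real (Suc J) / (real (Suc J) - \<alpha>)" using d unfolding u_def by (simp add: field_simps)
    then have "(real (Suc J) - \<alpha>) / real (Suc J) * (1 + \<alpha> * u) = 1" using d by simp
    then show ?thesis unfolding tail_prob_Suc by (simp only: mult.assoc mult_1_right)
  qed
  have h: "sibuya_score (Suc J) = sibuya_score J - u" unfolding u_def by (rule sibuya_score_Suc)
  have w: "(score_weight (Suc J))\<^sup>2 = u\<^sup>2" unfolding u_def by (simp add: score_weight_def)
  show ?case unfolding sum.lessThan_Suc[of _ "Suc J"] Suc.IH TJ h w sibuya_prob_tail[of _ "Suc J"]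
    using \<alpha>(1) by (simp add: power2_eq_square field_simps)
qed

text \<open>The tail decays like a negative power while the score grows logarithmically.\<close>
lemma fisher_boundary: "(\<lambda>J. 2 / \<alpha> * (T J * (1 / \<alpha> - sibuya_score J)) + T (Suc J) * (sibuya_score J)\<^sup>2) \<longlonglongrightarrow> 0"
proof -
  let ?L = "\<lambda>J. 1 + ln (real (Suc J))"
  have B1: "0 < score_bound" "1 / \<alpha> \<le> score_bound" "1 \<le> score_bound"   proof -
    have "1 < 1 / \<alpha>" "0 < 1 / (1 - \<alpha>)" using \<alpha> by auto
    then show "0 < score_bound" "1 / \<alpha> \<le> score_bound" "1 \<le> score_bound" unfolding score_bound_def by linarith+
  qed
  have L1: "1 \<le> ?L J" for J by simp
  have d: "\<bar>1 / \<alpha> - sibuya_score J\<bar> \<le> score_bound * ?L J" "\<bar>sibuya_score J\<bar> \<le> 2 * score_bound * ?L J" for J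
  proof -
    have "{..<Suc J} = insert 0 {1..<Suc J}" by auto
    then have e: "1 / \<alpha> - sibuya_score J = - (\<Sum>i\<in>{1..<Suc J}. score_weight i)" unfolding sibuya_score_def by (simp add: score_weight_def)
    have "\<bar>\<Sum>i\<in>{1..<Suc J}. score_weight i\<bar> \<le> (\<Sum>i\<in>{1..<Suc J}. 1 / (1 - \<alpha>) * (1 / real i))"
    proof (rule order_trans[OF sum_abs sum_mono])
      fix i assume i: "i \<in> {1..<Suc J}"
      have "real i * (1 - \<alpha>) \<le> real i - \<alpha>" using i \<alpha> by (simp add: algebra_simps)
      then have "1 / (real i - \<alpha>) \<le> 1 / (real i * (1 - \<alpha>))" using i \<alpha> by (intro divide_left_mono mult_pos_pos) auto
      then show "\<bar>score_weight i\<bar> \<le> 1 / (1 - \<alpha>) * (1 / real i)" using i \<alpha> by (simp add: score_weight_def mult.commute)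
    qed
    also have "\<dots> = 1 / (1 - \<alpha>) * (\<Sum>i\<in>{1..<Suc J}. 1 / real i)" by (simp only: sum_distrib_left)
    also have "\<dots> \<le> 1 / (1 - \<alpha>) * ?L J" using sum_inverse_upper[of "Suc J"] \<alpha> by (intro mult_left_mono) auto
    also have "\<dots> \<le> score_bound * ?L J" using L1[of J] \<alpha> by (intro mult_right_mono) (auto simp: score_bound_def)
    finally show 1: "\<bar>1 / \<alpha> - sibuya_score J\<bar> \<le> score_bound * ?L J" unfolding e by simp
    have "1 / \<alpha> \<le> score_bound * ?L J" using B1 mult_left_mono[OF L1[of J], of score_bound] by linarith
    moreover have "0 < 1 / \<alpha>" using \<alpha> by simp
    ultimately show "\<bar>sibuya_score J\<bar> \<le> 2 * score_bound * ?L J" using 1 by linarith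
  qed
  have lim: "(\<lambda>J. (2 / \<alpha> * score_bound + 4 * score_bound\<^sup>2) * ((?L J / real (Suc J) powr (\<alpha> / 2)) * (?L J / real (Suc J) powr (\<alpha> / 2)))) \<longlonglongrightarrow> 0"
  proof -
    have "(\<lambda>J. ?L J / real (Suc J) powr (\<alpha> / 2)) \<longlonglongrightarrow> 0"
      using LIMSEQ_Suc[OF tendsto_log_over_power[of "\<alpha> / 2"]] \<alpha> by simp
    from tendsto_mult_right_zero[OF tendsto_mult_zero[OF this this]] show ?thesis .
  qed
  show ?thesis
  proof (rule Lim_null_comparison[OF always_eventually lim], rule allI)
    fix J
    have T: "0 < T J" "0 < T (Suc J)" using tail_prob_bounds[OF \<alpha>] by auto
    have "(real (Suc J) - \<alpha>) / real (Suc J) \<le> 1" using \<alpha> by simp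
    then have TS: "T (Suc J) \<le> T J" unfolding tail_prob_Suc using T(1) by (intro mult_left_le) auto
    have LL: "?L J \<le> (?L J)\<^sup>2" "0 \<le> (?L J)\<^sup>2" using L1[of J] self_le_power[OF L1[of J], of 2] by auto
    have a: "\<bar>2 / \<alpha> * (T J * (1 / \<alpha> - sibuya_score J))\<bar> \<le> 2 / \<alpha> * (T J * (score_bound * (?L J)\<^sup>2))"
    proof -
      have "score_bound * ?L J \<le> score_bound * (?L J)\<^sup>2" using B1 LL by (intro mult_left_mono) auto
      then have "\<bar>1 / \<alpha> - sibuya_score J\<bar> \<le> score_bound * (?L J)\<^sup>2" using d(1)[of J] by linarith
      then have "2 / \<alpha> * (T J * \<bar>1 / \<alpha> - sibuya_score J\<bar>) \<le> 2 / \<alpha> * (T J * (score_bound * (?L J)\<^sup>2))" using T \<alpha> by (intro mult_left_mono) auto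
      then show ?thesis using T \<alpha> by (simp only: abs_mult) simp
    qed
    have b: "\<bar>T (Suc J) * (sibuya_score J)\<^sup>2\<bar> \<le> T J * (4 * score_bound\<^sup>2 * (?L J)\<^sup>2)"
    proof -
      have "\<bar>sibuya_score J\<bar>\<^sup>2 \<le> (2 * score_bound * ?L J)\<^sup>2" by (rule power_mono[OF d(2)]) simp
      then have "T (Suc J) * (sibuya_score J)\<^sup>2 \<le> T J * (2 * score_bound * ?L J)\<^sup>2" using T TS by (intro mult_mono) auto
      moreover have "0 \<le> T (Suc J) * (sibuya_score J)\<^sup>2" using T by simp
      ultimately show ?thesis by (simp only: abs_of_nonneg power_mult_distrib) simp
    qed
    have "norm (2 / \<alpha> * (T J * (1 / \<alpha> - sibuya_score J)) + T (Suc J) * (sibuya_score J)\<^sup>2)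
        \<le> \<bar>2 / \<alpha> * (T J * (1 / \<alpha> - sibuya_score J))\<bar> + \<bar>T (Suc J) * (sibuya_score J)\<^sup>2\<bar>" by (simp only: real_norm_def abs_triangle_ineq)
    then have "norm (2 / \<alpha> * (T J * (1 / \<alpha> - sibuya_score J)) + T (Suc J) * (sibuya_score J)\<^sup>2)
        \<le> 2 / \<alpha> * (T J * (score_bound * (?L J)\<^sup>2)) + T J * (4 * score_bound\<^sup>2 * (?L J)\<^sup>2)" using a b by linarith
    moreover have "2 / \<alpha> * (T J * (score_bound * (?L J)\<^sup>2)) + T J * (4 * score_bound\<^sup>2 * (?L J)\<^sup>2) = (2 / \<alpha> * score_bound + 4 * score_bound\<^sup>2) * (?L J)\<^sup>2 * T J"
      by (simp add: algebra_simps)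
    moreover have "(2 / \<alpha> * score_bound + 4 * score_bound\<^sup>2) * (?L J)\<^sup>2 * T J \<le> (2 / \<alpha> * score_bound + 4 * score_bound\<^sup>2) * (?L J)\<^sup>2 * real (Suc J) powr (- \<alpha>)"
      using B1 \<alpha> by (intro mult_left_mono tail_prob_decay) auto
    moreover have "(2 / \<alpha> * score_bound + 4 * score_bound\<^sup>2) * (?L J)\<^sup>2 * real (Suc J) powr (- \<alpha>)
      = (2 / \<alpha> * score_bound + 4 * score_bound\<^sup>2) * ((?L J / real (Suc J) powr (\<alpha> / 2)) * (?L J / real (Suc J) powr (\<alpha> / 2)))"
    proof -
      have "real (Suc J) powr \<alpha> = real (Suc J) powr (\<alpha> / 2) * real (Suc J) powr (\<alpha> / 2)" by (simp only: powr_add[symmetric]) simp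
      moreover have "x * (y * y) * (1 / (q * q)) = x * ((y / q) * (y / q))" for x y q :: real by simp
      ultimately show ?thesis by (simp only: powr_minus_divide power2_eq_square[of "1 + _"])
    qed
    ultimately show "norm (2 / \<alpha> * (T J * (1 / \<alpha> - sibuya_score J)) + T (Suc J) * (sibuya_score J)\<^sup>2)
      \<le> (2 / \<alpha> * score_bound + 4 * score_bound\<^sup>2) * ((?L J / real (Suc J) powr (\<alpha> / 2)) * (?L J / real (Suc J) powr (\<alpha> / 2)))" by linarith
  qed
qed

theorem fisher_info_eq: "fisher_info \<alpha> = info"
proof -
  let ?g = "\<lambda>m. sibuya_prob \<alpha> (Suc m) * (sibuya_score m)\<^sup>2"
  have "(\<lambda>J. \<Sum>j<Suc J. T j * (score_weight j)\<^sup>2) \<longlonglongrightarrow> info"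
    using LIMSEQ_Suc[OF summable_LIMSEQ[OF summable_info]] unfolding info_def .
  from tendsto_diff[OF this fisher_boundary] have "(\<lambda>J. \<Sum>m<Suc J. ?g m) \<longlonglongrightarrow> info" unfolding fisher_partial_sum by simp
  then have "?g sums info" unfolding sums_def by (rule LIMSEQ_imp_Suc)
  moreover have "0 \<le> ?g m" for m
    unfolding sibuya_prob_Suc using tail_prob_bounds[OF \<alpha>, of m] \<alpha> by (intro mult_nonneg_nonneg divide_nonneg_nonneg) auto
  ultimately have "(?g has_sum info) UNIV" by (intro sums_nonneg_imp_has_sum) auto
  then have "((\<lambda>j. sibuya_prob \<alpha> j * (deriv (\<lambda>a. ln (sibuya_prob a j)) \<alpha>)\<^sup>2) \<circ> Suc has_sum info) UNIV"
    unfolding comp_def deriv_ln_sibuya .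
  then have "((\<lambda>j. sibuya_prob \<alpha> j * (deriv (\<lambda>a. ln (sibuya_prob a j)) \<alpha>)\<^sup>2) has_sum info) (Suc ` UNIV)"
    by (subst has_sum_reindex) auto
  moreover have "Suc ` UNIV = {1..}" by (auto simp: image_iff) (metis Suc_le_D)
  ultimately show ?thesis unfolding fisher_info_def by (auto intro: infsumI)
qed

end


section \<open>The estimator as a root of the quasi-score\<close>

text \<open>A block of size \<open>j\<close> contributes one term for every \<open>i < j\<close>;
  exchanging the sums counts, for every \<open>i\<close>, the blocks larger than
  \<open>i\<close>.\<close>
lemma quasi_score_eq:
  assumes P: "partition_on {1..n} P"
  shows "quasi_score n P x = (real (card P) - 1) / x - (\<Sum>i\<in>{1..<n}. real (blocks_larger i P) / (real i - x))"
proof -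
  let ?g = "\<lambda>j. \<Sum>i\<in>{1..<j}. 1 / (real i - x)"
  note pb = partition_blocks[OF P]
  have "(\<Sum>j=2..n. real (blocks_of_size j P) * (\<Sum>i=1..j-1. 1 / (real i - x))) = (\<Sum>j=2..n. \<Sum>U\<in>P. of_bool (card U = j) * ?g j)"
  proof (rule sum.cong[OF refl])
    fix j assume j: "j \<in> {2..n}"
    have e: "{1..j-1} = {1..<j}" using j by auto
    have "real (blocks_of_size j P) = (\<Sum>U\<in>P. of_bool (card U = j))"
      unfolding blocks_of_size_def using pb(1) by (simp add: Int_def)
    then show "real (blocks_of_size j P) * (\<Sum>i=1..j-1. 1 / (real i - x)) = (\<Sum>U\<in>P. of_bool (card U = j) * ?g j)"
      unfolding e by (simp only: sum_distrib_right)
  qed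
  also have "\<dots> = (\<Sum>U\<in>P. \<Sum>j=2..n. of_bool (card U = j) * ?g j)" by (rule sum.swap)
  also have "\<dots> = (\<Sum>U\<in>P. \<Sum>i\<in>{1..<n}. of_bool (i < card U) / (real i - x))"
  proof (rule sum.cong[OF refl])
    fix U assume U: "U \<in> P"
    have "(\<Sum>j=2..n. of_bool (card U = j) * ?g j) = (\<Sum>j=2..n. if j = card U then ?g (card U) else 0)"
      by (intro sum.cong) auto
    also have "\<dots> = ?g (card U)" using pb(5,6)[OF U] by (cases "card U = 1") auto
    also have "\<dots> = (\<Sum>i\<in>{1..<n}. of_bool (i < card U) / (real i - x))"
      by (rule sum.mono_neutral_cong_left) (use pb(6)[OF U] in auto)
    finally show "(\<Sum>j=2..n. of_bool (card U = j) * ?g j) = (\<Sum>i\<in>{1..<n}. of_bool (i < card U) / (real i - x))" .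
  qed
  also have "\<dots> = (\<Sum>i\<in>{1..<n}. \<Sum>U\<in>P. of_bool (i < card U) / (real i - x))" by (rule sum.swap)
  also have "\<dots> = (\<Sum>i\<in>{1..<n}. real (blocks_larger i P) / (real i - x))"
  proof (rule sum.cong[OF refl])
    fix i
    have "real (blocks_larger i P) = (\<Sum>U\<in>P. of_bool (i < card U))"
      unfolding blocks_larger_def using pb(1) by (simp add: Int_def)
    then show "(\<Sum>U\<in>P. of_bool (i < card U) / (real i - x)) = real (blocks_larger i P) / (real i - x)"
      by (simp only: sum_divide_distrib)
  qed
  finally show ?thesis unfolding quasi_score_def by simp
qed

text \<open>Negative divided difference of the quasi-score; on the diagonal it is the observed
  information.\<close>
definition divided_score :: "nat \<Rightarrow> nat set set \<Rightarrow> real \<Rightarrow> real \<Rightarrow> real" where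
  "divided_score n P x y = (real (card P) - 1) / (x * y)
     + (\<Sum>i\<in>{1..<n}. real (blocks_larger i P) / ((real i - x) * (real i - y)))"

context
  fixes n :: nat and P :: "nat set set"
  assumes P: "partition_on {1..n} P" and n: "1 \<le> n"
begin

lemma quasi_score_diff:
  assumes "0 < x" "x < 1" "0 < y" "y < 1"
  shows "quasi_score n P x - quasi_score n P y = (y - x) * divided_score n P x y"
proof -
  let ?m = "real (card P) - 1" and ?b = "\<lambda>i. real (blocks_larger i P)"
  have "?m / x - ?m / y = (y - x) * (?m / (x * y))" using assms by (simp add: field_simps)
  moreover have "(\<Sum>i\<in>{1..<n}. ?b i / (real i - y)) - (\<Sum>i\<in>{1..<n}. ?b i / (real i - x))
      = (y - x) * (\<Sum>i\<in>{1..<n}. ?b i / ((real i - x) * (real i - y)))"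
    unfolding sum_subtractf[symmetric] sum_distrib_left
  proof (rule sum.cong[OF refl])
    fix i assume "i \<in> {1..<n}"
    then have "real i - x \<noteq> 0" "real i - y \<noteq> 0" using assms by auto
    then show "?b i / (real i - y) - ?b i / (real i - x) = (y - x) * (?b i / ((real i - x) * (real i - y)))"
      by (simp add: field_simps)
  qed
  ultimately show ?thesis unfolding quasi_score_eq[OF P] divided_score_def distrib_left by linarith
qed

lemma divided_score_pos:
  assumes a: "0 < a" "a < 1" "0 < divided_score n P a a" and xy: "0 < x" "x < 1" "0 < y" "y < 1"
  shows "0 < divided_score n P x y"
proof -
  have m0: "0 \<le> real (card P) - 1" using partition_blocks(9)[OF P n] by simp
  have t: "0 \<le> real (blocks_larger i P) / ((real i - x) * (real i - y))" if "i \<in> {1..<n}" for i using that xy by auto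
  have s: "0 \<le> (\<Sum>i\<in>{1..<n}. real (blocks_larger i P) / ((real i - x) * (real i - y)))" by (rule sum_nonneg[OF t])
  show ?thesis
  proof (cases "real (card P) - 1 = 0")
    case False
    then have "0 < (real (card P) - 1) / (x * y)" using m0 xy by simp
    then show ?thesis using s unfolding divided_score_def by linarith
  next
    case True
    obtain i where i: "i \<in> {1..<n}" "0 < blocks_larger i P"
    proof (rule ccontr)
      assume "\<not> thesis"
      then have "\<forall>i\<in>{1..<n}. blocks_larger i P = 0" using that by (metis neq0_conv)
      then have "divided_score n P a a = 0" unfolding divided_score_def True by simp
      then show False using a by simp
    qed
    have "0 < (\<Sum>i\<in>{1..<n}. real (blocks_larger i P) / ((real i - x) * (real i - y)))"
      by (rule sum_pos2[OF _ i(1) _ t]) (use i xy in auto)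
    then show ?thesis unfolding divided_score_def True by simp
  qed
qed

text \<open>A perturbation of \<open>x\<close> by a fraction \<open>e\<close> of the distance to the end
  points 0 and 1 changes each of the denominators \<open>x\<close> and \<open>i - x\<close> by
  a relative error of at most \<open>e\<close>. All terms are nonnegative, so the bound for
  the sum is relative too and holds uniformly in \<open>n\<close> and \<open>P\<close>.\<close>
lemma divided_score_near:
  assumes a: "0 < a" "a < 1" and e: "0 < e" "e \<le> 1 / 2" and x: "\<bar>x - a\<bar> \<le> e * min a (1 - a)"
  shows "\<bar>divided_score n P x a - divided_score n P a a\<bar> \<le> 2 * e * divided_score n P a a"
proof -
  let ?m = "real (card P) - 1" and ?b = "\<lambda>i. real (blocks_larger i P)"
  have m0: "0 \<le> ?m" using partition_blocks(9)[OF P n] by simp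
  have key: "\<bar>c / (u * v) - c / (v * v)\<bar> \<le> 2 * e * (c / (v * v))" if c: "0 \<le> c" and v: "0 < v" and u: "\<bar>u - v\<bar> \<le> e * v" for c u v :: real
  proof -
    have "e * v \<le> 1 / 2 * v" using e v by (intro mult_right_mono) auto
    then have "e * v \<le> v / 2" by simp
    then have u2: "v / 2 \<le> u" using u by linarith
    then have "0 < u" using v by linarith
    note u2 = u2 this
    have "c / (u * v) - c / (v * v) = c / (v * v) * ((v - u) / u)" using u2 v by (simp add: field_simps)
    then have "\<bar>c / (u * v) - c / (v * v)\<bar> = c / (v * v) * (\<bar>v - u\<bar> / u)" using c v u2 by (simp add: abs_mult)
    moreover have "\<bar>v - u\<bar> / u \<le> 2 * e"
    proof -
      have "\<bar>v - u\<bar> \<le> e * v" using u by (simp add: abs_minus_commute)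
      also have "e * v \<le> e * (2 * u)" using u2 e by (intro mult_left_mono) auto
      finally show ?thesis using u2 by (simp add: field_simps)
    qed
    then have "c / (v * v) * (\<bar>v - u\<bar> / u) \<le> c / (v * v) * (2 * e)" using c v by (intro mult_left_mono) auto
    ultimately show ?thesis by (simp add: mult.commute)
  qed
  have d: "e * min a (1 - a) \<le> e * a" "e * min a (1 - a) \<le> e * (1 - a)" using e by (auto intro!: mult_left_mono)
  have 1: "\<bar>?m / (x * a) - ?m / (a * a)\<bar> \<le> 2 * e * (?m / (a * a))"
    by (rule key[OF m0 a(1)]) (use x d in linarith)
  have 2: "\<bar>?b i / ((real i - x) * (real i - a)) - ?b i / ((real i - a) * (real i - a))\<bar> \<le> 2 * e * (?b i / ((real i - a) * (real i - a)))" if "i \<in> {1..<n}" for i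
  proof (rule key)
    have "e * (1 - a) \<le> e * (real i - a)" using that e by (intro mult_left_mono) auto
    then show "\<bar>(real i - x) - (real i - a)\<bar> \<le> e * (real i - a)" using x d by linarith
  qed (use that a in auto)
  have "\<bar>(\<Sum>i\<in>{1..<n}. ?b i / ((real i - x) * (real i - a))) - (\<Sum>i\<in>{1..<n}. ?b i / ((real i - a) * (real i - a)))\<bar>
     \<le> (\<Sum>i\<in>{1..<n}. 2 * e * (?b i / ((real i - a) * (real i - a))))"
    unfolding sum_subtractf[symmetric] by (rule order_trans[OF sum_abs sum_mono[OF 2]])
  then have "\<bar>(\<Sum>i\<in>{1..<n}. ?b i / ((real i - x) * (real i - a))) - (\<Sum>i\<in>{1..<n}. ?b i / ((real i - a) * (real i - a)))\<bar>
     \<le> 2 * e * (\<Sum>i\<in>{1..<n}. ?b i / ((real i - a) * (real i - a)))" by (simp only: sum_distrib_left)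
  then show ?thesis using 1 unfolding divided_score_def distrib_left by linarith
qed

text \<open>Near \<open>a\<close> the score falls below and rises above its value at \<open>a\<close> at
  a rate of at least half the observed information. If its value at \<open>a\<close> is small
  compared with that, it changes sign within distance \<open>e * min a (1 - a)\<close>. The
  sign change excludes the two degenerate partitions, for which the score has constant sign,
  and positivity of the divided difference makes the root unique.\<close>
lemma quasi_score_root:
  assumes a: "0 < a" "a < 1" and e: "0 < e" "e \<le> 1 / 4"
    and small: "\<bar>quasi_score n P a\<bar> < e * min a (1 - a) * (divided_score n P a a / 2)"
  shows "\<bar>qmle n P - a\<bar> \<le> e * min a (1 - a)"
    and "quasi_score n P a = (qmle n P - a) * divided_score n P (qmle n P) a"
    and "0 < divided_score n P a a"
proof -
  let ?d = "e * min a (1 - a)" and ?J = "divided_score n P a a" and ?f = "quasi_score n P"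
  have d0: "0 < ?d" using a e by auto
  have dm: "?d \<le> 1 / 4 * min a (1 - a)" using a e by (intro mult_right_mono) auto
  have m: "1 / 4 * min a (1 - a) \<le> a / 4" "1 / 4 * min a (1 - a) \<le> (1 - a) / 4" by auto
  have gen: "0 < a - d" "a - d < a" "a < a + d" "a + d < 1" "a - d < 1" "0 < a + d" if "0 < d" "d \<le> a / 4" "d \<le> (1 - a) / 4" for d
    using a that by auto
  note rng = gen[OF d0 order_trans[OF dm m(1)] order_trans[OF dm m(2)]]
  show J: "0 < ?J"
  proof (rule ccontr)
    assume "\<not> 0 < ?J"
    then have "?d * (?J / 2) \<le> 0" using d0 by (intro mult_nonneg_nonpos) auto
    then show False using small by linarith
  qed
  have half: "?J / 2 \<le> divided_score n P x a" if "\<bar>x - a\<bar> \<le> ?d" for x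
  proof -
    have "2 * e * ?J \<le> 1 / 2 * ?J" using J e by (intro mult_right_mono) auto
    then show ?thesis using divided_score_near[OF a e(1) _ that] e by linarith
  qed
  have right: "?f (a + ?d) < 0"
  proof -
    have "?f (a + ?d) - ?f a = - (?d * divided_score n P (a + ?d) a)"
      using quasi_score_diff[of "a + ?d" a] rng a by simp
    moreover have "?d * (?J / 2) \<le> ?d * divided_score n P (a + ?d) a" by (rule mult_left_mono[OF half]) (use d0 in auto)
    ultimately show ?thesis using small by linarith
  qed
  have left: "0 < ?f (a - ?d)"
  proof -
    have "?f (a - ?d) - ?f a = ?d * divided_score n P (a - ?d) a"
      using quasi_score_diff[of "a - ?d" a] rng a by simp
    moreover have "?d * (?J / 2) \<le> ?d * divided_score n P (a - ?d) a" by (rule mult_left_mono[OF half]) (use d0 in auto)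
    ultimately show ?thesis using small by linarith
  qed
  have cont: "continuous_on {a - ?d..a + ?d} ?f"
    unfolding quasi_score_eq[OF P, abs_def] using rng by (intro continuous_intros) auto
  obtain z where z: "a - ?d \<le> z" "z \<le> a + ?d" "?f z = 0"
    using IVT2'[of ?f "a + ?d" 0 "a - ?d"] right left cont rng by auto
  have z01: "0 < z" "z < 1" using z rng by linarith+
  have c1: "card P \<noteq> 1"
  proof
    assume "card P = 1"
    then have "?f (a - ?d) = - (\<Sum>i\<in>{1..<n}. real (blocks_larger i P) / (real i - (a - ?d)))" unfolding quasi_score_eq[OF P] by simp
    moreover have "0 \<le> (\<Sum>i\<in>{1..<n}. real (blocks_larger i P) / (real i - (a - ?d)))" using rng(5) by (intro sum_nonneg divide_nonneg_nonneg) auto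
    ultimately show False using left by linarith
  qed
  have cn: "card P \<noteq> n"
  proof
    assume cn: "card P = n"
    have "blocks_larger i P = 0" if i: "1 \<le> i" for i
    proof (rule ccontr)
      assume "blocks_larger i P \<noteq> 0"
      then obtain U where U: "U \<in> P" "i < card U" unfolding blocks_larger_def by (metis (mono_tags, lifting) card.empty empty_Collect_eq)
      have "(\<Sum>U\<in>P. 1) < (\<Sum>U\<in>P. card U)"
        by (rule sum_strict_mono_ex1) (use partition_blocks(1,5)[OF P] U i in \<open>auto intro!: bexI[of _ U]\<close>)
      then show False using partition_blocks(7)[OF P] cn by simp
    qed
    then have "?f (a + ?d) = (real (card P) - 1) / (a + ?d)" unfolding quasi_score_eq[OF P] by simp
    then show False using right partition_blocks(9)[OF P n] rng by (simp add: divide_less_0_iff)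
  qed
  have "(THE x. 0 < x \<and> x < 1 \<and> ?f x = 0) = z"
  proof (rule the_equality)
    fix x assume x: "0 < x \<and> x < 1 \<and> ?f x = 0"
    then have "(z - x) * divided_score n P x z = 0" using quasi_score_diff[of x z] z z01 by simp
    then show "x = z" using divided_score_pos[OF a J, of x z] x z01 by simp
  qed (use z z01 in auto)
  then have q: "qmle n P = z" unfolding qmle_def using c1 cn by simp
  show "\<bar>qmle n P - a\<bar> \<le> ?d" unfolding q using z by linarith
  show "?f a = (qmle n P - a) * divided_score n P (qmle n P) a"
    using quasi_score_diff[of z a] z z01 a unfolding q by (simp add: left_diff_distrib)
qed

end

context bounded_gibbs
begin

text \<open>By \<open>sum_increments\<close> and \<open>quasi_score_eq\<close> both sides are the same
  combination of block counts.\<close>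
lemma score_eq: assumes n: "1 \<le> n" and \<omega>: "\<omega> \<in> space M"
  shows "score n \<omega> = quasi_score n (\<pi> n \<omega>) \<alpha>" "obs_info n \<omega> = divided_score n (\<pi> n \<omega>) \<alpha> \<alpha>"
proof -
  have split: "{..<n} = insert 0 {1..<n}" using n by auto
  have c: "c j n \<omega> = real (blocks_larger j (\<pi> n \<omega>))" for j by (simp add: c_def)
  have "score n \<omega> = (c 0 n \<omega> - 1) * score_weight 0 + (\<Sum>j\<in>{1..<n}. c j n \<omega> * score_weight j)"
    unfolding score_def sum_increments[OF n \<omega>] split by simp
  also have "(\<Sum>j\<in>{1..<n}. c j n \<omega> * score_weight j) = - (\<Sum>j\<in>{1..<n}. c j n \<omega> / (real j - \<alpha>))"
    unfolding sum_negf[symmetric] by (intro sum.cong) (auto simp: score_weight_def)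
  finally show "score n \<omega> = quasi_score n (\<pi> n \<omega>) \<alpha>"
    unfolding quasi_score_eq[OF part[OF n \<omega>]] c0_eq_card[OF n \<omega>, symmetric] by (simp add: score_weight_def c)
  have "obs_info n \<omega> = (c 0 n \<omega> - 1) * (score_weight 0)\<^sup>2 + (\<Sum>j\<in>{1..<n}. c j n \<omega> * (score_weight j)\<^sup>2)"
    unfolding obs_info_def sum_increments[OF n \<omega>, where f="\<lambda>j. (score_weight j)\<^sup>2"] split by simp
  also have "(\<Sum>j\<in>{1..<n}. c j n \<omega> * (score_weight j)\<^sup>2) = (\<Sum>j\<in>{1..<n}. c j n \<omega> / ((real j - \<alpha>) * (real j - \<alpha>)))"
    by (intro sum.cong) (auto simp: score_weight_def power2_eq_square)
  finally show "obs_info n \<omega> = divided_score n (\<pi> n \<omega>) \<alpha> \<alpha>"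
    unfolding divided_score_def c0_eq_card[OF n \<omega>, symmetric] by (simp add: score_weight_def c power2_eq_square)
qed

end


section \<open>Asymptotics of the estimator\<close>

context bounded_gibbs
begin

definition estimation_error :: "nat \<Rightarrow> 'a \<Rightarrow> real" where
  "estimation_error n \<omega> = sqrt (real n powr \<alpha> * info) * (qmle n (\<pi> n \<omega>) - \<alpha>)"

lemma measurable_estimation_error: "estimation_error n \<in> borel_measurable M"
proof (cases "1 \<le> n")
  case True
  show ?thesis unfolding estimation_error_def[abs_def] by (rule measurable_pi_fun[OF True, where f="\<lambda>P. sqrt (real n powr \<alpha> * info) * (qmle n P - \<alpha>)"])
next
  case False
  then have "estimation_error n = (\<lambda>_. 0)" by (auto simp: estimation_error_def fun_eq_iff)
  then show ?thesis by simp
qed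

text \<open>At the root, \<open>quasi_score_root\<close> expresses the error of the estimator as the
  score divided by a divided difference, and \<open>divided_score_near\<close> compares the
  latter with the observed information up to a factor \<open>1 + O(e)\<close>.\<close>
lemma estimation_error_expansion:
  assumes n: "1 \<le> n" and \<omega>: "\<omega> \<in> space M" and e: "0 < e" "e \<le> 1 / 4"
    and S: "0 < S \<omega>" and J: "info * S \<omega> / 2 \<le> obs_info n \<omega> / real n powr \<alpha>"
    and small: "\<bar>score n \<omega> / real n powr \<alpha>\<bar> < e * min \<alpha> (1 - \<alpha>) * (info * S \<omega> / 4)"
  shows "\<bar>estimation_error n \<omega> - 1 / (S \<omega> * sqrt info) * (score n \<omega> / rate n)\<bar>
    \<le> sqrt info * (8 * e / (info * S \<omega>) + \<bar>real n powr \<alpha> / obs_info n \<omega> - 1 / (info * S \<omega>)\<bar>) * \<bar>score n \<omega> / rate n\<bar>"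
proof -
  let ?x = "qmle n (\<pi> n \<omega>)" and ?J = "obs_info n \<omega>" and ?N = "real n powr \<alpha>" and ?iS = "info * S \<omega>"
  let ?Q = "divided_score n (\<pi> n \<omega>) ?x \<alpha>" and ?F = "score n \<omega> / rate n"
  note sc = score_eq[OF n \<omega>]
  have N: "0 < ?N" using n by simp
  have r: "0 < rate n" "?N = rate n * rate n" using n rate_square[of n] by (auto simp: rate_def power2_eq_square powr_add[symmetric])
  have iS: "0 < ?iS" using info_pos S by simp
  have J': "?iS / 2 * ?N \<le> ?J" using J N by (simp add: pos_le_divide_eq)
  then have J0: "0 < ?J" using iS N by (smt (verit) divide_pos_pos mult_pos_pos)
  have d0: "0 < e * min \<alpha> (1 - \<alpha>)" using e \<alpha> by simp
  have "\<bar>score n \<omega>\<bar> = \<bar>score n \<omega> / ?N\<bar> * ?N" using N by (simp add: abs_divide)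
  also have "\<dots> < e * min \<alpha> (1 - \<alpha>) * (?iS / 4) * ?N" using small N by (intro mult_strict_right_mono) auto
  also have "\<dots> = e * min \<alpha> (1 - \<alpha>) * ((?iS / 2 * ?N) / 2)" by simp
  also have "\<dots> \<le> e * min \<alpha> (1 - \<alpha>) * (?J / 2)" using J' d0 by (intro mult_left_mono) auto
  finally have sm: "\<bar>quasi_score n (\<pi> n \<omega>) \<alpha>\<bar> < e * min \<alpha> (1 - \<alpha>) * (divided_score n (\<pi> n \<omega>) \<alpha> \<alpha> / 2)" unfolding sc .
  note root = quasi_score_root[OF part[OF n \<omega>] n \<alpha> e sm]
  have e2: "e \<le> 1 / 2" using e by simp
  have near: "\<bar>?Q - ?J\<bar> \<le> 2 * e * ?J" unfolding sc(2) by (rule divided_score_near[OF part[OF n \<omega>] n \<alpha> e(1) e2 root(1)])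
  have "2 * e * ?J \<le> 1 / 2 * ?J" using e J0 by (intro mult_right_mono) auto
  then have Q: "?J / 2 \<le> ?Q" using near by linarith
  then have Q0: "0 < ?Q" using J0 by linarith
  have "?x - \<alpha> = score n \<omega> / ?Q" using root(2) Q0 unfolding sc(1)[symmetric] by simp
  then have "estimation_error n \<omega> = sqrt info * (?N / ?Q) * ?F"
    unfolding estimation_error_def real_sqrt_mult r(2) using r(1) by (simp add: real_sqrt_mult[symmetric])
  moreover have "1 / (S \<omega> * sqrt info) * ?F = sqrt info * (1 / ?iS) * ?F"
  proof -
    have "sqrt info / info = 1 / sqrt info" using info_pos by (simp add: real_div_sqrt divide_simps)
    then have "sqrt info / info * (1 / S \<omega>) = 1 / (S \<omega> * sqrt info)" by (simp only: times_divide_times_eq mult_1 mult.commute)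
    then have "sqrt info * (1 / ?iS) = 1 / (S \<omega> * sqrt info)" by simp
    then show ?thesis by (simp only:)
  qed
  ultimately have "estimation_error n \<omega> - 1 / (S \<omega> * sqrt info) * ?F = sqrt info * (?N / ?Q - 1 / ?iS) * ?F"
    by (simp only: right_diff_distrib left_diff_distrib)
  then have eq: "\<bar>estimation_error n \<omega> - 1 / (S \<omega> * sqrt info) * ?F\<bar> = sqrt info * \<bar>?N / ?Q - 1 / ?iS\<bar> * \<bar>?F\<bar>"
    using info_pos by (simp only: abs_mult) simp
  have "\<bar>?N / ?Q - ?N / ?J\<bar> \<le> 8 * e / ?iS"
  proof -
    have "?N / ?Q - ?N / ?J = ?N * (?J - ?Q) / (?Q * ?J)" using Q0 J0 by (simp add: field_simps)
    then have "\<bar>?N / ?Q - ?N / ?J\<bar> = ?N * \<bar>?Q - ?J\<bar> / (?Q * ?J)" using N Q0 J0 by (simp add: abs_mult abs_divide abs_minus_commute)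
    also have "\<dots> \<le> ?N * (2 * e * ?J) / (?J / 2 * ?J)"
      using near Q N J0 e by (intro frac_le mult_left_mono mult_right_mono mult_pos_pos) auto
    also have "\<dots> = 4 * e * ?N / ?J" using J0 by (simp add: field_simps)
    also have "\<dots> \<le> 4 * e * ?N / (?iS / 2 * ?N)" using J' N iS e J0 by (intro divide_left_mono mult_pos_pos) auto
    also have "\<dots> = 8 * e / ?iS" using N iS by (simp add: field_simps)
    finally show ?thesis .
  qed
  then have "\<bar>?N / ?Q - 1 / ?iS\<bar> \<le> 8 * e / ?iS + \<bar>?N / ?J - 1 / ?iS\<bar>" by linarith
  then have "sqrt info * \<bar>?N / ?Q - 1 / ?iS\<bar> * \<bar>?F\<bar> \<le> sqrt info * (8 * e / ?iS + \<bar>?N / ?J - 1 / ?iS\<bar>) * \<bar>?F\<bar>"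
    using info_pos by (intro mult_right_mono mult_left_mono) auto
  then show ?thesis unfolding eq .
qed

text \<open>The error of the linear approximation is a vanishing multiple of the normalized score. The
  normalized score does not converge pointwise, hence the division by \<open>1 + \<bar>score /
  rate\<bar>\<close>, which is undone later by tightness.\<close>
lemma expansion_along_subsequence:
  fixes \<kappa> :: "nat \<Rightarrow> nat"
  assumes \<omega>: "\<omega> \<in> space M" and S: "0 < S \<omega>" and \<kappa>: "strict_mono \<kappa>"
    and J: "(\<lambda>n. obs_info (\<kappa> n) \<omega> / real (\<kappa> n) powr \<alpha>) \<longlonglongrightarrow> info * S \<omega>"
    and F: "(\<lambda>n. score (\<kappa> n) \<omega> / real (\<kappa> n) powr \<alpha>) \<longlonglongrightarrow> 0"
  shows "(\<lambda>n. (estimation_error (\<kappa> n) \<omega> - 1 / (S \<omega> * sqrt info) * (score (\<kappa> n) \<omega> / rate (\<kappa> n))) / (1 + \<bar>score (\<kappa> n) \<omega> / rate (\<kappa> n)\<bar>)) \<longlonglongrightarrow> 0"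
proof (rule LIMSEQ_I)
  fix \<epsilon> :: real assume \<epsilon>: "0 < \<epsilon>"
  let ?iS = "info * S \<omega>"
  have iS: "0 < ?iS" using info_pos S by simp
  define K where "K = sqrt info * (8 / ?iS + 1)"
  have K: "0 < K" unfolding K_def using info_pos iS by (intro mult_pos_pos add_pos_pos) auto
  define e where "e = min (1 / 4) (\<epsilon> / (2 * K))"
  have e: "0 < e" "e \<le> 1 / 4" "e \<le> \<epsilon> / (2 * K)" using \<epsilon> K by (auto simp: e_def)
  have inv: "(\<lambda>n. real (\<kappa> n) powr \<alpha> / obs_info (\<kappa> n) \<omega>) \<longlonglongrightarrow> 1 / ?iS"
    using tendsto_divide[OF tendsto_const[of 1] J] info_pos S by simp
  have d: "0 < e * min \<alpha> (1 - \<alpha>) * (?iS / 4)" using e \<alpha> iS by (intro mult_pos_pos) auto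
  have "\<forall>\<^sub>F n in sequentially. ?iS / 2 < obs_info (\<kappa> n) \<omega> / real (\<kappa> n) powr \<alpha>"
    by (rule order_tendstoD(1)[OF J]) (use iS in linarith)
  moreover have "\<forall>\<^sub>F n in sequentially. \<bar>score (\<kappa> n) \<omega> / real (\<kappa> n) powr \<alpha>\<bar> < e * min \<alpha> (1 - \<alpha>) * (?iS / 4)"
    by (rule order_tendstoD(2)[OF tendsto_rabs_zero[OF F] d])
  moreover have "\<forall>\<^sub>F n in sequentially. \<bar>real (\<kappa> n) powr \<alpha> / obs_info (\<kappa> n) \<omega> - 1 / ?iS\<bar> < e"
    by (rule order_tendstoD(2)[OF tendsto_rabs_zero[OF LIM_zero[OF inv]] e(1)])
  ultimately have "\<forall>\<^sub>F n in sequentially. norm ((estimation_error (\<kappa> n) \<omega> - 1 / (S \<omega> * sqrt info) * (score (\<kappa> n) \<omega> / rate (\<kappa> n))) / (1 + \<bar>score (\<kappa> n) \<omega> / rate (\<kappa> n)\<bar>) - 0) < \<epsilon>"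
    using eventually_ge_at_top[of 1]
  proof eventually_elim
    case (elim n)
    let ?F = "score (\<kappa> n) \<omega> / rate (\<kappa> n)" and ?X = "estimation_error (\<kappa> n) \<omega> - 1 / (S \<omega> * sqrt info) * (score (\<kappa> n) \<omega> / rate (\<kappa> n))"
    have pos: "0 < 1 + \<bar>?F\<bar>" by (rule add_pos_nonneg) auto
    have n: "1 \<le> \<kappa> n" using elim(4) strict_mono_imp_increasing[OF \<kappa>, of n] by linarith
    have 1: "\<bar>?X\<bar> \<le> sqrt info * (8 * e / ?iS + \<bar>real (\<kappa> n) powr \<alpha> / obs_info (\<kappa> n) \<omega> - 1 / ?iS\<bar>) * \<bar>?F\<bar>"
      by (rule estimation_error_expansion[OF n \<omega> e(1,2) S]) (use elim in linarith)+
    have 2: "sqrt info * (8 * e / ?iS + \<bar>real (\<kappa> n) powr \<alpha> / obs_info (\<kappa> n) \<omega> - 1 / ?iS\<bar>) * \<bar>?F\<bar> \<le> sqrt info * (8 * e / ?iS + e) * \<bar>?F\<bar>"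
      using elim(3) info_pos by (intro mult_right_mono mult_left_mono) auto
    have 3: "sqrt info * (8 * e / ?iS + e) = K * e" unfolding K_def by (simp add: algebra_simps)
    have "K * e \<le> \<epsilon> / 2" using e(3) K by (simp add: field_simps)
    then have 4: "K * e * \<bar>?F\<bar> \<le> \<epsilon> / 2 * \<bar>?F\<bar>" by (intro mult_right_mono) auto
    have b: "\<bar>?X\<bar> \<le> \<epsilon> / 2 * \<bar>?F\<bar>" by (rule order_trans[OF order_trans[OF 1 2[unfolded 3]] 4])
    have "\<epsilon> / 2 * y < \<epsilon> * (1 + y)" if "0 \<le> y" for y
      using \<epsilon> mult_nonneg_nonneg[of \<epsilon> y] that by (simp add: distrib_left add_nonneg_pos)
    from this[OF abs_ge_zero] have "\<epsilon> / 2 * \<bar>?F\<bar> < \<epsilon> * (1 + \<bar>?F\<bar>)" .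
    then have "\<bar>?X\<bar> < \<epsilon> * (1 + \<bar>?F\<bar>)" using b by (rule le_less_trans[rotated])
    then have "\<bar>?X\<bar> / (1 + \<bar>?F\<bar>) < \<epsilon>" by (subst pos_divide_less_eq[OF pos])
    moreover have "norm (?X / (1 + \<bar>?F\<bar>) - 0) = \<bar>?X\<bar> / (1 + \<bar>?F\<bar>)"
      using pos by (metis abs_divide abs_of_pos diff_zero real_norm_def)
    ultimately show ?case by (simp only:)
  qed
  then show "\<exists>no. \<forall>n\<ge>no. norm ((estimation_error (\<kappa> n) \<omega> - 1 / (S \<omega> * sqrt info) * (score (\<kappa> n) \<omega> / rate (\<kappa> n))) / (1 + \<bar>score (\<kappa> n) \<omega> / rate (\<kappa> n)\<bar>) - 0) < \<epsilon>"
    unfolding eventually_sequentially .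
qed

lemma integrable_score: "integrable M (\<lambda>\<omega>. score n \<omega> / x)"
  unfolding score_def by (intro integrable_divide measurable_sum_increments(2))

lemma integrable_obs_info_error: "integrable M (\<lambda>\<omega>. obs_info n \<omega> / real n powr \<alpha> - info * S \<omega>)"
  unfolding obs_info_def by (intro Bochner_Integration.integrable_diff integrable_divide integrable_mult_right integrable_S measurable_sum_increments(2))

lemma score_drift_L1: "(\<lambda>n. \<integral>\<omega>. \<bar>score n \<omega> / rate n - U n \<omega>\<bar> \<partial>M) \<longlonglongrightarrow> 0"
proof (rule tendsto_sandwich[OF _ _ tendsto_const drift_rate])
  show "\<forall>\<^sub>F n in sequentially. (\<integral>\<omega>. \<bar>score n \<omega> / rate n - U n \<omega>\<bar> \<partial>M) \<le> weight_error / \<alpha> * ((1 + ln (real n)) / rate n)"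
    using eventually_ge_at_top[of 1]
  proof eventually_elim
    case (elim n)
    have "(\<integral>\<omega>. \<bar>score n \<omega> / rate n - U n \<omega>\<bar> \<partial>M) \<le> (\<integral>\<omega>. weight_error / \<alpha> * ((1 + ln (real n)) / rate n) \<partial>M)"
      by (intro integral_mono integrable_abs Bochner_Integration.integrable_diff integrable_score U_tight(1) gp.integrable_const score_decomposition elim)
    then show ?case unfolding integral_constant .
  qed
qed (simp add: Bochner_Integration.integral_nonneg)

lemma score_tight: obtains B where "\<And>n. (\<integral>\<omega>. \<bar>score n \<omega> / rate n\<bar> \<partial>M) \<le> B"
proof -
  obtain B1 where B1: "\<And>n. \<bar>\<integral>\<omega>. \<bar>score n \<omega> / rate n - U n \<omega>\<bar> \<partial>M\<bar> \<le> B1"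
    using convergent_imp_Bseq[OF convergentI[OF score_drift_L1]] unfolding Bseq_def by (metis real_norm_def)
  let ?B = "sqrt ((score_bound\<^sup>2 + score_bound) * (2 + 2 * weight_error) * block_growth / \<alpha>)"
  have "(\<integral>\<omega>. \<bar>score n \<omega> / rate n\<bar> \<partial>M) \<le> B1 + ?B" for n
  proof -
    have d: "integrable M (\<lambda>\<omega>. \<bar>score n \<omega> / rate n - U n \<omega>\<bar>)" by (intro integrable_abs Bochner_Integration.integrable_diff integrable_score U_tight(1))
    have u: "integrable M (\<lambda>\<omega>. \<bar>U n \<omega>\<bar>)" by (intro integrable_abs U_tight(1))
    have "(\<integral>\<omega>. \<bar>score n \<omega> / rate n\<bar> \<partial>M) \<le> (\<integral>\<omega>. \<bar>score n \<omega> / rate n - U n \<omega>\<bar> + \<bar>U n \<omega>\<bar> \<partial>M)"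
    proof (rule integral_mono[OF integrable_abs[OF integrable_score] Bochner_Integration.integrable_add[OF d u]])
      fix \<omega> show "\<bar>score n \<omega> / rate n\<bar> \<le> \<bar>score n \<omega> / rate n - U n \<omega>\<bar> + \<bar>U n \<omega>\<bar>" by linarith
    qed
    also have "\<dots> = (\<integral>\<omega>. \<bar>score n \<omega> / rate n - U n \<omega>\<bar> \<partial>M) + (\<integral>\<omega>. \<bar>U n \<omega>\<bar> \<partial>M)" by (rule Bochner_Integration.integral_add[OF d u])
    also have "\<dots> \<le> B1 + ?B" using B1[of n] U_tight(2)[of n] by linarith
    finally show ?thesis .
  qed
  then show thesis by (rule that)
qed

lemma normalized_score_L1: "(\<lambda>n. \<integral>\<omega>. \<bar>score n \<omega> / real n powr \<alpha>\<bar> \<partial>M) \<longlonglongrightarrow> 0"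
proof -
  obtain B where B: "\<And>n. (\<integral>\<omega>. \<bar>score n \<omega> / rate n\<bar> \<partial>M) \<le> B" by (fact score_tight)
  have lim: "(\<lambda>n. B * real n powr (- (\<alpha> / 2))) \<longlonglongrightarrow> 0"
    by (rule tendsto_mult_right_zero[OF tendsto_powr_neg]) (use \<alpha> in simp)
  show ?thesis
  proof (rule tendsto_sandwich[OF _ _ tendsto_const lim])
    show "\<forall>\<^sub>F n in sequentially. (\<integral>\<omega>. \<bar>score n \<omega> / real n powr \<alpha>\<bar> \<partial>M) \<le> B * real n powr (- (\<alpha> / 2))"
      using eventually_ge_at_top[of 1]
    proof eventually_elim
      case (elim n)
      have p: "real n powr \<alpha> = rate n * rate n" unfolding rate_def by (simp add: powr_add[symmetric])
      have "(\<integral>\<omega>. \<bar>score n \<omega> / real n powr \<alpha>\<bar> \<partial>M) = (\<integral>\<omega>. \<bar>score n \<omega> / rate n\<bar> / rate n \<partial>M)"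
        unfolding p by (simp add: abs_divide rate_def)
      also have "\<dots> = (\<integral>\<omega>. \<bar>score n \<omega> / rate n\<bar> \<partial>M) / rate n" by (rule integral_divide_zero)
      also have "\<dots> \<le> B / rate n" using B[of n] by (intro divide_right_mono) (auto simp: rate_def)
      also have "\<dots> = B * real n powr (- (\<alpha> / 2))" by (simp add: rate_def powr_minus_divide)
      finally show ?case .
    qed
  qed (simp add: Bochner_Integration.integral_nonneg)
qed

lemma measurable_score: "(\<lambda>\<omega>. score n \<omega>) \<in> borel_measurable M" 
  unfolding score_def by (rule measurable_sum_increments(1))

text \<open>The pointwise expansion is applied along subsequences on which the observed information and
  the score divided by \<open>n powr \<alpha>\<close> converge almost surely.\<close>
lemma estimation_error_null: "gp.null_in_prob (\<lambda>n \<omega>. estimation_error n \<omega> - 1 / (S \<omega> * sqrt info) * U n \<omega>)"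
proof -
  let ?W = "\<lambda>\<omega>. 1 / (S \<omega> * sqrt info)" and ?F = "\<lambda>n \<omega>. score n \<omega> / rate n"
  let ?X = "\<lambda>n \<omega>. estimation_error n \<omega> - ?W \<omega> * ?F n \<omega>"
  have [measurable]: "S \<in> borel_measurable M" by (rule S_measurable)
  have [measurable]: "(\<lambda>\<omega>. score n \<omega>) \<in> borel_measurable M" for n by (rule measurable_score)
  have [measurable]: "estimation_error n \<in> borel_measurable M" for n by (rule measurable_estimation_error)
  have [measurable]: "U n \<in> borel_measurable M" for n by (rule borel_measurable_integrable[OF U_tight(1)])
  obtain B where B: "\<And>n. (\<integral>\<omega>. \<bar>?F n \<omega>\<bar> \<partial>M) \<le> B" by (fact score_tight)
  let ?u = "\<lambda>n \<omega>. \<bar>obs_info n \<omega> / real n powr \<alpha> - info * S \<omega>\<bar> + \<bar>score n \<omega> / real n powr \<alpha>\<bar>"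
  note oi = integrable_abs[OF integrable_obs_info_error] and si = integrable_abs[OF integrable_score]
  have "gp.null_in_prob (\<lambda>n \<omega>. ?X n \<omega> / (1 + \<bar>?F n \<omega>\<bar>))"
  proof (rule gp.null_in_prob_of_L1_subseq)
    show "integrable M (?u n)" for n by (rule Bochner_Integration.integrable_add[OF oi si])
    have "(\<integral>\<omega>. \<bar>?u n \<omega>\<bar> \<partial>M) = (\<integral>\<omega>. \<bar>obs_info n \<omega> / real n powr \<alpha> - info * S \<omega>\<bar> \<partial>M) + (\<integral>\<omega>. \<bar>score n \<omega> / real n powr \<alpha>\<bar> \<partial>M)" for n
    proof -
      have "(\<integral>\<omega>. \<bar>?u n \<omega>\<bar> \<partial>M) = (\<integral>\<omega>. ?u n \<omega> \<partial>M)" by (rule Bochner_Integration.integral_cong[OF refl]) simp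
      then show ?thesis unfolding Bochner_Integration.integral_add[OF oi si] .
    qed
    then show "(\<lambda>n. \<integral>\<omega>. \<bar>?u n \<omega>\<bar> \<partial>M) \<longlonglongrightarrow> 0" using tendsto_add[OF obs_info_L1 normalized_score_L1] by simp
    show "(\<lambda>\<omega>. ?X n \<omega> / (1 + \<bar>?F n \<omega>\<bar>)) \<in> borel_measurable M" for n by measurable
    show "AE \<omega> in M. \<forall>\<kappa>::nat \<Rightarrow> nat. strict_mono \<kappa> \<longrightarrow> (\<lambda>n. ?u (\<kappa> n) \<omega>) \<longlonglongrightarrow> 0 \<longrightarrow> (\<lambda>n. ?X (\<kappa> n) \<omega> / (1 + \<bar>?F (\<kappa> n) \<omega>\<bar>)) \<longlonglongrightarrow> 0"
      using AE_S_pos AE_space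
    proof eventually_elim
      case (elim \<omega>)
      show ?case
      proof (intro allI impI)
        fix \<kappa> :: "nat \<Rightarrow> nat" assume \<kappa>: "strict_mono \<kappa>" and u: "(\<lambda>n. ?u (\<kappa> n) \<omega>) \<longlonglongrightarrow> 0"
        have 1: "(\<lambda>n. obs_info (\<kappa> n) \<omega> / real (\<kappa> n) powr \<alpha> - info * S \<omega>) \<longlonglongrightarrow> 0"
          by (rule Lim_null_comparison[OF always_eventually u]) simp
        have 2: "(\<lambda>n. score (\<kappa> n) \<omega> / real (\<kappa> n) powr \<alpha>) \<longlonglongrightarrow> 0"
          by (rule Lim_null_comparison[OF always_eventually u]) simp
        show "(\<lambda>n. ?X (\<kappa> n) \<omega> / (1 + \<bar>?F (\<kappa> n) \<omega>\<bar>)) \<longlonglongrightarrow> 0"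
          by (rule expansion_along_subsequence[OF elim(2,1) \<kappa> LIM_zero_cancel[OF 1] 2])
      qed
    qed
  qed
  then have "gp.null_in_prob (\<lambda>n \<omega>. ?X n \<omega> / (1 + \<bar>?F n \<omega>\<bar>) * (1 + \<bar>?F n \<omega>\<bar>))"
  proof (rule gp.null_in_prob_mult_tight)
    show "integrable M (\<lambda>\<omega>. 1 + \<bar>?F n \<omega>\<bar>)" for n by (intro Bochner_Integration.integrable_add gp.integrable_const si)
    have "(\<integral>\<omega>. \<bar>1 + \<bar>?F n \<omega>\<bar>\<bar> \<partial>M) = (\<integral>\<omega>. 1 + \<bar>?F n \<omega>\<bar> \<partial>M)" for n by (rule Bochner_Integration.integral_cong[OF refl]) simp
    also have "\<dots> n = 1 + (\<integral>\<omega>. \<bar>?F n \<omega>\<bar> \<partial>M)" for n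
      unfolding Bochner_Integration.integral_add[OF gp.integrable_const si] integral_constant ..
    finally show "(\<integral>\<omega>. \<bar>1 + \<bar>?F n \<omega>\<bar>\<bar> \<partial>M) \<le> 1 + B" for n using B[of n] by simp
  qed
  then have X: "gp.null_in_prob ?X"
  proof -
    have "?X n \<omega> / (1 + \<bar>?F n \<omega>\<bar>) * (1 + \<bar>?F n \<omega>\<bar>) = ?X n \<omega>" for n \<omega>
      by (rule nonzero_eq_divide_eq[THEN iffD1, OF _ refl]) linarith
    with \<open>gp.null_in_prob (\<lambda>n \<omega>. ?X n \<omega> / (1 + \<bar>?F n \<omega>\<bar>) * (1 + \<bar>?F n \<omega>\<bar>))\<close> show ?thesis by (simp only:)
  qed
  have "gp.null_in_prob (\<lambda>n \<omega>. ?W \<omega> * (?F n \<omega> - U n \<omega>))"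
  proof (rule gp.null_in_prob_of_L1_subseq[OF Bochner_Integration.integrable_diff[OF integrable_score U_tight(1)] score_drift_L1])
    show "(\<lambda>\<omega>. ?W \<omega> * (?F n \<omega> - U n \<omega>)) \<in> borel_measurable M" for n by measurable
    show "AE \<omega> in M. \<forall>\<kappa>::nat \<Rightarrow> nat. strict_mono \<kappa> \<longrightarrow> (\<lambda>n. ?F (\<kappa> n) \<omega> - U (\<kappa> n) \<omega>) \<longlonglongrightarrow> 0 \<longrightarrow> (\<lambda>n. ?W \<omega> * (?F (\<kappa> n) \<omega> - U (\<kappa> n) \<omega>)) \<longlonglongrightarrow> 0"
      by (intro AE_I2 allI impI tendsto_mult_right_zero)
  qed
  from gp.null_in_prob_add[OF X this] show ?thesis by (simp add: right_diff_distrib)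
qed

text \<open>The martingale part \<open>U\<close> is asymptotically a centred normal variable with the
  random variance \<open>info * S\<close>. The estimation error is \<open>U\<close> times the
  \<open>G\<close>-measurable factor \<open>1 / (S * sqrt info)\<close>, hence has asymptotic
  variance \<open>1 / S\<close>, which is the conditional variance of \<open>N / sqrt
  S\<close> given \<open>G\<close>.\<close>
theorem estimation_error_stable:
  assumes N: "distributed M lborel N std_normal_density" and indep: "indep_of_field M N G"
  shows "stably_converges M G estimation_error (\<lambda>\<omega>. N \<omega> / sqrt (S \<omega>))"
proof (rule gp.stably_convergesI[OF subalgebra_G measurable_estimation_error])
  have SG[measurable]: "S \<in> borel_measurable G" by (rule S_measurable_G)
  have [measurable]: "S \<in> borel_measurable M" by (rule S_measurable)
  have NM[measurable]: "N \<in> borel_measurable M" using distributed_measurable[OF N] by simp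
  have [measurable]: "U n \<in> borel_measurable M" for n by (rule borel_measurable_integrable[OF U_tight(1)])
  have [measurable]: "estimation_error n \<in> borel_measurable M" for n by (rule measurable_estimation_error)
  show "(\<lambda>\<omega>. N \<omega> / sqrt (S \<omega>)) \<in> borel_measurable M" by measurable
  fix A and t :: real assume A: "A \<in> sets G"
  then have AM[measurable]: "A \<in> gp.events" using subalgebra_G by (auto simp: subalgebra_def)
  let ?W = "\<lambda>\<omega>. t * (1 / (S \<omega> * sqrt info))" and ?\<Lambda> = "\<lambda>\<omega>. info * max 0 (S \<omega>)"
  have W: "?W \<in> borel_measurable G" and L: "?\<Lambda> \<in> borel_measurable G" by measurable
  have "(\<lambda>n. \<integral>\<omega>. indicator A \<omega> *\<^sub>R iexp (?W \<omega> * U n \<omega>) \<partial>M)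
     \<longlonglongrightarrow> (\<integral>\<omega>. indicator A \<omega> *\<^sub>R complex_of_real (exp (- ((?W \<omega>)\<^sup>2 * ?\<Lambda> \<omega> / 2))) \<partial>M)"
    by (rule gp.random_multiplier[OF subalgebra_G A W L _ U_tight score_martingale_clt]) (use info_pos in auto)
  then have lim: "(\<lambda>n. \<integral>\<omega>. indicator A \<omega> *\<^sub>R iexp (t * estimation_error n \<omega>) \<partial>M)
     \<longlonglongrightarrow> (\<integral>\<omega>. indicator A \<omega> *\<^sub>R complex_of_real (exp (- ((?W \<omega>)\<^sup>2 * ?\<Lambda> \<omega> / 2))) \<partial>M)"
  proof (rule gp.slutsky_set_char[rotated 4])
    have "gp.null_in_prob (\<lambda>n \<omega>. (estimation_error n \<omega> - 1 / (S \<omega> * sqrt info) * U n \<omega>) * t)"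
      by (rule gp.null_in_prob_mult_tight[OF estimation_error_null gp.integrable_const, where B="\<bar>t\<bar>"]) (simp add: gp.prob_space)
    then show "gp.null_in_prob (\<lambda>n \<omega>. t * estimation_error n \<omega> - ?W \<omega> * U n \<omega>)" by (simp add: algebra_simps)
  qed (auto intro: AM)
  \<comment> \<open>The truncation \<open>max 0 S\<close> served to have a variance that is nonnegative
    everywhere; it is invisible where \<open>S\<close> is positive.\<close>
  have "(\<integral>\<omega>. indicator A \<omega> *\<^sub>R complex_of_real (exp (- ((?W \<omega>)\<^sup>2 * ?\<Lambda> \<omega> / 2))) \<partial>M)
      = (\<integral>\<omega>. indicator A \<omega> *\<^sub>R complex_of_real (exp (- ((t / sqrt (S \<omega>))\<^sup>2 / 2))) \<partial>M)"
  proof (rule integral_cong_AE)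
    show "AE \<omega> in M. indicator A \<omega> *\<^sub>R complex_of_real (exp (- ((?W \<omega>)\<^sup>2 * ?\<Lambda> \<omega> / 2))) = indicator A \<omega> *\<^sub>R complex_of_real (exp (- ((t / sqrt (S \<omega>))\<^sup>2 / 2)))"
      using AE_S_pos
    proof eventually_elim
      case (elim \<omega>)
      have alg: "(t * (1 / (x * sqrt i)))\<^sup>2 * (i * x) = (t / sqrt x)\<^sup>2" if "0 < x" "0 < i" for x i :: real
      proof -
        have "(t * (1 / (x * sqrt i)))\<^sup>2 * (i * x) = t\<^sup>2 / (x * x * i) * (i * x)"
          using that by (simp add: power_divide power_mult_distrib power2_eq_square[of x])
        also have "\<dots> = t\<^sup>2 / x" using that by (simp add: field_simps)
        finally show ?thesis using that by (simp add: power_divide)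
      qed
      have m: "max 0 (S \<omega>) = S \<omega>" using elim by simp
      show ?case unfolding m alg[OF elim info_pos] ..
    qed
  qed measurable
  also have "\<dots> = (\<integral>\<omega>. indicator A \<omega> *\<^sub>R iexp (t / sqrt (S \<omega>) * N \<omega>) \<partial>M)"
    by (rule gp.set_char_independent_normal[OF subalgebra_G A _ N indep, symmetric]) measurable
  also have "\<dots> = (\<integral>\<omega>. indicator A \<omega> *\<^sub>R iexp (t * (N \<omega> / sqrt (S \<omega>))) \<partial>M)" by (simp only: times_divide_eq_left times_divide_eq_right)
  finally show "(\<lambda>n. \<integral>\<omega>. indicator A \<omega> *\<^sub>R iexp (t * estimation_error n \<omega>) \<partial>M)
     \<longlonglongrightarrow> (\<integral>\<omega>. indicator A \<omega> *\<^sub>R iexp (t * (N \<omega> / sqrt (S \<omega>))) \<partial>M)" using lim by (simp only:)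
qed

end

theorem theorem3p3:
  fixes \<alpha> \<theta>_lo \<theta>_hi :: real
    and \<mu> :: "real measure"
    and M :: "'a measure"
    and \<pi> :: "nat \<Rightarrow> 'a \<Rightarrow> nat set set"
    and N :: "'a \<Rightarrow> real"
  assumes "0 < \<alpha>" "\<alpha> < 1"
    and "real_distribution \<mu>"
    and "measure_support \<mu> \<subseteq> {\<theta>_lo..\<theta>_hi}"
    and "- \<alpha> < \<theta>_lo" "\<theta>_lo \<le> 0" "0 \<le> \<theta>_hi"
    and "gibbs_partition M \<alpha> \<mu> \<pi>"
    and "distributed M lborel N std_normal_density"
    and "indep_of_field M N (partition_field_inf M \<pi>)"
  shows "alpha_diversity \<alpha> \<pi> \<in> borel_measurable (partition_field_inf M \<pi>) \<and>
    (AE \<omega> in M. 0 < alpha_diversity \<alpha> \<pi> \<omega> \<and>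
      (\<lambda>n. real n powr (- \<alpha>) * real (card (\<pi> n \<omega>))) \<longlonglongrightarrow> alpha_diversity \<alpha> \<pi> \<omega>) \<and>
    stably_converges M (partition_field_inf M \<pi>)
      (\<lambda>n \<omega>. sqrt (real n powr \<alpha> * fisher_info \<alpha>) * (qmle n (\<pi> n \<omega>) - \<alpha>))
      (\<lambda>\<omega>. N \<omega> / sqrt (alpha_diversity \<alpha> \<pi> \<omega>))"
  proof -
  interpret gp: gibbs_partition M \<alpha> \<mu> \<pi> by fact
  interpret \<mu>: real_distribution \<mu> by fact
  interpret bounded_gibbs M \<alpha> \<mu> \<pi> \<theta>_lo \<theta>_hi
    by unfold_locales (use assms in auto)
  have S: "S = alpha_diversity \<alpha> \<pi>" by (fact S_def)
  have "AE \<omega> in M. 0 < alpha_diversity \<alpha> \<pi> \<omega> \<and>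
      (\<lambda>n. real n powr (- \<alpha>) * real (card (\<pi> n \<omega>))) \<longlonglongrightarrow> alpha_diversity \<alpha> \<pi> \<omega>"
    using AE_S_pos AE_r_tendsto AE_space by eventually_elim (simp add: S_eq S[symmetric])
  moreover have "(\<lambda>n \<omega>. sqrt (real n powr \<alpha> * fisher_info \<alpha>) * (qmle n (\<pi> n \<omega>) - \<alpha>)) = estimation_error"
    by (intro ext) (simp add: estimation_error_def fisher_info_eq)
  ultimately show ?thesis
    using S_measurable_G estimation_error_stable[OF assms(9,10)] unfolding S by simp
qed

end
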